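(* Given complex numbers $\eta_j$ ($0\le j\le n$), $\zeta_j$ ($1\le j\le n$) and $\chi_j$, where $\chi_{-j}=-\overline{\chi_j}$, let $g:S^1\to SU(2)$ be the product of $SU(2)$ loops (with $z\in S^1$) $$g=a(\eta_0)\begin{pmatrix}1&\eta_0\\-\bar\eta_0&1\end{pmatrix}\cdots a(\eta_n)\begin{pmatrix}1&\eta_nz^n\\-\bar\eta_nz^{-n}&1\end{pmatrix}\begin{pmatrix}e^{\sum\chi_jz^j}&0\\0&e^{-\sum\chi_jz^j}\end{pmatrix}a(\zeta_n)\begin{pmatrix}1&\zeta_nz^{-n}\\-\bar\zeta_nz^n&1\end{pmatrix}\cdots a(\zeta_1)\begin{pmatrix}1&\zeta_1z^{-1}\\-\bar\zeta_1z&1\end{pmatrix},$$ where $a(\cdot)=(1+|\cdot|^2)^{-1/2}$. Let $A(g)$ denote the Toeplitz operator defined by the symbol $g$. Then $$\det\big(A(g)A(g)^*\big)=\prod_j a(\eta_j)^{2j}\,a(\zeta_j)^{2j}\,e^{-|j||\chi_j|^2}.$$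
   Context: Let $\mathcal H=L^2(S^1,\mathbb C^2)$, let $\mathcal H_+$ be the Hardy space of functions $\sum_{k\ge0}f_kz^k$, and let $P_+$ be the orthogonal projection onto $\mathcal H_+$. The (block) Toeplitz operator $A(g)$ on $\mathcal H_+$ is $A(g)f=P_+(gf)$, and $\det$ is the Fredholm determinant. In the product over $j$, each of the three kinds of factor is taken over the indices for which the corresponding parameter is given: $0\le j\le n$ for $\eta_j$, $1\le j\le n$ for $\zeta_j$, and all indices $j$ (positive and negative) for $\chi_j$. *)

theory Defs
  imports "HOL-Analysis.Analysis" "HOL-Combinatorics.Permutations"
begin

section \<open>The Hilbert space of square-integrable functions on the circle\<close>

text \<open>
  Normalized arc length. The underlying space of this measure is the unit circle itself, so
  measurability and integrals only see the values of functions there. Elements of $L^2$ are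
  represented by functions, which are identified when they agree almost everywhere.
\<close>
definition circle :: "complex measure" where
  "circle = distr (uniform_measure lborel {0..2*pi}) (restrict_space borel (sphere 0 1)) cis"

type_synonym vfun = "complex \<Rightarrow> complex^2"
type_synonym mfun = "complex \<Rightarrow> complex^2^2"

definition L2 :: "vfun set" where
  "L2 = {f \<in> borel_measurable circle. integrable circle (\<lambda>z. (norm (f z))\<^sup>2)}"

definition L2_norm :: "vfun \<Rightarrow> real" where
  "L2_norm f = sqrt (\<integral>z. (norm (f z))\<^sup>2 \<partial>circle)"

text \<open>Linear in the second argument.\<close>
definition L2_inner :: "vfun \<Rightarrow> vfun \<Rightarrow> complex" where
  "L2_inner f g = (\<integral>z. (\<Sum>i\<in>UNIV. cnj (f z $ i) * g z $ i) \<partial>circle)"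

definition fourier_coeff :: "vfun \<Rightarrow> int \<Rightarrow> complex^2" where
  "fourier_coeff f k = (\<integral>z. (z powi (- k)) *s f z \<partial>circle)"


section \<open>Hardy space and Toeplitz operators\<close>

definition Hardy :: "vfun set" where
  "Hardy = {f \<in> L2. \<forall>k<0. fourier_coeff f k = 0}"

text \<open>
  The orthogonal projection of \<open>f\<close>, characterized up to almost-everywhere equality; the choice
  picks one representative. The same applies to the adjoint below.
\<close>
definition Hardy_proj :: "vfun \<Rightarrow> vfun" where
  "Hardy_proj f = (SOME h. h \<in> Hardy \<and> (\<forall>u\<in>Hardy. L2_inner u (\<lambda>z. f z - h z) = 0))"

definition Toeplitz :: "mfun \<Rightarrow> vfun \<Rightarrow> vfun" where
  "Toeplitz g f = Hardy_proj (\<lambda>z. g z *v f z)"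

definition Hardy_adjoint :: "(vfun \<Rightarrow> vfun) \<Rightarrow> vfun \<Rightarrow> vfun" where
  "Hardy_adjoint S f = (SOME h. h \<in> Hardy \<and> (\<forall>u\<in>Hardy. L2_inner u h = L2_inner (S u) f))"


section \<open>The Fredholm determinant on Hardy space\<close>

definition Hardy_onb :: "(nat \<Rightarrow> vfun) \<Rightarrow> bool" where
  "Hardy_onb e \<longleftrightarrow>
     (\<forall>n. e n \<in> Hardy) \<and>
     (\<forall>m n. L2_inner (e m) (e n) = (if m = n then 1 else 0)) \<and>
     (\<forall>f\<in>Hardy. (\<lambda>N. L2_norm (\<lambda>z. f z - (\<Sum>n<N. L2_inner (e n) f *s e n z))) \<longlonglongrightarrow> 0)"

text \<open>
  Trace class operators are the nuclear ones, i.e.\ those of the form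
  $T f = \sum_n \langle x_n, f\rangle\, y_n$ with $\sum_n \|x_n\|\,\|y_n\| < \infty$.
\<close>
definition Hardy_trace_class :: "(vfun \<Rightarrow> vfun) \<Rightarrow> bool" where
  "Hardy_trace_class T \<longleftrightarrow>
     (\<forall>f\<in>Hardy. T f \<in> Hardy) \<and>
     (\<exists>x y. (\<forall>n::nat. x n \<in> Hardy \<and> y n \<in> Hardy) \<and>
        summable (\<lambda>n. L2_norm (x n) * L2_norm (y n)) \<and>
        (\<forall>f\<in>Hardy. (\<lambda>N. L2_norm (\<lambda>z. T f z - (\<Sum>n<N. L2_inner (x n) f *s y n z))) \<longlonglongrightarrow> 0))"

definition principal_minor :: "(nat \<Rightarrow> nat \<Rightarrow> complex) \<Rightarrow> nat set \<Rightarrow> complex" where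
  "principal_minor M I = (\<Sum>p | p permutes I. of_int (sign p) * (\<Prod>i\<in>I. M i (p i)))"

text \<open>
  \<open>S\<close> has a Fredholm determinant if $T = S - 1$ is trace class, and then
  $\det S = \sum_{k\ge0} \mathrm{tr}(\Lambda^k T)$. In an orthonormal basis the trace of
  $\Lambda^k T$ is the sum of all principal $k \times k$ minors of the matrix of $T$; the value
  is independent of the basis.
\<close>
definition has_Fredholm_det :: "(vfun \<Rightarrow> vfun) \<Rightarrow> complex \<Rightarrow> bool" where
  "has_Fredholm_det S d \<longleftrightarrow>
     (let T = (\<lambda>f z. S f z - f z) in
        Hardy_trace_class T \<and>
        (\<forall>e. Hardy_onb e \<longrightarrow>
           (principal_minor (\<lambda>i j. L2_inner (e i) (T (e j))) has_sum d) {I. finite I}))"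


section \<open>The loop\<close>

definition mat2 :: "complex \<Rightarrow> complex \<Rightarrow> complex \<Rightarrow> complex \<Rightarrow> complex^2^2" where
  "mat2 a b c d = vector [vector [a, b], vector [c, d]]"

definition a_fac :: "complex \<Rightarrow> real" where
  "a_fac x = (1 + (cmod x)\<^sup>2) powr (- 1/2)"

definition eta_factor :: "(nat \<Rightarrow> complex) \<Rightarrow> nat \<Rightarrow> mfun" where
  "eta_factor \<eta> j z =
     a_fac (\<eta> j) *\<^sub>R mat2 1 (\<eta> j * z powi int j) (- cnj (\<eta> j) * z powi (- int j)) 1"

definition zeta_factor :: "(nat \<Rightarrow> complex) \<Rightarrow> nat \<Rightarrow> mfun" where
  "zeta_factor \<zeta> j z =
     a_fac (\<zeta> j) *\<^sub>R mat2 1 (\<zeta> j * z powi (- int j)) (- cnj (\<zeta> j) * z powi int j) 1"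

definition chi_factor :: "(int \<Rightarrow> complex) \<Rightarrow> mfun" where
  "chi_factor chi z =
     (let s = (\<Sum>\<^sub>\<infinity>j\<in>UNIV. chi j * z powi j) in mat2 (exp s) 0 0 (exp (- s)))"

text \<open>The multiplication of the type class on \<^typ>\<open>complex^2^2\<close> is entrywise, hence the folds.\<close>
definition mat_prod :: "(complex^2^2) list \<Rightarrow> complex^2^2" where
  "mat_prod Ms = foldr (**) Ms (mat 1)"

definition root_loop ::
  "nat \<Rightarrow> (nat \<Rightarrow> complex) \<Rightarrow> (nat \<Rightarrow> complex) \<Rightarrow> (int \<Rightarrow> complex) \<Rightarrow> mfun" where
  "root_loop n \<eta> \<zeta> chi z =
     mat_prod (map (\<lambda>j. eta_factor \<eta> j z) [0..<Suc n]) **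
     chi_factor chi z **
     mat_prod (map (\<lambda>j. zeta_factor \<zeta> j z) (rev [1..<Suc n]))"

end

theory Submission
  imports Defs
begin

text \<open>
  For a unitary loop \<open>g\<close> the matrix of \<open>A(g) A(g)\<^sup>*\<close> is the Gram matrix of the vectors \<open>T e\<close>, where
  \<open>T f = P\<^sub>+(g\<^sup>* f)\<close> is a contraction and \<open>e\<close> runs through an orthonormal basis of the Hardy space. Its finite
  sections have decreasing determinants; write \<open>D(g)\<close> for their limit. By Sylvester's identity \<open>D(g)\<close> can be
  computed from any orthonormal basis, and also from the complementary space, so \<open>D\<close> does not change when
  \<open>g(z)\<close> is replaced by \<open>g(1/z)\<^sup>*\<close>. If one basis vector \<open>v\<close> is exchanged for a unit vector \<open>w\<close> orthogonal to the
  others such that \<open>T (w - t v)\<close> is in the closed span of the remaining images, \<open>D\<close> is multiplied by \<open>|t|\<^sup>2\<close>.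

  A left factor with parameter \<open>\<eta>\<^sub>j\<close> amounts to \<open>j\<close> such exchanges with \<open>t = a(\<eta>\<^sub>j)\<close>, because a nonzero vector
  annihilated by \<open>T\<close> persists along the product; the \<open>\<zeta>\<close> factors follow by reflection. In a diagonal loop
  with entry \<open>u / cnj u\<close>, \<open>u\<close> analytic, multiplying \<open>u\<close> by \<open>1 - a z\<close> is a single exchange, with
  \<open>|t|\<^sup>2 = (1 - |a|\<^sup>2) |u(cnj a) / u(0)|\<^sup>2\<close>. Taking \<open>n k\<close> such factors and letting \<open>n\<close> tend to infinity bounds the
  effect of \<open>exp(- \<gamma> z\<^sup>k)\<close> on \<open>D\<close> from below, as \<open>D\<close> is upper semicontinuous. Building the exponent up from a constant
  gives one inequality for its determinant; stripping it of its Fourier coefficients, together with \<open>D \<le> 1\<close>,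
  gives the other.

  Finally, \<open>D(g) > 0\<close> makes \<open>1 - A(g) A(g)\<^sup>*\<close> trace class by Hadamard's inequality, and then \<open>D(g)\<close> is the sum of
  the principal minors.
\<close>

section \<open>Determinants and principal minors\<close>

text \<open>The limit \<open>D\<close> exists for every unitary loop, so none of the intermediate
  loops has to be shown to have a Fredholm determinant; positivity of the final value alone leads
  back to the operator. The price is that \<open>D\<close> is only upper semicontinuous along
  pointwise limits: every passage to the limit bounds \<open>D\<close> from below, and the only
  upper bound known in advance is \<open>D \<le> 1\<close>. That the two bounds meet is due to the
  form of the gain. Removing c z^k from an exponent with k-th coefficient f changes ln D by at least
  -k|c|^2 + 2k Re(f cnj c); this is +k|f|^2 for c = f, and -k|c|^2 when c = -f is removed from an
  exponent without such a term. The exponent 2j of a rotation factor counts the j monomials z^m, m <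
  j, of the first component whose partner z^(m-j) in the second lies outside the Hardy space; each
  contributes a^2. In the diagonal loop each entry contributes k|chi_k|^2, which matches the indices
  k and -k of the product.\<close>

definition pdet :: "('i \<Rightarrow> 'i \<Rightarrow> complex) \<Rightarrow> 'i set \<Rightarrow> complex" where
  "pdet M I = (\<Sum>p | p permutes I. of_int (sign p) * (\<Prod>i\<in>I. M i (p i)))"

text \<open>The copy \<open>pdet\<close> is polymorphic in the index, because minors indexed by
  pairs (Fourier index, component) and by disjoint sums occur besides those indexed by
  \<open>nat\<close>.\<close>

lemma principal_minor_eq_pdet: "principal_minor = pdet"
  by (intro ext) (simp add: principal_minor_def pdet_def)

lemma pdet_empty [simp]: "pdet M {} = 1"
  by (simp add: pdet_def)

lemma pdet_cong:
  assumes "\<And>i j. i \<in> I \<Longrightarrow> j \<in> I \<Longrightarrow> M i j = N i j"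
  shows "pdet M I = pdet N I"
  unfolding pdet_def
  by (intro sum.cong prod.cong arg_cong2[where f="(*)"] refl) (auto simp: assms permutes_in_image)

lemma pdet_row_linear:
  assumes "finite I" "i \<in> I"
  shows "pdet (M(i := \<lambda>j. a * r j + b * s j)) I = a * pdet (M(i := r)) I + b * pdet (M(i := s)) I"
proof -
  have *: "(\<Prod>k\<in>I. (M(i := q)) k (p k)) = q (p i) * (\<Prod>k\<in>I-{i}. M k (p k))" for q p
    using assms by (subst prod.remove[of _ i]) (auto intro!: prod.cong)
  show ?thesis
    unfolding pdet_def * by (simp add: sum_distrib_left sum.distrib[symmetric] algebra_simps)
qed

lemma pdet_row_zero:
  assumes "finite I" "i \<in> I" "\<And>j. j \<in> I \<Longrightarrow> M i j = 0"
  shows "pdet M I = 0"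
  unfolding pdet_def
proof (rule sum.neutral, safe)
  fix p assume "p permutes I"
  hence "M i (p i) = 0" using assms permutes_in_image by metis
  thus "of_int (sign p) * (\<Prod>i\<in>I. M i (p i)) = 0"
    using assms by auto
qed

text \<open>Composition with the transposition of \<open>i\<close> and \<open>j\<close> permutes the
  summands and reverses their signs, so the determinant equals its own negative.\<close>

lemma pdet_equal_rows:
  assumes fin: "finite I" and ij: "i \<in> I" "j \<in> I" "i \<noteq> j"
    and eq: "\<And>k. k \<in> I \<Longrightarrow> M i k = M j k"
  shows "pdet M I = 0"
proof -
  let ?t = "Transposition.transpose i j"
  have t: "?t permutes I" using ij by (intro permutes_swap_id)
  let ?F = "\<lambda>p. of_int (sign p) * (\<Prod>k\<in>I. M k (p k))"
  have F: "?F (p \<circ> ?t) = - ?F p" if p: "p permutes I" for p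
  proof -
    have "sign (p \<circ> ?t) = - sign p"
      using p fin ij by (subst sign_compose) (auto simp: sign_swap_id permutation_swap_id intro: permutes_imp_permutation)
    moreover have "(\<Prod>k\<in>I. M k ((p \<circ> ?t) k)) = (\<Prod>k\<in>I. M k (p k))"
    proof -
      have "(\<Prod>k\<in>I. M k ((p \<circ> ?t) k)) = (\<Prod>k\<in>I. M (?t k) ((p \<circ> ?t) (?t k)))"
        by (rule prod.permute[OF t, unfolded o_def, simplified])
      also have "\<dots> = (\<Prod>k\<in>I. M k (p k))"
      proof (rule prod.cong[OF refl])
        fix k assume k: "k \<in> I"
        hence "p k \<in> I" using p permutes_in_image by metis
        thus "M (?t k) ((p \<circ> ?t) (?t k)) = M k (p k)"
          using eq by (cases "k = i"; cases "k = j") (auto simp: Transposition.transpose_def)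
      qed
      finally show ?thesis .
    qed
    ultimately show ?thesis by simp
  qed
  have "pdet M I = (\<Sum>p | p permutes I. ?F (p \<circ> ?t))"
    unfolding pdet_def using t
    by (intro sum.reindex_bij_witness[where i="\<lambda>p. p \<circ> ?t" and j="\<lambda>p. p \<circ> ?t"])
       (auto simp: permutes_compose o_assoc[symmetric])
  also have "\<dots> = - pdet M I"
    unfolding pdet_def sum_negf[symmetric] by (intro sum.cong) (use F in auto)
  finally show ?thesis by simp
qed

lemma pdet_row_op:
  assumes "finite I" "i \<in> I" "b \<in> I" "b \<noteq> i"
  shows "pdet (M(i := \<lambda>j. M i j + c * M b j)) I = pdet M I"
proof -
  have "pdet (M(i := M b)) I = 0"
    by (rule pdet_equal_rows[of _ i b]) (use assms in auto)
  thus ?thesis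
    using pdet_row_linear[OF assms(1,2), of M 1 "M i" c "M b"] by simp
qed

text \<open>Common core of the expansions along a row and along a column: by \<open>z\<close> only
  permutations fixing \<open>b\<close> contribute, and these are the permutations of
  \<open>C\<close>.\<close>

lemma pdet_insert_aux:
  assumes fin: "finite C" and b: "b \<notin> C"
    and z: "\<And>p. p permutes insert b C \<Longrightarrow> p b \<noteq> b \<Longrightarrow> (\<Prod>i\<in>insert b C. M i (p i)) = 0"
  shows "pdet M (insert b C) = M b b * pdet M C"
proof -
  have sub: "{p. p permutes C} \<subseteq> {p. p permutes insert b C}"
    by (auto intro: permutes_subset)
  have "pdet M (insert b C) = (\<Sum>p | p permutes C. of_int (sign p) * (\<Prod>i\<in>insert b C. M i (p i)))"
    unfolding pdet_def
  proof (rule sum.mono_neutral_right[OF _ sub], goal_cases)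
    case 1 show ?case using fin by (simp add: finite_permutations)
  next
    case 2
    show ?case
    proof
    fix p assume "p \<in> {p. p permutes insert b C} - {p. p permutes C}"
    hence p: "p permutes insert b C" "\<not> p permutes C" by auto
    have "p b \<noteq> b"
      using p permutes_superset[of p "insert b C" C] by auto
    thus "of_int (sign p) * (\<Prod>i\<in>insert b C. M i (p i)) = 0"
      using z p by simp
    qed
  qed
  also have "\<dots> = M b b * pdet M C"
    unfolding pdet_def sum_distrib_left using fin b
    by (intro sum.cong refl) (auto simp: permutes_not_in algebra_simps)
  finally show ?thesis .
qed

lemma pdet_insert_row:
  assumes "finite C" "b \<notin> C" "\<And>j. j \<in> C \<Longrightarrow> M b j = 0"
  shows "pdet M (insert b C) = M b b * pdet M C"
proof (rule pdet_insert_aux[OF assms(1,2)])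
  fix p assume p: "p permutes insert b C" "p b \<noteq> b"
  hence "p b \<in> C" using permutes_in_image[OF p(1), of b] by auto
  thus "(\<Prod>i\<in>insert b C. M i (p i)) = 0" using assms by auto
qed

lemma pdet_insert_col:
  assumes "finite C" "b \<notin> C" "\<And>i. i \<in> C \<Longrightarrow> M i b = 0"
  shows "pdet M (insert b C) = M b b * pdet M C"
proof (rule pdet_insert_aux[OF assms(1,2)])
  fix p assume p: "p permutes insert b C" "p b \<noteq> b"
  have "inv p b \<noteq> b" "p (inv p b) = b"
    using p permutes_inverses[OF p(1)] by metis+
  moreover hence "inv p b \<in> C" using permutes_in_image[OF p(1), of "inv p b"] by auto
  ultimately show "(\<Prod>i\<in>insert b C. M i (p i)) = 0"
    using assms by (intro prod_zero) (auto intro!: bexI[of _ "inv p b"])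
qed

lemma pdet_Schur:
  assumes fin: "finite C" and b: "b \<notin> C" and nz: "M b b \<noteq> 0"
  shows "pdet M (insert b C) = M b b * pdet (\<lambda>i j. M i j - M i b * M b j / M b b) C"
proof -
  \<comment> \<open>\<open>E D\<close> is the matrix after multiples of row \<open>b\<close> have
    been subtracted from the rows in \<open>D\<close> so as to clear their entries in column
    \<open>b\<close>.\<close>
  define E where "E D = (\<lambda>i. if i \<in> D then (\<lambda>j. M i j - M i b * M b j / M b b) else M i)" for D
  have "pdet (E D) (insert b C) = pdet M (insert b C)" if "D \<subseteq> C" for D
    using finite_subset[OF that fin] that
  proof (induction D rule: finite_induct)
    case empty thus ?case by (simp add: E_def)
  next
    case (insert d D)
    have "E (insert d D) = (E D)(d := \<lambda>j. E D d j + (- M d b / M b b) * E D b j)"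
      using insert b by (auto simp: E_def fun_eq_iff)
    hence "pdet (E (insert d D)) (insert b C) = pdet (E D) (insert b C)"
      using insert b fin by (simp only:) (rule pdet_row_op, auto)
    thus ?case using insert by simp
  qed
  from this[OF subset_refl] have "pdet M (insert b C) = pdet (E C) (insert b C)" by simp
  also have "\<dots> = E C b b * pdet (E C) C"
    by (rule pdet_insert_col[OF fin b]) (use nz in \<open>auto simp: E_def\<close>)
  also have "pdet (E C) C = pdet (\<lambda>i j. M i j - M i b * M b j / M b b) C"
    by (intro pdet_cong) (auto simp: E_def)
  finally show ?thesis using b by (simp add: E_def)
qed

lemma pdet_identity_plus:
  assumes "finite A"
  shows "pdet (\<lambda>i j. of_bool (i = j) + T i j) A = (\<Sum>I\<in>Pow A. pdet T I)"
proof -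
  \<comment> \<open>Multilinearity in the rows, one row at a time. \<open>D\<close> collects the
    rows for which the \<open>T\<close> part has already been chosen; where the identity part is
    chosen, the index drops out.\<close>
  have *: "pdet (\<lambda>i j. (if i \<in> C then of_bool (i = j) else 0) + T i j) (C \<union> D) = (\<Sum>I\<in>Pow C. pdet T (I \<union> D))"
    if "finite C" "finite D" "C \<inter> D = {}" for C D
    using that
  proof (induction C arbitrary: D rule: finite_induct)
    case empty thus ?case by simp
  next
    case (insert b C)
    let ?M = "\<lambda>C i j. (if i \<in> C then of_bool (i = j) else 0) + T i j"
    let ?X = "insert b (C \<union> D)"
    have fX: "finite ?X" using insert by auto
    have "?M (insert b C) = (?M C)(b := \<lambda>j. 1 * of_bool (b = j) + 1 * T b j)"
      using insert.hyps by (auto simp: fun_eq_iff)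
    hence "pdet (?M (insert b C)) ?X = pdet ((?M C)(b := \<lambda>j. of_bool (b = j))) ?X + pdet ((?M C)(b := T b)) ?X"
      using pdet_row_linear[OF fX, of b "?M C" 1 "\<lambda>j. of_bool (b = j)" 1 "T b"] by simp
    also have "pdet ((?M C)(b := \<lambda>j. of_bool (b = j))) ?X = pdet ((?M C)(b := \<lambda>j. of_bool (b = j))) (C \<union> D)"
      using insert by (subst pdet_insert_row) auto
    also have "\<dots> = pdet (?M C) (C \<union> D)"
      using insert by (intro pdet_cong) auto
    also have "\<dots> = (\<Sum>I\<in>Pow C. pdet T (I \<union> D))" using insert by auto
    also have "(?M C)(b := T b) = ?M C" using insert by (auto simp: fun_eq_iff)
    also have "pdet (?M C) ?X = pdet (?M C) (C \<union> insert b D)" by simp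
    also have "\<dots> = (\<Sum>I\<in>Pow C. pdet T (I \<union> insert b D))" using insert by (intro insert.IH) auto
    also have "\<dots> = (\<Sum>I\<in>insert b ` Pow C. pdet T (I \<union> D))"
      using insert by (subst sum.reindex) (auto intro!: inj_onI, (metis insert_ident subset_iff)+)
    also have "(\<Sum>I\<in>Pow C. pdet T (I \<union> D)) + (\<Sum>I\<in>insert b ` Pow C. pdet T (I \<union> D)) =
        (\<Sum>I\<in>Pow (insert b C). pdet T (I \<union> D))"
      unfolding Pow_insert using insert by (subst sum.union_disjoint) auto
    finally show ?case by simp
  qed
  have "pdet (\<lambda>i j. of_bool (i = j) + T i j) A = pdet (\<lambda>i j. (if i \<in> A then of_bool (i = j) else 0) + T i j) (A \<union> {})"
    by (simp, intro pdet_cong) auto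
  also have "\<dots> = (\<Sum>I\<in>Pow A. pdet T I)" using *[OF assms, of "{}"] by simp
  finally show ?thesis .
qed

lemma pdet_reindex:
  assumes "finite A" "inj_on f A"
  shows "pdet M (f ` A) = pdet (\<lambda>i j. M (f i) (f j)) A"
proof -
  have b: "bij_betw f A (f ` A)" "bij_betw (inv_into A f) (f ` A) A"
    using assms by (auto simp: inj_on_imp_bij_betw bij_betw_inv_into)
  have "pdet (\<lambda>i j. M (f i) (f j)) A = pdet M (f ` A)"
    unfolding pdet_def
  proof (rule sum.reindex_bij_witness[where j="map_permutation A f" and i="map_permutation (f ` A) (inv_into A f)"], goal_cases)
    case (1 p) thus ?case using map_permutation_compose_inv[OF b(1), of p "inv_into A f"] assms by simp
  next
    case (2 p) thus ?case using map_permutation_permutes[OF b(1)] by simp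
  next
    case (3 p) thus ?case using map_permutation_compose_inv[OF b(2), of p f] by (simp add: f_inv_into_f)
  next
    case (4 p) thus ?case using map_permutation_permutes[OF b(2)] by simp
  next
    case (5 p)
    have "(\<Prod>i\<in>f ` A. M i (map_permutation A f p i)) = (\<Prod>i\<in>A. M (f i) (f (p i)))"
      using assms by (simp add: prod.reindex map_permutation_apply)
    thus ?case using 5 assms by (simp add: sign_map_permutation)
  qed
  thus ?thesis by simp
qed

text \<open>Both sides are the determinant of the block matrix with diagonal blocks \<open>1\<close> and
  off-diagonal blocks \<open>Y\<close> and \<open>Z\<close>.\<close>
lemma pdet_Sylvester:
  assumes "finite A" "finite B"
  shows "pdet (\<lambda>i j. of_bool (i = j) - (\<Sum>b\<in>B. Y i b * Z b j)) A =
         pdet (\<lambda>b c. of_bool (b = c) - (\<Sum>i\<in>A. Z b i * Y i c)) B"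
proof -
  \<comment> \<open>Eliminating \<open>B\<close>, on which \<open>M\<close> is the identity, leaves
    the Schur complement on \<open>A\<close>. Removing one index \<open>b\<close> keeps the rest of
    the block equal to the identity, since \<open>M c b = 0\<close> for the other \<open>c\<close>
    in \<open>B\<close>.\<close>
  have elim: "pdet M (A \<union> B) = pdet (\<lambda>i j. M i j - (\<Sum>b\<in>B. M i b * M b j)) A"
    if "finite A" "finite B" "A \<inter> B = {}" "\<And>b c. b \<in> B \<Longrightarrow> c \<in> B \<Longrightarrow> M b c = of_bool (b = c)"
    for A B :: "'x set" and M :: "'x \<Rightarrow> 'x \<Rightarrow> complex"
    using that(2,1,3,4)
  proof (induction B arbitrary: M rule: finite_induct)
    case empty thus ?case by simp
  next
    case (insert b B)
    let ?N = "\<lambda>i j. M i j - M i b * M b j"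
    have "pdet M (A \<union> insert b B) = pdet ?N (A \<union> B)"
      using pdet_Schur[of "A \<union> B" b M] insert by auto
    also have "\<dots> = pdet (\<lambda>i j. ?N i j - (\<Sum>c\<in>B. ?N i c * ?N c j)) A"
      using insert by (intro insert.IH) auto
    also have "\<dots> = pdet (\<lambda>i j. M i j - (\<Sum>c\<in>insert b B. M i c * M c j)) A"
    proof (rule pdet_cong)
      fix i j assume "i \<in> A" "j \<in> A"
      have "(\<Sum>c\<in>B. ?N i c * ?N c j) = (\<Sum>c\<in>B. M i c * M c j)"
        using insert by (intro sum.cong) auto
      thus "?N i j - (\<Sum>c\<in>B. ?N i c * ?N c j) = M i j - (\<Sum>c\<in>insert b B. M i c * M c j)"
        using insert by simp
    qed
    finally show ?case .
  qed
  define M :: "'a + 'b \<Rightarrow> 'a + 'b \<Rightarrow> complex" where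
    "M = (\<lambda>x y. case x of Inl i \<Rightarrow> (case y of Inl j \<Rightarrow> of_bool (i = j) | Inr c \<Rightarrow> Y i c)
       | Inr b \<Rightarrow> (case y of Inl j \<Rightarrow> Z b j | Inr c \<Rightarrow> of_bool (b = c)))"
  have "pdet (\<lambda>i j. of_bool (i = j) - (\<Sum>b\<in>B. Y i b * Z b j)) A = pdet (\<lambda>x y. M x y - (\<Sum>b\<in>Inr ` B. M x b * M b y)) (Inl ` A)"
    using assms by (subst pdet_reindex) (auto simp: M_def sum.reindex inj_on_def)
  also have "\<dots> = pdet M (Inl ` A \<union> Inr ` B)"
    by (rule elim[symmetric]) (use assms in \<open>auto simp: M_def\<close>)
  also have "\<dots> = pdet M (Inr ` B \<union> Inl ` A)" by (simp add: Un_commute)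
  also have "\<dots> = pdet (\<lambda>x y. M x y - (\<Sum>b\<in>Inl ` A. M x b * M b y)) (Inr ` B)"
    by (rule elim) (use assms in \<open>auto simp: M_def\<close>)
  also have "\<dots> = pdet (\<lambda>b c. of_bool (b = c) - (\<Sum>i\<in>A. Z b i * Y i c)) B"
    using assms by (subst pdet_reindex) (auto simp: M_def sum.reindex inj_on_def)
  finally show ?thesis .
qed

section \<open>Gram determinants of infinite families\<close>

text \<open>Functions on the circle are handled through their families of Fourier coefficients:
  these are determined pointwise, the functions only up to null sets.\<close>

definition l2 :: "('k \<Rightarrow> complex) \<Rightarrow> bool" where
  "l2 x \<longleftrightarrow> (\<lambda>k. (cmod (x k))\<^sup>2) summable_on UNIV"

definition ip :: "('k \<Rightarrow> complex) \<Rightarrow> ('k \<Rightarrow> complex) \<Rightarrow> complex" where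
  "ip x y = (\<Sum>\<^sub>\<infinity>k. cnj (x k) * y k)"

definition nrm :: "('k \<Rightarrow> complex) \<Rightarrow> real" where
  "nrm x = sqrt (\<Sum>\<^sub>\<infinity>k. (cmod (x k))\<^sup>2)"

definition res :: "'k set \<Rightarrow> ('k \<Rightarrow> complex) \<Rightarrow> 'k \<Rightarrow> complex" where
  "res S x = (\<lambda>k. if k \<in> S then x k else 0)"

lemma l2_dominated:
  assumes "\<And>k. (cmod (z k))\<^sup>2 \<le> f k" "f summable_on UNIV"
  shows "l2 z"
  unfolding l2_def by (rule summable_on_comparison_test[OF assms(2)]) (use assms in auto)

lemma l2_zero [simp]: "l2 (\<lambda>_. 0)"
  by (simp add: l2_def)

lemma l2_scale [simp]: "l2 x \<Longrightarrow> l2 (\<lambda>k. c * x k)"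
  by (simp add: l2_def norm_mult power_mult_distrib summable_on_cmult_right)

lemma cmod_add_square_le: "(cmod (a + b))\<^sup>2 \<le> 2 * (cmod a)\<^sup>2 + 2 * (cmod b)\<^sup>2"
proof -
  have "(cmod (a + b))\<^sup>2 \<le> (cmod a + cmod b)\<^sup>2"
    by (intro power_mono norm_triangle_ineq) auto
  also have "\<dots> \<le> 2 * (cmod a)\<^sup>2 + 2 * (cmod b)\<^sup>2"
    using zero_le_power2[of "cmod a - cmod b"] by (simp add: power2_eq_square algebra_simps)
  finally show ?thesis .
qed

lemma l2_add [simp]: "l2 x \<Longrightarrow> l2 y \<Longrightarrow> l2 (\<lambda>k. x k + y k)"
  by (rule l2_dominated[OF cmod_add_square_le])
     (auto simp: l2_def intro!: summable_on_add summable_on_cmult_right)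

lemma l2_diff [simp]: "l2 x \<Longrightarrow> l2 y \<Longrightarrow> l2 (\<lambda>k. x k - y k)"
  using l2_add[of x "\<lambda>k. (-1) * y k"] l2_scale[of y "-1"] by simp

lemma l2_sum [simp]: "(\<And>i. i \<in> A \<Longrightarrow> l2 (x i)) \<Longrightarrow> l2 (\<lambda>k. \<Sum>i\<in>A. x i k)"
  by (induction A rule: infinite_finite_induct) auto

lemma l2_res [simp]: "l2 x \<Longrightarrow> l2 (res S x)"
  by (rule l2_dominated[of _ "\<lambda>k. (cmod (x k))\<^sup>2"]) (auto simp: l2_def res_def)

lemma ip_abs_summable:
  assumes "l2 x" "l2 y"
  shows "(\<lambda>k. norm (cnj (x k) * y k)) summable_on A"
proof (rule summable_on_comparison_test)
  show "(\<lambda>k. (cmod (x k))\<^sup>2 + (cmod (y k))\<^sup>2) summable_on A"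
    using assms unfolding l2_def by (intro summable_on_add) (auto intro: summable_on_subset)
  fix k show "norm (cnj (x k) * y k) \<le> (cmod (x k))\<^sup>2 + (cmod (y k))\<^sup>2"
    using sum_squares_bound[of "cmod (x k)" "cmod (y k)"] mult_nonneg_nonneg[OF norm_ge_zero norm_ge_zero, of "x k" "y k"]
    unfolding norm_mult complex_mod_cnj by linarith
qed auto

lemma ip_summable:
  assumes "l2 x" "l2 y"
  shows "(\<lambda>k. cnj (x k) * y k) summable_on A"
  by (rule abs_summable_summable) (rule ip_abs_summable[OF assms])

lemma ip_add_right: "l2 x \<Longrightarrow> l2 y \<Longrightarrow> l2 z \<Longrightarrow> ip x (\<lambda>k. y k + z k) = ip x y + ip x z"
  unfolding ip_def by (simp add: distrib_left infsum_add ip_summable)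

lemma ip_scale_right: "ip x (\<lambda>k. c * y k) = c * ip x y"
  unfolding ip_def by (simp add: mult.left_commute infsum_cmult_right')

lemma ip_cnj: "cnj (ip x y) = ip y x"
  unfolding ip_def infsum_cnj[symmetric] by (simp add: mult.commute)

lemma ip_add_left: "l2 x \<Longrightarrow> l2 y \<Longrightarrow> l2 z \<Longrightarrow> ip (\<lambda>k. y k + z k) x = ip y x + ip z x"
  by (subst (1 2 3) ip_cnj[symmetric]) (simp add: ip_add_right)

lemma ip_scale_left: "ip (\<lambda>k. c * y k) x = cnj c * ip y x"
  by (subst (1 2) ip_cnj[symmetric]) (simp add: ip_scale_right)

lemma ip_diff_right: "l2 x \<Longrightarrow> l2 y \<Longrightarrow> l2 z \<Longrightarrow> ip x (\<lambda>k. y k - z k) = ip x y - ip x z"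
  using ip_add_right[of x y "\<lambda>k. (-1) * z k"] ip_scale_right[of x "-1" z] l2_scale[of z "-1"] by simp

lemma ip_diff_left: "l2 x \<Longrightarrow> l2 y \<Longrightarrow> l2 z \<Longrightarrow> ip (\<lambda>k. y k - z k) x = ip y x - ip z x"
  by (subst (1 2 3) ip_cnj[symmetric]) (simp add: ip_diff_right)

lemma ip_sum_right: "l2 x \<Longrightarrow> (\<And>i. i \<in> A \<Longrightarrow> l2 (y i)) \<Longrightarrow> ip x (\<lambda>k. \<Sum>i\<in>A. y i k) = (\<Sum>i\<in>A. ip x (y i))"
  by (induction A rule: infinite_finite_induct) (auto simp: ip_add_right, (simp add: ip_def)+)

lemma ip_sum_left: "l2 x \<Longrightarrow> (\<And>i. i \<in> A \<Longrightarrow> l2 (y i)) \<Longrightarrow> ip (\<lambda>k. \<Sum>i\<in>A. y i k) x = (\<Sum>i\<in>A. ip (y i) x)"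
  using arg_cong[OF ip_sum_right[of x A y], of cnj] by (simp add: ip_cnj)

lemma nrm_nonneg [simp]: "0 \<le> nrm x"
  by (simp add: nrm_def infsum_nonneg)

lemma nrm_sq: "(nrm x)\<^sup>2 = (\<Sum>\<^sub>\<infinity>k. (cmod (x k))\<^sup>2)"
  by (simp add: nrm_def infsum_nonneg)

lemma ip_self:
  assumes "l2 x"
  shows "ip x x = of_real ((nrm x)\<^sup>2)"
proof -
  have "ip x x = (\<Sum>\<^sub>\<infinity>k. of_real ((cmod (x k))\<^sup>2))"
    unfolding ip_def by (intro infsum_cong) (simp add: mult.commute complex_norm_square[symmetric])
  also have "\<dots> = of_real (\<Sum>\<^sub>\<infinity>k. (cmod (x k))\<^sup>2)"
    using assms unfolding l2_def by (intro infsumI has_sum_of_real has_sum_infsum)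
  finally show ?thesis by (simp add: nrm_sq)
qed

lemma nrm_zero [simp]: "nrm (\<lambda>_. 0) = 0"
  by (simp add: nrm_def)

lemma nrm_scale: "nrm (\<lambda>k. c * x k) = cmod c * nrm x"
  by (simp add: nrm_def norm_mult power_mult_distrib infsum_cmult_right' real_sqrt_mult)

lemma nrm_eq_zero: "l2 x \<Longrightarrow> nrm x = 0 \<Longrightarrow> x k = 0"
  using nonneg_infsum_le_0D[of "\<lambda>k. (cmod (x k))\<^sup>2" UNIV k] by (simp add: nrm_def l2_def)

lemma nrm_mono: "l2 y \<Longrightarrow> (\<And>k. cmod (x k) \<le> cmod (y k)) \<Longrightarrow> nrm x \<le> nrm y"
  unfolding nrm_def real_sqrt_le_iff
  by (intro infsum_mono) (auto simp: l2_def intro!: power_mono summable_on_comparison_test[of "\<lambda>k. (cmod (y k))\<^sup>2"])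

lemma nrm_res_le: "l2 x \<Longrightarrow> nrm (res S x) \<le> nrm x"
  by (rule nrm_mono) (auto simp: res_def)

text \<open>The projection onto the orthogonal complement of \<open>b\<close>; division by zero
  makes it the identity for \<open>b = 0\<close>.\<close>

definition pj :: "('k \<Rightarrow> complex) \<Rightarrow> ('k \<Rightarrow> complex) \<Rightarrow> 'k \<Rightarrow> complex" where
  "pj b x = (\<lambda>k. x k - ip b x / ip b b * b k)"

lemma l2_pj [simp]: "l2 b \<Longrightarrow> l2 x \<Longrightarrow> l2 (pj b x)"
  unfolding pj_def by (intro l2_diff l2_scale)

lemma ip_pj:
  assumes "l2 b" "l2 x" "l2 y" "nrm b \<noteq> 0"
  shows "ip (pj b x) (pj b y) = ip x y - ip x b * ip b y / ip b b"
proof -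
  have bb: "ip b b \<noteq> 0" "cnj (ip b b) = ip b b" using assms by (auto simp: ip_self)
  have 1: "ip b (pj b y) = 0"
    unfolding pj_def using assms bb by (simp add: ip_diff_right ip_scale_right del: times_divide_eq_left) simp
  have "ip (pj b x) (pj b y) = ip x (pj b y) - cnj (ip b x / ip b b) * ip b (pj b y)"
    using assms by (subst (1) pj_def) (simp add: ip_diff_left ip_scale_left del: complex_cnj_divide times_divide_eq_left)
  also have "\<dots> = ip x y - ip b y / ip b b * ip x b"
    unfolding 1 using assms by (simp add: pj_def ip_diff_right ip_scale_right del: times_divide_eq_left)
  finally show ?thesis by (simp add: algebra_simps)
qed

lemma nrm_pj_sq:
  assumes "l2 b" "l2 x" "nrm b \<noteq> 0"
  shows "(nrm (pj b x))\<^sup>2 = (nrm x)\<^sup>2 - (cmod (ip b x))\<^sup>2 / (nrm b)\<^sup>2"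
proof -
  have "ip x b * ip b x = of_real ((cmod (ip b x))\<^sup>2)"
    unfolding complex_norm_square by (subst (1) ip_cnj[symmetric]) (simp add: mult.commute)
  hence "complex_of_real ((nrm (pj b x))\<^sup>2) = of_real ((nrm x)\<^sup>2 - (cmod (ip b x))\<^sup>2 / (nrm b)\<^sup>2)"
    using ip_pj[OF assms(1,2,2,3)] assms by (simp add: ip_self)
  thus ?thesis using of_real_eq_iff by blast
qed

lemma nrm_pj_le: "l2 b \<Longrightarrow> l2 x \<Longrightarrow> nrm b \<noteq> 0 \<Longrightarrow> nrm (pj b x) \<le> nrm x"
  by (rule power2_le_imp_le) (auto simp: nrm_pj_sq)

lemma ip_Cauchy_Schwarz:
  assumes "l2 x" "l2 y"
  shows "cmod (ip x y) \<le> nrm x * nrm y"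
proof (cases "nrm x = 0")
  case True
  hence "x = (\<lambda>_. 0)" using nrm_eq_zero[OF assms(1)] by auto
  thus ?thesis by (simp add: ip_def)
next
  case False
  hence "(cmod (ip x y))\<^sup>2 / (nrm x)\<^sup>2 \<le> (nrm y)\<^sup>2"
    using nrm_pj_sq[OF assms False] zero_le_power2[of "nrm (pj x y)"] by linarith
  hence "(cmod (ip x y))\<^sup>2 \<le> (nrm x * nrm y)\<^sup>2"
    using False by (simp add: field_simps)
  thus ?thesis by (rule power2_le_imp_le) auto
qed

lemma nrm_triangle:
  assumes "l2 x" "l2 y"
  shows "nrm (\<lambda>k. x k + y k) \<le> nrm x + nrm y"
proof (rule power2_le_imp_le)
  have "complex_of_real ((nrm (\<lambda>k. x k + y k))\<^sup>2) = of_real ((nrm x)\<^sup>2 + (nrm y)\<^sup>2) + (ip x y + cnj (ip x y))"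
    using assms by (simp add: ip_self[symmetric] ip_add_left ip_add_right ip_cnj del: of_real_power)
  also have "\<dots> = of_real ((nrm x)\<^sup>2 + (nrm y)\<^sup>2 + 2 * Re (ip x y))"
    by (simp add: complex_add_cnj)
  finally have "(nrm (\<lambda>k. x k + y k))\<^sup>2 = (nrm x)\<^sup>2 + (nrm y)\<^sup>2 + 2 * Re (ip x y)"
    using of_real_eq_iff by blast
  also have "\<dots> \<le> (nrm x)\<^sup>2 + (nrm y)\<^sup>2 + 2 * (nrm x * nrm y)"
    using ip_Cauchy_Schwarz[OF assms] complex_Re_le_cmod[of "ip x y"] by linarith
  finally show "(nrm (\<lambda>k. x k + y k))\<^sup>2 \<le> (nrm x + nrm y)\<^sup>2"
    by (simp add: power2_eq_square algebra_simps)
qed auto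

section \<open>Gram determinants of finite families\<close>

definition gram :: "('i \<Rightarrow> 'k \<Rightarrow> complex) \<Rightarrow> 'i \<Rightarrow> 'i \<Rightarrow> complex" where
  "gram x i j = ip (x i) (x j)"

lemma pdet_gram_zero:
  assumes "finite A" "b \<in> A" "\<And>i. i \<in> A \<Longrightarrow> l2 (x i)" "nrm (x b) = 0"
  shows "pdet (gram x) A = 0"
proof (rule pdet_row_zero[OF assms(1,2)])
  have "x b = (\<lambda>_. 0)" using nrm_eq_zero[of "x b"] assms by auto
  thus "gram x b j = 0" for j by (simp add: gram_def ip_def)
qed

text \<open>The Schur complement of a Gram matrix is again a Gram matrix, that of the vectors
  projected off \<open>x b\<close>. The induction below rests on this.\<close>

lemma pdet_gram_Schur:
  assumes "finite C" "b \<notin> C" "\<And>i. i \<in> insert b C \<Longrightarrow> l2 (x i)" "nrm (x b) \<noteq> 0"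
  shows "pdet (gram x) (insert b C) = of_real ((nrm (x b))\<^sup>2) * pdet (gram (\<lambda>i. pj (x b) (x i))) C"
proof -
  have "pdet (gram x) (insert b C) = gram x b b * pdet (\<lambda>i j. gram x i j - gram x i b * gram x b j / gram x b b) C"
    by (rule pdet_Schur) (use assms in \<open>auto simp: gram_def ip_self\<close>)
  also have "pdet (\<lambda>i j. gram x i j - gram x i b * gram x b j / gram x b b) C = pdet (gram (\<lambda>i. pj (x b) (x i))) C"
    using assms by (intro pdet_cong) (auto simp: gram_def ip_pj)
  finally show ?thesis using assms unfolding gram_def[of x b b] by (simp add: ip_self)
qed

text \<open>What the limit arguments retain of a projection: linearity and the norm bound. No
  formula for \<open>R\<close> has to be carried along.\<close>

definition linear_contraction :: "(('k \<Rightarrow> complex) \<Rightarrow> 'k \<Rightarrow> complex) \<Rightarrow> bool" where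
  "linear_contraction R \<longleftrightarrow>
     (\<forall>v. l2 v \<longrightarrow> l2 (R v) \<and> nrm (R v) \<le> nrm v) \<and>
     (\<forall>v w. l2 v \<longrightarrow> l2 w \<longrightarrow> R (\<lambda>k. v k + w k) = (\<lambda>k. R v k + R w k)) \<and>
     (\<forall>t v. l2 v \<longrightarrow> R (\<lambda>k. t * v k) = (\<lambda>k. t * R v k))"

text \<open>Here \<open>c\<close> is the Gram determinant of the \<open>x i\<close> and \<open>R\<close> is the projection onto their orthogonal
  complement, up to the degenerate case \<open>c = 0\<close>.\<close>
lemma gram_insert_quadratic_form:
  fixes x :: "'i \<Rightarrow> 'k \<Rightarrow> complex"
  assumes "finite A" "\<forall>i\<in>A. l2 (x i)"
  shows "\<exists>c R. 0 \<le> c \<and> pdet (gram x) A = of_real c \<and>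
     linear_contraction R \<and>
     (\<forall>v i. l2 v \<longrightarrow> i \<notin> A \<longrightarrow> pdet (gram (x(i := v))) (insert i A) = of_real (c * (nrm (R v))\<^sup>2))"
  using assms
proof (induction A arbitrary: x rule: finite_induct)
  case empty
  have "pdet (gram (x(i := v))) {i} = of_real ((nrm v)\<^sup>2)" if "l2 v" for v i
    using pdet_insert_row[of "{}" i "gram (x(i := v))"] that by (simp add: gram_def ip_self)
  thus ?case by (intro exI[of _ 1] exI[of _ "\<lambda>v. v"]) (simp add: linear_contraction_def del: fun_upd_apply)
next
  case (insert b C)
  show ?case
  proof (cases "nrm (x b) = 0")
    case True
    have "pdet (gram x) (insert b C) = 0"
      using True insert by (intro pdet_gram_zero[of _ b]) auto
    moreover have "pdet (gram (x(i := v))) (insert i (insert b C)) = 0" if "l2 v" "i \<notin> insert b C" for v i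
      using True insert that by (intro pdet_gram_zero[of _ b]) auto
    ultimately show ?thesis
      by (intro exI[of _ 0] exI[of _ "\<lambda>v. v"]) (simp add: linear_contraction_def del: fun_upd_apply)
  next
    case False
    have xb: "l2 (x b)" using insert by auto
    let ?x = "\<lambda>i. pj (x b) (x i)"
    have "\<forall>i\<in>C. l2 (?x i)" using insert by auto
    from insert.IH[OF this] obtain c R where R: "0 \<le> c" "pdet (gram ?x) C = of_real c"
      "linear_contraction R"
      "\<And>v i. l2 v \<Longrightarrow> i \<notin> C \<Longrightarrow> pdet (gram (?x(i := v))) (insert i C) = of_real (c * (nrm (R v))\<^sup>2)"
      by blast
    have R3: "nrm (R v) \<le> nrm v" if "l2 v" for v
      using R(3) that by (simp add: linear_contraction_def)
    have pa: "pj (x b) (\<lambda>k. v k + w k) = (\<lambda>k. pj (x b) v k + pj (x b) w k)" if "l2 v" "l2 w" for v w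
      using that xb by (auto simp: pj_def ip_add_right fun_eq_iff add_divide_distrib algebra_simps)
    have ps: "pj (x b) (\<lambda>k. t * v k) = (\<lambda>k. t * pj (x b) v k)" for t v
      by (auto simp: pj_def ip_scale_right fun_eq_iff algebra_simps)
    \<comment> \<open>The pivot is \<open>b\<close> and not the new index \<open>i\<close>: the
      pivoting is then independent of \<open>v\<close>, and one \<open>R\<close> serves all
      \<open>v\<close>.\<close>
    have 1: "pdet (gram (x(i := v))) (insert i (insert b C)) = of_real ((nrm (x b))\<^sup>2 * c * (nrm (R (pj (x b) v)))\<^sup>2)"
      if v: "l2 v" and i: "i \<notin> insert b C" for v i
    proof -
      let ?y = "x(i := v)"
      have yb: "?y b = x b" using i by auto
      have "pdet (gram ?y) (insert b (insert i C)) = of_real ((nrm (?y b))\<^sup>2) * pdet (gram (\<lambda>j. pj (?y b) (?y j))) (insert i C)"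
        using insert i v False yb by (intro pdet_gram_Schur) auto
      also have "(\<lambda>j. pj (?y b) (?y j)) = ?x(i := pj (x b) v)"
        unfolding yb by (rule ext) simp
      also have "pdet (gram \<dots>) (insert i C) = of_real (c * (nrm (R (pj (x b) v)))\<^sup>2)"
        using i v xb by (intro R) auto
      finally show ?thesis unfolding yb by (simp only: of_real_mult mult.assoc insert_commute[of i b])
    qed
    have 2: "pdet (gram x) (insert b C) = of_real ((nrm (x b))\<^sup>2 * c)"
      using pdet_gram_Schur[of C b x] insert False R(2) by simp
    have 3: "linear_contraction (\<lambda>v. R (pj (x b) v))"
      using R(3) order_trans[OF R3 nrm_pj_le[OF xb _ False]] xb
      by (auto simp: linear_contraction_def pa ps)
    show ?thesis
      by (intro exI[of _ "(nrm (x b))\<^sup>2 * c"] exI[of _ "\<lambda>v. R (pj (x b) v)"] conjI allI impI 1 2 3)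
         (use R(1) in auto)
  qed
qed

text \<open>The real part loses nothing, since Gram determinants of square-summable vectors are real
  (\<open>pdet_gram_eq\<close>).\<close>

definition gdet :: "('i \<Rightarrow> 'k \<Rightarrow> complex) \<Rightarrow> 'i set \<Rightarrow> real" where
  "gdet x A = Re (pdet (gram x) A)"

lemma gdet_empty [simp]: "gdet x {} = 1"
  by (simp add: gdet_def)

lemma
  assumes "finite A" "\<And>i. i \<in> A \<Longrightarrow> l2 (x i)"
  shows gdet_nonneg: "0 \<le> gdet x A"
    and pdet_gram_eq: "pdet (gram x) A = of_real (gdet x A)"
proof -
  have xA: "\<forall>i\<in>A. l2 (x i)" using assms by blast
  obtain c where "0 \<le> c" "pdet (gram x) A = of_real c"
    using gram_insert_quadratic_form[OF assms(1) xA] by (elim exE conjE) (rule that)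
  thus "0 \<le> gdet x A" "pdet (gram x) A = of_real (gdet x A)" by (simp_all add: gdet_def)
qed

lemma gdet_insert_quadratic_form:
  assumes "finite A" and xA: "\<forall>i\<in>A. l2 (x i)"
  obtains R where "linear_contraction R"
     "\<And>v i. l2 v \<Longrightarrow> i \<notin> A \<Longrightarrow> gdet (x(i := v)) (insert i A) = gdet x A * (nrm (R v))\<^sup>2"
proof -
  obtain c R where cR: "0 \<le> c \<and> pdet (gram x) A = of_real c \<and>
     linear_contraction R \<and>
     (\<forall>v i. l2 v \<longrightarrow> i \<notin> A \<longrightarrow> pdet (gram (x(i := v))) (insert i A) = of_real (c * (nrm (R v))\<^sup>2))"
    using gram_insert_quadratic_form[OF assms(1) xA] by (elim exE)
  show thesis by (rule that[of R]) (use cR in \<open>auto simp: gdet_def\<close>)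
qed

text \<open>The new factor is the squared norm of \<open>R (x i)\<close>, and \<open>R\<close> is a
  contraction.\<close>

lemma gdet_insert_le:
  assumes "finite A" "\<And>i. i \<in> A \<Longrightarrow> l2 (x i)" "i \<notin> A" "l2 (x i)"
  shows "gdet x (insert i A) \<le> gdet x A * (nrm (x i))\<^sup>2"
proof -
  obtain R where R: "linear_contraction R"
     "\<And>v i. l2 v \<Longrightarrow> i \<notin> A \<Longrightarrow> gdet (x(i := v)) (insert i A) = gdet x A * (nrm (R v))\<^sup>2"
    by (rule gdet_insert_quadratic_form[of A x]) (use assms in auto)
  have "gdet x (insert i A) = gdet x A * (nrm (R (x i)))\<^sup>2" using R(2)[of "x i" i] assms by simp
  also have "\<dots> \<le> gdet x A * (nrm (x i))\<^sup>2"
    using assms R(1) by (intro mult_left_mono power_mono gdet_nonneg) (auto simp: linear_contraction_def)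
  finally show ?thesis .
qed

lemma gdet_Hadamard:
  assumes "finite A" "\<And>i. i \<in> A \<Longrightarrow> l2 (x i)"
  shows "gdet x A \<le> (\<Prod>i\<in>A. (nrm (x i))\<^sup>2)"
  using assms
proof (induction A rule: finite_induct)
  case (insert i A)
  have "gdet x (insert i A) \<le> gdet x A * (nrm (x i))\<^sup>2"
    using insert by (intro gdet_insert_le) auto
  also have "\<dots> \<le> (\<Prod>i\<in>A. (nrm (x i))\<^sup>2) * (nrm (x i))\<^sup>2"
    using insert by (intro mult_right_mono) auto
  finally show ?case using insert by (simp add: mult.commute)
qed auto

lemma gdet_antimono:
  assumes "finite B" "A \<subseteq> B" "\<And>i. i \<in> B \<Longrightarrow> l2 (x i)" "\<And>i. i \<in> B - A \<Longrightarrow> nrm (x i) \<le> 1"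
  shows "gdet x B \<le> gdet x A"
proof -
  have "gdet x (A \<union> C) \<le> gdet x A" if "finite C" "C \<subseteq> B - A" for C
    using that
  proof (induction C rule: finite_induct)
    case (insert i C)
    have fin: "finite A" using assms finite_subset by auto
    have "gdet x (insert i (A \<union> C)) \<le> gdet x (A \<union> C) * (nrm (x i))\<^sup>2"
      using insert fin assms by (intro gdet_insert_le) auto
    also have "\<dots> \<le> gdet x (A \<union> C)"
      using insert assms fin by (intro mult_right_le_one_le gdet_nonneg) (auto simp: power_le_one)
    also have "\<dots> \<le> gdet x A" using insert by auto
    finally show ?case by simp
  qed auto
  from this[of "B - A"] show ?thesis using assms by (simp add: Un_absorb1)
qed

lemma gdet_reindex:
  assumes "finite A" "inj_on f A"
  shows "gdet x (f ` A) = gdet (\<lambda>i. x (f i)) A"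
  unfolding gdet_def by (simp add: pdet_reindex[OF assms] gram_def[abs_def])

section \<open>Determinants over infinite index sets\<close>

definition idet :: "('i \<Rightarrow> 'i \<Rightarrow> complex) \<Rightarrow> 'i set \<Rightarrow> real" where
  "idet Q I = (INF A\<in>{A. finite A \<and> A \<subseteq> I}. Re (pdet Q A))"

text \<open>An infimum instead of a limit: for vectors of norm at most 1 the finite determinants
  decrease, so both agree, and an infimum is estimated from either side without convergence
  arguments. \<open>idet\<close> is kept separate because the dual form of the determinant comes as
  a matrix that is not given as a Gram matrix.\<close>

definition ldet :: "('i \<Rightarrow> 'k \<Rightarrow> complex) \<Rightarrow> 'i set \<Rightarrow> real" where
  "ldet x I = idet (gram x) I"

definition contr :: "('i \<Rightarrow> 'k \<Rightarrow> complex) \<Rightarrow> 'i set \<Rightarrow> bool" where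
  "contr x I \<longleftrightarrow> (\<forall>i\<in>I. l2 (x i) \<and> nrm (x i) \<le> 1)"

lemma antimono_tendsto_INF:
  fixes f :: "'a set \<Rightarrow> real"
  assumes mono: "\<And>A B. finite B \<Longrightarrow> A \<subseteq> B \<Longrightarrow> B \<subseteq> I \<Longrightarrow> f B \<le> f A"
    and low: "\<And>A. finite A \<Longrightarrow> A \<subseteq> I \<Longrightarrow> c \<le> f A"
  shows "(f \<longlongrightarrow> (INF A\<in>{A. finite A \<and> A \<subseteq> I}. f A)) (finite_subsets_at_top I)"
proof -
  let ?F = "{A. finite A \<and> A \<subseteq> I}"
  have bdd: "bdd_below (f ` ?F)" using low by (intro bdd_belowI2[of _ c]) auto
  show ?thesis
  proof (rule order_tendstoI)
    fix a assume a: "a < (INF A\<in>?F. f A)"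
    show "\<forall>\<^sub>F A in finite_subsets_at_top I. a < f A"
      unfolding eventually_finite_subsets_at_top
      using a by (intro exI[of _ "{}"]) (auto intro: less_le_trans cINF_lower[OF bdd])
  next
    fix a assume "(INF A\<in>?F. f A) < a"
    then obtain A where A: "finite A" "A \<subseteq> I" "f A < a"
      using cInf_lessD[of "f ` ?F" a] by auto
    show "\<forall>\<^sub>F A in finite_subsets_at_top I. f A < a"
      unfolding eventually_finite_subsets_at_top
      using A mono by (intro exI[of _ A]) (auto intro: le_less_trans)
  qed
qed

lemma idet_le:
  assumes "finite A" "A \<subseteq> I" "\<And>A. finite A \<Longrightarrow> A \<subseteq> I \<Longrightarrow> 0 \<le> Re (pdet Q A)"
  shows "idet Q I \<le> Re (pdet Q A)"
  unfolding idet_def by (rule cINF_lower) (use assms in \<open>auto intro!: bdd_belowI2[of _ 0]\<close>)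

lemma idet_greatest:
  assumes "\<And>A. finite A \<Longrightarrow> A \<subseteq> I \<Longrightarrow> c \<le> Re (pdet Q A)"
  shows "c \<le> idet Q I"
  unfolding idet_def by (rule cINF_greatest) (use assms in auto)

lemma idet_cong:
  assumes "\<And>i j. i \<in> I \<Longrightarrow> j \<in> I \<Longrightarrow> Q i j = Q' i j"
  shows "idet Q I = idet Q' I"
  unfolding idet_def
  by (intro INF_cong refl arg_cong[where f=Re] pdet_cong) (use assms in auto)

lemma contr_D:
  assumes "contr x I" "i \<in> I"
  shows "l2 (x i)" "nrm (x i) \<le> 1"
  using assms by (auto simp: contr_def)

lemma contr_subset_D:
  assumes "contr x I" "A \<subseteq> I" "i \<in> A"
  shows "l2 (x i)" "nrm (x i) \<le> 1"
  using assms by (auto simp: contr_def)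

lemma ldet_le: "contr x I \<Longrightarrow> finite A \<Longrightarrow> A \<subseteq> I \<Longrightarrow> ldet x I \<le> gdet x A"
  unfolding ldet_def gdet_def
  by (rule idet_le) (auto intro!: gdet_nonneg[unfolded gdet_def] dest: contr_subset_D)

lemma ldet_greatest: "(\<And>A. finite A \<Longrightarrow> A \<subseteq> I \<Longrightarrow> c \<le> gdet x A) \<Longrightarrow> c \<le> ldet x I"
  unfolding ldet_def gdet_def by (rule idet_greatest)

lemma ldet_nonneg: "contr x I \<Longrightarrow> 0 \<le> ldet x I"
  by (auto intro!: ldet_greatest gdet_nonneg dest: contr_subset_D)

lemma ldet_le_1: "contr x I \<Longrightarrow> ldet x I \<le> 1"
  using ldet_le[of x I "{}"] by simp

lemma gdet_tendsto_ldet: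
  assumes "contr x I"
  shows "(gdet x \<longlongrightarrow> ldet x I) (finite_subsets_at_top I)"
  unfolding ldet_def idet_def gdet_def[symmetric] using assms
  by (intro antimono_tendsto_INF[where c=0] gdet_antimono gdet_nonneg) (auto dest: contr_subset_D)

lemma ldet_reindex:
  assumes "bij_betw f I J"
  shows "ldet x J = ldet (\<lambda>i. x (f i)) I"
proof -
  have "{A. finite A \<and> A \<subseteq> J} = (`) f ` {A. finite A \<and> A \<subseteq> I}"
  proof (intro equalityI subsetI)
    fix B assume "B \<in> {A. finite A \<and> A \<subseteq> J}"
    then obtain A where "A \<subseteq> I" "finite A" "B = f ` A"
      using finite_subset_image[of B f I] assms by (auto simp: bij_betw_def)
    thus "B \<in> (`) f ` {A. finite A \<and> A \<subseteq> I}" by blast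
  qed (use assms in \<open>auto simp: bij_betw_def\<close>)
  moreover have "gdet x (f ` A) = gdet (\<lambda>i. x (f i)) A" if "finite A" "A \<subseteq> I" for A
    using that assms by (intro gdet_reindex) (auto simp: bij_betw_def intro: inj_on_subset)
  ultimately show ?thesis
    unfolding ldet_def idet_def gdet_def[symmetric] by (simp add: image_image)
qed

lemma tendsto_pdet:
  assumes "\<And>i j. i \<in> A \<Longrightarrow> j \<in> A \<Longrightarrow> ((\<lambda>n. M n i j) \<longlongrightarrow> N i j) F"
  shows "((\<lambda>n. pdet (M n) A) \<longlongrightarrow> pdet N A) F"
  unfolding pdet_def
  by (intro tendsto_sum tendsto_mult tendsto_prod tendsto_const assms) (auto simp: permutes_in_image)

text \<open>Each finite determinant is continuous in the entries of the Gram matrix, and an infimum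
  of continuous functions is upper semicontinuous.\<close>

lemma ldet_upper_semicontinuous:
  assumes F: "F \<noteq> bot" and lim: "\<And>i j. i \<in> I \<Longrightarrow> j \<in> I \<Longrightarrow> ((\<lambda>n. gram (x n) i j) \<longlongrightarrow> gram y i j) F"
    and c: "(c \<longlongrightarrow> d) F" and le: "\<And>n. c n \<le> ldet (x n) I" and x: "\<And>n. contr (x n) I"
  shows "d \<le> ldet y I"
proof (rule ldet_greatest)
  fix A assume A: "finite A" "A \<subseteq> I"
  have "((\<lambda>n. gdet (x n) A) \<longlongrightarrow> gdet y A) F"
    unfolding gdet_def using lim A by (intro tendsto_Re tendsto_pdet) auto
  thus "d \<le> gdet y A"
    by (rule tendsto_le[OF F _ c]) (auto intro!: always_eventually order_trans[OF le ldet_le[OF x A]])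
qed

text \<open>The distance of \<open>v\<close> from the closed span of the other \<open>x j\<close>,
  times the square root of their own determinant. If that determinant vanishes, so does
  \<open>sd\<close>, and the exchange below holds with both sides 0. The square root makes it a
  seminorm.\<close>

definition sd :: "('i \<Rightarrow> 'k \<Rightarrow> complex) \<Rightarrow> 'i set \<Rightarrow> 'i \<Rightarrow> ('k \<Rightarrow> complex) \<Rightarrow> real" where
  "sd x I i v = (INF A\<in>{A. finite A \<and> A \<subseteq> I - {i}}. sqrt (gdet (x(i := v)) (insert i A)))"

context
  fixes x :: "'i \<Rightarrow> 'k \<Rightarrow> complex" and I i
  assumes x: "contr x (I - {i})"
begin

lemma gdet_upd_nonneg:
  assumes "l2 v" "finite A" "A \<subseteq> I - {i}"
  shows "0 \<le> gdet (x(i := v)) (insert i A)"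
  using assms contr_subset_D[OF x] by (intro gdet_nonneg) auto

lemma sd_le:
  assumes "l2 v" "finite A" "A \<subseteq> I - {i}"
  shows "sd x I i v \<le> sqrt (gdet (x(i := v)) (insert i A))"
proof -
  have "bdd_below ((\<lambda>A. sqrt (gdet (x(i := v)) (insert i A))) ` {A. finite A \<and> A \<subseteq> I - {i}})"
    by (rule bdd_belowI2[of _ 0]) (simp add: gdet_upd_nonneg[OF assms(1)])
  thus ?thesis
    unfolding sd_def by (rule cINF_lower) (use assms in simp)
qed

lemma sd_tendsto:
  assumes "l2 v"
  shows "((\<lambda>A. sqrt (gdet (x(i := v)) (insert i A))) \<longlongrightarrow> sd x I i v) (finite_subsets_at_top (I - {i}))"
  unfolding sd_def
proof (rule antimono_tendsto_INF[where c=0])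
  fix A B assume AB: "finite B" "A \<subseteq> B" "B \<subseteq> I - {i}"
  have "gdet (x(i := v)) (insert i B) \<le> gdet (x(i := v)) (insert i A)"
    using AB assms contr_subset_D[OF x] by (intro gdet_antimono) auto
  thus "sqrt (gdet (x(i := v)) (insert i B)) \<le> sqrt (gdet (x(i := v)) (insert i A))" by simp
qed (use gdet_upd_nonneg[OF assms] in auto)

lemma gdet_upd_form:
  assumes "finite A" "A \<subseteq> I - {i}"
  obtains R where "linear_contraction R"
     "\<And>v. l2 v \<Longrightarrow> sqrt (gdet (x(i := v)) (insert i A)) = sqrt (gdet x A) * nrm (R v)"
proof -
  have xA: "\<forall>j\<in>A. l2 (x j)" using contr_subset_D[OF x] assms by auto
  obtain R where R: "linear_contraction R"
     "\<And>v i. l2 v \<Longrightarrow> i \<notin> A \<Longrightarrow> gdet (x(i := v)) (insert i A) = gdet x A * (nrm (R v))\<^sup>2"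
    by (rule gdet_insert_quadratic_form[OF assms(1) xA]) (rule that)
  have i: "i \<notin> A" using assms by auto
  show thesis
    by (rule that[OF R(1)]) (auto simp: R(2) i real_sqrt_mult)
qed

lemma tendsto_finite_subsets_le:
  fixes f g :: "'i set \<Rightarrow> real"
  assumes "(f \<longlongrightarrow> a) (finite_subsets_at_top J)" "(g \<longlongrightarrow> b) (finite_subsets_at_top J)"
    "\<And>A. finite A \<Longrightarrow> A \<subseteq> J \<Longrightarrow> f A \<le> g A"
  shows "a \<le> b"
  by (rule tendsto_le[OF _ assms(2,1)])
     (auto intro!: assms(3) eventually_finite_subsets_at_top_weakI)

lemma sd_nonneg: "l2 v \<Longrightarrow> 0 \<le> sd x I i v"
  by (rule tendsto_finite_subsets_le[OF tendsto_const sd_tendsto]) (auto simp: gdet_upd_nonneg)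

text \<open>For a fixed finite \<open>A\<close> the quantity is a constant times the norm of the
  linear image \<open>R v\<close>, hence a seminorm in \<open>v\<close>; the inequality survives the
  limit.\<close>

lemma sd_add:
  assumes "l2 v" "l2 w"
  shows "sd x I i (\<lambda>k. v k + w k) \<le> sd x I i v + sd x I i w"
proof (rule tendsto_finite_subsets_le[OF sd_tendsto tendsto_add[OF sd_tendsto sd_tendsto]])
  fix A assume A: "finite A" "A \<subseteq> I - {i}"
    obtain R where R0: "linear_contraction R"
      and Rq: "\<And>v. l2 v \<Longrightarrow> sqrt (gdet (x(i := v)) (insert i A)) = sqrt (gdet x A) * nrm (R v)"
      by (rule gdet_upd_form[OF A]) (rule that)
    have R: "\<And>v. l2 v \<Longrightarrow> l2 (R v)"
     "\<And>v w. l2 v \<Longrightarrow> l2 w \<Longrightarrow> R (\<lambda>k. v k + w k) = (\<lambda>k. R v k + R w k)"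
       "\<And>v. l2 v \<Longrightarrow> sqrt (gdet (x(i := v)) (insert i A)) = sqrt (gdet x A) * nrm (R v)"
      using R0 Rq by (auto simp: linear_contraction_def)
  have "0 \<le> gdet x A" using A contr_subset_D[OF x] by (intro gdet_nonneg) auto
  hence "sqrt (gdet x A) * nrm (R (\<lambda>k. v k + w k)) \<le> sqrt (gdet x A) * (nrm (R v) + nrm (R w))"
    unfolding R(2)[OF assms] by (intro mult_left_mono nrm_triangle R assms) auto
  thus "sqrt (gdet (x(i := \<lambda>k. v k + w k)) (insert i A)) \<le>
      sqrt (gdet (x(i := v)) (insert i A)) + sqrt (gdet (x(i := w)) (insert i A))"
    using assms by (simp add: R(3) distrib_left)
qed (use assms in auto)

lemma sd_scale:
  assumes "l2 v"
  shows "sd x I i (\<lambda>k. t * v k) = cmod t * sd x I i v"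
proof -
  have eq: "sqrt (gdet (x(i := \<lambda>k. t * v k)) (insert i A)) = cmod t * sqrt (gdet (x(i := v)) (insert i A))"
    if A: "finite A" "A \<subseteq> I - {i}" for A
  proof -
    obtain R where R0: "linear_contraction R"
      and Rq: "\<And>v. l2 v \<Longrightarrow> sqrt (gdet (x(i := v)) (insert i A)) = sqrt (gdet x A) * nrm (R v)"
      by (rule gdet_upd_form[OF A]) (rule that)
    have R: "\<And>t v. l2 v \<Longrightarrow> R (\<lambda>k. t * v k) = (\<lambda>k. t * R v k)"
       "\<And>v. l2 v \<Longrightarrow> sqrt (gdet (x(i := v)) (insert i A)) = sqrt (gdet x A) * nrm (R v)"
      using R0 Rq by (auto simp: linear_contraction_def)
    show ?thesis
      using assms by (simp add: R nrm_scale)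
  qed
  have "((\<lambda>A. cmod t * sqrt (gdet (x(i := v)) (insert i A))) \<longlongrightarrow> sd x I i (\<lambda>k. t * v k)) (finite_subsets_at_top (I - {i}))"
    by (rule Lim_transform_eventually[OF sd_tendsto])
       (intro assms l2_scale, intro eventually_finite_subsets_at_top_weakI, rule eq)
  moreover have "((\<lambda>A. cmod t * sqrt (gdet (x(i := v)) (insert i A))) \<longlongrightarrow> cmod t * sd x I i v) (finite_subsets_at_top (I - {i}))"
    by (intro tendsto_mult tendsto_const sd_tendsto assms)
  ultimately show ?thesis
    by (rule tendsto_unique[rotated]) simp
qed

lemma sd_le_nrm:
  assumes "l2 v"
  shows "sd x I i v \<le> nrm v"
proof (rule tendsto_finite_subsets_le[OF sd_tendsto tendsto_const])
  fix A assume A: "finite A" "A \<subseteq> I - {i}"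
    obtain R where R0: "linear_contraction R"
      and Rq: "\<And>v. l2 v \<Longrightarrow> sqrt (gdet (x(i := v)) (insert i A)) = sqrt (gdet x A) * nrm (R v)"
      by (rule gdet_upd_form[OF A]) (rule that)
    have R: "\<And>v. l2 v \<Longrightarrow> nrm (R v) \<le> nrm v"
       "\<And>v. l2 v \<Longrightarrow> sqrt (gdet (x(i := v)) (insert i A)) = sqrt (gdet x A) * nrm (R v)"
      using R0 Rq by (auto simp: linear_contraction_def)
  have "gdet x A \<le> gdet x {}"
    using A contr_subset_D[OF x] by (intro gdet_antimono) auto
  moreover have "0 \<le> gdet x A" using A contr_subset_D[OF x] by (intro gdet_nonneg) auto
  ultimately have "sqrt (gdet x A) * nrm (R v) \<le> 1 * nrm v"
    by (intro mult_mono R assms) auto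
  thus "sqrt (gdet (x(i := v)) (insert i A)) \<le> nrm v" using R assms by simp
qed (use assms in auto)

text \<open>With \<open>x j\<close> in position \<open>i\<close>, the set \<open>{i, j}\<close>
  already produces two equal rows.\<close>

lemma sd_member:
  assumes "j \<in> I - {i}"
  shows "sd x I i (x j) = 0"
proof (rule antisym)
  have lj: "l2 (x j)" using assms x by (auto simp: contr_def)
  have "sd x I i (x j) \<le> sqrt (gdet (x(i := x j)) (insert i {j}))"
    using assms by (intro sd_le[OF lj]) auto
  also have "gdet (x(i := x j)) (insert i {j}) = 0"
    unfolding gdet_def using assms by (subst pdet_equal_rows[of _ i j]) (auto simp: gram_def)
  finally show "sd x I i (x j) \<le> 0" by simp
  show "0 \<le> sd x I i (x j)" using sd_nonneg[OF lj] .
qed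

lemma sd_null_add:
  assumes "l2 v" "l2 w" "sd x I i v = 0" "sd x I i w = 0"
  shows "sd x I i (\<lambda>k. v k + w k) = 0"
  using sd_add[of v w] sd_nonneg[of "\<lambda>k. v k + w k"] assms by simp

lemma sd_null_scale: "l2 v \<Longrightarrow> sd x I i v = 0 \<Longrightarrow> sd x I i (\<lambda>k. t * v k) = 0"
  by (simp add: sd_scale)

text \<open>Domination of \<open>sd\<close> by the norm makes the null space closed. Infinite linear
  combinations enter the exchange arguments through this.\<close>

lemma sd_null_closed:
  assumes v: "l2 v" and w: "\<And>n. l2 (w n)" "\<And>n. sd x I i (w n) = 0"
    and lim: "(\<lambda>n::nat. nrm (\<lambda>k. v k - w n k)) \<longlonglongrightarrow> 0"
  shows "sd x I i v = 0"
proof (rule antisym)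
  have "sd x I i v \<le> nrm (\<lambda>k. v k - w n k)" for n
  proof -
    have "sd x I i v = sd x I i (\<lambda>k. (v k - w n k) + w n k)" by simp
    also have "\<dots> \<le> sd x I i (\<lambda>k. v k - w n k) + sd x I i (w n)" by (intro sd_add) (use v w in auto)
    also have "\<dots> \<le> nrm (\<lambda>k. v k - w n k)" using sd_le_nrm[of "\<lambda>k. v k - w n k"] v w by simp
    finally show ?thesis .
  qed
  thus "sd x I i v \<le> 0" by (intro LIMSEQ_le_const[OF lim]) auto
qed (rule sd_nonneg[OF v])

lemma ldet_upd:
  assumes i: "i \<in> I" and v: "l2 v" "nrm v \<le> 1"
  shows "ldet (x(i := v)) I = (sd x I i v)\<^sup>2"
proof (rule antisym)
  let ?y = "x(i := v)"
  have y: "contr ?y I" using x v by (auto simp: contr_def)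
  have "((\<lambda>A. (sqrt (gdet ?y (insert i A)))\<^sup>2) \<longlongrightarrow> (sd x I i v)\<^sup>2) (finite_subsets_at_top (I - {i}))"
    by (intro tendsto_power sd_tendsto v)
  thus "ldet ?y I \<le> (sd x I i v)\<^sup>2"
  proof (rule tendsto_finite_subsets_le[OF tendsto_const])
    fix A assume A: "finite A" "A \<subseteq> I - {i}"
    have "ldet ?y I \<le> gdet ?y (insert i A)" using A i by (intro ldet_le[OF y]) auto
    thus "ldet ?y I \<le> (sqrt (gdet ?y (insert i A)))\<^sup>2" using gdet_upd_nonneg[OF v(1) A] by simp
  qed
  show "(sd x I i v)\<^sup>2 \<le> ldet ?y I"
  proof (rule ldet_greatest)
    fix A assume A: "finite A" "A \<subseteq> I"
    have "sd x I i v \<le> sqrt (gdet ?y (insert i (A - {i})))"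
      using A by (intro sd_le[OF v(1)]) auto
    hence "(sd x I i v)\<^sup>2 \<le> (sqrt (gdet ?y (insert i (A - {i}))))\<^sup>2"
      using sd_nonneg[OF v(1)] by (intro power_mono)
    also have "\<dots> = gdet ?y (insert i A)"
      using gdet_upd_nonneg[OF v(1), of "A - {i}"] A by auto
    \<comment> \<open>Sets without \<open>i\<close> do not lower the infimum: adjoining
      \<open>i\<close> decreases the determinant, as \<open>v\<close> has norm at most 1.\<close>
    also have "\<dots> \<le> gdet ?y A"
      using A i contr_D[OF y] by (intro gdet_antimono) (auto simp del: fun_upd_apply)
    finally show "(sd x I i v)\<^sup>2 \<le> gdet ?y A" .
  qed
qed

end

text \<open>\<open>v\<close> and \<open>t\<close> times \<open>x i\<close> differ by a null vector,
  so the seminorm \<open>sd\<close> takes the same value on both.\<close>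

lemma ldet_exchange:
  assumes x: "contr x I" and i: "i \<in> I" and v: "l2 v" "nrm v \<le> 1"
    and null: "sd x I i (\<lambda>k. v k - t * x i k) = 0"
  shows "ldet (x(i := v)) I = (cmod t)\<^sup>2 * ldet x I"
proof -
  have x': "contr x (I - {i})" and xi: "l2 (x i)" "nrm (x i) \<le> 1" using x i by (auto simp: contr_def)
  let ?r = "\<lambda>k. v k - t * x i k"
  have r: "l2 ?r" and tx: "l2 (\<lambda>k. t * x i k)" using v xi by auto
  have a: "l2 (\<lambda>k. - 1 * ?r k)" by (intro l2_scale r)
  have "sd x I i v = sd x I i (\<lambda>k. ?r k + t * x i k)" by simp
  also have "\<dots> \<le> sd x I i (\<lambda>k. t * x i k)"
    using sd_add[OF x' r tx] null by simp
  finally have 1: "sd x I i v \<le> sd x I i (\<lambda>k. t * x i k)" .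
  have "sd x I i (\<lambda>k. t * x i k) = sd x I i (\<lambda>k. - 1 * ?r k + v k)" by simp
  also have "\<dots> \<le> sd x I i v"
    using sd_add[OF x' a v(1)] sd_null_scale[OF x' r null, of "-1"] by simp
  finally have "sd x I i v = cmod t * sd x I i (x i)"
    using 1 sd_scale[OF x' xi(1), of t] by simp
  moreover have "ldet x I = (sd x I i (x i))\<^sup>2"
    using ldet_upd[OF x' i xi] by simp
  ultimately show ?thesis
    using ldet_upd[OF x' i v] by (simp add: power_mult_distrib)
qed

section \<open>Orthonormal families and change of basis\<close>

definition orthonormal :: "('i \<Rightarrow> 'k \<Rightarrow> complex) \<Rightarrow> 'i set \<Rightarrow> bool" where
  "orthonormal v I \<longleftrightarrow> (\<forall>i\<in>I. l2 (v i)) \<and> (\<forall>i\<in>I. \<forall>j\<in>I. ip (v i) (v j) = of_bool (i = j))"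

definition un :: "'k \<Rightarrow> 'k \<Rightarrow> complex" where
  "un b = (\<lambda>k. of_bool (k = b))"

lemma un_apply: "un b c = of_bool (c = b)"
  by (simp add: un_def)

lemma has_sum_single:
  fixes f :: "'k \<Rightarrow> 'a :: {comm_monoid_add, topological_space}"
  assumes "\<And>k. k \<noteq> b \<Longrightarrow> f k = 0"
  shows "(f has_sum f b) UNIV"
  by (rule has_sum_finite_neutralI[of "{b}"]) (use assms in auto)

lemma l2_un [simp]: "l2 (un b)"
  unfolding l2_def by (rule has_sum_imp_summable[OF has_sum_single[of b]]) (auto simp: un_def)

lemma ip_un_left [simp]: "ip (un b) x = x b"
proof -
  have "ip (un b) x = cnj (un b b) * x b"
    unfolding ip_def by (rule infsumI, rule has_sum_single) (auto simp: un_def)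
  thus ?thesis by (simp add: un_def)
qed

lemma ip_un_right [simp]: "ip x (un b) = cnj (x b)"
  by (subst ip_cnj[symmetric]) simp

lemma nrm_un [simp]: "nrm (un b) = 1"
proof -
  have "(\<Sum>\<^sub>\<infinity>k. (cmod (un b k))\<^sup>2) = (cmod (un b b))\<^sup>2"
    by (rule infsumI, rule has_sum_single) (auto simp: un_def)
  thus ?thesis by (simp add: nrm_def un_def)
qed

lemma orthonormal_l2: "orthonormal v I \<Longrightarrow> i \<in> I \<Longrightarrow> l2 (v i)"
  by (simp add: orthonormal_def)

lemma orthonormal_ip: "orthonormal v I \<Longrightarrow> i \<in> I \<Longrightarrow> j \<in> I \<Longrightarrow> ip (v i) (v j) = of_bool (i = j)"
  by (simp add: orthonormal_def)

lemma orthonormal_nrm: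
  assumes "orthonormal v I" "i \<in> I"
  shows "nrm (v i) = 1"
proof -
  have "complex_of_real ((nrm (v i))\<^sup>2) = 1"
    using ip_self[of "v i"] orthonormal_l2[OF assms] orthonormal_ip[OF assms assms(2)] by simp
  hence "(nrm (v i))\<^sup>2 = 1\<^sup>2" using of_real_eq_1_iff by fastforce
  thus ?thesis by (rule power2_eq_imp_eq) auto
qed

definition co_proj :: "('i \<Rightarrow> 'k \<Rightarrow> complex) \<Rightarrow> 'i set \<Rightarrow> ('k \<Rightarrow> complex) \<Rightarrow> 'k \<Rightarrow> complex" where
  "co_proj v A f = (\<lambda>k. f k - (\<Sum>i\<in>A. ip (v i) f * v i k))"

lemma
  assumes v: "orthonormal v I" and A: "finite A" "A \<subseteq> I" and f: "l2 f" and g: "l2 g"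
  shows l2_co_proj: "l2 (co_proj v A f)"
    and ip_co_proj: "ip (co_proj v A f) (co_proj v A g) = ip f g - (\<Sum>i\<in>A. ip f (v i) * ip (v i) g)"
proof -
  have vl: "l2 (v i)" if "i \<in> A" for i using orthonormal_l2[OF v] that A by auto
  have l: "l2 (co_proj v A h)" if "l2 h" for h
    unfolding co_proj_def using vl that by (intro l2_diff l2_sum l2_scale) auto
  show "l2 (co_proj v A f)" by (rule l[OF f])
  have 1: "ip (v i) (co_proj v A g) = 0" if i: "i \<in> A" for i
  proof -
    have "ip (v i) (co_proj v A g) = ip (v i) g - (\<Sum>j\<in>A. ip (v j) g * ip (v i) (v j))"
      unfolding co_proj_def using vl g i by (subst ip_diff_right) (auto simp: ip_sum_right ip_scale_right)
    also have "(\<Sum>j\<in>A. ip (v j) g * ip (v i) (v j)) = (\<Sum>j\<in>A. if i = j then ip (v j) g else 0)"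
      using i A by (intro sum.cong refl) (auto simp: orthonormal_ip[OF v] subset_iff)
    also have "\<dots> = ip (v i) g" using i A by (simp add: sum.delta)
    finally show ?thesis by simp
  qed
  have "ip (co_proj v A f) (co_proj v A g) = ip f (co_proj v A g) - (\<Sum>j\<in>A. cnj (ip (v j) f) * ip (v j) (co_proj v A g))"
    unfolding co_proj_def[of v A f] using vl f l[OF g]
    by (subst ip_diff_left) (auto simp: ip_sum_left ip_scale_left)
  also have "\<dots> = ip f (co_proj v A g)" by (simp add: 1)
  also have "\<dots> = ip f g - (\<Sum>j\<in>A. ip (v j) g * ip f (v j))"
    unfolding co_proj_def using vl f g by (subst ip_diff_right) (auto simp: ip_sum_right ip_scale_right)
  finally show "ip (co_proj v A f) (co_proj v A g) = ip f g - (\<Sum>i\<in>A. ip f (v i) * ip (v i) g)"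
    by (simp add: mult.commute)
qed

lemma Bessel:
  assumes v: "orthonormal v I" and A: "finite A" "A \<subseteq> I" and f: "l2 f"
  shows "(\<Sum>i\<in>A. (cmod (ip (v i) f))\<^sup>2) \<le> (nrm f)\<^sup>2"
    and "(nrm (co_proj v A f))\<^sup>2 = (nrm f)\<^sup>2 - (\<Sum>i\<in>A. (cmod (ip (v i) f))\<^sup>2)"
proof -
  have "ip f (v i) * ip (v i) f = of_real ((cmod (ip (v i) f))\<^sup>2)" for i
    unfolding complex_norm_square by (simp add: ip_cnj mult.commute)
  hence "complex_of_real ((nrm (co_proj v A f))\<^sup>2) = of_real ((nrm f)\<^sup>2 - (\<Sum>i\<in>A. (cmod (ip (v i) f))\<^sup>2))"
    using ip_co_proj[OF assms f] l2_co_proj[OF assms f] f by (simp add: ip_self)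
  thus "(nrm (co_proj v A f))\<^sup>2 = (nrm f)\<^sup>2 - (\<Sum>i\<in>A. (cmod (ip (v i) f))\<^sup>2)"
    using of_real_eq_iff by blast
  thus "(\<Sum>i\<in>A. (cmod (ip (v i) f))\<^sup>2) \<le> (nrm f)\<^sup>2"
    using zero_le_power2[of "nrm (co_proj v A f)"] by linarith
qed

lemma Bessel_summable:
  assumes v: "orthonormal v I" and f: "l2 f"
  shows "(\<lambda>i. (cmod (ip (v i) f))\<^sup>2) summable_on I"
  by (rule nonneg_bdd_above_summable_on) (auto intro!: bdd_aboveI2[of _ _ "(nrm f)\<^sup>2"] Bessel(1)[OF v _ _ f])

lemma res_ip:
  assumes "l2 x" "l2 y"
  shows "ip (res S x) (res S y) = (\<Sum>\<^sub>\<infinity>k\<in>S. cnj (x k) * y k)"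
  unfolding ip_def by (rule infsum_cong_neutral) (auto simp: res_def)

lemma res_ip_compl:
  assumes "l2 x" "l2 y"
  shows "ip (res S x) (res S y) = ip x y - (\<Sum>\<^sub>\<infinity>k\<in>-S. cnj (x k) * y k)"
proof -
  have "(\<Sum>\<^sub>\<infinity>k\<in>S \<union> - S. cnj (x k) * y k) = (\<Sum>\<^sub>\<infinity>k\<in>S. cnj (x k) * y k) + (\<Sum>\<^sub>\<infinity>k\<in>-S. cnj (x k) * y k)"
    using assms by (intro infsum_Un_disjoint ip_summable) auto
  thus ?thesis using assms by (simp add: res_ip) (simp add: ip_def)
qed

lemma contr_res:
  assumes v: "orthonormal v I"
  shows "contr (\<lambda>i. res S (v i)) I"
  using orthonormal_l2[OF v] orthonormal_nrm[OF v] nrm_res_le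
  unfolding contr_def by (metis l2_res)

text \<open>The matrix of the orthogonal projection onto the closed span of the
  \<open>v i\<close>.\<close>

definition kern :: "('i \<Rightarrow> 'k \<Rightarrow> complex) \<Rightarrow> 'i set \<Rightarrow> 'k \<Rightarrow> 'k \<Rightarrow> complex" where
  "kern v I b c = (\<Sum>\<^sub>\<infinity>i\<in>I. v i b * cnj (v i c))"

lemma kern_summable:
  assumes v: "orthonormal v I"
  shows "(\<lambda>i. v i b * cnj (v i c)) summable_on I"
proof (rule abs_summable_summable, rule summable_on_comparison_test)
  show "(\<lambda>i. (cmod (ip (v i) (un b)))\<^sup>2 + (cmod (ip (v i) (un c)))\<^sup>2) summable_on I"
    by (intro summable_on_add Bessel_summable[OF v]) auto
  fix i
  show "norm (v i b * cnj (v i c)) \<le> (cmod (ip (v i) (un b)))\<^sup>2 + (cmod (ip (v i) (un c)))\<^sup>2"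
    using sum_squares_bound[of "cmod (v i b)" "cmod (v i c)"] mult_nonneg_nonneg[OF norm_ge_zero norm_ge_zero, of "v i b" "v i c"]
    unfolding norm_mult complex_mod_cnj ip_un_right by linarith
qed auto

text \<open>Both sides are limits of the determinants \<open>det (1 - Y Y\<^sup>*) = det (1 - Y\<^sup>* Y)\<close> over finite sections
  \<open>Y\<close> of the matrix \<open>(v i b)\<close> with \<open>b \<notin> S\<close>; these decrease in both index sets.\<close>
lemma ldet_res_dual:
  assumes v: "orthonormal v I"
  shows "ldet (\<lambda>i. res S (v i)) I = idet (\<lambda>b c. of_bool (b = c) - kern v I b c) (- S)"
proof -
  define D where "D A B = Re (pdet (\<lambda>i j. of_bool (i = j) - (\<Sum>b\<in>B. cnj (v i b) * v j b)) A)" for A B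
  define G where "G B = Re (pdet (\<lambda>b c. of_bool (b = c) - kern v I b c) B)" for B
  define F where "F = gdet (\<lambda>i. res S (v i))"
  have vl: "l2 (v i)" if "i \<in> I" for i using orthonormal_l2[OF v that] .
  have D_A: "D A B = gdet (\<lambda>i. res (- B) (v i)) A" if "A \<subseteq> I" "finite B" for A B
    unfolding D_def gdet_def using that vl
    by (intro arg_cong[where f=Re] pdet_cong) (auto simp: gram_def res_ip_compl orthonormal_ip[OF v] subset_iff)
  \<comment> \<open>By Sylvester's identity the same number is a Gram determinant over
    \<open>B\<close>, of unit vectors projected off the \<open>v i\<close>; this yields monotonicity
    in \<open>B\<close>.\<close>
  have D_B: "D A B = gdet (\<lambda>b. co_proj v A (un b)) B" if A: "finite A" "A \<subseteq> I" and "finite B" for A B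
  proof -
    have "pdet (\<lambda>i j. of_bool (i = j) - (\<Sum>b\<in>B. cnj (v i b) * v j b)) A =
        pdet (\<lambda>b c. of_bool (b = c) - (\<Sum>i\<in>A. v i b * cnj (v i c))) B"
      by (rule pdet_Sylvester) (use that in auto)
    also have "\<dots> = pdet (gram (\<lambda>b. co_proj v A (un b))) B"
      by (intro pdet_cong) (auto simp: gram_def ip_co_proj[OF v A] un_apply)
    finally show ?thesis by (simp add: D_def gdet_def)
  qed
  have mono_A: "D A' B \<le> D A B" if "finite A'" "A \<subseteq> A'" "A' \<subseteq> I" "finite B" for A A' B
  proof -
    have "gdet (\<lambda>i. res (- B) (v i)) A' \<le> gdet (\<lambda>i. res (- B) (v i)) A"
      using that contr_subset_D[OF contr_res[OF v]] by (intro gdet_antimono) auto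
    thus ?thesis using that by (simp add: D_A)
  qed
  have mono_B: "D A B' \<le> D A B" if A: "finite A" "A \<subseteq> I" and "finite B'" "B \<subseteq> B'" for A B B'
  proof -
    have "nrm (co_proj v A (un b)) \<le> 1" for b
    proof -
      have "(nrm (co_proj v A (un b)))\<^sup>2 \<le> 1\<^sup>2"
        using Bessel(2)[OF v A, of "un b"] by (simp add: sum_nonneg)
      thus ?thesis by (rule power2_le_imp_le) auto
    qed
    hence "gdet (\<lambda>b. co_proj v A (un b)) B' \<le> gdet (\<lambda>b. co_proj v A (un b)) B"
      using that l2_co_proj[OF v A l2_un l2_un] by (intro gdet_antimono) auto
    thus ?thesis using that finite_subset[OF that(4,3)] by (simp add: D_B)
  qed
  have lim_B: "((\<lambda>B. D A B) \<longlongrightarrow> F A) (finite_subsets_at_top (- S))" if "A \<subseteq> I" for A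
    unfolding F_def D_def gdet_def
  proof (intro tendsto_Re tendsto_pdet)
    fix i j assume ij: "i \<in> A" "j \<in> A"
    have "((\<lambda>B. of_bool (i = j) - (\<Sum>b\<in>B. cnj (v i b) * v j b)) \<longlongrightarrow> of_bool (i = j) - (\<Sum>\<^sub>\<infinity>b\<in>-S. cnj (v i b) * v j b))
       (finite_subsets_at_top (- S))"
      using ij that vl by (intro tendsto_diff tendsto_const infsum_tendsto ip_summable) auto
    thus "((\<lambda>B. of_bool (i = j) - (\<Sum>b\<in>B. cnj (v i b) * v j b)) \<longlongrightarrow> gram (\<lambda>i. res S (v i)) i j) (finite_subsets_at_top (- S))"
      using ij that vl by (simp add: gram_def res_ip_compl orthonormal_ip[OF v] subset_iff)
  qed
  have lim_A: "((\<lambda>A. D A B) \<longlongrightarrow> G B) (finite_subsets_at_top I)" if "finite B" for B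
  proof -
    have "((\<lambda>A. Re (pdet (\<lambda>b c. of_bool (b = c) - (\<Sum>i\<in>A. v i b * cnj (v i c))) B)) \<longlongrightarrow> G B) (finite_subsets_at_top I)"
      unfolding G_def kern_def
      by (intro tendsto_Re tendsto_pdet tendsto_diff tendsto_const infsum_tendsto kern_summable[OF v])
    thus ?thesis
    proof (rule Lim_transform_eventually, intro eventually_finite_subsets_at_top_weakI)
      fix A assume "finite A" "A \<subseteq> I"
      thus "Re (pdet (\<lambda>b c. of_bool (b = c) - (\<Sum>i\<in>A. v i b * cnj (v i c))) B) = D A B"
        unfolding D_def using that by (subst pdet_Sylvester) auto
    qed
  qed
  \<comment> \<open>\<open>F\<close> and \<open>G\<close> are the limits of \<open>D\<close> in
    \<open>B\<close> and in \<open>A\<close>; a decreasing family stays above its limit.\<close>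
  have FD: "F A \<le> D A B" if A: "finite A" "A \<subseteq> I" and B: "finite B" "B \<subseteq> - S" for A B
    by (rule tendsto_upperbound[OF lim_B[OF A(2)]])
       (use that in \<open>auto simp: eventually_finite_subsets_at_top intro!: exI[of _ B] mono_B\<close>)
  have GD: "G B \<le> D A B" if A: "finite A" "A \<subseteq> I" and B: "finite B" for A B
    by (rule tendsto_upperbound[OF lim_A[OF B]])
       (use that in \<open>auto simp: eventually_finite_subsets_at_top intro!: exI[of _ A] mono_A\<close>)
  have LG: "ldet (\<lambda>i. res S (v i)) I \<le> G B" if B: "finite B" "B \<subseteq> - S" for B
    by (rule tendsto_lowerbound[OF lim_A[OF B(1)]])
       (use B in \<open>auto intro!: eventually_finite_subsets_at_top_weakI
          order_trans[OF ldet_le[OF contr_res[OF v]] FD[unfolded F_def]]\<close>)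
  have G0: "0 \<le> G B" if B: "finite B" "B \<subseteq> - S" for B
    using order_trans[OF ldet_nonneg[OF contr_res[OF v]] LG[OF B]] .
  show ?thesis
  proof (rule antisym)
    show "ldet (\<lambda>i. res S (v i)) I \<le> idet (\<lambda>b c. of_bool (b = c) - kern v I b c) (- S)"
      using LG unfolding G_def by (rule idet_greatest)
    show "idet (\<lambda>b c. of_bool (b = c) - kern v I b c) (- S) \<le> ldet (\<lambda>i. res S (v i)) I"
    proof (rule ldet_greatest)
      fix A assume A: "finite A" "A \<subseteq> I"
      have "idet (\<lambda>b c. of_bool (b = c) - kern v I b c) (- S) \<le> F A"
        by (rule tendsto_lowerbound[OF lim_B[OF A(2)]])
           (auto intro!: eventually_finite_subsets_at_top_weakI
             order_trans[OF idet_le GD[OF A, unfolded G_def]] G0[unfolded G_def])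
      thus "idet (\<lambda>b c. of_bool (b = c) - kern v I b c) (- S) \<le> gdet (\<lambda>i. res S (v i)) A"
        by (simp add: F_def)
    qed
  qed
qed

text \<open>Polarization: the quadratic form of a projection determines its matrix entries. Test
  vectors of finite support in \<open>T\<close> suffice, because an entry needs only combinations of
  \<open>un b\<close> and \<open>un c\<close>.\<close>

lemma kern_eqI:
  fixes v :: "'i \<Rightarrow> 'k \<Rightarrow> complex" and w :: "'j \<Rightarrow> 'k \<Rightarrow> complex"
  assumes v: "orthonormal v I" and w: "orthonormal w J" and b: "b \<in> T" "c \<in> T"
    and eq: "\<And>f. l2 f \<Longrightarrow> (\<And>k. k \<notin> T \<Longrightarrow> f k = 0) \<Longrightarrow> finite {k. f k \<noteq> 0} \<Longrightarrow>
      (\<Sum>\<^sub>\<infinity>i\<in>I. (cmod (ip (v i) f))\<^sup>2) = (\<Sum>\<^sub>\<infinity>j\<in>J. (cmod (ip (w j) f))\<^sup>2)"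
  shows "kern v I b c = kern w J b c"
proof -
  define f where "f t = (\<lambda>k. un b k + t * un c k)" for t :: complex
  \<comment> \<open>\<open>t\<close> runs through 1, -1, i, -i, and \<open>q\<close> is the
    polarization formula in the four resulting values.\<close>
  define q :: "(nat \<Rightarrow> complex) \<Rightarrow> complex" where "q = (\<lambda>s. (s 0 - s 1 - \<i> * (s 2 - s 3)) / 4)"
  define t :: "nat \<Rightarrow> complex" where "t = (\<lambda>n. if n = 0 then 1 else if n = 1 then -1 else if n = 2 then \<i> else -\<i>)"
  have f: "l2 (f s)" for s unfolding f_def by (intro l2_add l2_scale l2_un)
  have pol: "kern u K b c = q (\<lambda>n. of_real (\<Sum>\<^sub>\<infinity>i\<in>K. (cmod (ip (u i) (f (t n))))\<^sup>2))"
    if u: "orthonormal u K" for u :: "'z \<Rightarrow> 'k \<Rightarrow> complex" and K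
  proof -
    have s: "((\<lambda>i. complex_of_real ((cmod (ip (u i) (f s)))\<^sup>2)) has_sum of_real (\<Sum>\<^sub>\<infinity>i\<in>K. (cmod (ip (u i) (f s)))\<^sup>2)) K" for s
      by (intro has_sum_of_real has_sum_infsum Bessel_summable[OF u] f)
    have "((\<lambda>i. (1/4) * ((complex_of_real ((cmod (ip (u i) (f (t 0))))\<^sup>2) + (-1) * complex_of_real ((cmod (ip (u i) (f (t 1))))\<^sup>2)) +
        (-\<i>) * (complex_of_real ((cmod (ip (u i) (f (t 2))))\<^sup>2) + (-1) * complex_of_real ((cmod (ip (u i) (f (t 3))))\<^sup>2)))) has_sum
       (1/4) * ((of_real (\<Sum>\<^sub>\<infinity>i\<in>K. (cmod (ip (u i) (f (t 0))))\<^sup>2) + (-1) * of_real (\<Sum>\<^sub>\<infinity>i\<in>K. (cmod (ip (u i) (f (t 1))))\<^sup>2)) +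
        (-\<i>) * (of_real (\<Sum>\<^sub>\<infinity>i\<in>K. (cmod (ip (u i) (f (t 2))))\<^sup>2) + (-1) * of_real (\<Sum>\<^sub>\<infinity>i\<in>K. (cmod (ip (u i) (f (t 3))))\<^sup>2)))) K"
      by (intro has_sum_add has_sum_cmult_right s)
    also have "(\<lambda>i. (1/4) * ((complex_of_real ((cmod (ip (u i) (f (t 0))))\<^sup>2) + (-1) * complex_of_real ((cmod (ip (u i) (f (t 1))))\<^sup>2)) +
        (-\<i>) * (complex_of_real ((cmod (ip (u i) (f (t 2))))\<^sup>2) + (-1) * complex_of_real ((cmod (ip (u i) (f (t 3))))\<^sup>2)))) =
       (\<lambda>i. q (\<lambda>n. of_real ((cmod (ip (u i) (f (t n))))\<^sup>2)))"
      by (auto simp: q_def fun_eq_iff)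
    finally have 1: "(\<Sum>\<^sub>\<infinity>i\<in>K. q (\<lambda>n. of_real ((cmod (ip (u i) (f (t n))))\<^sup>2))) =
        q (\<lambda>n. of_real (\<Sum>\<^sub>\<infinity>i\<in>K. (cmod (ip (u i) (f (t n))))\<^sup>2))"
      by (subst infsumI) (auto simp: q_def)
    have "q (\<lambda>n. of_real ((cmod (ip (u i) (f (t n))))\<^sup>2)) = u i b * cnj (u i c)" if "i \<in> K" for i
    proof -
      have e: "ip (u i) (f s) = cnj (u i b) + s * cnj (u i c)" for s
        using orthonormal_l2[OF u that] unfolding f_def by (simp add: ip_add_right ip_scale_right)
      show ?thesis
        unfolding e q_def t_def complex_norm_square by (simp add: algebra_simps)
    qed
    hence "kern u K b c = (\<Sum>\<^sub>\<infinity>i\<in>K. q (\<lambda>n. of_real ((cmod (ip (u i) (f (t n))))\<^sup>2)))"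
      unfolding kern_def by (intro infsum_cong) simp
    with 1 show ?thesis by simp
  qed
  have "(\<Sum>\<^sub>\<infinity>i\<in>I. (cmod (ip (v i) (f s)))\<^sup>2) = (\<Sum>\<^sub>\<infinity>j\<in>J. (cmod (ip (w j) (f s)))\<^sup>2)" for s
  proof (rule eq[OF f])
    show "f s k = 0" if "k \<notin> T" for k using b that by (auto simp: f_def un_def)
    show "finite {k. f s k \<noteq> 0}"
      by (rule finite_subset[of _ "{b, c}"]) (auto simp: f_def un_def split: if_splits)
  qed
  thus ?thesis by (simp add: pol[OF v] pol[OF w])
qed

text \<open>In the dual form the family enters only through the matrix of its projection, restricted
  to the complement of \<open>S\<close>.\<close>

lemma ldet_basis_change:
  assumes v: "orthonormal v I" and w: "orthonormal w J"
    and eq: "\<And>f. l2 f \<Longrightarrow> (\<And>k. k \<in> S \<Longrightarrow> f k = 0) \<Longrightarrow> finite {k. f k \<noteq> 0} \<Longrightarrow>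
      (\<Sum>\<^sub>\<infinity>i\<in>I. (cmod (ip (v i) f))\<^sup>2) = (\<Sum>\<^sub>\<infinity>j\<in>J. (cmod (ip (w j) f))\<^sup>2)"
  shows "ldet (\<lambda>i. res S (v i)) I = ldet (\<lambda>j. res S (w j)) J"
  unfolding ldet_res_dual[OF v] ldet_res_dual[OF w]
  by (rule idet_cong) (use eq in \<open>auto intro!: kern_eqI[OF v w, of _ "- S"]\<close>)

section \<open>Fourier series on the circle\<close>

lemma space_circle [simp]: "space circle = sphere 0 1"
  by (simp add: circle_def space_restrict_space)

lemma sets_circle [measurable_cong]: "sets circle = sets (restrict_space borel (sphere 0 1))"
  by (simp add: circle_def)

lemma cis_measurable_circle:
  "cis \<in> measurable (uniform_measure lborel {0..2*pi}) (restrict_space borel (sphere 0 1))"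
proof (rule measurable_restrict_space2)
  have "continuous_on UNIV cis" by (intro continuous_intros)
  hence "cis \<in> borel_measurable borel" by (rule borel_measurable_continuous_onI)
  thus "cis \<in> borel_measurable (uniform_measure lborel {0..2*pi})"
    by (simp add: measurable_def)
qed auto

lemma borel_measurable_circle_continuous:
  fixes f :: "complex \<Rightarrow> 'a :: topological_space"
  assumes "continuous_on (sphere 0 1) f"
  shows "f \<in> borel_measurable circle"
  using borel_measurable_continuous_on_restrict[OF assms] measurable_cong_sets[OF sets_circle refl] by metis

lemma uniform_measure_eq_density:
  "uniform_measure lborel {0..2*pi} = density lborel (\<lambda>t. ennreal (indicator {0..2*pi} t / (2*pi)))"
  unfolding uniform_measure_def
  by (intro density_cong) (auto simp: indicator_def divide_ennreal[symmetric] ennreal_1[symmetric] simp del: ennreal_1)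

lemma integral_circle:
  fixes f :: "complex \<Rightarrow> 'a :: {banach, second_countable_topology}"
  assumes f: "f \<in> borel_measurable circle"
  shows "(\<integral>z. f z \<partial>circle) = (1 / (2*pi)) *\<^sub>R (\<integral>t. indicator {0..2*pi} t *\<^sub>R f (cis t) \<partial>lborel)"
proof -
  have f': "f \<in> borel_measurable (restrict_space borel (sphere 0 1))"
    using f measurable_cong_sets[OF sets_circle refl] by metis
  have m: "(\<lambda>t. f (cis t)) \<in> borel_measurable lborel"
    using measurable_compose[OF cis_measurable_circle f'] by (simp add: measurable_def)
  have "(\<integral>z. f z \<partial>circle) = (\<integral>t. f (cis t) \<partial>uniform_measure lborel {0..2*pi})"
    unfolding circle_def by (rule integral_distr[OF cis_measurable_circle f'])
  also have "\<dots> = (\<integral>t. (indicator {0..2*pi} t / (2*pi)) *\<^sub>R f (cis t) \<partial>lborel)"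
    unfolding uniform_measure_eq_density by (rule integral_density[OF m]) auto
  also have "\<dots> = (\<integral>t. (1 / (2*pi)) *\<^sub>R (indicator {0..2*pi} t *\<^sub>R f (cis t)) \<partial>lborel)"
    by (simp add: field_simps)
  also have "\<dots> = (1 / (2*pi)) *\<^sub>R (\<integral>t. indicator {0..2*pi} t *\<^sub>R f (cis t) \<partial>lborel)"
    by (rule integral_scaleR_right)
  finally show ?thesis .
qed

lemma integral_circle_inverse:
  fixes f :: "complex \<Rightarrow> 'a :: {banach, second_countable_topology}"
  assumes f: "continuous_on (sphere 0 1) f"
  shows "(\<integral>z. f (inverse z) \<partial>circle) = (\<integral>z. f z \<partial>circle)"
proof -
  have f': "continuous_on (sphere 0 1) (\<lambda>z. f (inverse z))"
    by (rule continuous_on_compose2[OF f]) (auto intro!: continuous_intros simp: norm_inverse)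
  have "(\<integral>t. indicator {0..2*pi} t *\<^sub>R f (cis t) \<partial>lborel) =
      (\<integral>t. indicator {0..2*pi} (2*pi + (-1) * t) *\<^sub>R f (cis (2*pi + (-1) * t)) \<partial>lborel)"
    using lborel_integral_real_affine[of "-1" "\<lambda>t. indicator {0..2*pi} t *\<^sub>R f (cis t)" "2*pi"] by simp
  also have "\<dots> = (\<integral>t. indicator {0..2*pi} t *\<^sub>R f (inverse (cis t)) \<partial>lborel)"
    by (intro Bochner_Integration.integral_cong) (auto simp: indicator_def cis_inverse cis_divide[symmetric] inverse_eq_divide[symmetric])
  finally show ?thesis
    using f f' by (simp add: integral_circle borel_measurable_circle_continuous)
qed

lemma prob_space_circle: "emeasure circle (sphere 0 1) = 1" "finite_measure circle"
proof -
  have "emeasure (uniform_measure lborel {0..2*pi}) UNIV = 1"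
    using emeasure_uniform_measure_1[of lborel "{0..2*pi}"] by auto
  moreover have "cis -` sphere 0 1 \<inter> UNIV = UNIV" by auto
  moreover have "sphere 0 1 \<in> sets (restrict_space borel (sphere 0 1 :: complex set))"
    using sets.top[of "restrict_space borel (sphere 0 1 :: complex set)"] by (simp add: space_restrict_space)
  ultimately show e: "emeasure circle (sphere 0 1) = 1"
    unfolding circle_def by (subst emeasure_distr[OF cis_measurable_circle]) auto
  show "finite_measure circle"
    by (rule finite_measureI) (simp add: e)
qed

lemma integrable_circle_continuous:
  fixes f :: "complex \<Rightarrow> 'a :: {banach, second_countable_topology}"
  assumes f: "continuous_on (sphere 0 1) f"
  shows "integrable circle f"
proof -
  interpret finite_measure circle by (rule prob_space_circle)
  have "bounded (f ` sphere 0 1)"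
    by (intro compact_imp_bounded compact_continuous_image f) simp
  then obtain B where "\<forall>z\<in>sphere 0 1. norm (f z) \<le> B" unfolding bounded_iff by blast
  thus ?thesis
    by (intro integrable_const_bound[of _ B] borel_measurable_circle_continuous f AE_I2) auto
qed

lemma integral_circle_powi: "(\<integral>z. z powi k \<partial>circle) = of_bool (k = 0)"
proof (cases "k = 0")
  case True
  interpret finite_measure circle by (rule prob_space_circle)
  show ?thesis using True by (simp add: measure_def prob_space_circle(1))
next
  case False
  have c: "continuous_on (sphere 0 1) (\<lambda>z::complex. z powi k)"
    by (intro continuous_intros) auto
  have "(\<integral>t. indicator {0..2*pi} t *\<^sub>R cis (of_int k * t) \<partial>lborel) =
     cis (of_int k * (2*pi)) / (\<i> * of_int k) - cis (of_int k * 0) / (\<i> * of_int k)"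
  proof (rule integral_FTC_Icc)
    fix t :: real
    have "cis (of_int k * t) = exp (t *\<^sub>R (\<i> * of_int k))" for t
      by (simp add: cis_conv_exp scaleR_conv_of_real mult_ac)
    hence "((\<lambda>t. cis (of_int k * t) / (\<i> * of_int k)) has_vector_derivative
        (cis (of_int k * t) * (\<i> * of_int k)) / (\<i> * of_int k)) (at t)"
      by (intro has_vector_derivative_divide) (simp add: exp_scaleR_has_vector_derivative_right)
    thus "((\<lambda>t. cis (of_int k * t) / (\<i> * of_int k)) has_vector_derivative cis (of_int k * t)) (at t within {0..2*pi})"
      using False by (simp add: has_vector_derivative_at_within)
  qed (auto intro!: continuous_intros)
  also have "cis (of_int k * (2*pi)) = 1"
    using cis_multiple_2pi[of "of_int k"] by (simp add: mult.commute)
  finally show ?thesis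
    using False by (simp add: integral_circle[OF borel_measurable_circle_continuous[OF c]] cis_power_int)
qed


section \<open>Functions with vanishing trigonometric moments\<close>

lemma measurable_cut [measurable]: "(\<lambda>z. z) \<in> borel_measurable circle"
  by (intro borel_measurable_circle_continuous continuous_intros)

text \<open>Stone-Weierstrass: a continuous weight is uniformly close to a polynomial in Re z and Im
  z, and on the circle such a polynomial is trigonometric.\<close>

lemma integral_eq_0_of_moments:
  assumes f: "integrable circle f" and mom: "\<And>k. (\<integral>z. z powi k * f z \<partial>circle) = 0"
    and g: "continuous_on (sphere 0 1) g"
  shows "(\<integral>z. of_real (g z) * f z \<partial>circle) = 0"
proof -
  have bnd: "integrable circle (\<lambda>z. q z * h z)"
    if "continuous_on (sphere 0 1) q" "integrable circle h" for q h :: "complex \<Rightarrow> complex"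
  proof -
    have "bounded (q ` sphere 0 1)"
      by (intro compact_imp_bounded compact_continuous_image that) simp
    then obtain B where B: "\<forall>z\<in>sphere 0 1. norm (q z) \<le> B" unfolding bounded_iff by blast
    have "B \<ge> 0" using B[rule_format, of 1] norm_ge_zero[of "q 1"] by (simp, linarith)
    show ?thesis
    proof (rule Bochner_Integration.integrable_bound)
      show "integrable circle (\<lambda>z. of_real B * h z)" using that by auto
      show "(\<lambda>z. q z * h z) \<in> borel_measurable circle"
        using that borel_measurable_circle_continuous[OF that(1)] by auto
      show "AE z in circle. norm (q z * h z) \<le> norm (of_real B * h z)"
        using B \<open>B \<ge> 0\<close> by (intro AE_I2) (auto simp: norm_mult intro!: mult_right_mono)
    qed
  qed
  \<comment> \<open>\<open>h\<close> is quantified because a product \<open>p q\<close> is treated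
    by applying the claim for \<open>p\<close> to the function \<open>q h\<close>, whose moments
    vanish by the claim for \<open>q\<close>.\<close>
  have rp: "continuous_on (sphere 0 1) p \<and> (\<forall>h. integrable circle h \<longrightarrow> (\<forall>k. (\<integral>z. z powi k * h z \<partial>circle) = 0) \<longrightarrow>
      (\<forall>k. (\<integral>z. z powi k * (of_real (p z) * h z) \<partial>circle) = 0))"
    if "real_polynomial_function p" for p :: "complex \<Rightarrow> real"
    using that
  proof induction
    case (linear p)
    have c: "continuous_on (sphere 0 1) p" by (intro linear_continuous_on linear)
    interpret bounded_linear p by (rule linear)
    \<comment> \<open>A real linear \<open>p\<close> is determined by its values at 1 and i, and on
      the circle Re z and Im z are combinations of z and z^-1.\<close>
    have p: "complex_of_real (p z) = ((p 1 - \<i> * p \<i>) / 2) * z powi 1 + ((p 1 + \<i> * p \<i>) / 2) * z powi (-1)"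
      if "z \<in> sphere 0 1" for z
    proof -
      have "p z = p (Re z *\<^sub>R 1 + Im z *\<^sub>R \<i>)" by (rule arg_cong[where f=p]) (simp add: complex_eq_iff)
      also have "\<dots> = Re z * p 1 + Im z * p \<i>" by (simp only: add scaleR real_scaleR_def)
      finally have 1: "p z = Re z * p 1 + Im z * p \<i>" .
      have "inverse z = cnj z" using that by (simp add: inverse_complex_def complex_eq_iff cmod_def)
      hence "z powi (-1) = cnj z" "z powi 1 = z" by (simp_all add: power_int_minus)
      thus ?thesis unfolding 1 by (simp only:) (simp add: complex_eq_iff field_simps)
    qed
    show ?case
    proof (intro conjI c allI impI)
      fix h k assume h: "integrable circle h" "\<forall>k. (\<integral>z. z powi k * h z \<partial>circle) = 0"
      have i: "integrable circle (\<lambda>z. z powi k * h z)" for k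
        using h by (intro bnd continuous_intros) auto
      have "(\<integral>z. z powi k * (of_real (p z) * h z) \<partial>circle) =
        (\<integral>z. ((p 1 - \<i> * p \<i>) / 2) * (z powi (k + 1) * h z) + ((p 1 + \<i> * p \<i>) / 2) * (z powi (k - 1) * h z) \<partial>circle)"
      proof (intro Bochner_Integration.integral_cong refl)
        fix z assume "z \<in> space circle"
        hence z: "z \<in> sphere 0 1" by simp
        hence "z \<noteq> 0" by auto
        hence "z powi (k + 1) = z powi k * z powi 1" "z powi (k - 1) = z powi k * z powi (-1)"
          using power_int_add[of z k 1] power_int_add[of z k "-1"] by auto
        thus "z powi k * (of_real (p z) * h z) =
          ((p 1 - \<i> * p \<i>) / 2) * (z powi (k + 1) * h z) + ((p 1 + \<i> * p \<i>) / 2) * (z powi (k - 1) * h z)"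
          unfolding p[OF z] by (simp only: algebra_simps)
      qed
      also have "\<dots> = 0"
        using h(2) i by (subst Bochner_Integration.integral_add) auto
      finally show "(\<integral>z. z powi k * (of_real (p z) * h z) \<partial>circle) = 0" .
    qed
  next
    case (const c)
    have "(\<integral>z. z powi k * (of_real c * h z) \<partial>circle) = of_real c * (\<integral>z. z powi k * h z \<partial>circle)" for h k
      by (simp add: mult.left_commute[of _ "of_real c"])
    thus ?case by auto
  next
    case (add p q)
    show ?case
    proof (intro conjI continuous_on_add allI impI)
      fix h k assume h: "integrable circle h" "\<forall>k. (\<integral>z. z powi k * h z \<partial>circle) = 0"
      have "integrable circle (\<lambda>z. z powi k * (of_real (p z) * h z))" "integrable circle (\<lambda>z. z powi k * (of_real (q z) * h z))"
        using h add by (auto intro!: bnd continuous_intros)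
      hence "(\<integral>z. z powi k * (of_real (p z) * h z) + z powi k * (of_real (q z) * h z) \<partial>circle) = 0"
        using add h by simp
      thus "(\<integral>z. z powi k * (of_real (p z + q z) * h z) \<partial>circle) = 0"
        by (simp add: distrib_left distrib_right)
    qed (use add in auto)
  next
    case (mult p q)
    show ?case
    proof (intro conjI continuous_on_mult allI impI)
      fix h k assume h: "integrable circle h" "\<forall>k. (\<integral>z. z powi k * h z \<partial>circle) = 0"
      have "integrable circle (\<lambda>z. of_real (q z) * h z)"
        using h mult by (auto intro!: bnd continuous_intros)
      hence "(\<integral>z. z powi k * (of_real (p z) * (of_real (q z) * h z)) \<partial>circle) = 0"
        using mult h by blast
      thus "(\<integral>z. z powi k * (of_real (p z * q z) * h z) \<partial>circle) = 0" by (simp add: mult.assoc)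
    qed (use mult in auto)
  qed
  have gi: "integrable circle (\<lambda>z. of_real (g z) * f z)"
    using f g by (intro bnd continuous_intros)
  define B where "B = (\<integral>z. norm (f z) \<partial>circle)"
  have "B \<ge> 0" unfolding B_def by simp
  have "norm (\<integral>z. of_real (g z) * f z \<partial>circle) \<le> e" if e: "e > 0" for e
  proof -
    define e' where "e' = e / (B + 1)"
    have "e' > 0" using e \<open>B \<ge> 0\<close> by (simp add: e'_def)
    then obtain p where p: "real_polynomial_function p" "\<And>z. z \<in> sphere 0 1 \<Longrightarrow> \<bar>g z - p z\<bar> < e'"
      using Stone_Weierstrass_real_polynomial_function[of "sphere 0 1" g e'] g by auto
    have pc: "continuous_on (sphere 0 1) p" using rp[OF p(1)] by blast
    have pi: "integrable circle (\<lambda>z. of_real (p z) * f z)"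
      using f pc by (intro bnd continuous_intros)
    have "(\<integral>z. z powi 0 * (of_real (p z) * f z) \<partial>circle) = 0"
      using rp[OF p(1)] f mom by blast
    hence "(\<integral>z. of_real (g z) * f z \<partial>circle) = (\<integral>z. of_real (g z) * f z - of_real (p z) * f z \<partial>circle)"
      using gi pi by simp
    also have "norm \<dots> \<le> (\<integral>z. norm (of_real (g z) * f z - of_real (p z) * f z) \<partial>circle)"
      by (rule integral_norm_bound)
    also have "\<dots> \<le> (\<integral>z. e' * norm (f z) \<partial>circle)"
    proof (rule integral_mono)
      fix z assume "z \<in> space circle"
      hence "\<bar>g z - p z\<bar> \<le> e'" using p(2)[of z] by simp
      hence "\<bar>g z - p z\<bar> * norm (f z) \<le> e' * norm (f z)" by (intro mult_right_mono) auto
      thus "norm (of_real (g z) * f z - of_real (p z) * f z) \<le> e' * norm (f z)"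
        by (simp flip: left_diff_distrib of_real_diff add: norm_mult)
    qed (use gi pi f in auto)
    also have "\<dots> = e * (B / (B + 1))" by (simp add: B_def[symmetric] e'_def)
    also have "\<dots> \<le> e * 1" using e \<open>B \<ge> 0\<close> by (intro mult_left_mono) auto
    finally show ?thesis by simp
  qed
  hence "norm (\<integral>z. of_real (g z) * f z \<partial>circle) \<le> 0" by (rule field_le_epsilon[of _ 0, simplified])
  thus ?thesis by simp
qed

text \<open>The integrals of \<open>f\<close> over closed sets vanish as limits of integrals with
  continuous weights. Closed sets are stable under intersection and generate the Borel sets, so the
  integrals over all Borel sets vanish.\<close>

lemma AE_0_of_moments:
  assumes f: "integrable circle f" and mom: "\<And>k. (\<integral>z. z powi k * f z \<partial>circle) = 0"
  shows "AE z in circle. f z = 0"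
proof -
  have closed: "(LINT z:B|circle. f z) = 0" if B: "closed B" for B
  proof (cases "B = {}")
    case False
    \<comment> \<open>Piecewise linear functions of the distance to \<open>B\<close>, decreasing to
      its indicator.\<close>
    define \<phi> where "\<phi> n z = max 0 (1 - real n * infdist z B)" for n z
    have \<phi>c: "continuous_on (sphere 0 1) (\<phi> n)" for n
      unfolding \<phi>_def by (intro continuous_intros)
    have lim: "(\<lambda>n. \<phi> n z) \<longlonglongrightarrow> indicator B z" for z
    proof (cases "z \<in> B")
      case True
      thus ?thesis by (simp add: \<phi>_def)
    next
      case nz: False
      hence d: "infdist z B > 0" using B False by (simp add: infdist_pos_not_in_closed)
      obtain N where N: "1 < real N * infdist z B" using reals_Archimedean3[OF d] by blast
      have "eventually (\<lambda>n. \<phi> n z = 0) sequentially"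
        using eventually_ge_at_top[of N]
      proof eventually_elim
        case (elim n)
        have "real N * infdist z B \<le> real n * infdist z B" using elim d by (intro mult_right_mono) auto
        thus ?case using N by (simp add: \<phi>_def)
      qed
      thus ?thesis using nz by (simp add: tendsto_eventually)
    qed
    have "(\<lambda>n. \<integral>z. of_real (\<phi> n z) * f z \<partial>circle) \<longlonglongrightarrow> (\<integral>z. of_real (indicator B z) * f z \<partial>circle)"
    proof (rule integral_dominated_convergence[where w="\<lambda>z. norm (f z)"])
      have "B \<in> sets borel" using B by (rule borel_closed)
      thus "(\<lambda>z. of_real (indicator B z) * f z) \<in> borel_measurable circle"
        using f by measurable
      show "(\<lambda>z. of_real (\<phi> n z) * f z) \<in> borel_measurable circle" for n
        using f borel_measurable_circle_continuous[OF \<phi>c] by measurable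
      show "AE z in circle. (\<lambda>n. of_real (\<phi> n z) * f z) \<longlonglongrightarrow> of_real (indicator B z) * f z"
        by (intro AE_I2 tendsto_mult tendsto_of_real lim tendsto_const)
      show "AE z in circle. norm (of_real (\<phi> n z) * f z) \<le> norm (f z)" for n
        by (intro AE_I2) (auto simp: norm_mult \<phi>_def infdist_nonneg intro!: mult_left_le_one_le)
    qed (use f in auto)
    moreover have "(\<integral>z. of_real (\<phi> n z) * f z \<partial>circle) = 0" for n
      by (rule integral_eq_0_of_moments[OF f mom \<phi>c])
    ultimately have "(\<integral>z. of_real (indicator B z) * f z \<partial>circle) = 0"
      by (simp add: LIMSEQ_const_iff)
    thus ?thesis by (simp add: set_lebesgue_integral_def scaleR_conv_of_real)
  qed (simp add: set_lebesgue_integral_def)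
  have m[measurable]: "B \<inter> sphere 0 1 \<in> sets circle" if "B \<in> sets borel" for B
    using that by (auto simp: sets_circle sets_restrict_space)
  have cut: "(LINT z:B|circle. f z) = (LINT z:B \<inter> sphere 0 1|circle. f z)" for B
    unfolding set_lebesgue_integral_def by (intro Bochner_Integration.integral_cong) (auto simp: indicator_def)
  have si: "set_integrable circle (B \<inter> sphere 0 1) f" if "B \<in> sets borel" for B
    unfolding set_integrable_def using f m[OF that] by (intro integrable_mult_indicator)
  have all: "(LINT z:B|circle. f z) = 0" if "B \<in> sigma_sets UNIV {B. closed B}" for B
  proof (rule sigma_sets_induct_disjoint[OF _ _ that])
    show "Int_stable {B :: complex set. closed B}" by (auto simp: Int_stable_def)
  next
    fix B assume compl: "B \<in> sigma_sets UNIV {B :: complex set. closed B}" "(LINT z:B|circle. f z) = 0"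
    hence B: "B \<in> sets borel" by (simp add: borel_eq_closed)
    have "(LINT z:B \<inter> sphere 0 1|circle. f z) + (LINT z:(- B) \<inter> sphere 0 1|circle. f z) =
        (LINT z:(B \<inter> sphere 0 1) \<union> (- B \<inter> sphere 0 1)|circle. f z)"
      using B by (intro set_integral_Un[symmetric] si) auto
    also have "(B \<inter> sphere 0 1) \<union> (- B \<inter> sphere 0 1) = UNIV \<inter> sphere 0 1" by auto
    also have "(LINT z:UNIV \<inter> sphere 0 1|circle. f z) = 0"
      unfolding cut[of UNIV, symmetric] by (rule closed) simp
    finally have "(LINT z:B|circle. f z) + (LINT z:- B|circle. f z) = 0"
      unfolding cut[of B, symmetric] cut[of "- B", symmetric] .
    thus "(LINT z:UNIV - B|circle. f z) = 0" unfolding compl(2) Compl_eq_Diff_UNIV by simp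
  next
    fix A :: "nat \<Rightarrow> complex set"
    assume union: "disjoint_family A" "range A \<subseteq> sigma_sets UNIV {B. closed B}" "\<And>i. (LINT z:A i|circle. f z) = 0"
    hence A: "A i \<in> sets borel" for i by (auto simp: borel_eq_closed)
    have "(LINT z:(\<Union>i. A i \<inter> sphere 0 1)|circle. f z) = (\<Sum>i. LINT z:A i \<inter> sphere 0 1|circle. f z)"
    proof (rule lebesgue_integral_countable_add)
      show "A i \<inter> sphere 0 1 \<in> sets circle" for i using m A by blast
      have "set_integrable circle ((\<Union>i. A i) \<inter> sphere 0 1) f" using A by (intro si) auto
      also have "(\<Union>i. A i) \<inter> sphere 0 1 = (\<Union>i. A i \<inter> sphere 0 1)" by blast
      finally show "set_integrable circle (\<Union>i. A i \<inter> sphere 0 1) f" .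
      show "(A i \<inter> sphere 0 1) \<inter> (A j \<inter> sphere 0 1) = {}" if "i \<noteq> j" for i j
      proof -
        have "A i \<inter> A j = {}" using union(1) that unfolding disjoint_family_on_def by blast
        thus ?thesis by blast
      qed
    qed
    also have "(\<Union>i. A i \<inter> sphere 0 1) = (\<Union>i. A i) \<inter> sphere 0 1" by auto
    finally have "(LINT z:(\<Union>i. A i)|circle. f z) = (\<Sum>i. LINT z:A i|circle. f z)"
      unfolding cut[symmetric] .
    thus "(LINT z:(\<Union>i. A i)|circle. f z) = 0" using union(3) by simp
  qed (use closed in \<open>auto simp: set_lebesgue_integral_def\<close>)
  have z: "(LINT z:A|circle. f z) = 0" if A: "A \<in> sets circle" for A
  proof -
    obtain B where B: "B \<in> sets borel" "A = B \<inter> sphere 0 1" using A by (auto simp: sets_circle sets_restrict_space)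
    from B(1) show ?thesis unfolding B(2) cut[of B, symmetric] by (intro all) (simp add: borel_eq_closed)
  qed
  have si': "set_integrable circle A f" if "A \<in> sets circle" for A
    unfolding set_integrable_def using f that by (intro integrable_mult_indicator)
  have "AE z in circle. Re (f z) = 0"
  proof (rule density_unique_real)
    fix A assume A: "A \<in> sets circle"
    have "Re (LINT z:A|circle. f z) = (LINT z:A|circle. Re (f z))"
      using si'[OF A] unfolding set_lebesgue_integral_def set_integrable_def by (subst integral_Re[symmetric]) auto
    thus "(LINT z:A|circle. Re (f z)) = (LINT z:A|circle. 0)" using z[OF A] by simp
  qed (use f in auto)
  moreover have "AE z in circle. Im (f z) = 0"
  proof (rule density_unique_real)
    fix A assume A: "A \<in> sets circle"
    have "Im (LINT z:A|circle. f z) = (LINT z:A|circle. Im (f z))"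
      using si'[OF A] unfolding set_lebesgue_integral_def set_integrable_def by (subst integral_Im[symmetric]) auto
    thus "(LINT z:A|circle. Im (f z)) = (LINT z:A|circle. 0)" using z[OF A] by simp
  qed (use f in auto)
  ultimately show ?thesis by eventually_elim (simp add: complex_eq_iff)
qed

section \<open>Scalar square-integrable functions\<close>

definition Ls :: "(complex \<Rightarrow> complex) \<Rightarrow> bool" where
  "Ls f \<longleftrightarrow> f \<in> borel_measurable circle \<and> integrable circle (\<lambda>z. (cmod (f z))\<^sup>2)"

definition fc :: "(complex \<Rightarrow> complex) \<Rightarrow> int \<Rightarrow> complex" where
  "fc f k = (\<integral>z. z powi (- k) * f z \<partial>circle)"

definition si :: "(complex \<Rightarrow> complex) \<Rightarrow> (complex \<Rightarrow> complex) \<Rightarrow> complex" where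
  "si f g = (\<integral>z. cnj (f z) * g z \<partial>circle)"

definition sn :: "(complex \<Rightarrow> complex) \<Rightarrow> real" where
  "sn f = sqrt (\<integral>z. (cmod (f z))\<^sup>2 \<partial>circle)"

definition trig :: "int set \<Rightarrow> (int \<Rightarrow> complex) \<Rightarrow> complex \<Rightarrow> complex" where
  "trig A c z = (\<Sum>k\<in>A. c k * z powi k)"

lemma Ls_measurable [measurable_dest]: "Ls f \<Longrightarrow> f \<in> borel_measurable circle"
  by (simp add: Ls_def)

lemma Ls_bounded_by:
  assumes f: "f \<in> borel_measurable circle" and g: "integrable circle g" and le: "\<And>z. z \<in> sphere 0 1 \<Longrightarrow> (cmod (f z))\<^sup>2 \<le> g z"
  shows "Ls f"
  unfolding Ls_def
proof (intro conjI f Bochner_Integration.integrable_bound[OF g])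
  show "(\<lambda>z. (cmod (f z))\<^sup>2) \<in> borel_measurable circle" using f by measurable
  show "AE z in circle. norm ((cmod (f z))\<^sup>2) \<le> norm (g z)"
    using le by (intro AE_I2) (auto intro: order_trans[OF _ abs_ge_self])
qed

lemma Ls_add [intro]: "Ls f \<Longrightarrow> Ls g \<Longrightarrow> Ls (\<lambda>z. f z + g z)"
  by (rule Ls_bounded_by[OF _ _ cmod_add_square_le]) (auto simp: Ls_def)

lemma Ls_scale [intro]: "Ls f \<Longrightarrow> Ls (\<lambda>z. c * f z)"
  by (auto simp: Ls_def norm_mult power_mult_distrib)

lemma Ls_diff [intro]: "Ls f \<Longrightarrow> Ls g \<Longrightarrow> Ls (\<lambda>z. f z - g z)"
  using Ls_add[of f "\<lambda>z. (-1) * g z"] Ls_scale[of g "-1"] by simp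

lemma Ls_mult_continuous [intro]:
  assumes f: "Ls f" and q: "continuous_on (sphere 0 1) q"
  shows "Ls (\<lambda>z. q z * f z)"
proof -
  have "bounded (q ` sphere 0 1)"
    by (intro compact_imp_bounded compact_continuous_image q) simp
  then obtain B where B: "\<forall>z\<in>sphere 0 1. norm (q z) \<le> B" unfolding bounded_iff by blast
  show ?thesis
  proof (rule Ls_bounded_by)
    show "(\<lambda>z. q z * f z) \<in> borel_measurable circle"
      using f borel_measurable_circle_continuous[OF q] by (auto simp: Ls_def)
    show "integrable circle (\<lambda>z. B\<^sup>2 * (cmod (f z))\<^sup>2)" using f by (auto simp: Ls_def)
    show "(cmod (q z * f z))\<^sup>2 \<le> B\<^sup>2 * (cmod (f z))\<^sup>2" if "z \<in> sphere 0 1" for z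
      using B that by (auto simp: norm_mult power_mult_distrib intro!: mult_right_mono power_mono)
  qed
qed

lemma Ls_continuous: "continuous_on (sphere 0 1) f \<Longrightarrow> Ls f"
  unfolding Ls_def by (auto intro!: borel_measurable_circle_continuous integrable_circle_continuous continuous_intros)

lemma continuous_on_circle_powi [continuous_intros]: "continuous_on (sphere 0 1) (\<lambda>z::complex. z powi k)"
  by (intro continuous_intros) auto

lemma continuous_on_trig [continuous_intros]: "continuous_on (sphere 0 1) (trig A c)"
  unfolding trig_def by (intro continuous_intros)

lemma Ls_powi: "Ls (\<lambda>z. z powi k)" and Ls_trig [intro]: "Ls (trig A c)"
  by (auto intro!: Ls_continuous continuous_intros)

lemma borel_measurable_cnj [measurable (raw)]:
  assumes "f \<in> borel_measurable M"
  shows "(\<lambda>z. cnj (f z)) \<in> borel_measurable M"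
  by (rule measurable_compose[OF assms]) (intro borel_measurable_continuous_onI continuous_intros)

lemma si_integrable:
  assumes "Ls f" "Ls g"
  shows "integrable circle (\<lambda>z. cnj (f z) * g z)"
proof (rule Bochner_Integration.integrable_bound)
  show "integrable circle (\<lambda>z. (cmod (f z))\<^sup>2 + (cmod (g z))\<^sup>2)" using assms by (auto simp: Ls_def)
  show "(\<lambda>z. cnj (f z) * g z) \<in> borel_measurable circle" using assms by (auto simp: Ls_def)
  show "AE z in circle. norm (cnj (f z) * g z) \<le> norm ((cmod (f z))\<^sup>2 + (cmod (g z))\<^sup>2)"
  proof (rule AE_I2)
    fix z
    show "norm (cnj (f z) * g z) \<le> norm ((cmod (f z))\<^sup>2 + (cmod (g z))\<^sup>2)"
      using sum_squares_bound[of "cmod (f z)" "cmod (g z)"] mult_nonneg_nonneg[OF norm_ge_zero norm_ge_zero, of "f z" "g z"]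
      unfolding norm_mult complex_mod_cnj real_norm_def by linarith
  qed
qed

lemma cnj_powi: "z \<in> sphere 0 1 \<Longrightarrow> cnj (z powi k) = z powi (- k)"
proof -
  assume "z \<in> sphere 0 1"
  hence "inverse z = cnj z" by (simp add: inverse_complex_def complex_eq_iff cmod_def)
  thus ?thesis by (simp add: power_int_minus power_int_inverse[symmetric])
qed

lemma fc_eq_si: "fc f k = si (\<lambda>z. z powi k) f"
  unfolding fc_def si_def by (intro Bochner_Integration.integral_cong refl) (simp only: cnj_powi space_circle)

lemma Ls_integrable: "Ls f \<Longrightarrow> integrable circle f"
  using si_integrable[OF Ls_powi[of 0], of f] by simp

lemma si_add_right: "Ls f \<Longrightarrow> Ls g \<Longrightarrow> Ls h \<Longrightarrow> si f (\<lambda>z. g z + h z) = si f g + si f h"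
  unfolding si_def distrib_left by (intro Bochner_Integration.integral_add si_integrable)

lemma si_diff_right: "Ls f \<Longrightarrow> Ls g \<Longrightarrow> Ls h \<Longrightarrow> si f (\<lambda>z. g z - h z) = si f g - si f h"
  unfolding si_def right_diff_distrib by (intro Bochner_Integration.integral_diff si_integrable)

lemma si_diff_left: "Ls f \<Longrightarrow> Ls g \<Longrightarrow> Ls h \<Longrightarrow> si (\<lambda>z. f z - g z) h = si f h - si g h"
  unfolding si_def complex_cnj_diff left_diff_distrib by (intro Bochner_Integration.integral_diff si_integrable)

lemma si_scale_right: "si f (\<lambda>z. c * g z) = c * si f g"
  unfolding si_def by (simp add: mult.left_commute)

lemma si_cnj: "cnj (si f g) = si g f"
proof -
  have "cnj (si f g) = (\<integral>z. cnj (cnj (f z) * g z) \<partial>circle)" 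
    unfolding si_def by (rule Bochner_Integration.integral_cnj[symmetric])
  thus ?thesis by (simp add: si_def mult.commute)
qed

lemma sn_sq: "(sn f)\<^sup>2 = (\<integral>z. (cmod (f z))\<^sup>2 \<partial>circle)" and sn_nonneg [simp]: "0 \<le> sn f"
  by (simp_all add: sn_def)

lemma si_self: "si f f = of_real ((sn f)\<^sup>2)"
proof -
  have "si f f = (\<integral>z. complex_of_real ((cmod (f z))\<^sup>2) \<partial>circle)"
    unfolding si_def by (intro Bochner_Integration.integral_cong refl) (simp add: complex_norm_square mult.commute del: of_real_power)
  thus ?thesis by (simp add: sn_sq del: of_real_power)
qed

lemma si_Cauchy_Schwarz:
  assumes f: "Ls f" and g: "Ls g"
  shows "cmod (si f g) \<le> sn f * sn g"
proof (rule field_le_epsilon)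
  fix e :: real assume e: "e > 0"
  \<comment> \<open>\<open>s\<close> is the optimal weight sn g / sn f for the inequality of means,
    with both norms increased by \<open>d\<close> so that neither can vanish; \<open>d\<close> is
    chosen to keep the total error below \<open>e\<close>.\<close>
  define d where "d = e / (sn f + sn g + 1)"
  have d: "d > 0" using e by (simp add: d_def add_nonneg_pos)
  define s where "s = (sn g + d) / (sn f + d)"
  have s: "s > 0" using d by (simp add: s_def add_nonneg_pos)
  have "cmod (si f g) \<le> (\<integral>z. cmod (cnj (f z) * g z) \<partial>circle)"
    unfolding si_def by (rule integral_norm_bound)
  also have "\<dots> \<le> (\<integral>z. (s * (cmod (f z))\<^sup>2 + (1/s) * (cmod (g z))\<^sup>2) / 2 \<partial>circle)"
  proof (rule integral_mono)
    show "integrable circle (\<lambda>z. cmod (cnj (f z) * g z))" by (intro integrable_norm si_integrable f g)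
    show "integrable circle (\<lambda>z. (s * (cmod (f z))\<^sup>2 + (1/s) * (cmod (g z))\<^sup>2) / 2)" using f g by (auto simp: Ls_def)
    fix z
    have "0 \<le> (1/s) * (s * cmod (f z) - cmod (g z))\<^sup>2" using s by simp
    also have "\<dots> = s * (cmod (f z))\<^sup>2 + (1/s) * (cmod (g z))\<^sup>2 - 2 * (cmod (f z) * cmod (g z))"
      using s by (simp add: power2_eq_square field_simps)
    finally show "cmod (cnj (f z) * g z) \<le> (s * (cmod (f z))\<^sup>2 + (1/s) * (cmod (g z))\<^sup>2) / 2"
      by (simp add: norm_mult)
  qed
  also have "\<dots> = (s * (sn f)\<^sup>2 + (1/s) * (sn g)\<^sup>2) / 2"
    using f g by (simp add: sn_sq Ls_def)
  also have "s * (sn f)\<^sup>2 \<le> (sn g + d) * sn f"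
  proof -
    have "s * (sn f)\<^sup>2 = (sn g + d) * (sn f * (sn f / (sn f + d)))" by (simp add: s_def power2_eq_square)
    also have "\<dots> \<le> (sn g + d) * (sn f * 1)" using d by (intro mult_left_mono) (auto simp: divide_le_eq_1 add_nonneg_pos)
    finally show ?thesis by simp
  qed
  also have "(1/s) * (sn g)\<^sup>2 \<le> (sn f + d) * sn g"
  proof -
    have "(1/s) * (sn g)\<^sup>2 = (sn f + d) * (sn g * (sn g / (sn g + d)))" by (simp add: s_def power2_eq_square)
    also have "\<dots> \<le> (sn f + d) * (sn g * 1)" using d by (intro mult_left_mono) (auto simp: divide_le_eq_1 add_nonneg_pos)
    finally show ?thesis by simp
  qed
  finally have "cmod (si f g) \<le> sn f * sn g + d * (sn f + sn g) / 2" by (simp add: algebra_simps add_divide_distrib)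
  also have "d * (sn f + sn g) / 2 \<le> e"
  proof -
    have "d * (sn f + sn g) \<le> d * (sn f + sn g + 1)" using d by simp
    also have "\<dots> = e"
    proof -
      have "sn f + sn g + 1 \<noteq> 0" using sn_nonneg[of f] sn_nonneg[of g] by linarith
      thus ?thesis by (simp add: d_def)
    qed
    finally show ?thesis using e by simp
  qed
  finally show "cmod (si f g) \<le> sn f * sn g + e" by simp
qed

lemma fc_trig: "finite A \<Longrightarrow> fc (trig A c) k = (if k \<in> A then c k else 0)"
proof -
  assume A: "finite A"
  have "fc (trig A c) k = (\<integral>z. (\<Sum>j\<in>A. c j * z powi (j - k)) \<partial>circle)"
    unfolding fc_def trig_def sum_distrib_left
  proof (intro Bochner_Integration.integral_cong refl sum.cong)
    fix z :: complex and j assume "z \<in> space circle"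
    hence "z \<noteq> 0" by auto
    thus "z powi (- k) * (c j * z powi j) = c j * z powi (j - k)"
      using power_int_add[of z "-k" j] by (simp add: algebra_simps)
  qed
  also have "\<dots> = (\<Sum>j\<in>A. c j * of_bool (j = k))"
    by (subst Bochner_Integration.integral_sum)
       (auto intro!: integrable_circle_continuous continuous_intros simp: integral_circle_powi)
  finally show ?thesis using A by (simp add: of_bool_def if_distrib sum.delta cong: if_cong)
qed

lemma si_trig_left: "Ls f \<Longrightarrow> si (trig A c) f = (\<Sum>k\<in>A. cnj (c k) * fc f k)"
proof -
  assume f: "Ls f"
  have "si (trig A c) f = (\<integral>z. (\<Sum>k\<in>A. cnj (c k) * (cnj (z powi k) * f z)) \<partial>circle)"
    unfolding si_def trig_def cnj_sum sum_distrib_right by (simp only: complex_cnj_mult mult.assoc)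
  also have "\<dots> = (\<Sum>k\<in>A. cnj (c k) * fc f k)"
    unfolding fc_eq_si si_def
    by (subst Bochner_Integration.integral_sum)
       (simp_all only: integral_mult_right_zero integrable_mult_right[OF si_integrable[OF Ls_powi f]])
  finally show ?thesis .
qed

lemma sn_trig_sq: "finite A \<Longrightarrow> (sn (trig A c))\<^sup>2 = (\<Sum>k\<in>A. (cmod (c k))\<^sup>2)"
proof -
  assume A: "finite A"
  have "complex_of_real ((sn (trig A c))\<^sup>2) = (\<Sum>k\<in>A. cnj (c k) * c k)"
    unfolding si_self[symmetric] using A by (subst si_trig_left) (auto simp: fc_trig)
  also have "\<dots> = of_real (\<Sum>k\<in>A. (cmod (c k))\<^sup>2)"
    unfolding of_real_sum by (intro sum.cong refl) (simp add: complex_norm_square mult.commute del: of_real_power)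
  finally show ?thesis using of_real_eq_iff by blast
qed

text \<open>Bessel's inequality: subtracting a partial Fourier sum lowers the squared norm by
  exactly the sum of the squared coefficients.\<close>

lemma fc_l2:
  assumes f: "Ls f"
  shows "l2 (fc f)"
  unfolding l2_def
proof (rule nonneg_bdd_above_summable_on)
  have "(\<Sum>k\<in>A. (cmod (fc f k))\<^sup>2) \<le> (sn f)\<^sup>2" if A: "finite A" for A
  proof -
    let ?t = "trig A (fc f)"
    have 1: "si ?t f = of_real ((sn ?t)\<^sup>2)"
      using A unfolding si_self[symmetric] by (simp add: si_trig_left f Ls_trig fc_trig)
    have 2: "si f ?t = of_real ((sn ?t)\<^sup>2)"
      using arg_cong[OF 1, of cnj] by (simp add: si_cnj)
    have "si (\<lambda>z. f z - ?t z) (\<lambda>z. f z - ?t z) = (si f f - si f ?t) - (si ?t f - si ?t ?t)"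
      using f by (simp add: si_diff_left si_diff_right Ls_diff Ls_trig)
    hence "complex_of_real ((sn (\<lambda>z. f z - ?t z))\<^sup>2) = of_real ((sn f)\<^sup>2 - (sn ?t)\<^sup>2)"
      unfolding 1 2 unfolding si_self by simp
    hence "(sn (\<lambda>z. f z - ?t z))\<^sup>2 = (sn f)\<^sup>2 - (sn ?t)\<^sup>2" using of_real_eq_iff by blast
    thus ?thesis using A sn_trig_sq[of A "fc f"] zero_le_power2[of "sn (\<lambda>z. f z - ?t z)"] by linarith
  qed
  thus "bdd_above (sum (\<lambda>k. (cmod (fc f k))\<^sup>2) ` {F. F \<subseteq> UNIV \<and> finite F})"
    by (intro bdd_aboveI2) auto
qed auto

text \<open>Symmetric intervals are cofinal among the finite sets of integers, so unordered sums
  become limits of sequences.\<close>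

definition sq :: "nat \<Rightarrow> int set" where "sq n = {- int n..int n}"

lemma finite_sq [simp]: "finite (sq n)" by (simp add: sq_def)

lemma filterlim_sq: "filterlim sq (finite_subsets_at_top UNIV) sequentially"
  unfolding filterlim_finite_subsets_at_top
proof (intro allI impI)
  fix X :: "int set" assume X: "finite X \<and> X \<subseteq> UNIV"
  define N where "N = nat (Max (insert 0 (abs ` X)))"
  have "X \<subseteq> sq n" if "n \<ge> N" for n
  proof
    fix k assume "k \<in> X"
    hence "\<bar>k\<bar> \<le> Max (insert 0 (abs ` X))" using X by (intro Max_ge) auto
    thus "k \<in> sq n" using that by (auto simp: sq_def N_def)
  qed
  thus "\<forall>\<^sub>F n in sequentially. finite (sq n) \<and> X \<subseteq> sq n \<and> sq n \<subseteq> UNIV"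
    using eventually_mono[OF eventually_ge_at_top[of N]] by auto
qed

lemma sum_sq_tendsto:
  assumes "(f :: int \<Rightarrow> 'a :: {comm_monoid_add, t2_space}) summable_on UNIV"
  shows "(\<lambda>n. \<Sum>k\<in>sq n. f k) \<longlonglongrightarrow> infsum f UNIV"
  using filterlim_compose[OF infsum_tendsto[OF assms] filterlim_sq] .

text \<open>Along a rapid subsequence the partial sums converge almost everywhere, and Fatou's lemma
  shows that this pointwise limit is also the limit in norm.\<close>

lemma Riesz_Fischer:
  assumes c: "l2 c"
  obtains F where "Ls F" "(\<lambda>n. sn (\<lambda>z. F z - trig (sq n) c z)) \<longlonglongrightarrow> 0"
proof -
  define S where "S n = trig (sq n) c" for n
  define t where "t n = infsum (\<lambda>k. (cmod (c k))\<^sup>2) UNIV - (\<Sum>k\<in>sq n. (cmod (c k))\<^sup>2)" for n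
  have cs: "(\<lambda>k. (cmod (c k))\<^sup>2) summable_on UNIV" using c by (simp add: l2_def)
  have t0: "0 \<le> t n" for n
    unfolding t_def using finite_sum_le_infsum[OF cs, of "sq n"] by simp
  have tlim: "t \<longlonglongrightarrow> 0"
    unfolding t_def using tendsto_diff[OF tendsto_const sum_sq_tendsto[OF cs], of "infsum (\<lambda>k. (cmod (c k))\<^sup>2) UNIV"] by simp
  have sub: "sq n \<subseteq> sq m" if "n \<le> m" for n m using that by (auto simp: sq_def)
  have Sd: "(sn (\<lambda>z. S m z - S n z))\<^sup>2 \<le> t n" if "n \<le> m" for n m
  proof -
    have "(\<lambda>z. S m z - S n z) = trig (sq m - sq n) c"
      unfolding S_def trig_def by (simp add: fun_eq_iff sum_diff[OF finite_sq sub[OF that]])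
    hence "(sn (\<lambda>z. S m z - S n z))\<^sup>2 = (\<Sum>k\<in>sq m - sq n. (cmod (c k))\<^sup>2)"
      by (simp add: sn_trig_sq)
    also have "\<dots> = (\<Sum>k\<in>sq m. (cmod (c k))\<^sup>2) - (\<Sum>k\<in>sq n. (cmod (c k))\<^sup>2)"
      by (rule sum_diff[OF finite_sq sub[OF that]])
    also have "\<dots> \<le> t n" unfolding t_def using finite_sum_le_infsum[OF cs, of "sq m"] by simp
    finally show ?thesis .
  qed
  have "\<exists>N. \<forall>n\<ge>N. t n \<le> (1/4)^j" for j
  proof -
    have "eventually (\<lambda>n. t n < (1/4)^j) sequentially" by (rule order_tendstoD(2)[OF tlim]) simp
    thus ?thesis by (auto simp: eventually_sequentially intro: less_imp_le)
  qed
  then obtain N where N: "\<And>j n. n \<ge> N j \<Longrightarrow> t n \<le> (1/4)^j" by metis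
  \<comment> \<open>The summand \<open>j\<close> gives \<open>j \<le> r j\<close>, the partial sums
    make \<open>r\<close> increasing, and \<open>N j \<le> r j\<close> keeps the tail below
    4^-j.\<close>
  define r where "r j = j + (\<Sum>i\<le>j. N i)" for j
  have r: "t (r j) \<le> (1/4)^j" "r j \<le> r (Suc j)" "j \<le> r j" for j
    unfolding r_def by (auto intro!: N trans_le_add2 member_le_sum)
  define d where "d j z = S (r (Suc j)) z - S (r j) z" for j z
  have LS: "Ls (S n)" for n unfolding S_def by auto
  have Ld: "Ls (d j)" for j unfolding d_def by (intro Ls_diff LS)
  have dint: "(\<integral>z. cmod (d j z) \<partial>circle) \<le> (1/2)^j" for j
  proof -
    have "si (\<lambda>z. 1) (\<lambda>z. of_real (cmod (d j z))) = of_real (\<integral>z. cmod (d j z) \<partial>circle)"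
      unfolding si_def by simp
    hence "(\<integral>z. cmod (d j z) \<partial>circle) = cmod (si (\<lambda>z. 1) (\<lambda>z. of_real (cmod (d j z))))" by simp
    also have "\<dots> \<le> sn (\<lambda>z. 1) * sn (\<lambda>z. of_real (cmod (d j z)))"
      using Ld[of j] Ls_powi[of 0] by (intro si_Cauchy_Schwarz) (auto simp: Ls_def)
    also have "sn (\<lambda>z. 1) = 1"
      using integral_circle_powi[of 0] by (simp add: sn_def measure_def prob_space_circle)
    also have "sn (\<lambda>z. of_real (cmod (d j z))) = sn (d j)" by (simp add: sn_def)
    also have "sn (d j) \<le> (1/2)^j"
    proof (rule power2_le_imp_le)
      have "(sn (d j))\<^sup>2 \<le> t (r j)" unfolding d_def by (intro Sd r)
      also have "\<dots> \<le> (1/4)^j" by (rule r)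
      also have "\<dots> = ((1/2)^j)\<^sup>2" by (simp add: power2_eq_square flip: power_mult_distrib)
      finally show "(sn (d j))\<^sup>2 \<le> ((1/2)^j)\<^sup>2" .
    qed simp
    finally show ?thesis by simp
  qed
  have dm: "d j \<in> borel_measurable circle" for j using Ld by (simp add: Ls_def)
  have "(\<integral>\<^sup>+z. (\<Sum>j. ennreal (cmod (d j z))) \<partial>circle) = (\<Sum>j. \<integral>\<^sup>+z. ennreal (cmod (d j z)) \<partial>circle)"
    using dm by (intro nn_integral_suminf) auto
  also have "\<dots> = (\<Sum>j. ennreal (\<integral>z. cmod (d j z) \<partial>circle))"
    using Ls_integrable[OF Ld] by (intro suminf_cong nn_integral_eq_integral) auto
  also have "\<dots> \<le> (\<Sum>j. ennreal ((1/2)^j))"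
    by (intro suminf_le ennreal_leI dint) auto
  also have "\<dots> < top"
  proof -
    have "summable (\<lambda>j. (1/2 :: real)^j)" by (rule summable_geometric) simp
    thus ?thesis unfolding less_top[symmetric] by (rule ennreal_suminf_neq_top) simp
  qed
  finally have "AE z in circle. (\<Sum>j. ennreal (cmod (d j z))) \<noteq> \<infinity>"
    using dm by (intro nn_integral_PInf_AE) auto
  hence conv: "AE z in circle. (\<lambda>j. S (r j) z) \<longlonglongrightarrow> lim (\<lambda>j. S (r j) z)"
  proof eventually_elim
    case (elim z)
    hence "summable (\<lambda>j. cmod (d j z))" by (intro summable_suminf_not_top) auto
    hence "summable (\<lambda>j. d j z)" by (rule summable_norm_cancel)
    hence "(\<lambda>n. \<Sum>j<n. d j z) \<longlonglongrightarrow> (\<Sum>j. d j z)" by (rule summable_LIMSEQ)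
    moreover have "(\<Sum>j<n. d j z) = S (r n) z - S (r 0) z" for n
      unfolding d_def by (rule sum_lessThan_telescope)
    ultimately have "(\<lambda>n. (S (r n) z - S (r 0) z) + S (r 0) z) \<longlonglongrightarrow> (\<Sum>j. d j z) + S (r 0) z"
      by (intro tendsto_add) auto
    hence "convergent (\<lambda>n. S (r n) z)" by (auto simp: convergent_def)
    thus ?case by (simp add: convergent_LIMSEQ_iff)
  qed
  define F where "F z = lim (\<lambda>j. S (r j) z)" for z
  have Sm: "S n \<in> borel_measurable circle" for n using LS by (simp add: Ls_def)
  have Fm: "F \<in> borel_measurable circle" unfolding F_def using Sm by measurable
  \<comment> \<open>Fatou's lemma along the subsequence, with \<open>n\<close> fixed.\<close>
  have key: "(\<integral>\<^sup>+z. ennreal ((cmod (F z - S n z))\<^sup>2) \<partial>circle) \<le> ennreal (t n)" for n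
  proof -
    have "(\<integral>\<^sup>+z. ennreal ((cmod (F z - S n z))\<^sup>2) \<partial>circle) = (\<integral>\<^sup>+z. liminf (\<lambda>j. ennreal ((cmod (S (r j) z - S n z))\<^sup>2)) \<partial>circle)"
    proof (rule nn_integral_cong_AE, use conv in eventually_elim)
      case (elim z)
      have "(\<lambda>j. ennreal ((cmod (S (r j) z - S n z))\<^sup>2)) \<longlonglongrightarrow> ennreal ((cmod (F z - S n z))\<^sup>2)"
        unfolding F_def by (intro tendsto_ennrealI tendsto_power tendsto_norm tendsto_diff elim tendsto_const)
      from lim_imp_Liminf[OF _ this] show ?case by simp
    qed
    also have "\<dots> \<le> liminf (\<lambda>j. \<integral>\<^sup>+z. ennreal ((cmod (S (r j) z - S n z))\<^sup>2) \<partial>circle)"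
      using Sm by (intro nn_integral_liminf) auto
    also have "\<dots> \<le> liminf (\<lambda>j. ennreal (t n))"
    proof (rule Liminf_mono)
      show "\<forall>\<^sub>F j in sequentially. (\<integral>\<^sup>+z. ennreal ((cmod (S (r j) z - S n z))\<^sup>2) \<partial>circle) \<le> ennreal (t n)"
        using eventually_ge_at_top[of n]
      proof eventually_elim
        case (elim j)
        have "(\<integral>\<^sup>+z. ennreal ((cmod (S (r j) z - S n z))\<^sup>2) \<partial>circle) = ennreal ((sn (\<lambda>z. S (r j) z - S n z))\<^sup>2)"
          unfolding sn_sq using Ls_diff[OF LS LS, of "r j" n] by (intro nn_integral_eq_integral) (auto simp: Ls_def)
        also have "\<dots> \<le> ennreal (t n)" using elim r(3)[of j] by (intro ennreal_leI Sd) auto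
        finally show ?case .
      qed
    qed
    also have "\<dots> = ennreal (t n)" by (simp add: Liminf_const)
    finally show ?thesis .
  qed
  have LF: "Ls (\<lambda>z. F z - S n z)" for n
    unfolding Ls_def
  proof (intro conjI integrableI_bounded)
    show "(\<lambda>z. F z - S n z) \<in> borel_measurable circle" using Fm Sm by measurable
    thus "(\<lambda>z. (cmod (F z - S n z))\<^sup>2) \<in> borel_measurable circle" by measurable
    show "(\<integral>\<^sup>+z. ennreal (norm ((cmod (F z - S n z))\<^sup>2)) \<partial>circle) < \<infinity>"
      using key[of n] by (simp add: le_less_trans[OF _ ennreal_less_top])
  qed
  have "Ls F" using Ls_add[OF LF[of 0] LS[of 0]] by simp
  moreover have "(\<lambda>n. sn (\<lambda>z. F z - trig (sq n) c z)) \<longlonglongrightarrow> 0"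
  proof (rule tendsto_sandwich[OF _ _ tendsto_const])
    show "(\<lambda>n. sqrt (t n)) \<longlonglongrightarrow> 0" using tendsto_real_sqrt[OF tlim] by simp
    have "(sn (\<lambda>z. F z - S n z))\<^sup>2 \<le> t n" for n
    proof -
      have "ennreal ((sn (\<lambda>z. F z - S n z))\<^sup>2) = (\<integral>\<^sup>+z. ennreal ((cmod (F z - S n z))\<^sup>2) \<partial>circle)"
        unfolding sn_sq using LF[of n] by (intro nn_integral_eq_integral[symmetric]) (auto simp: Ls_def)
      also have "\<dots> \<le> ennreal (t n)" by (rule key)
      finally show ?thesis using t0 by (simp add: ennreal_le_iff)
    qed
    thus "\<forall>\<^sub>F n in sequentially. sn (\<lambda>z. F z - trig (sq n) c z) \<le> sqrt (t n)"
      unfolding S_def by (intro always_eventually allI real_le_rsqrt)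
  qed auto
  ultimately show thesis by (rule that)
qed

lemma fc_diff: "Ls f \<Longrightarrow> Ls g \<Longrightarrow> fc (\<lambda>z. f z - g z) k = fc f k - fc g k"
  unfolding fc_eq_si by (intro si_diff_right Ls_powi)

lemma fc_norm_le: "Ls f \<Longrightarrow> cmod (fc f k) \<le> sn f"
proof -
  assume f: "Ls f"
  have "(sn (\<lambda>z. z powi k))\<^sup>2 = 1"
    using sn_trig_sq[of "{k}" "\<lambda>_. 1"] by (simp add: trig_def[abs_def])
  hence "sn (\<lambda>z. z powi k) = 1" using power2_eq_imp_eq[of "sn (\<lambda>z. z powi k)" 1] by simp
  thus ?thesis unfolding fc_eq_si using si_Cauchy_Schwarz[OF Ls_powi f, of k] by simp
qed

lemma Riesz_Fischer_fc:
  assumes c: "l2 c"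
  obtains F where "Ls F" "fc F = c" "(\<lambda>n. sn (\<lambda>z. F z - trig (sq n) c z)) \<longlonglongrightarrow> 0"
proof -
  obtain F where F: "Ls F" "(\<lambda>n. sn (\<lambda>z. F z - trig (sq n) c z)) \<longlonglongrightarrow> 0"
    by (rule Riesz_Fischer[OF c])
  have "fc F k = c k" for k
  proof -
    have "(\<lambda>n. fc F k - fc (trig (sq n) c) k) \<longlonglongrightarrow> 0"
      by (rule Lim_null_comparison[OF _ F(2)])
         (use F(1) in \<open>auto intro!: always_eventually fc_norm_le simp: fc_diff[OF F(1) Ls_trig, symmetric]\<close>)
    moreover have "\<forall>\<^sub>F n in sequentially. fc F k - fc (trig (sq n) c) k = fc F k - c k"
      using eventually_ge_at_top[of "nat \<bar>k\<bar>"] by eventually_elim (auto simp: fc_trig sq_def)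
    ultimately have "(\<lambda>n::nat. fc F k - c k) \<longlonglongrightarrow> 0" by (rule Lim_transform_eventually)
    thus ?thesis by (simp add: LIMSEQ_const_iff)
  qed
  hence "fc F = c" by auto
  thus thesis using F that by blast
qed

lemma fc_eq_imp_AE_eq:
  assumes "Ls f" "Ls g" "fc f = fc g"
  shows "AE z in circle. f z = g z"
proof -
  have "(\<integral>z. z powi k * (f z - g z) \<partial>circle) = 0" for k
    using fc_diff[OF assms(1,2), of "- k"] assms(3) by (simp add: fc_def)
  hence "AE z in circle. f z - g z = 0"
    using Ls_integrable[OF assms(1)] Ls_integrable[OF assms(2)] by (intro AE_0_of_moments) auto
  thus ?thesis by eventually_elim simp
qed

text \<open>The function that \<open>Riesz_Fischer_fc\<close> builds from the coefficients of
  \<open>f\<close> agrees with \<open>f\<close> almost everywhere, by uniqueness of Fourier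
  coefficients.\<close>

lemma Fourier_convergence:
  assumes f: "Ls f"
  shows "(\<lambda>n. sn (\<lambda>z. f z - trig (sq n) (fc f) z)) \<longlonglongrightarrow> 0"
proof -
  obtain F where F: "Ls F" "fc F = fc f" "(\<lambda>n. sn (\<lambda>z. F z - trig (sq n) (fc f) z)) \<longlonglongrightarrow> 0"
    by (rule Riesz_Fischer_fc[OF fc_l2[OF f]])
  have "sn (\<lambda>z. F z - trig (sq n) (fc f) z) = sn (\<lambda>z. f z - trig (sq n) (fc f) z)" for n
    unfolding sn_def
    using fc_eq_imp_AE_eq[OF F(1) f F(2)] Ls_diff[OF F(1) Ls_trig, of "sq n" "fc f"] Ls_diff[OF f Ls_trig, of "sq n" "fc f"]
    by (intro arg_cong[where f=sqrt] integral_cong_AE) (auto simp: Ls_def)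
  thus ?thesis using F(3) by simp
qed

lemma Parseval:
  assumes f: "Ls f" and g: "Ls g"
  shows "si f g = ip (fc f) (fc g)"
proof -
  have "(\<lambda>n. si f g - (\<Sum>k\<in>sq n. cnj (fc f k) * fc g k)) \<longlonglongrightarrow> 0"
  proof (rule Lim_null_comparison)
    show "(\<lambda>n. sn (\<lambda>z. f z - trig (sq n) (fc f) z) * sn g) \<longlonglongrightarrow> 0"
      using tendsto_mult[OF Fourier_convergence[OF f] tendsto_const, of "sn g"] by simp
    show "\<forall>\<^sub>F n in sequentially. norm (si f g - (\<Sum>k\<in>sq n. cnj (fc f k) * fc g k)) \<le> sn (\<lambda>z. f z - trig (sq n) (fc f) z) * sn g"
    proof (intro always_eventually allI)
      fix n
      have "si f g - (\<Sum>k\<in>sq n. cnj (fc f k) * fc g k) = si (\<lambda>z. f z - trig (sq n) (fc f) z) g"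
        using f g by (simp add: si_diff_left si_trig_left Ls_trig)
      thus "norm (si f g - (\<Sum>k\<in>sq n. cnj (fc f k) * fc g k)) \<le> sn (\<lambda>z. f z - trig (sq n) (fc f) z) * sn g"
        using f g by (auto intro!: si_Cauchy_Schwarz)
    qed
  qed
  moreover have "(\<lambda>n. si f g - (\<Sum>k\<in>sq n. cnj (fc f k) * fc g k)) \<longlonglongrightarrow> si f g - ip (fc f) (fc g)"
    unfolding ip_def by (intro tendsto_diff tendsto_const sum_sq_tendsto ip_summable fc_l2 f g)
  ultimately show ?thesis using LIMSEQ_unique by fastforce
qed

section \<open>Unitary loops\<close>

definition co :: "vfun \<Rightarrow> int \<times> 2 \<Rightarrow> complex" where
  "co f = (\<lambda>(k, c). fc (\<lambda>z. f z $ c) k)"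

definition bas :: "int \<times> 2 \<Rightarrow> vfun" where
  "bas = (\<lambda>(k, c) z. axis c (z powi k))"

definition KP :: "(int \<times> 2) set" where "KP = {0..} \<times> UNIV"

definition adj :: "complex^2^2 \<Rightarrow> complex^2^2" where
  "adj M = (\<chi> i j. cnj (M $ j $ i))"

text \<open>Unitary rather than special unitary, since the diagonal entries are altered one at a
  time; and only on the circle, where functions are compared.\<close>

definition loop :: "mfun \<Rightarrow> bool" where
  "loop g \<longleftrightarrow> (\<forall>i j. continuous_on (sphere 0 1) (\<lambda>z. g z $ i $ j)) \<and> (\<forall>z\<in>sphere 0 1. adj (g z) ** g z = mat 1)"

lemma two_cases: "(c::2) = 1 \<or> c = 2"
  using exhaust_2 by blast

lemma has_sum_int_2:
  fixes f :: "int \<times> 2 \<Rightarrow> 'a :: topological_comm_monoid_add"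
  assumes "((\<lambda>k. f (k, 1)) has_sum a) UNIV" "((\<lambda>k. f (k, 2)) has_sum b) UNIV"
  shows "(f has_sum (a + b)) UNIV"
proof -
  have r: "(f has_sum s) (range (\<lambda>k. (k, c)))" if "((\<lambda>k. f (k, c)) has_sum s) UNIV" for c s
    using that by (subst has_sum_reindex) (auto simp: o_def inj_on_def)
  have "(f has_sum (a + b)) (range (\<lambda>k. (k, 1)) \<union> range (\<lambda>k. (k, 2)))"
    by (intro has_sum_Un_disjoint r assms) auto
  also have "range (\<lambda>k. (k, 1)) \<union> range (\<lambda>k. (k, 2)) = (UNIV :: (int \<times> 2) set)"
    using two_cases by auto
  finally show ?thesis .
qed

lemma L2_iff: "f \<in> L2 \<longleftrightarrow> (\<forall>c. Ls (\<lambda>z. f z $ c))"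
proof
  assume f: "f \<in> L2"
  show "\<forall>c. Ls (\<lambda>z. f z $ c)"
  proof
    fix c
    show "Ls (\<lambda>z. f z $ c)"
    proof (rule Ls_bounded_by[of _ "\<lambda>z. (norm (f z))\<^sup>2"])
      have "f \<in> borel_measurable circle" using f by (simp add: L2_def)
      thus "(\<lambda>z. f z $ c) \<in> borel_measurable circle"
        by (rule measurable_compose) (intro borel_measurable_continuous_onI continuous_intros)
      show "integrable circle (\<lambda>z. (norm (f z))\<^sup>2)" using f by (simp add: L2_def)
      show "(cmod (f z $ c))\<^sup>2 \<le> (norm (f z))\<^sup>2" for z
        by (intro power_mono Finite_Cartesian_Product.norm_nth_le norm_ge_zero)
    qed
  qed
next
  assume f: "\<forall>c. Ls (\<lambda>z. f z $ c)"
  have "(\<lambda>z. \<Sum>c\<in>UNIV. axis c (f z $ c)) \<in> borel_measurable circle"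
  proof (rule borel_measurable_sum)
    fix c :: 2
    have "(\<lambda>z. f z $ c) \<in> borel_measurable circle" using f by (auto simp: Ls_def)
    moreover have "continuous_on UNIV (\<lambda>x. if i = c then x else (0 :: complex))" for i :: 2
      by (cases "i = c") auto
    hence "continuous_on UNIV (axis c :: complex \<Rightarrow> complex^2)"
      unfolding axis_def[abs_def] by (intro continuous_on_vec_lambda)
    ultimately show "(\<lambda>z. axis c (f z $ c)) \<in> borel_measurable circle"
      by (rule measurable_compose[OF _ borel_measurable_continuous_onI])
  qed
  also have "(\<lambda>z. \<Sum>c\<in>UNIV. axis c (f z $ c)) = f"
    by (auto simp: fun_eq_iff vec_eq_iff axis_def if_distrib cong: if_cong)
  finally have m: "f \<in> borel_measurable circle" .
  have "(\<lambda>z. (norm (f z))\<^sup>2) = (\<lambda>z. \<Sum>c\<in>UNIV. (cmod (f z $ c))\<^sup>2)"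
    by (auto simp: norm_vec_def L2_set_def sum_nonneg)
  moreover have "integrable circle \<dots>" using f by (auto simp: Ls_def)
  ultimately show "f \<in> L2" using m by (simp add: L2_def)
qed

lemma L2_add [intro]: "f \<in> L2 \<Longrightarrow> g \<in> L2 \<Longrightarrow> (\<lambda>z. f z + g z) \<in> L2"
  and L2_diff [intro]: "f \<in> L2 \<Longrightarrow> g \<in> L2 \<Longrightarrow> (\<lambda>z. f z - g z) \<in> L2"
  and L2_scale [intro]: "f \<in> L2 \<Longrightarrow> (\<lambda>z. t *s f z) \<in> L2"
  by (auto simp: L2_iff)

lemma L2_zero [simp]: "(\<lambda>z. 0) \<in> L2"
  using Ls_continuous[of "\<lambda>_. 0"] by (simp add: L2_iff)

lemma L2_sum [intro]: "(\<And>i. i \<in> A \<Longrightarrow> f i \<in> L2) \<Longrightarrow> (\<lambda>z. \<Sum>i\<in>A. f i z) \<in> L2"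
  by (induction A rule: infinite_finite_induct) auto

lemma L2_continuous: "(\<And>c. continuous_on (sphere 0 1) (\<lambda>z. f z $ c)) \<Longrightarrow> f \<in> L2"
  by (auto simp: L2_iff intro: Ls_continuous)

lemma bas_L2 [simp]: "bas b \<in> L2"
proof (rule L2_continuous)
  fix d
  obtain k c where b: "b = (k, c)" by (cases b)
  show "continuous_on (sphere 0 1) (\<lambda>z. bas b z $ d)"
    by (cases "c = d") (auto simp: bas_def b axis_def intro!: continuous_on_circle_powi)
qed

lemma L2_mult:
  assumes "\<And>i j. continuous_on (sphere 0 1) (\<lambda>z. g z $ i $ j)" "f \<in> L2"
  shows "(\<lambda>z. g z *v f z) \<in> L2"
  using assms unfolding L2_iff matrix_vector_mult_def
  by (auto simp: UNIV_2 intro!: Ls_add Ls_mult_continuous)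

lemma co_l2:
  assumes "f \<in> L2"
  shows "l2 (co f)"
proof -
  have s: "((\<lambda>k. (cmod (co f (k, c)))\<^sup>2) has_sum (\<Sum>\<^sub>\<infinity>k. (cmod (co f (k, c)))\<^sup>2)) UNIV" for c
    using assms fc_l2 by (intro has_sum_infsum) (auto simp: co_def L2_iff l2_def)
  show ?thesis unfolding l2_def using has_sum_int_2[OF s s] by (rule has_sum_imp_summable)
qed

lemma L2_inner_eq_ip:
  assumes f: "f \<in> L2" and g: "g \<in> L2"
  shows "L2_inner f g = ip (co f) (co g)"
proof -
  have Lf: "Ls (\<lambda>z. f z $ c)" and Lg: "Ls (\<lambda>z. g z $ c)" for c using f g by (auto simp: L2_iff)
  have "L2_inner f g = (\<Sum>c\<in>UNIV. si (\<lambda>z. f z $ c) (\<lambda>z. g z $ c))"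
    unfolding L2_inner_def si_def using si_integrable[OF Lf Lg]
    by (intro Bochner_Integration.integral_sum)
  also have "\<dots> = ip (\<lambda>k. co f (k, 1)) (\<lambda>k. co g (k, 1)) + ip (\<lambda>k. co f (k, 2)) (\<lambda>k. co g (k, 2))"
    by (simp add: UNIV_2 Parseval[OF Lf Lg] co_def)
  also have "\<dots> = ip (co f) (co g)"
  proof -
    have s: "((\<lambda>k. cnj (co f (k, c)) * co g (k, c)) has_sum ip (\<lambda>k. co f (k, c)) (\<lambda>k. co g (k, c))) UNIV" for c
      unfolding ip_def using fc_l2[OF Lf] fc_l2[OF Lg] by (intro has_sum_infsum ip_summable) (auto simp: co_def)
    show ?thesis using infsumI[OF has_sum_int_2[OF s s]] by (simp add: ip_def)
  qed
  finally show ?thesis .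
qed

lemma L2_norm_eq_nrm:
  assumes f: "f \<in> L2"
  shows "L2_norm f = nrm (co f)"
proof -
  have "L2_inner f f = (\<integral>z. complex_of_real ((norm (f z))\<^sup>2) \<partial>circle)"
    unfolding L2_inner_def
  proof (intro Bochner_Integration.integral_cong refl)
    fix z
    have "(norm (f z))\<^sup>2 = (\<Sum>c\<in>UNIV. (cmod (f z $ c))\<^sup>2)"
      by (auto simp: norm_vec_def L2_set_def sum_nonneg)
    thus "(\<Sum>i\<in>UNIV. cnj (f z $ i) * f z $ i) = complex_of_real ((norm (f z))\<^sup>2)"
      by (simp add: complex_norm_square mult.commute del: of_real_power)
  qed
  hence "complex_of_real ((nrm (co f))\<^sup>2) = of_real (\<integral>z. (norm (f z))\<^sup>2 \<partial>circle)"
    using L2_inner_eq_ip[OF f f] co_l2[OF f] by (simp add: ip_self del: of_real_power)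
  hence "(nrm (co f))\<^sup>2 = (\<integral>z. (norm (f z))\<^sup>2 \<partial>circle)" using of_real_eq_iff by blast
  thus ?thesis unfolding L2_norm_def by (intro real_sqrt_unique) auto
qed

lemma co_surj:
  assumes "l2 F"
  obtains f where "f \<in> L2" "co f = F"
proof -
  have "\<exists>h. Ls h \<and> fc h = (\<lambda>k. F (k, c))" for c
  proof -
    have "l2 (\<lambda>k. F (k, c))"
      using summable_on_reindex[of "\<lambda>k. (k, c)" UNIV "\<lambda>b. (cmod (F b))\<^sup>2"] assms
      by (auto simp: l2_def o_def inj_on_def intro: summable_on_subset)
    thus ?thesis by (rule Riesz_Fischer_fc) blast
  qed
  then obtain h where h: "\<And>c. Ls (h c)" "\<And>c. fc (h c) = (\<lambda>k. F (k, c))" by metis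
  show thesis
    by (rule that[of "\<lambda>z. \<chi> c. h c z"]) (auto simp: L2_iff co_def h fun_eq_iff)
qed

lemma co_add: "f \<in> L2 \<Longrightarrow> g \<in> L2 \<Longrightarrow> co (\<lambda>z. f z + g z) = (\<lambda>b. co f b + co g b)"
  by (auto simp: co_def fun_eq_iff L2_iff fc_eq_si intro!: si_add_right Ls_powi)

lemma co_diff: "f \<in> L2 \<Longrightarrow> g \<in> L2 \<Longrightarrow> co (\<lambda>z. f z - g z) = (\<lambda>b. co f b - co g b)"
  by (auto simp: co_def fun_eq_iff L2_iff fc_eq_si intro!: si_diff_right Ls_powi)

lemma co_scale: "co (\<lambda>z. t *s f z) = (\<lambda>b. t * co f b)"
  by (auto simp: co_def fun_eq_iff fc_eq_si si_scale_right)

lemma co_zero: "co (\<lambda>z. 0) = (\<lambda>b. 0)"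
  by (auto simp: co_def fc_def)

lemma co_sum: "(\<And>i. i \<in> A \<Longrightarrow> f i \<in> L2) \<Longrightarrow> co (\<lambda>z. \<Sum>i\<in>A. f i z) = (\<lambda>b. \<Sum>i\<in>A. co (f i) b)"
  by (induction A rule: infinite_finite_induct) (auto simp: co_zero co_add L2_sum)

lemma co_bas: "co (bas b) = un b"
proof -
  obtain k c where b: "b = (k, c)" by (cases b)
  have "co (bas b) (l, d) = un b (l, d)" for l d
  proof -
    have "co (bas b) (l, d) = fc (trig (if c = d then {k} else {}) (\<lambda>_. 1)) l"
      unfolding co_def bas_def b by (simp add: axis_def trig_def[abs_def])
    thus ?thesis by (auto simp: fc_trig un_def b)
  qed
  thus ?thesis by auto
qed

lemma co_eq_inner: "f \<in> L2 \<Longrightarrow> co f b = L2_inner (bas b) f"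
  by (simp add: L2_inner_eq_ip co_bas)

lemma adj_inner: "(\<Sum>i\<in>UNIV. cnj (x $ i) * (M *v y) $ i) = (\<Sum>i\<in>UNIV. cnj ((adj M *v x) $ i) * y $ i)"
  by (simp add: matrix_vector_mult_def adj_def UNIV_2 algebra_simps)

lemma adj_adj [simp]: "adj (adj M) = M"
  by (simp add: adj_def vec_eq_iff)

lemma adj_mult: "adj (M ** N) = adj N ** adj M"
  by (simp add: adj_def vec_eq_iff matrix_matrix_mult_def mult.commute)

lemma L2_inner_adj: "L2_inner f (\<lambda>z. g z *v h z) = L2_inner (\<lambda>z. adj (g z) *v f z) h"
  unfolding L2_inner_def adj_inner ..

lemma loop_continuous: "loop g \<Longrightarrow> continuous_on (sphere 0 1) (\<lambda>z. g z $ i $ j)"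
  by (simp add: loop_def)

lemma loop_adj_right: "loop g \<Longrightarrow> z \<in> sphere 0 1 \<Longrightarrow> g z ** adj (g z) = mat 1"
  using matrix_left_right_inverse[of "adj (g z)" "g z"] by (simp add: loop_def)

lemma loop_adj: "loop g \<Longrightarrow> loop (\<lambda>z. adj (g z))"
  using loop_adj_right unfolding loop_def by (auto simp: adj_def intro!: continuous_intros)

lemma loop_mult:
  assumes g: "loop g" and h: "loop h"
  shows "loop (\<lambda>z. g z ** h z)"
proof -
  have "adj (g z ** h z) ** (g z ** h z) = mat 1" if "z \<in> sphere 0 1" for z
  proof -
    have "adj (g z ** h z) ** (g z ** h z) = adj (h z) ** (adj (g z) ** g z) ** h z"
      by (simp add: adj_mult matrix_mul_assoc)
    thus ?thesis using g h that by (simp add: loop_def)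
  qed
  moreover have "continuous_on (sphere 0 1) (\<lambda>z. (g z ** h z) $ i $ j)" for i j
    by (simp add: matrix_matrix_mult_def UNIV_2) (intro continuous_intros loop_continuous g h)
  ultimately show ?thesis unfolding loop_def by blast
qed

lemma loop_L2 [intro]: "loop g \<Longrightarrow> f \<in> L2 \<Longrightarrow> (\<lambda>z. g z *v f z) \<in> L2"
  by (intro L2_mult loop_continuous)

lemma loop_adj_L2 [intro]: "loop g \<Longrightarrow> f \<in> L2 \<Longrightarrow> (\<lambda>z. adj (g z) *v f z) \<in> L2"
  by (intro loop_L2 loop_adj)

lemma loop_isometry:
  assumes g: "loop g"
  shows "L2_inner (\<lambda>z. g z *v f z) (\<lambda>z. g z *v h z) = L2_inner f h"
proof -
  have "L2_inner (\<lambda>z. g z *v f z) (\<lambda>z. g z *v h z) = L2_inner (\<lambda>z. adj (g z) *v (g z *v f z)) h"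
    by (rule L2_inner_adj)
  also have "\<dots> = L2_inner f h"
    unfolding L2_inner_def using g
    by (intro Bochner_Integration.integral_cong refl) (simp add: matrix_vector_mul_assoc loop_def)
  finally show ?thesis .
qed

section \<open>The determinant of a unitary loop\<close>

definition vonb :: "('i \<Rightarrow> vfun) \<Rightarrow> 'i set \<Rightarrow> bool" where
  "vonb v I \<longleftrightarrow> (\<forall>i\<in>I. v i \<in> L2) \<and> (\<forall>i\<in>I. \<forall>j\<in>I. L2_inner (v i) (v j) = of_bool (i = j))"

text \<open>For \<open>f\<close> in the Hardy space these are the Fourier coefficients of A(g)^* f.
  The values are families, so that \<open>ldet\<close> applies.\<close>

definition Tmap :: "mfun \<Rightarrow> vfun \<Rightarrow> int \<times> 2 \<Rightarrow> complex" where
  "Tmap g f = res KP (co (\<lambda>z. adj (g z) *v f z))"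

definition vdet :: "mfun \<Rightarrow> ('i \<Rightarrow> vfun) \<Rightarrow> 'i set \<Rightarrow> real" where
  "vdet g v I = ldet (\<lambda>i. Tmap g (v i)) I"

definition tdet :: "mfun \<Rightarrow> real" where
  "tdet g = vdet g bas KP"

lemma vonb_L2: "vonb v I \<Longrightarrow> i \<in> I \<Longrightarrow> v i \<in> L2" by (simp add: vonb_def)

lemma vonb_bas: "vonb bas I"
  by (simp add: vonb_def L2_inner_eq_ip co_bas un_apply)

lemma orthonormal_loop:
  assumes g: "loop g" and v: "vonb v I"
  shows "orthonormal (\<lambda>i. co (\<lambda>z. adj (g z) *v v i z)) I"
  unfolding orthonormal_def
  using v loop_adj_L2[OF g] by (auto simp: vonb_def co_l2 L2_inner_eq_ip[symmetric] loop_isometry[OF loop_adj[OF g]])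

lemma contr_Tmap: "loop g \<Longrightarrow> vonb v I \<Longrightarrow> contr (\<lambda>i. Tmap g (v i)) I"
  unfolding Tmap_def by (intro contr_res orthonormal_loop)

lemma tdet_le_1: "loop g \<Longrightarrow> tdet g \<le> 1"
  unfolding vdet_def tdet_def by (intro ldet_le_1 contr_Tmap vonb_bas)

text \<open>Equal Parseval sums mean equal projections, and this persists after applying the adjoint
  of the loop: a test vector \<open>f\<close> for the images is the test vector \<open>g f\<close>
  for the families themselves.\<close>

lemma vdet_basis_change:
  assumes g: "loop g" and v: "vonb v I" and w: "vonb w J"
    and eq: "\<And>f. f \<in> L2 \<Longrightarrow> (\<Sum>\<^sub>\<infinity>i\<in>I. (cmod (L2_inner (v i) f))\<^sup>2) = (\<Sum>\<^sub>\<infinity>j\<in>J. (cmod (L2_inner (w j) f))\<^sup>2)"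
  shows "vdet g v I = vdet g w J"
  unfolding vdet_def Tmap_def
proof (rule ldet_basis_change[OF orthonormal_loop[OF g v] orthonormal_loop[OF g w]])
  fix F :: "int \<times> 2 \<Rightarrow> complex" assume "l2 F"
  then obtain f where f: "f \<in> L2" "co f = F" by (rule co_surj)
  have gf: "(\<lambda>z. g z *v f z) \<in> L2" using g f by auto
  have e: "ip (co (\<lambda>z. adj (g z) *v u z)) F = L2_inner u (\<lambda>z. g z *v f z)" if "u \<in> L2" for u
    unfolding f(2)[symmetric] L2_inner_eq_ip[OF loop_adj_L2[OF g that] f(1), symmetric] by (rule L2_inner_adj[symmetric])
  have "(\<Sum>\<^sub>\<infinity>i\<in>I. (cmod (ip (co (\<lambda>z. adj (g z) *v v i z)) F))\<^sup>2) = (\<Sum>\<^sub>\<infinity>i\<in>I. (cmod (L2_inner (v i) (\<lambda>z. g z *v f z)))\<^sup>2)"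
    by (intro infsum_cong) (simp add: e vonb_L2[OF v])
  also have "\<dots> = (\<Sum>\<^sub>\<infinity>j\<in>J. (cmod (L2_inner (w j) (\<lambda>z. g z *v f z)))\<^sup>2)" by (rule eq[OF gf])
  also have "\<dots> = (\<Sum>\<^sub>\<infinity>j\<in>J. (cmod (ip (co (\<lambda>z. adj (g z) *v w j z)) F))\<^sup>2)"
    by (intro infsum_cong) (simp add: e vonb_L2[OF w])
  finally show "(\<Sum>\<^sub>\<infinity>i\<in>I. (cmod (ip (co (\<lambda>z. adj (g z) *v v i z)) F))\<^sup>2) =
     (\<Sum>\<^sub>\<infinity>j\<in>J. (cmod (ip (co (\<lambda>z. adj (g z) *v w j z)) F))\<^sup>2)" .
qed

text \<open>The matrix in \<open>ldet_res_dual\<close> is 1 minus the Gram matrix of the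
  nonnegative-frequency parts of g e_b, b outside \<open>KP\<close>. As g is isometric, this is the
  Gram matrix of their negative-frequency parts.\<close>

lemma tdet_eq_dual:
  assumes g: "loop g"
  shows "tdet g = ldet (\<lambda>b. res (- KP) (co (\<lambda>z. g z *v bas b z))) (- KP)"
proof -
  have gb: "(\<lambda>z. g z *v bas b z) \<in> L2" for b using g by auto
  have l: "l2 (co (\<lambda>z. g z *v bas b z))" for b by (rule co_l2[OF gb])
  have e: "co (\<lambda>z. adj (g z) *v bas i z) b = cnj (co (\<lambda>z. g z *v bas b z) i)" for i b
  proof -
    have "co (\<lambda>z. adj (g z) *v bas i z) b = L2_inner (bas b) (\<lambda>z. adj (g z) *v bas i z)"
      using g by (intro co_eq_inner loop_adj_L2) auto
    also have "\<dots> = ip (co (\<lambda>z. g z *v bas b z)) (co (bas i))"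
      using L2_inner_adj[of "bas b" "\<lambda>z. adj (g z)" "bas i"] by (simp add: L2_inner_eq_ip[OF gb])
    finally show ?thesis by (simp add: co_bas)
  qed
  have "tdet g = idet (\<lambda>b c. of_bool (b = c) - kern (\<lambda>i. co (\<lambda>z. adj (g z) *v bas i z)) KP b c) (- KP)"
    unfolding tdet_def vdet_def Tmap_def by (rule ldet_res_dual[OF orthonormal_loop[OF g vonb_bas]])
  also have "\<dots> = idet (gram (\<lambda>b. res (- KP) (co (\<lambda>z. g z *v bas b z)))) (- KP)"
  proof (rule idet_cong)
    fix b c
    have "ip (co (\<lambda>z. g z *v bas b z)) (co (\<lambda>z. g z *v bas c z)) = of_bool (b = c)"
      by (simp add: L2_inner_eq_ip[OF gb gb, symmetric] loop_isometry[OF g]) (simp add: L2_inner_eq_ip co_bas un_apply)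
    thus "of_bool (b = c) - kern (\<lambda>i. co (\<lambda>z. adj (g z) *v bas i z)) KP b c =
        gram (\<lambda>b. res (- KP) (co (\<lambda>z. g z *v bas b z))) b c"
      by (simp add: gram_def res_ip_compl[OF l l] kern_def e)
  qed
  finally show ?thesis by (simp add: ldet_def)
qed

text \<open>Reflection \<open>z \<mapsto> z\<^sup>-\<^sup>1\<close> interchanges the two Hardy spaces.\<close>
lemma tdet_flip:
  assumes g: "loop g" and h: "loop h" and gh: "\<And>z. z \<in> sphere 0 1 \<Longrightarrow> h z = adj (g (inverse z))"
  shows "tdet h = tdet g"
proof -
  \<comment> \<open>The shift by one makes the reflection exchange the indices k \<ge> 0 with k < 0,
    with nothing left over at 0.\<close>
  define \<sigma> :: "int \<times> 2 \<Rightarrow> int \<times> 2" where "\<sigma> = (\<lambda>(k, c). (- k - 1, c))"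
  have \<sigma>2: "\<sigma> (\<sigma> b) = b" for b by (simp add: \<sigma>_def split: prod.splits)
  have bij: "bij \<sigma>" using \<sigma>2 by (metis bijI')
  have KP: "\<sigma> b \<in> - KP \<longleftrightarrow> b \<in> KP" "\<sigma> b \<in> KP \<longleftrightarrow> b \<in> - KP" for b by (auto simp: \<sigma>_def KP_def split: prod.splits)
  have bijK: "bij_betw \<sigma> KP (- KP)"
    by (rule bij_betw_byWitness[where f'=\<sigma>]) (auto simp: \<sigma>2 KP simp del: Compl_iff)
  let ?y = "\<lambda>b. res (- KP) (co (\<lambda>z. g z *v bas b z))"
  have e: "Tmap h (bas b) i = ?y (\<sigma> b) (\<sigma> i)" for b i
  proof -
    obtain k c l d where b: "b = (k, c)" "i = (l, d)" by (cases b, cases i)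
    have comp: "(M *v axis c t) $ d = M $ d $ c * t" for M :: "complex^2^2" and t
      by (simp add: matrix_vector_mult_def axis_def if_distrib cong: if_cong)
    have c: "continuous_on (sphere 0 1) (\<lambda>z. z powi (l - k) * g z $ d $ c)"
      using g by (intro continuous_intros loop_continuous)
    have "co (\<lambda>z. adj (h z) *v bas b z) i = (\<integral>z. z powi (- l) * (g (inverse z) $ d $ c * z powi k) \<partial>circle)"
      unfolding co_def fc_def b bas_def prod.case
      by (intro Bochner_Integration.integral_cong refl) (simp add: gh comp)
    also have "\<dots> = (\<integral>z. inverse z powi (l - k) * g (inverse z) $ d $ c \<partial>circle)"
    proof (intro Bochner_Integration.integral_cong refl)
      fix z :: complex assume "z \<in> space circle"
      hence "z \<noteq> 0" by auto
      thus "z powi (- l) * (g (inverse z) $ d $ c * z powi k) = inverse z powi (l - k) * g (inverse z) $ d $ c"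
        using power_int_add[of z "- l" k] by (simp add: power_int_inverse power_int_minus[symmetric])
    qed
    also have "\<dots> = (\<integral>z. z powi (l - k) * g z $ d $ c \<partial>circle)"
      by (rule integral_circle_inverse[OF c])
    also have "\<dots> = (\<integral>z. z powi (- (- l - 1)) * (g z $ d $ c * z powi (- k - 1)) \<partial>circle)"
    proof (intro Bochner_Integration.integral_cong refl)
      fix z :: complex assume "z \<in> space circle"
      hence "z \<noteq> 0" by auto
      thus "z powi (l - k) * g z $ d $ c = z powi (- (- l - 1)) * (g z $ d $ c * z powi (- k - 1))"
        using power_int_add[of z "- (- l - 1)" "- k - 1"] by simp
    qed
    also have "\<dots> = co (\<lambda>z. g z *v bas (\<sigma> b) z) (\<sigma> i)"
      unfolding co_def fc_def b bas_def prod.case \<sigma>_def comp ..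
    finally show ?thesis using KP(1)[of i] unfolding Tmap_def res_def by simp
  qed
  have "ip (Tmap h (bas b)) (Tmap h (bas c)) = ip (?y (\<sigma> b)) (?y (\<sigma> c))" for b c
    unfolding ip_def e by (rule infsum_reindex_bij_betw[OF bij])
  hence "tdet h = ldet (\<lambda>b. ?y (\<sigma> b)) KP"
    unfolding tdet_def vdet_def ldet_def by (intro idet_cong) (simp add: gram_def)
  also have "\<dots> = tdet g"
    unfolding tdet_eq_dual[OF g] by (rule ldet_reindex[OF bijK, symmetric])
  finally show ?thesis .
qed

lemma Tmap_l2: "loop g \<Longrightarrow> f \<in> L2 \<Longrightarrow> l2 (Tmap g f)"
  unfolding Tmap_def by (intro l2_res co_l2) auto

lemma Tmap_add: "loop g \<Longrightarrow> f \<in> L2 \<Longrightarrow> h \<in> L2 \<Longrightarrow> Tmap g (\<lambda>z. f z + h z) = (\<lambda>k. Tmap g f k + Tmap g h k)"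
  unfolding Tmap_def res_def by (auto simp: matrix_vector_right_distrib co_add loop_adj_L2 fun_eq_iff)

lemma Tmap_diff: "loop g \<Longrightarrow> f \<in> L2 \<Longrightarrow> h \<in> L2 \<Longrightarrow> Tmap g (\<lambda>z. f z - h z) = (\<lambda>k. Tmap g f k - Tmap g h k)"
  unfolding Tmap_def res_def by (auto simp: matrix_vector_mult_diff_distrib co_diff loop_adj_L2 fun_eq_iff)

lemma Tmap_scale: "Tmap g (\<lambda>z. t *s f z) = (\<lambda>k. t * Tmap g f k)"
proof -
  have "adj (g z) *v (t *s f z) = t *s (adj (g z) *v f z)" for z
    by (simp add: vec_eq_iff matrix_vector_mult_def UNIV_2 algebra_simps)
  thus ?thesis unfolding Tmap_def res_def by (auto simp: co_scale fun_eq_iff)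
qed

lemma nrm_Tmap_le:
  assumes "loop g" "f \<in> L2"
  shows "nrm (Tmap g f) \<le> nrm (co f)"
proof -
  have L: "(\<lambda>z. adj (g z) *v f z) \<in> L2" using assms by auto
  have "complex_of_real ((nrm (co (\<lambda>z. adj (g z) *v f z)))\<^sup>2) = of_real ((nrm (co f))\<^sup>2)"
    using loop_isometry[OF loop_adj[OF assms(1)], of f f] assms(2)
    by (simp add: L2_inner_eq_ip L ip_self co_l2 del: of_real_power)
  hence "(nrm (co (\<lambda>z. adj (g z) *v f z)))\<^sup>2 = (nrm (co f))\<^sup>2" by (simp only: of_real_eq_iff)
  hence "nrm (co (\<lambda>z. adj (g z) *v f z)) = nrm (co f)" by (rule power2_eq_imp_eq) simp_all
  thus ?thesis unfolding Tmap_def using nrm_res_le[OF co_l2[OF L], of KP] by simp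
qed

text \<open>Vectors whose image under \<open>Tmap g\<close> has distance \<open>0\<close> from the other members of the family, measured
  by the limiting Gram determinants.\<close>
definition null :: "mfun \<Rightarrow> ('i \<Rightarrow> vfun) \<Rightarrow> 'i set \<Rightarrow> 'i \<Rightarrow> vfun \<Rightarrow> bool" where
  "null g v I i f \<longleftrightarrow> f \<in> L2 \<and> sd (\<lambda>j. Tmap g (v j)) I i (Tmap g f) = 0"

context
  fixes g :: mfun and v :: "'i \<Rightarrow> vfun" and I and i :: 'i
  assumes g: "loop g" and v: "vonb v I"
begin

lemma contr_Tmap_others: "contr (\<lambda>j. Tmap g (v j)) (I - {i})"
  using contr_Tmap[OF g v] by (auto simp: contr_def)

lemma null_add: "null g v I i f \<Longrightarrow> null g v I i h \<Longrightarrow> null g v I i (\<lambda>z. f z + h z)"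
  unfolding null_def using sd_null_add[OF contr_Tmap_others] by (auto simp: Tmap_add[OF g] Tmap_l2[OF g])

lemma null_scale: "null g v I i f \<Longrightarrow> null g v I i (\<lambda>z. t *s f z)"
  unfolding null_def using sd_null_scale[OF contr_Tmap_others] by (auto simp: Tmap_scale Tmap_l2[OF g])

lemma null_diff: "null g v I i f \<Longrightarrow> null g v I i h \<Longrightarrow> null g v I i (\<lambda>z. f z - h z)"
  using null_add[of f "\<lambda>z. (-1) *s h z"] null_scale[of h "-1"] by simp

lemma null_zero: "null g v I i (\<lambda>z. 0)"
proof -
  have T: "Tmap g (\<lambda>z. 0) = (\<lambda>k. 0)" using Tmap_scale[of g 0 "\<lambda>z. 0"] by (simp add: fun_eq_iff)
  show ?thesis
    unfolding null_def T using sd_scale[OF contr_Tmap_others, of "\<lambda>_. 0" 0] by simp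
qed

lemma null_sum: "(\<And>j. j \<in> A \<Longrightarrow> null g v I i (f j)) \<Longrightarrow> null g v I i (\<lambda>z. \<Sum>j\<in>A. f j z)"
  by (induction A rule: infinite_finite_induct) (auto simp: null_zero null_add)

lemma null_member: "j \<in> I - {i} \<Longrightarrow> null g v I i (v j)"
  unfolding null_def using sd_member[OF contr_Tmap_others] vonb_L2[OF v] by auto

text \<open>A vector with image 0 has distance 0 from everything; this is how annihilated vectors
  enter.\<close>

lemma null_kernel:
  assumes "f \<in> L2" "\<And>b. b \<in> KP \<Longrightarrow> co (\<lambda>z. adj (g z) *v f z) b = 0"
  shows "null g v I i f"
proof -
  have "Tmap g f = Tmap g (\<lambda>z. 0)"
    using assms(2) by (auto simp: Tmap_def res_def fun_eq_iff co_zero)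
  thus ?thesis using null_zero assms(1) by (simp add: null_def)
qed

lemma null_limit:
  assumes f: "f \<in> L2" and h: "\<And>n. null g v I i (h n)"
    and lim: "(\<lambda>n::nat. nrm (co (\<lambda>z. f z - h n z))) \<longlonglongrightarrow> 0"
  shows "null g v I i f"
proof -
  have hL: "h n \<in> L2" for n using h by (simp add: null_def)
  have "sd (\<lambda>j. Tmap g (v j)) I i (Tmap g f) = 0"
  proof (rule sd_null_closed[OF contr_Tmap_others])
    show "l2 (Tmap g f)" "\<And>n. l2 (Tmap g (h n))" using f hL by (auto intro: Tmap_l2[OF g])
    show "\<And>n. sd (\<lambda>j. Tmap g (v j)) I i (Tmap g (h n)) = 0" using h by (simp add: null_def)
    show "(\<lambda>n. nrm (\<lambda>k. Tmap g f k - Tmap g (h n) k)) \<longlonglongrightarrow> 0"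
    proof (rule tendsto_sandwich[OF _ _ tendsto_const lim])
      show "\<forall>\<^sub>F n in sequentially. nrm (\<lambda>k. Tmap g f k - Tmap g (h n) k) \<le> nrm (co (\<lambda>z. f z - h n z))"
        using nrm_Tmap_le[OF g L2_diff[OF f hL]] by (simp add: Tmap_diff[OF g f hL])
    qed auto
  qed
  thus ?thesis using f by (simp add: null_def)
qed

text \<open>Orthonormality of the new family supplies the norm bound that keeps the determinants
  decreasing.\<close>

lemma vdet_exchange:
  assumes i: "i \<in> I" and w: "vonb (v(i := w)) I" and null: "null g v I i (\<lambda>z. w z - t *s v i z)"
  shows "vdet g (v(i := w)) I = (cmod t)\<^sup>2 * vdet g v I"
proof -
  have wL: "w \<in> L2" and viL: "v i \<in> L2" using vonb_L2[OF w i] vonb_L2[OF v i] by auto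
  have eq: "(\<lambda>j. Tmap g ((v(i := w)) j)) = (\<lambda>j. Tmap g (v j))(i := Tmap g w)" by auto
  have c: "contr ((\<lambda>j. Tmap g (v j))(i := Tmap g w)) I" using contr_Tmap[OF g w] unfolding eq .
  show ?thesis
    unfolding vdet_def eq
  proof (rule ldet_exchange[OF contr_Tmap[OF g v] i])
    show "l2 (Tmap g w)" "nrm (Tmap g w) \<le> 1" using contr_D[OF c i] by auto
    have tL: "(\<lambda>z. t *s v i z) \<in> L2" using viL by auto
    show "sd (\<lambda>j. Tmap g (v j)) I i (\<lambda>k. Tmap g w k - t * Tmap g (v i) k) = 0"
      using null by (simp add: null_def Tmap_diff[OF g wL tL] Tmap_scale)
  qed
qed

end

lemma Fourier_sq_convergence:
  assumes f: "f \<in> L2"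
  shows "(\<lambda>n. nrm (co (\<lambda>z. f z - (\<Sum>b\<in>sq n \<times> UNIV. co f b *s bas b z)))) \<longlonglongrightarrow> 0"
proof -
  let ?s = "\<lambda>n z. \<Sum>b\<in>sq n \<times> UNIV. co f b *s bas b z"
  have sL: "?s n \<in> L2" for n by (intro L2_sum L2_scale bas_L2)
  have cs: "co (?s n) = res (sq n \<times> UNIV) (co f)" for n
  proof
    fix a
    have "co (?s n) a = (\<Sum>b\<in>sq n \<times> UNIV. co f b * un b a)"
      by (subst co_sum) (auto simp: co_scale co_bas)
    also have "\<dots> = (\<Sum>b\<in>sq n \<times> UNIV. if a = b then co f b else 0)"
      by (intro sum.cong refl) (auto simp: un_apply)
    also have "\<dots> = res (sq n \<times> UNIV) (co f) a"
      by (simp add: sum.delta res_def)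
    finally show "co (?s n) a = res (sq n \<times> UNIV) (co f) a" .
  qed
  have sm: "(\<lambda>b. (cmod (co f b))\<^sup>2) summable_on UNIV" using co_l2[OF f] by (simp add: l2_def)
  have nr: "(nrm (co (\<lambda>z. f z - ?s n z)))\<^sup>2 = (\<Sum>\<^sub>\<infinity>b. (cmod (co f b))\<^sup>2) - (\<Sum>b\<in>sq n \<times> UNIV. (cmod (co f b))\<^sup>2)" for n
  proof -
    have "(nrm (co (\<lambda>z. f z - ?s n z)))\<^sup>2 = (\<Sum>\<^sub>\<infinity>b\<in>-(sq n \<times> UNIV). (cmod (co f b))\<^sup>2)"
      unfolding nrm_sq by (rule infsum_cong_neutral) (auto simp: co_diff[OF f sL] cs res_def)
    moreover have "(\<Sum>\<^sub>\<infinity>b\<in>(sq n \<times> UNIV) \<union> -(sq n \<times> UNIV). (cmod (co f b))\<^sup>2) =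
        (\<Sum>\<^sub>\<infinity>b\<in>sq n \<times> UNIV. (cmod (co f b))\<^sup>2) + (\<Sum>\<^sub>\<infinity>b\<in>-(sq n \<times> UNIV). (cmod (co f b))\<^sup>2)"
      by (rule infsum_Un_disjoint) (auto intro: summable_on_subset[OF sm])
    ultimately show ?thesis unfolding Compl_partition by simp
  qed
  have "filterlim (\<lambda>n. sq n \<times> (UNIV :: 2 set)) (finite_subsets_at_top UNIV) sequentially"
    unfolding filterlim_finite_subsets_at_top
  proof (intro allI impI)
    fix X :: "(int \<times> 2) set" assume X: "finite X \<and> X \<subseteq> UNIV"
    have "\<forall>\<^sub>F n in sequentially. finite (sq n) \<and> fst ` X \<subseteq> sq n \<and> sq n \<subseteq> UNIV"
      using filterlim_sq X unfolding filterlim_finite_subsets_at_top by (metis finite_imageI subset_UNIV)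
    thus "\<forall>\<^sub>F n in sequentially. finite (sq n \<times> (UNIV :: 2 set)) \<and> X \<subseteq> sq n \<times> UNIV \<and> sq n \<times> UNIV \<subseteq> UNIV"
      by eventually_elim (auto simp: image_subset_iff)
  qed
  hence "(\<lambda>n. \<Sum>b\<in>sq n \<times> UNIV. (cmod (co f b))\<^sup>2) \<longlonglongrightarrow> (\<Sum>\<^sub>\<infinity>b. (cmod (co f b))\<^sup>2)"
    by (rule filterlim_compose[OF infsum_tendsto[OF sm]])
  from tendsto_diff[OF tendsto_const this, of "\<Sum>\<^sub>\<infinity>b. (cmod (co f b))\<^sup>2"]
  have "(\<lambda>n. (nrm (co (\<lambda>z. f z - ?s n z)))\<^sup>2) \<longlonglongrightarrow> 0" by (simp add: nr)
  from tendsto_real_sqrt[OF this] show ?thesis by simp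
qed

text \<open>Null vectors form a closed subspace, so only the monomials occurring in \<open>f\<close>
  have to be examined.\<close>

lemma null_Fourier:
  assumes g: "loop g" and v: "vonb v I" and f: "f \<in> L2" and b: "\<And>b. co f b \<noteq> 0 \<Longrightarrow> null g v I i (bas b)"
  shows "null g v I i f"
proof (rule null_limit[OF g v f _ Fourier_sq_convergence[OF f]])
  fix n
  show "null g v I i (\<lambda>z. \<Sum>b\<in>sq n \<times> UNIV. co f b *s bas b z)"
  proof (rule null_sum[OF g v])
    fix a
    show "null g v I i (\<lambda>z. co f a *s bas a z)"
    proof (cases "co f a = 0")
      case True thus ?thesis using null_zero[OF g v] by simp
    qed (auto intro: null_scale[OF g v] b)
  qed
qed

section \<open>Rotation factors\<close>

lemma vec_mat2 [simp]:
  "mat2 a b c d $ 1 $ 1 = a" "mat2 a b c d $ 1 $ 2 = b" "mat2 a b c d $ 2 $ 1 = c" "mat2 a b c d $ 2 $ 2 = d"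
  by (simp_all add: mat2_def)

lemma mat2_mult_vec [simp]:
  "(mat2 a b c d *v v) $ 1 = a * v $ 1 + b * v $ 2" "(mat2 a b c d *v v) $ 2 = c * v $ 1 + d * v $ 2"
  by (simp_all add: matrix_vector_mult_def UNIV_2)

lemma adj_mat2: "adj (mat2 a b c d) = mat2 (cnj a) (cnj c) (cnj b) (cnj d)"
  by (simp add: vec_eq_iff forall_2 adj_def)

lemma adj_scaleR: "adj (r *\<^sub>R M) = r *\<^sub>R adj M"
  by (simp add: vec_eq_iff adj_def)

lemma scaleR_mult_vec [simp]: "((r *\<^sub>R M) *v v) $ c = of_real r * (M *v v) $ c" for M :: "complex^2^2"
  by (simp add: matrix_vector_mult_def UNIV_2 scaleR_conv_of_real[symmetric] algebra_simps)

lemma mat2_mult: "mat2 a b c d ** mat2 a' b' c' d' = mat2 (a*a' + b*c') (a*b' + b*d') (c*a' + d*c') (c*b' + d*d')"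
  by (simp add: vec_eq_iff forall_2 matrix_matrix_mult_def UNIV_2)

lemma mat_1_eq_mat2: "mat 1 = mat2 1 0 0 1"
  by (simp add: vec_eq_iff forall_2 mat_def)

lemma a_fac_pos: "a_fac e > 0"
proof -
  have "1 + (cmod e)\<^sup>2 \<noteq> 0" using zero_le_power2[of "cmod e"] by linarith
  thus ?thesis by (simp add: a_fac_def)
qed

lemma a_fac_sq: "(a_fac e)\<^sup>2 * (1 + (cmod e)\<^sup>2) = 1"
proof -
  have "1 + (cmod e)\<^sup>2 > 0" by (simp add: add_pos_nonneg)
  hence p: "1 + (cmod e)\<^sup>2 \<noteq> 0" by linarith
  have "(a_fac e)\<^sup>2 = (1 + (cmod e)\<^sup>2) powr (-1)"
    unfolding a_fac_def power2_eq_square powr_add[symmetric] by simp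
  also have "\<dots> = inverse (1 + (cmod e)\<^sup>2)"
    using \<open>1 + (cmod e)\<^sup>2 > 0\<close> by (simp add: powr_minus)
  finally show ?thesis using p by simp
qed

lemma a_fac_sq': "complex_of_real (a_fac e) * of_real (a_fac e) * (1 + e * cnj e) = 1"
  using arg_cong[OF a_fac_sq[of e], of complex_of_real]
  by (simp only: of_real_mult of_real_add complex_norm_square power2_eq_square[of "a_fac e"] of_real_1)

text \<open>One form for both kinds of factor: \<open>j\<close> is nonnegative for \<eta> and
  negative for \<zeta>.\<close>

definition rot :: "complex \<Rightarrow> int \<Rightarrow> mfun" where
  "rot e j z = a_fac e *\<^sub>R mat2 1 (e * z powi j) (- cnj e * z powi (- j)) 1"

lemma adj_rot:
  assumes "z \<in> sphere 0 1"
  shows "adj (rot e j z) = a_fac e *\<^sub>R mat2 1 (- e * z powi j) (cnj e * z powi (- j)) 1"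
  unfolding rot_def adj_scaleR adj_mat2 complex_cnj_mult complex_cnj_minus cnj_powi[OF assms] by simp

lemma loop_rot: "loop (rot e j)"
  unfolding loop_def
proof (intro conjI allI ballI)
  fix c d :: 2
  show "continuous_on (sphere 0 1) (\<lambda>z. rot e j z $ c $ d)"
    using two_cases[of c] two_cases[of d]
    by (elim disjE; simp add: rot_def del: mult_minus_left; intro continuous_intros)
next
  fix z :: complex assume z: "z \<in> sphere 0 1"
  hence "z \<noteq> 0" by auto
  hence zz: "z powi j * z powi (- j) = 1" by (simp add: power_int_minus)
  have sm: "(r *\<^sub>R M) ** (r *\<^sub>R N) = (r * r) *\<^sub>R (M ** N)" for r and M N :: "complex^2^2"
    by (simp add: vec_eq_iff matrix_matrix_mult_def UNIV_2 algebra_simps)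
  have z1: "e * z powi j * (cnj e * z powi (- j)) = e * cnj e" "z powi (- j) * z powi j = 1"
    using zz by (simp_all add: mult_ac)
  have "adj (rot e j z) ** rot e j z = (a_fac e * a_fac e) *\<^sub>R mat2 (1 + e * cnj e) 0 0 (1 + e * cnj e)"
    unfolding adj_rot[OF z] unfolding rot_def sm mat2_mult using z1
    by (intro arg_cong2[where f=scaleR] refl arg_cong2[where f="\<lambda>a d. mat2 a 0 0 d"]) (simp_all add: mat2_def mult_ac add.commute)
  also have "\<dots> = mat 1"
  proof -
    have "(a_fac e * a_fac e) *\<^sub>R (1 + e * cnj e) = 1"
      using a_fac_sq'[of e] by (simp add: scaleR_conv_of_real)
    thus ?thesis by (simp add: mat_1_eq_mat2 vec_eq_iff forall_2)
  qed
  finally show "adj (rot e j z) ** rot e j z = mat 1" .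
qed

lemma fc_shift: "fc (\<lambda>z. z powi p * f z) k = fc f (k - p)"
  unfolding fc_def
proof (intro Bochner_Integration.integral_cong refl)
  fix z :: complex assume "z \<in> space circle"
  hence "z \<noteq> 0" by auto
  thus "z powi - k * (z powi p * f z) = z powi - (k - p) * f z"
    using power_int_add[of z "- k" p] by (simp add: algebra_simps)
qed

lemma fc_cong: "(\<And>z. z \<in> sphere 0 1 \<Longrightarrow> f z = g z) \<Longrightarrow> fc f k = fc g k"
  unfolding fc_def by (intro Bochner_Integration.integral_cong refl) simp

lemma co_cong: "(\<And>z. z \<in> sphere 0 1 \<Longrightarrow> f z = g z) \<Longrightarrow> co f = co g"
  by (auto simp: co_def fun_eq_iff intro!: fc_cong)

lemma fc_add: "Ls f \<Longrightarrow> Ls g \<Longrightarrow> fc (\<lambda>z. f z + g z) k = fc f k + fc g k"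
  unfolding fc_eq_si by (intro si_add_right Ls_powi)

lemma fc_scale: "fc (\<lambda>z. c * f z) k = c * fc f k"
  unfolding fc_eq_si by (rule si_scale_right)

lemma fc_lincomb_shift:
  assumes "Ls f" "Ls g"
  shows "fc (\<lambda>z. r * (a * f z + b * z powi p * g z)) k = r * (a * fc f k + b * fc g (k - p))"
proof -
  have L: "Ls (\<lambda>z. b * (z powi p * g z))" by (intro Ls_scale Ls_mult_continuous assms continuous_intros)
  thus ?thesis
    using fc_add[OF Ls_scale[OF assms(1), of a] L, of k]
    by (simp add: fc_scale fc_shift mult.assoc)
qed

text \<open>For every p < 0 the product z^p w is annihilated by \<open>Tmap h\<close>, because h^* w
  has no positive frequencies. The support conditions make z^p e_2 its lowest term in the second
  component and push the first component beyond z^(p+j), so that z^p e_2 can be solved for in terms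
  of basis vectors of higher index.\<close>

definition annihilator :: "int \<Rightarrow> mfun \<Rightarrow> vfun \<Rightarrow> bool" where
  "annihilator j h w \<longleftrightarrow> w \<in> L2 \<and> (\<forall>k\<le>j. co w (k, 1) = 0) \<and> (\<forall>k<0. co w (k, 2) = 0) \<and> co w (0, 2) \<noteq> 0 \<and>
     (\<forall>k>0. \<forall>c. co (\<lambda>z. adj (h z) *v w z) (k, c) = 0)"

lemma co_shift: "co (\<lambda>z. z powi p *s f z) (k, c) = co f (k - p, c)"
  by (simp add: co_def fc_shift)

text \<open>Since the rotation is unitary, h^* w does not change. In the second component, the
  coefficients of index at most 0 receive nothing from the first, whose support lies beyond
  \<open>j\<close>, so the constant term is only scaled. The first component may now start at
  \<open>j\<close>, one step earlier, which fits the next factor.\<close>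

lemma annihilator_rot:
  assumes h: "loop h" and w: "annihilator j h w"
  shows "annihilator (j - 1) (\<lambda>z. rot e j z ** h z) (\<lambda>z. rot e j z *v w z)"
proof -
  let ?w = "\<lambda>z. rot e j z *v w z"
  have wL: "w \<in> L2" using w by (simp add: annihilator_def)
  have L: "Ls (\<lambda>z. w z $ c)" for c using wL by (simp add: L2_iff)
  have "co ?w (k, 1) = fc (\<lambda>z. a_fac e * (1 * w z $ 1 + e * z powi j * w z $ 2)) k" for k
    by (simp add: co_def rot_def)
  hence 1: "co ?w (k, 1) = a_fac e * (co w (k, 1) + e * co w (k - j, 2))" for k
    unfolding fc_lincomb_shift[OF L L] by (simp add: co_def)
  have "co ?w (k, 2) = fc (\<lambda>z. a_fac e * (1 * w z $ 2 + (- cnj e) * z powi (- j) * w z $ 1)) k" for k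
    by (simp add: co_def rot_def add.commute)
  hence 2: "co ?w (k, 2) = a_fac e * (co w (k, 2) - cnj e * co w (k + j, 1))" for k
    unfolding fc_lincomb_shift[OF L L] by (simp add: co_def)
  have 3: "co (\<lambda>z. adj (rot e j z ** h z) *v ?w z) = co (\<lambda>z. adj (h z) *v w z)"
  proof (rule co_cong)
    fix z :: complex assume z: "z \<in> sphere 0 1"
    have "adj (rot e j z ** h z) *v ?w z = adj (h z) *v ((adj (rot e j z) ** rot e j z) *v w z)"
      by (simp add: adj_mult matrix_vector_mul_assoc matrix_mul_assoc)
    also have "adj (rot e j z) ** rot e j z = mat 1" using loop_rot z by (simp add: loop_def)
    finally show "adj (rot e j z ** h z) *v ?w z = adj (h z) *v w z" by simp
  qed
  show ?thesis
    using w a_fac_pos[of e] loop_L2[OF loop_rot wL, of e j] unfolding annihilator_def 1 2 3 by auto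
qed

text \<open>Interpolates between the monomials (\<open>m = 0\<close>) and the basis rotated in the
  indices below \<open>j\<close> (\<open>m = j\<close>); consecutive families differ in one vector.
  For indices k with 0 \<le> k < j the added monomial has negative index k - j and lies outside the
  Hardy space.\<close>

definition part_rot :: "complex \<Rightarrow> nat \<Rightarrow> nat \<Rightarrow> int \<times> 2 \<Rightarrow> vfun" where
  "part_rot e j m b = (if snd b = 1 \<and> fst b < int m
     then (\<lambda>z. of_real (a_fac e) *s (bas b z + cnj e *s bas (fst b - int j, 2) z)) else bas b)"

lemma part_rot_L2: "part_rot e j m b \<in> L2"
  unfolding part_rot_def by (auto intro!: L2_scale L2_add)

lemma co_part_rot: "co (part_rot e j m b) = (if snd b = 1 \<and> fst b < int m
     then (\<lambda>k. of_real (a_fac e) * (un b k + cnj e * un (fst b - int j, 2) k)) else un b)"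
proof -
  have "co (\<lambda>z. of_real (a_fac e) *s (bas b z + cnj e *s bas (fst b - int j, 2) z)) =
     (\<lambda>k. of_real (a_fac e) * (un b k + cnj e * un (fst b - int j, 2) k))"
    unfolding co_scale by (subst co_add) (auto simp: co_scale co_bas)
  thus ?thesis by (auto simp: part_rot_def co_bas)
qed

lemma ip_part_rot: "l2 f \<Longrightarrow> ip (co (part_rot e j m b)) f = (if snd b = 1 \<and> fst b < int m
     then of_real (a_fac e) * (f b + e * f (fst b - int j, 2)) else f b)"
  by (auto simp: co_part_rot ip_scale_left ip_add_left)

text \<open>By \<open>m \<le> j\<close> the added monomials all have negative index and cannot meet
  the unrotated members; \<open>a_fac\<close> restores the norm.\<close>

lemma vonb_part_rot:
  assumes m: "m \<le> j"
  shows "vonb (part_rot e j m) KP"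
  unfolding vonb_def
proof (intro conjI ballI part_rot_L2)
  fix b c assume "b \<in> KP" "c \<in> KP"
  moreover obtain k i l n where bc: "b = (k, i)" "c = (l, n)" by (cases b, cases c)
  ultimately have kl: "0 \<le> k" "0 \<le> l" by (auto simp: KP_def)
  have n12: "(1::2) \<noteq> 2" by simp
  have "L2_inner (part_rot e j m b) (part_rot e j m c) = ip (co (part_rot e j m b)) (co (part_rot e j m c))"
    by (rule L2_inner_eq_ip[OF part_rot_L2 part_rot_L2])
  also have "\<dots> = of_bool (b = c)"
    unfolding ip_part_rot[OF co_l2[OF part_rot_L2]] using kl m n12 a_fac_sq'[of e]
    by (auto simp: co_part_rot bc un_apply algebra_simps)
  finally show "L2_inner (part_rot e j m b) (part_rot e j m c) = of_bool (b = c)" .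
qed

text \<open>In the pairs (m + j, 1), (m, 2) the rotation acts by unitary 2 x 2 blocks; the first sum
  collects the indices without a partner.\<close>

lemma infsum_KP_split:
  fixes \<phi> :: "int \<times> 2 \<Rightarrow> real"
  assumes s: "\<phi> summable_on KP"
  shows "infsum \<phi> KP = (\<Sum>k\<in>{0..<int j}. \<phi> (k, 1)) + (\<Sum>\<^sub>\<infinity>m\<in>{0..}. \<phi> (m + int j, 1) + \<phi> (m, 2))"
proof -
  let ?A = "{0..<int j} \<times> {1}" and ?f = "\<lambda>m. (m + int j, 1 :: 2)" and ?g = "\<lambda>m. (m, 2 :: 2)"
  let ?B = "?f ` {0..}" and ?C = "?g ` {0 :: int..}"
  have KP: "KP = ?A \<union> (?B \<union> ?C)"
  proof (intro equalityI subsetI)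
    fix b assume "b \<in> KP"
    moreover obtain k c where b: "b = (k, c)" by (cases b)
    ultimately have k: "0 \<le> k" by (simp add: KP_def)
    show "b \<in> ?A \<union> (?B \<union> ?C)"
    proof (cases "c = 1")
      case True
      show ?thesis
      proof (cases "k < int j")
        case False
        have "b = ?f (k - int j)" using True b by simp
        moreover have "k - int j \<in> {0..}" using False by simp
        ultimately show ?thesis by blast
      qed (use True k b in auto)
    next
      case False
      thus ?thesis using two_cases[of c] k b by auto
    qed
  qed (auto simp: KP_def)
  have sA: "\<phi> summable_on ?A" and sB: "\<phi> summable_on ?B" and sC: "\<phi> summable_on ?C"
    by (auto intro!: summable_on_subset[OF s] simp: KP)
  have "infsum \<phi> KP = infsum \<phi> ?A + infsum \<phi> (?B \<union> ?C)"
    unfolding KP by (rule infsum_Un_disjoint[OF sA summable_on_Un_disjoint[OF sB sC]]) auto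
  also have "infsum \<phi> (?B \<union> ?C) = infsum \<phi> ?B + infsum \<phi> ?C"
    by (rule infsum_Un_disjoint[OF sB sC]) auto
  also have "infsum \<phi> ?B = (\<Sum>\<^sub>\<infinity>m\<in>{0..}. \<phi> (m + int j, 1))"
    by (subst infsum_reindex) (auto simp: o_def inj_on_def)
  also have "infsum \<phi> ?C = (\<Sum>\<^sub>\<infinity>m\<in>{0..}. \<phi> (m, 2))"
    by (subst infsum_reindex) (auto simp: o_def inj_on_def)
  also have "(\<Sum>\<^sub>\<infinity>m\<in>{0..}. \<phi> (m + int j, 1)) + (\<Sum>\<^sub>\<infinity>m\<in>{0..}. \<phi> (m, 2)) = (\<Sum>\<^sub>\<infinity>m\<in>{0..}. \<phi> (m + int j, 1) + \<phi> (m, 2))"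
    using sB sC by (intro infsum_add[symmetric]) (auto simp: summable_on_reindex o_def inj_on_def)
  also have "infsum \<phi> ?A = (\<Sum>k\<in>{0..<int j}. \<phi> (k, 1))"
  proof -
    have A: "?A = (\<lambda>k. (k, 1)) ` {0..<int j}" by auto
    show ?thesis unfolding infsum_finite[OF finite_cartesian_product[OF finite_atLeastLessThan_int finite.insertI[OF finite.emptyI]]]
      unfolding A by (subst sum.reindex) (auto simp: inj_on_def)
  qed
  finally show ?thesis .
qed

lemma vonb_summable:
  assumes "vonb v I" "f \<in> L2"
  shows "(\<lambda>i. (cmod (L2_inner (v i) f))\<^sup>2) summable_on I"
proof -
  have o: "orthonormal (\<lambda>i. co (v i)) I"
    using assms by (auto simp: orthonormal_def vonb_def co_l2 L2_inner_eq_ip[symmetric])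
  have "(\<lambda>i. (cmod (ip (co (v i)) (co f)))\<^sup>2) summable_on I"
    by (rule Bessel_summable[OF o co_l2[OF assms(2)]])
  also have "?this \<longleftrightarrow> ?thesis"
    using assms by (intro summable_on_cong) (simp add: L2_inner_eq_ip vonb_L2)
  finally show ?thesis .
qed

lemma vonb_loop:
  assumes "loop g" "vonb v I"
  shows "vonb (\<lambda>i z. g z *v v i z) I"
  using assms loop_L2 by (auto simp: vonb_def loop_isometry)

text \<open>A left factor can be moved into the basis, where it acts by its adjoint.\<close>

lemma tdet_mult:
  assumes g: "loop g" and h: "loop h"
  shows "tdet (\<lambda>z. g z ** h z) = vdet h (\<lambda>b z. adj (g z) *v bas b z) KP"
proof -
  have "Tmap (\<lambda>z. g z ** h z) (bas b) = Tmap h (\<lambda>z. adj (g z) *v bas b z)" for b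
    by (simp add: Tmap_def adj_mult matrix_vector_mul_assoc)
  thus ?thesis by (simp add: tdet_def vdet_def)
qed

text \<open>The rotation \<open>rot e j\<close> mixes \<open>z\<^sup>m e\<^sub>1\<close> with \<open>z\<^sup>m\<^sup>-\<^sup>j e\<^sub>2\<close>; when both lie in the Hardy space it only changes
  the basis there.\<close>
lemma tdet_rot_eq_part_rot:
  assumes h: "loop h"
  shows "tdet (\<lambda>z. rot e (int j) z ** h z) = vdet h (part_rot e j j) KP"
  unfolding tdet_mult[OF loop_rot h]
proof (rule vdet_basis_change[OF h])
  let ?r = "\<lambda>b z. adj (rot e (int j) z) *v bas b z"
  show r: "vonb ?r KP" by (intro vonb_loop loop_adj loop_rot vonb_bas)
  show p: "vonb (part_rot e j j) KP" by (rule vonb_part_rot) simp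
  fix f assume f: "f \<in> L2"
  let ?F = "co f" and ?a = "complex_of_real (a_fac e)"
  have co_r: "L2_inner (?r b) f = co (\<lambda>z. rot e (int j) z *v f z) b" for b
    unfolding L2_inner_adj[symmetric] by (intro co_eq_inner[symmetric] loop_L2 loop_rot f)
  have L: "Ls (\<lambda>z. f z $ c)" for c using f by (simp add: L2_iff)
  have "L2_inner (?r (k, 1)) f = fc (\<lambda>z. ?a * (1 * f z $ 1 + e * z powi (int j) * f z $ 2)) k" for k
    by (simp add: co_r) (simp add: co_def rot_def)
  hence 1: "L2_inner (?r (k, 1)) f = ?a * (?F (k, 1) + e * ?F (k - int j, 2))" for k
    unfolding fc_lincomb_shift[OF L L] by (simp add: co_def)
  have "L2_inner (?r (k, 2)) f = fc (\<lambda>z. ?a * (1 * f z $ 2 + (- cnj e) * z powi (- int j) * f z $ 1)) k" for k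
    by (simp add: co_r) (simp add: co_def rot_def add.commute)
  hence 2: "L2_inner (?r (k, 2)) f = ?a * (?F (k, 2) - cnj e * ?F (k + int j, 1))" for k
    unfolding fc_lincomb_shift[OF L L] by (simp add: co_def)
  have 3: "L2_inner (part_rot e j j b) f = (if snd b = 1 \<and> fst b < int j
     then ?a * (?F b + e * ?F (fst b - int j, 2)) else ?F b)" for b
    by (simp add: L2_inner_eq_ip[OF part_rot_L2 f] ip_part_rot co_l2[OF f])
  \<comment> \<open>The block acting on a pair of coefficients is unitary, so rotated and unrotated
    pairs have the same Parseval contribution.\<close>
  have par: "(cmod (?a * (x + e * y)))\<^sup>2 + (cmod (?a * (y - cnj e * x)))\<^sup>2 = (cmod x)\<^sup>2 + (cmod y)\<^sup>2" for x y
  proof -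
    have "complex_of_real ((cmod (?a * (x + e * y)))\<^sup>2 + (cmod (?a * (y - cnj e * x)))\<^sup>2) =
        (?a * ?a * (1 + e * cnj e)) * (x * cnj x + y * cnj y)"
      unfolding of_real_add complex_norm_square by (simp add: algebra_simps)
    also have "\<dots> = complex_of_real ((cmod x)\<^sup>2 + (cmod y)\<^sup>2)"
      unfolding a_fac_sq' of_real_add complex_norm_square by simp
    finally show ?thesis by (simp only: of_real_eq_iff)
  qed
  show "(\<Sum>\<^sub>\<infinity>i\<in>KP. (cmod (L2_inner (?r i) f))\<^sup>2) = (\<Sum>\<^sub>\<infinity>i\<in>KP. (cmod (L2_inner (part_rot e j j i) f))\<^sup>2)"
    unfolding infsum_KP_split[OF vonb_summable[OF r f], of j] infsum_KP_split[OF vonb_summable[OF p f], of j]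
  proof (rule arg_cong2[where f="(+)"])
    show "(\<Sum>k = 0..<int j. (cmod (L2_inner (?r (k, 1)) f))\<^sup>2) = (\<Sum>k = 0..<int j. (cmod (L2_inner (part_rot e j j (k, 1)) f))\<^sup>2)"
      by (rule sum.cong) (simp_all add: 1 3)
    show "(\<Sum>\<^sub>\<infinity>m\<in>{0..}. (cmod (L2_inner (?r (m + int j, 1)) f))\<^sup>2 + (cmod (L2_inner (?r (m, 2)) f))\<^sup>2) =
        (\<Sum>\<^sub>\<infinity>m\<in>{0..}. (cmod (L2_inner (part_rot e j j (m + int j, 1)) f))\<^sup>2 + (cmod (L2_inner (part_rot e j j (m, 2)) f))\<^sup>2)"
    proof (rule infsum_cong)
      fix m :: int assume "m \<in> {0..}"
      thus "(cmod (L2_inner (?r (m + int j, 1)) f))\<^sup>2 + (cmod (L2_inner (?r (m, 2)) f))\<^sup>2 =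
          (cmod (L2_inner (part_rot e j j (m + int j, 1)) f))\<^sup>2 + (cmod (L2_inner (part_rot e j j (m, 2)) f))\<^sup>2"
        using par[of "?F (m + int j, 1)" "?F (m, 2)"] by (simp add: 1 2 3)
    qed
  qed
qed

text \<open>The vector in position (m, 1) is exchanged with t = \<open>a_fac e\<close>. The
  remainder is a multiple of z^(m-j) e_2, and it is null because the annihilated vector expresses it
  through monomials already known to be null.\<close>

lemma vdet_part_rot_Suc:
  assumes h: "loop h" and w: "annihilator (int j) h w" and m: "m < j"
  shows "vdet h (part_rot e j (Suc m)) KP = (a_fac e)\<^sup>2 * vdet h (part_rot e j m) KP"
proof -
  let ?v = "part_rot e j m" and ?i = "(int m, 1 :: 2)"
  let ?w = "\<lambda>z. of_real (a_fac e) *s (bas ?i z + cnj e *s bas (int m - int j, 2) z)"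
  have upd: "part_rot e j (Suc m) = ?v(?i := ?w)"
    by (auto simp: part_rot_def fun_eq_iff)
  have v: "vonb ?v KP" using m by (intro vonb_part_rot) simp
  have wL: "w \<in> L2" using w by (simp add: annihilator_def)
  have i: "?i \<in> KP" by (simp add: KP_def)
  have mem2: "null h ?v KP ?i (bas (k, 2))" if "0 \<le> k" for k
    using null_member[OF h v, of "(k, 2)" ?i] that by (simp add: part_rot_def KP_def)
  have mem1: "null h ?v KP ?i (bas (k, 1))" if "int m < k" for k
    using null_member[OF h v, of "(k, 1)" ?i] that by (simp add: part_rot_def KP_def)
  \<comment> \<open>All z^p e_2 with m - j \<le> p < 0 are null, by induction from p = -1 downwards;
    here p = -n - 1.\<close>
  have neg: "null h ?v KP ?i (bas (- int n - 1, 2))" if "int m - int j \<le> - int n - 1" for n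
    using that
  proof (induction n rule: less_induct)
    case (less n)
    define p where "p = - int n - 1"
    define W where "W z = z powi p *s w z" for z
    have W: "W \<in> L2" unfolding W_def using wL by (auto simp: L2_iff intro!: Ls_mult_continuous continuous_intros)
    have coW: "co W (k, c) = co w (k - p, c)" for k c unfolding W_def by (rule co_shift)
    have hW: "(\<lambda>z. adj (h z) *v W z) = (\<lambda>z. z powi p *s (adj (h z) *v w z))"
      by (simp add: W_def fun_eq_iff vec_eq_iff matrix_vector_mult_def UNIV_2 algebra_simps)
    have nW: "null h ?v KP ?i W"
    proof (rule null_kernel[OF h v W])
      fix b assume "b \<in> KP"
      thus "co (\<lambda>z. adj (h z) *v W z) b = 0"
        unfolding hW using w by (cases b) (auto simp: KP_def co_shift annihilator_def p_def)
    qed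
    let ?R = "\<lambda>z. W z - co w (0, 2) *s bas (p, 2) z"
    have R: "?R \<in> L2" using W by (intro L2_diff L2_scale) auto
    have coR: "co ?R b = co W b - co w (0, 2) * un (p, 2) b" for b
      using W by (subst co_diff) (auto simp: co_scale co_bas)
    \<comment> \<open>Apart from its leading term, z^p w involves in the second component only k >
      p, covered by members and by induction, and in the first only k > p + j \<ge> m, which are
      members not yet rotated.\<close>
    have nR: "null h ?v KP ?i ?R"
    proof (rule null_Fourier[OF h v R])
      fix b assume b: "co ?R b \<noteq> 0"
      obtain k c where bk: "b = (k, c)" by (cases b)
      show "null h ?v KP ?i (bas b)"
      proof (cases "c = 1")
        case True
        hence "co w (k - p, 1) \<noteq> 0" using b by (simp add: coR coW bk un_apply)
        hence "k - p > int j" using w by (auto simp: annihilator_def not_less[symmetric])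
        thus ?thesis using less.prems mem1[of k] True by (simp add: bk p_def)
      next
        case False
        hence c: "c = 2" using two_cases by blast
        have "k \<noteq> p" using b c by (auto simp: coR coW bk un_apply)
        moreover have "\<not> k < p" using b c w by (auto simp: coR coW bk un_apply annihilator_def)
        ultimately have kp: "k > p" by simp
        show ?thesis
        proof (cases "k \<ge> 0")
          case True thus ?thesis using mem2 c bk by simp
        next
          case False
          hence "nat (- k - 1) < n" "- int (nat (- k - 1)) - 1 = k" using kp by (auto simp: p_def)
          thus ?thesis using less.IH[of "nat (- k - 1)"] less.prems kp c bk by (simp add: p_def)
        qed
      qed
    qed
    \<comment> \<open>The leading coefficient is nonzero, so z^p e_2 can be isolated.\<close>
    have "null h ?v KP ?i (\<lambda>z. (1 / co w (0, 2)) *s (W z - ?R z))"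
      by (intro null_scale[OF h v] null_diff[OF h v] nW nR)
    also have "(\<lambda>z. (1 / co w (0, 2)) *s (W z - ?R z)) = bas (p, 2)"
      using w by (auto simp: fun_eq_iff vec_eq_iff annihilator_def)
    finally show ?case by (simp add: p_def)
  qed
  have "null h ?v KP ?i (\<lambda>z. (of_real (a_fac e) * cnj e) *s bas (int m - int j, 2) z)"
    using neg[of "j - m - 1"] m by (intro null_scale[OF h v]) (simp add: of_nat_diff)
  also have "(\<lambda>z. (of_real (a_fac e) * cnj e) *s bas (int m - int j, 2) z) = (\<lambda>z. ?w z - of_real (a_fac e) *s ?v ?i z)"
    by (simp add: part_rot_def fun_eq_iff vec_eq_iff algebra_simps)
  finally have nl: "null h ?v KP ?i (\<lambda>z. ?w z - of_real (a_fac e) *s ?v ?i z)" .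
  have "vonb (part_rot e j (Suc m)) KP" using m by (intro vonb_part_rot) simp
  from vdet_exchange[OF h v i this[unfolded upd] nl] show ?thesis by (simp add: upd)
qed

lemma tdet_rot:
  assumes h: "loop h" and w: "annihilator (int j) h w"
  shows "tdet (\<lambda>z. rot e (int j) z ** h z) = a_fac e ^ (2 * j) * tdet h"
proof -
  have "vdet h (part_rot e j m) KP = a_fac e ^ (2 * m) * vdet h (part_rot e j 0) KP" if "m \<le> j" for m
    using that by (induction m) (auto simp: vdet_part_rot_Suc[OF h w] power2_eq_square)
  from this[of j] have "tdet (\<lambda>z. rot e (int j) z ** h z) = a_fac e ^ (2 * j) * vdet h (part_rot e j 0) KP"
    by (simp add: tdet_rot_eq_part_rot[OF h])
  also have "vdet h (part_rot e j 0) KP = tdet h"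
    unfolding tdet_def vdet_def ldet_def
    by (intro idet_cong) (auto simp: gram_def part_rot_def KP_def)
  finally show ?thesis .
qed

lemma mat_prod_Cons: "mat_prod (M # Ms) = M ** mat_prod Ms"
  by (simp add: mat_prod_def)

lemma mat_prod_Nil: "mat_prod [] = mat 1"
  by (simp add: mat_prod_def)

lemma eta_factor_eq_rot: "eta_factor \<eta> j = rot (\<eta> j) (int j)"
  by (simp add: fun_eq_iff eta_factor_def rot_def)

text \<open>The product is built from the right, hence with decreasing index. The annihilator loses
  one from its index with each factor, so just before the factor \<open>m\<close> is applied it has
  index exactly \<open>m\<close>.\<close>

lemma tdet_eta_product:
  fixes \<eta> :: "nat \<Rightarrow> complex" and h :: mfun and n m :: nat
  assumes h: "loop h" and w: "annihilator (int n) h w" and m: "m \<le> Suc n"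
  defines "p \<equiv> \<lambda>m z. mat_prod (map (\<lambda>j. eta_factor \<eta> j z) [m..<Suc n]) ** h z"
  shows "loop (p m) \<and> (\<exists>w'. annihilator (int m - 1) (p m) w') \<and>
     tdet (p m) = (\<Prod>j=m..n. a_fac (\<eta> j) ^ (2 * j)) * tdet h"
  using m
proof (induction m rule: inc_induct)
  case base
  have "p (Suc n) = h" by (simp add: p_def mat_prod_Nil fun_eq_iff)
  thus ?case using h w by auto
next
  case (step m)
  have pm: "p m = (\<lambda>z. rot (\<eta> m) (int m) z ** p (Suc m) z)"
    using step.hyps by (simp add: p_def fun_eq_iff upt_conv_Cons[of m] mat_prod_Cons matrix_mul_assoc eta_factor_eq_rot del: upt_Suc)
  obtain w' where w': "annihilator (int m) (p (Suc m)) w'" using step.IH by auto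
  have l: "loop (p (Suc m))" using step.IH by blast
  have "tdet (p m) = a_fac (\<eta> m) ^ (2 * m) * tdet (p (Suc m))"
    unfolding pm by (rule tdet_rot[OF l w'])
  also have "\<dots> = (\<Prod>j=m..n. a_fac (\<eta> j) ^ (2 * j)) * tdet h"
    using step by (simp add: prod.atLeast_Suc_atMost)
  finally show ?case
    using annihilator_rot[OF l w'] loop_mult[OF loop_rot l] unfolding pm by blast
qed

section \<open>Analytic functions on the circle\<close>

definition an :: "(complex \<Rightarrow> complex) \<Rightarrow> bool" where
  "an f \<longleftrightarrow> continuous_on (sphere 0 1) f \<and> (\<forall>k<0. fc f k = 0)"

text \<open>The value at \<open>a\<close> of the analytic extension to the disc, by its power
  series. Functions satisfying \<open>an\<close> are the boundary values of the disc
  algebra.\<close>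

definition ev :: "(complex \<Rightarrow> complex) \<Rightarrow> complex \<Rightarrow> complex" where
  "ev f a = (\<Sum>l. fc f (int l) * a ^ l)"

lemma an_Ls: "an f \<Longrightarrow> Ls f" by (simp add: an_def Ls_continuous)

lemma an_continuous: "an f \<Longrightarrow> continuous_on (sphere 0 1) f" by (simp add: an_def)

lemma fc_neg: "an f \<Longrightarrow> k < 0 \<Longrightarrow> fc f k = 0" by (simp add: an_def)

lemma an_add: "an f \<Longrightarrow> an g \<Longrightarrow> an (\<lambda>z. f z + g z)"
  using fc_add an_Ls by (auto simp: an_def intro!: continuous_intros)

lemma an_scale: "an f \<Longrightarrow> an (\<lambda>z. c * f z)"
  by (auto simp: an_def fc_scale intro!: continuous_intros)

lemma an_diff: "an f \<Longrightarrow> an g \<Longrightarrow> an (\<lambda>z. f z - g z)"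
  using fc_diff an_Ls by (auto simp: an_def intro!: continuous_intros)

lemma fc_monom: "fc (\<lambda>z. c * z powi n) k = (if k = n then c else 0)"
  using fc_trig[of "{n}" "\<lambda>_. c" k] by (simp add: trig_def[abs_def])

lemma an_monom: "0 \<le> n \<Longrightarrow> an (\<lambda>z. c * z powi n)"
  unfolding an_def fc_monom by (auto intro!: continuous_intros)

lemma fc_const: "fc (\<lambda>z. c) k = (if k = 0 then c else 0)"
  using fc_monom[of c 0 k] by simp

lemma an_const: "an (\<lambda>z. c)"
  using an_monom[of 0 c] by simp

lemma an_power_id: "an (\<lambda>z. c * z ^ n)"
  using an_monom[of "int n" c] by simp

lemma fc_power_id: "fc (\<lambda>z. c * z ^ n) k = (if k = int n then c else 0)"
  using fc_monom[of c "int n" k] by simp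

lemma fc_cnj: "fc (\<lambda>z. cnj (f z)) k = cnj (fc f (- k))"
proof -
  have "fc (\<lambda>z. cnj (f z)) k = (\<integral>z. cnj (z powi (- (- k)) * f z) \<partial>circle)"
    unfolding fc_def
    by (intro Bochner_Integration.integral_cong refl) (simp only: complex_cnj_mult cnj_powi space_circle minus_minus)
  thus ?thesis unfolding fc_def by (simp only: Bochner_Integration.integral_cnj)
qed

text \<open>Parseval's identity for z^k cnj f and g; the supports of the coefficients make the sum
  finite.\<close>

lemma fc_mult:
  assumes f: "an f" and g: "an g"
  shows "fc (\<lambda>z. f z * g z) k = (\<Sum>l\<in>{0..k}. fc f (k - l) * fc g l)"
proof -
  have c: "Ls (\<lambda>z. z powi k * cnj (f z))"
    using an_continuous[OF f] by (intro Ls_continuous continuous_intros)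
  have "fc (\<lambda>z. f z * g z) k = si (\<lambda>z. z powi k * cnj (f z)) g"
    unfolding fc_def si_def
    by (intro Bochner_Integration.integral_cong refl) (simp only: complex_cnj_mult cnj_powi space_circle complex_cnj_cnj mult.assoc)
  also have "\<dots> = (\<Sum>\<^sub>\<infinity>l. fc f (k - l) * fc g l)"
    unfolding Parseval[OF c an_Ls[OF g]] ip_def by (simp add: fc_shift fc_cnj)
  also have "\<dots> = (\<Sum>\<^sub>\<infinity>l\<in>{0..k}. fc f (k - l) * fc g l)"
    by (rule infsum_cong_neutral) (use fc_neg[OF f] fc_neg[OF g] in \<open>auto simp: not_le\<close>)
  finally show ?thesis by simp
qed

lemma an_mult: "an f \<Longrightarrow> an g \<Longrightarrow> an (\<lambda>z. f z * g z)"
  using an_continuous[of f] an_continuous[of g]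
  by (subst an_def) (auto simp: fc_mult intro!: continuous_on_mult)

lemma an_power: "an f \<Longrightarrow> an (\<lambda>z. f z ^ n)"
  by (induction n) (auto simp: an_const an_mult)

lemma ev_abs_summable:
  assumes f: "Ls f" and a: "cmod a < 1"
  shows "summable (\<lambda>l. norm (fc f (int l) * a ^ l))"
proof (rule summable_comparison_test')
  show "summable (\<lambda>l. sn f * cmod a ^ l)" using a by (intro summable_mult summable_geometric) simp
  show "norm (norm (fc f (int l) * a ^ l)) \<le> sn f * cmod a ^ l" for l
    using fc_norm_le[OF f, of "int l"] by (simp add: norm_mult norm_power mult_right_mono)
qed

lemma ev_summable: "Ls f \<Longrightarrow> cmod a < 1 \<Longrightarrow> summable (\<lambda>l. fc f (int l) * a ^ l)"
  by (rule summable_norm_cancel) (rule ev_abs_summable)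

lemma ev_norm_le:
  assumes f: "Ls f" and a: "cmod a < 1"
  shows "cmod (ev f a) \<le> sn f / (1 - cmod a)"
proof -
  have "cmod (ev f a) \<le> (\<Sum>l. norm (fc f (int l) * a ^ l))"
    unfolding ev_def by (rule summable_norm[OF ev_abs_summable[OF assms]])
  also have "\<dots> \<le> (\<Sum>l. sn f * cmod a ^ l)"
    using a fc_norm_le[OF f]
    by (intro suminf_le ev_abs_summable[OF assms] summable_mult summable_geometric)
       (auto simp: norm_mult norm_power mult_right_mono)
  also have "\<dots> = sn f / (1 - cmod a)"
    using a by (simp add: suminf_mult suminf_geometric summable_geometric)
  finally show ?thesis .
qed

lemma ev_add: "Ls f \<Longrightarrow> Ls g \<Longrightarrow> cmod a < 1 \<Longrightarrow> ev (\<lambda>z. f z + g z) a = ev f a + ev g a"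
  unfolding ev_def by (simp add: fc_add distrib_right suminf_add[symmetric] ev_summable)

lemma ev_diff: "Ls f \<Longrightarrow> Ls g \<Longrightarrow> cmod a < 1 \<Longrightarrow> ev (\<lambda>z. f z - g z) a = ev f a - ev g a"
  unfolding ev_def by (simp add: fc_diff left_diff_distrib suminf_diff[symmetric] ev_summable)

lemma ev_scale: "Ls f \<Longrightarrow> cmod a < 1 \<Longrightarrow> ev (\<lambda>z. c * f z) a = c * ev f a"
  unfolding ev_def by (simp add: fc_scale mult.assoc suminf_mult ev_summable)

lemma ev_0: "ev f 0 = fc f 0"
  unfolding ev_def using suminf_finite[of "{0}" "\<lambda>l. fc f (int l) * 0 ^ l"] by simp

lemma ev_power_id: "ev (\<lambda>z. c * z ^ n) a = c * a ^ n"
  unfolding ev_def fc_power_id by (subst suminf_finite[of "{n}"]) auto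

lemma ev_const: "ev (\<lambda>z. c) a = c"
  using ev_power_id[of c 0 a] by simp

lemma ev_mult:
  assumes f: "an f" and g: "an g" and a: "cmod a < 1"
  shows "ev (\<lambda>z. f z * g z) a = ev f a * ev g a"
proof -
  have "fc (\<lambda>z. f z * g z) (int k) * a ^ k = (\<Sum>i\<le>k. (fc g (int i) * a ^ i) * (fc f (int (k - i)) * a ^ (k - i)))" for k
  proof -
    have "{0..int k} = int ` {..k}"
      by (auto simp: image_iff) (metis atMost_iff nat_le_iff zero_le_imp_eq_int nat_int)
    hence "fc (\<lambda>z. f z * g z) (int k) = (\<Sum>i\<le>k. fc f (int (k - i)) * fc g (int i))"
      unfolding fc_mult[OF f g] by (simp add: sum.reindex of_nat_diff)
    also have "\<dots> * a ^ k = (\<Sum>i\<le>k. (fc g (int i) * a ^ i) * (fc f (int (k - i)) * a ^ (k - i)))"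
      unfolding sum_distrib_right
    proof (rule sum.cong[OF refl])
      fix i assume "i \<in> {..k}"
      hence "a ^ k = a ^ i * a ^ (k - i)" by (simp add: power_add[symmetric])
      thus "fc f (int (k - i)) * fc g (int i) * a ^ k = (fc g (int i) * a ^ i) * (fc f (int (k - i)) * a ^ (k - i))"
        by simp
    qed
    finally show ?thesis .
  qed
  hence "ev (\<lambda>z. f z * g z) a = ev g a * ev f a"
    unfolding ev_def using Cauchy_product[OF ev_abs_summable[OF an_Ls[OF g] a] ev_abs_summable[OF an_Ls[OF f] a]] by simp
  thus ?thesis by (simp add: mult.commute)
qed

lemma sn_le_sup:
  assumes f: "Ls f" and B: "\<And>z. z \<in> sphere 0 1 \<Longrightarrow> cmod (f z) \<le> B" and "B \<ge> 0"
  shows "sn f \<le> B"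
proof -
  interpret finite_measure circle by (rule prob_space_circle)
  have "(\<integral>z. (cmod (f z))\<^sup>2 \<partial>circle) \<le> (\<integral>z. B\<^sup>2 \<partial>circle)"
    using f B by (intro integral_mono) (auto simp: Ls_def intro!: power_mono)
  also have "\<dots> = B\<^sup>2" by (simp add: measure_def prob_space_circle)
  finally show ?thesis unfolding sn_def using \<open>B \<ge> 0\<close> by (intro real_le_lsqrt) auto
qed

text \<open>Convergence in mean is enough, because Fourier coefficients and, by
  \<open>ev_norm_le\<close>, values at interior points are continuous in that norm.\<close>

lemma an_limit:
  assumes f: "continuous_on (sphere 0 1) f" and g: "\<And>n. an (g n)" and lim: "(\<lambda>n::nat. sn (\<lambda>z. f z - g n z)) \<longlonglongrightarrow> 0"
  shows "an f" and "cmod a < 1 \<Longrightarrow> (\<lambda>n. ev (g n) a) \<longlonglongrightarrow> ev f a"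
    and "(\<lambda>n. fc (g n) k) \<longlonglongrightarrow> fc f k"
proof -
  have L: "Ls f" using f by (rule Ls_continuous)
  have l: "(\<lambda>n. fc (g n) k) \<longlonglongrightarrow> fc f k" for k
  proof -
    have "(\<lambda>n. fc f k - fc (g n) k) \<longlonglongrightarrow> 0"
      by (rule Lim_null_comparison[OF _ lim])
         (use L an_Ls[OF g] in \<open>auto intro!: always_eventually fc_norm_le simp: fc_diff[symmetric]\<close>)
    from tendsto_diff[OF tendsto_const this, of "fc f k"] show ?thesis by simp
  qed
  show "(\<lambda>n. fc (g n) k) \<longlonglongrightarrow> fc f k" by (rule l)
  have "fc f k = 0" if "k < 0" for k
    using l[of k] fc_neg[OF g that] by (simp add: LIMSEQ_const_iff)
  thus "an f" using f by (simp add: an_def)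
  show "(\<lambda>n. ev (g n) a) \<longlonglongrightarrow> ev f a" if a: "cmod a < 1"
  proof -
    have "(\<lambda>n. ev f a - ev (g n) a) \<longlonglongrightarrow> 0"
    proof (rule Lim_null_comparison)
      show "(\<lambda>n. sn (\<lambda>z. f z - g n z) / (1 - cmod a)) \<longlonglongrightarrow> 0"
        using tendsto_divide[OF lim tendsto_const, of "1 - cmod a"] a by simp
      show "\<forall>\<^sub>F n in sequentially. norm (ev f a - ev (g n) a) \<le> sn (\<lambda>z. f z - g n z) / (1 - cmod a)"
        using ev_norm_le[OF Ls_diff[OF L an_Ls[OF g]] a] by (simp add: ev_diff[OF L an_Ls[OF g] a])
    qed
    from tendsto_diff[OF tendsto_const this, of "ev f a"] show ?thesis by simp
  qed
qed

text \<open>The partial sums of the exponential series converge boundedly on the circle, hence in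
  mean.\<close>

lemma an_exp:
  assumes f: "an f"
  shows "an (\<lambda>z. exp (f z))" and "cmod a < 1 \<Longrightarrow> ev (\<lambda>z. exp (f z)) a = exp (ev f a)"
proof -
  define g where "g N z = (\<Sum>n<N. f z ^ n /\<^sub>R fact n)" for N z
  have c: "continuous_on (sphere 0 1) (\<lambda>z. exp (f z))" using f by (intro continuous_intros an_continuous)
  have gS: "an (g (Suc N)) \<and> (cmod a < 1 \<longrightarrow> ev (g (Suc N)) a = ev (g N) a + ev f a ^ N /\<^sub>R fact N)"
    if "an (g N)" for N a
  proof -
    have p: "an (\<lambda>z. (1 / fact N) * f z ^ N)" by (intro an_scale an_power f)
    have evp: "ev (\<lambda>z. f z ^ m) a = ev f a ^ m" if "cmod a < 1" for m
      by (induction m) (auto simp: ev_const ev_mult[OF f an_power[OF f] that])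
    have "g (Suc N) = (\<lambda>z. g N z + (1 / fact N) * f z ^ N)"
      by (simp add: g_def fun_eq_iff scaleR_conv_of_real field_simps)
    hence "an (g (Suc N))" and "cmod a < 1 \<Longrightarrow> ev (g (Suc N)) a = ev (g N) a + (1 / fact N) * ev f a ^ N"
      using an_add[OF that p] ev_add[OF an_Ls[OF that] an_Ls[OF p], of a] ev_scale[OF an_Ls[OF an_power[OF f, of N]], of a "1 / fact N"] evp[of N]
      by simp_all
    thus ?thesis by (auto simp: scaleR_conv_of_real inverse_eq_divide)
  qed
  have g: "an (g N)" for N by (induction N) (use gS an_const[of 0] in \<open>auto simp: g_def[abs_def]\<close>)
  have evg: "ev (g N) a = (\<Sum>n<N. ev f a ^ n /\<^sub>R fact n)" if "cmod a < 1" for N a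
    by (induction N) (use gS[OF g] that ev_const[of 0] in \<open>auto simp: g_def[abs_def]\<close>)
  have "bounded (f ` sphere 0 1)"
    by (intro compact_imp_bounded compact_continuous_image an_continuous f) simp
  then obtain B where B: "\<forall>z\<in>sphere 0 1. norm (f z) \<le> B" unfolding bounded_iff by blast
  have "(\<lambda>n. \<integral>z. (cmod (exp (f z) - g n z))\<^sup>2 \<partial>circle) \<longlonglongrightarrow> (\<integral>z. 0 \<partial>circle)"
  proof (rule integral_dominated_convergence[where w="\<lambda>z. (2 * exp B)\<^sup>2"])
    interpret finite_measure circle by (rule prob_space_circle)
    show "integrable circle (\<lambda>z. (2 * exp B)\<^sup>2)" by simp
    show "(\<lambda>z. (cmod (exp (f z) - g n z))\<^sup>2) \<in> borel_measurable circle" for n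
      by (intro borel_measurable_circle_continuous continuous_on_power continuous_on_norm continuous_on_diff c an_continuous[OF g])
    show "AE z in circle. (\<lambda>n. (cmod (exp (f z) - g n z))\<^sup>2) \<longlonglongrightarrow> 0"
    proof (rule AE_I2)
      fix z
      have "(\<lambda>n. g n z) \<longlonglongrightarrow> exp (f z)"
        using exp_converges[of "f z"] unfolding sums_def g_def .
      hence "(\<lambda>n. (cmod (exp (f z) - g n z))\<^sup>2) \<longlonglongrightarrow> (cmod (exp (f z) - exp (f z)))\<^sup>2"
        by (intro tendsto_intros)
      thus "(\<lambda>n. (cmod (exp (f z) - g n z))\<^sup>2) \<longlonglongrightarrow> 0" by simp
    qed
    show "AE z in circle. norm ((cmod (exp (f z) - g n z))\<^sup>2) \<le> (2 * exp B)\<^sup>2" for n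
    proof (rule AE_I2)
      fix z assume "z \<in> space circle"
      hence fB: "cmod (f z) \<le> B" using B by simp
      have "cmod (g n z) \<le> (\<Sum>i<n. cmod (f z) ^ i /\<^sub>R fact i)"
        unfolding g_def by (rule sum_norm_le) (simp add: norm_power)
      also have "\<dots> \<le> exp (cmod (f z))"
        unfolding exp_def using summable_exp_generic[of "cmod (f z)"] by (intro sum_le_suminf) auto
      also have "\<dots> \<le> exp B" using fB by simp
      finally have "cmod (g n z) \<le> exp B" .
      moreover have "cmod (exp (f z)) \<le> exp B" using fB norm_exp[of "f z"] by (meson exp_le_cancel_iff order_trans)
      ultimately have "cmod (exp (f z) - g n z) \<le> 2 * exp B" using norm_triangle_ineq4[of "exp (f z)" "g n z"] by linarith
      from power_mono[OF this, of 2] show "norm ((cmod (exp (f z) - g n z))\<^sup>2) \<le> (2 * exp B)\<^sup>2" by simp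
    qed
  qed auto
  hence lim: "(\<lambda>n. sn (\<lambda>z. exp (f z) - g n z)) \<longlonglongrightarrow> 0"
    unfolding sn_def using tendsto_real_sqrt by fastforce
  show "an (\<lambda>z. exp (f z))" by (rule an_limit(1)[OF c g lim])
  show "ev (\<lambda>z. exp (f z)) a = exp (ev f a)" if a: "cmod a < 1"
  proof (rule LIMSEQ_unique[OF an_limit(2)[OF c g lim a]])
    show "(\<lambda>n. ev (g n) a) \<longlonglongrightarrow> exp (ev f a)"
      unfolding evg[OF a] using exp_converges[of "ev f a"] unfolding sums_def .
  qed
qed

lemma one_minus_az_nonzero: "cmod a < 1 \<Longrightarrow> z \<in> sphere 0 1 \<Longrightarrow> 1 - a * z \<noteq> 0"
  by (auto simp: norm_mult dest!: arg_cong[where f=cmod])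

lemma geometric_an:
  assumes a: "cmod a < 1"
  shows "an (\<lambda>z. 1 / (1 - a * z))" and "fc (\<lambda>z. 1 / (1 - a * z)) (int l) = a ^ l"
proof -
  let ?r = "\<lambda>z. 1 / (1 - a * z)"
  have c: "continuous_on (sphere 0 1) ?r"
    using one_minus_az_nonzero[OF a] by (intro continuous_intros) auto
  define g where "g n z = trig (int ` {..<n}) (\<lambda>k. a ^ nat k) z" for n z
  have fg: "fc (g n) k = (if k \<in> int ` {..<n} then a ^ nat k else 0)" for n k
    unfolding g_def[abs_def] by (rule fc_trig) simp
  have g: "an (g n)" for n
    unfolding an_def fg by (auto simp: g_def[abs_def] intro!: continuous_intros)
  have d: "?r z - g n z = (a * z) ^ n / (1 - a * z)" if "z \<in> sphere 0 1" for z n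
  proof -
    have "g n z = (\<Sum>i<n. (a * z) ^ i)"
      by (simp add: g_def trig_def sum.reindex power_mult_distrib)
    also have "\<dots> = (1 - (a * z) ^ n) / (1 - a * z)"
      using one_minus_az_nonzero[OF a that] sum_gp_strict[of "a * z" n] by auto
    finally show ?thesis by (simp add: diff_divide_distrib)
  qed
  have lim: "(\<lambda>n. sn (\<lambda>z. ?r z - g n z)) \<longlonglongrightarrow> 0"
  proof (rule tendsto_sandwich[OF _ _ tendsto_const])
    show "(\<lambda>n. cmod a ^ n / (1 - cmod a)) \<longlonglongrightarrow> 0"
      using tendsto_divide[OF LIMSEQ_power_zero[of "cmod a"] tendsto_const, of "1 - cmod a"] a by simp
    show "\<forall>\<^sub>F n in sequentially. sn (\<lambda>z. ?r z - g n z) \<le> cmod a ^ n / (1 - cmod a)"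
    proof (intro always_eventually allI sn_le_sup)
      fix n show "Ls (\<lambda>z. ?r z - g n z)" by (intro Ls_diff Ls_continuous[OF c] an_Ls[OF g])
      fix z :: complex assume z: "z \<in> sphere 0 1"
      have "1 - cmod a \<le> cmod (1 - a * z)"
        using norm_triangle_ineq2[of 1 "a * z"] z by (simp add: norm_mult)
      thus "cmod (?r z - g n z) \<le> cmod a ^ n / (1 - cmod a)"
        unfolding d[OF z] using z a by (auto simp: norm_divide norm_power norm_mult intro!: divide_left_mono mult_pos_pos)
    qed (use a in auto)
  qed auto
  show "an ?r" by (rule an_limit(1)[OF c g lim])
  have "(\<lambda>n. fc (g n) (int l)) \<longlonglongrightarrow> a ^ l"
    by (rule tendsto_eventually) (use eventually_gt_at_top[of l] in \<open>eventually_elim, auto simp: fg\<close>)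
  from LIMSEQ_unique[OF an_limit(3)[OF c g lim] this] show "fc ?r (int l) = a ^ l" .
qed

lemma fc_factor_id:
  assumes f: "an f" and g: "an g" and eq: "\<And>z. z \<in> sphere 0 1 \<Longrightarrow> z * g z = f z" and a: "cmod a < 1"
  shows "a * ev g a = ev f a"
proof -
  have "ev f a = ev (\<lambda>z. (1 * z ^ 1) * g z) a"
    unfolding ev_def using fc_cong[of f "\<lambda>z. (1 * z ^ 1) * g z"] eq by simp
  also have "\<dots> = a * ev g a"
    by (simp only: ev_mult[OF an_power_id g a] ev_power_id) simp
  finally show ?thesis by simp
qed

lemma an_cong: "(\<And>z. z \<in> sphere 0 1 \<Longrightarrow> f z = g z) \<Longrightarrow> an f \<longleftrightarrow> an g"
  unfolding an_def using fc_cong[of f g] continuous_on_cong[of "sphere 0 1" "sphere 0 1" f g] by simp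

section \<open>Diagonal loops\<close>

text \<open>The entries form one function of the component, so that the arguments below can alter
  the entry of an arbitrary component \<open>c\<close>.\<close>

definition dgv :: "(2 \<Rightarrow> complex \<Rightarrow> complex) \<Rightarrow> mfun" where
  "dgv \<phi> z = (\<chi> i j. if i = j then \<phi> i z else 0)"

definition ax :: "2 \<Rightarrow> (complex \<Rightarrow> complex) \<Rightarrow> vfun" where
  "ax c f = (\<lambda>z. axis c (f z))"

lemma dgv_mult_vec [simp]: "(dgv \<phi> z *v v) $ i = \<phi> i z * v $ i"
  by (simp add: dgv_def matrix_vector_mult_def if_distribR if_distrib[of "\<lambda>x. x * _"] cong: if_cong)

lemma adj_dgv: "adj (dgv \<phi> z) = dgv (\<lambda>i z. cnj (\<phi> i z)) z"
  by (auto simp: adj_def dgv_def vec_eq_iff)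

lemma dgv_mult: "dgv \<phi> z ** dgv \<psi> z = dgv (\<lambda>i z. \<phi> i z * \<psi> i z) z"
  using two_cases by (auto simp: vec_eq_iff matrix_matrix_mult_def dgv_def UNIV_2)

lemma loop_dgv:
  assumes "\<And>i. continuous_on (sphere 0 1) (\<phi> i)" "\<And>i z. z \<in> sphere 0 1 \<Longrightarrow> cmod (\<phi> i z) = 1"
  shows "loop (dgv \<phi>)"
  unfolding loop_def
proof (intro conjI allI ballI)
  fix i j show "continuous_on (sphere 0 1) (\<lambda>z. dgv \<phi> z $ i $ j)"
    using assms(1) by (cases "i = j") (simp_all add: dgv_def)
next
  fix z :: complex assume z: "z \<in> sphere 0 1"
  have "cnj (\<phi> i z) * \<phi> i z = 1" for i
    using assms(2)[OF z, of i] complex_norm_square[of "\<phi> i z"] by (simp add: mult.commute)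
  thus "adj (dgv \<phi> z) ** dgv \<phi> z = mat 1"
    unfolding adj_dgv dgv_mult by (simp add: dgv_def mat_def vec_eq_iff)
qed

lemma co_ax: "co (ax c f) (k, d) = (if c = d then fc f k else 0)"
  by (auto simp: co_def ax_def axis_def fc_def)

lemma ax_L2: "Ls f \<Longrightarrow> ax c f \<in> L2"
proof -
  assume f: "Ls f"
  have "Ls (\<lambda>z. if d = c then f z else 0)" for d
    using f Ls_continuous[of "\<lambda>_. 0"] by (cases "d = c") auto
  thus ?thesis by (simp add: L2_iff ax_def axis_def)
qed

lemma bas_eq_ax: "bas (k, c) = ax c (\<lambda>z. z powi k)"
  by (simp add: bas_def ax_def)

lemma inner_ax: "L2_inner (ax c f) (ax d g) = (if c = d then si f g else 0)"
  using two_cases[of c] two_cases[of d] by (auto simp: L2_inner_def ax_def axis_def si_def UNIV_2)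

lemma L2_cong:
  assumes "\<And>z. z \<in> sphere 0 1 \<Longrightarrow> f z = g z"
  shows "f \<in> L2 \<longleftrightarrow> g \<in> L2"
proof -
  have "f \<in> borel_measurable circle \<longleftrightarrow> g \<in> borel_measurable circle"
    by (rule measurable_cong) (use assms in auto)
  moreover have "integrable circle (\<lambda>z. (norm (f z))\<^sup>2) \<longleftrightarrow> integrable circle (\<lambda>z. (norm (g z))\<^sup>2)"
    by (rule Bochner_Integration.integrable_cong) (use assms in auto)
  ultimately show ?thesis by (simp add: L2_def)
qed

lemma inner_cong:
  assumes "\<And>z. z \<in> sphere 0 1 \<Longrightarrow> f z = f' z" "\<And>z. z \<in> sphere 0 1 \<Longrightarrow> g z = g' z"
  shows "L2_inner f g = L2_inner f' g'"
  unfolding L2_inner_def by (intro Bochner_Integration.integral_cong refl) (use assms in simp)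

lemma Tmap_cong: "(\<And>z. z \<in> sphere 0 1 \<Longrightarrow> f z = f' z) \<Longrightarrow> Tmap g f = Tmap g f'"
  unfolding Tmap_def by (intro arg_cong[where f="res KP"] co_cong) simp

lemma null_cong:
  assumes "null g v I i f" "\<And>z. z \<in> sphere 0 1 \<Longrightarrow> f z = f' z"
  shows "null g v I i f'"
proof -
  have "Tmap g f = Tmap g f'" "f \<in> L2 \<longleftrightarrow> f' \<in> L2"
    by (intro Tmap_cong L2_cong assms(2); assumption)+
  thus ?thesis using assms(1) by (simp add: null_def)
qed

lemma vonb_cong:
  assumes "\<And>i z. i \<in> I \<Longrightarrow> z \<in> sphere 0 1 \<Longrightarrow> v i z = w i z" "vonb v I"
  shows "vonb w I"
  unfolding vonb_def
proof (intro conjI ballI)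
  fix i assume i: "i \<in> I"
  show "w i \<in> L2" using L2_cong[of "v i" "w i"] assms i by (simp add: vonb_def)
  fix j assume j: "j \<in> I"
  have "L2_inner (w i) (w j) = L2_inner (v i) (v j)" using assms i j by (intro inner_cong) auto
  thus "L2_inner (w i) (w j) = of_bool (i = j)" using assms(2) i j by (simp add: vonb_def)
qed

lemma vdet_cong:
  assumes "\<And>i z. i \<in> I \<Longrightarrow> z \<in> sphere 0 1 \<Longrightarrow> v i z = w i z"
  shows "vdet g v I = vdet g w I"
  unfolding vdet_def ldet_def
proof (rule idet_cong)
  fix i j assume "i \<in> I" "j \<in> I"
  hence "Tmap g (v i) = Tmap g (w i)" "Tmap g (v j) = Tmap g (w j)" using assms by (auto intro!: Tmap_cong)
  thus "gram (\<lambda>i. Tmap g (v i)) i j = gram (\<lambda>i. Tmap g (w i)) i j" by (simp add: gram_def)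
qed

lemma co_proj_sum:
  assumes "orthonormal v I" "A \<subseteq> I" "\<And>j. j \<in> B \<Longrightarrow> l2 (x j)"
  shows "co_proj v A (\<lambda>k. \<Sum>j\<in>B. t j * x j k) = (\<lambda>k. \<Sum>j\<in>B. t j * co_proj v A (x j) k)"
proof
  fix k
  have "ip (v i) (\<lambda>k. \<Sum>j\<in>B. t j * x j k) = (\<Sum>j\<in>B. t j * ip (v i) (x j))" if "i \<in> A" for i
    using that assms orthonormal_l2[OF assms(1), of i] by (subst ip_sum_right) (auto simp: ip_scale_right)
  hence "(\<Sum>i\<in>A. ip (v i) (\<lambda>k. \<Sum>j\<in>B. t j * x j k) * v i k) = (\<Sum>i\<in>A. \<Sum>j\<in>B. t j * (ip (v i) (x j) * v i k))"
    by (intro sum.cong refl) (simp add: sum_distrib_right mult.assoc)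
  also have "\<dots> = (\<Sum>j\<in>B. \<Sum>i\<in>A. t j * (ip (v i) (x j) * v i k))" by (rule sum.swap)
  finally show "co_proj v A (\<lambda>k. \<Sum>j\<in>B. t j * x j k) k = (\<Sum>j\<in>B. t j * co_proj v A (x j) k)"
    unfolding co_proj_def by (simp add: right_diff_distrib sum_subtractf sum_distrib_left)
qed

lemma co_proj_member:
  assumes v: "orthonormal v I" and A: "finite A" "A \<subseteq> I" and i: "i \<in> A"
  shows "co_proj v A (v i) = (\<lambda>_. 0)"
proof
  fix k
  have "(\<Sum>j\<in>A. ip (v j) (v i) * v j k) = (\<Sum>j\<in>A. if j = i then v j k else 0)"
    using A i by (intro sum.cong refl) (auto simp: orthonormal_ip[OF v] subset_iff)
  also have "\<dots> = v i k" using A i by (simp add: sum.delta')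
  finally show "co_proj v A (v i) k = 0" by (simp add: co_proj_def)
qed

text \<open>One direction is Bessel's inequality for the part of \<open>f\<close> in
  \<open>P\<close>. For the other, a finite part of \<open>f\<close> lies in the span of finitely
  many \<open>v i\<close>, so projecting off these removes it.\<close>

lemma orthonormal_complete:
  assumes v: "orthonormal v I" and supp: "\<And>i k. i \<in> I \<Longrightarrow> k \<notin> P \<Longrightarrow> v i k = 0"
    and span: "\<And>b. b \<in> P \<Longrightarrow> \<exists>A c. finite A \<and> A \<subseteq> I \<and> un b = (\<lambda>k. \<Sum>i\<in>A. c i * v i k)"
    and f: "l2 f"
  shows "(\<Sum>\<^sub>\<infinity>i\<in>I. (cmod (ip (v i) f))\<^sup>2) = (\<Sum>\<^sub>\<infinity>b\<in>P. (cmod (f b))\<^sup>2)"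
proof (rule antisym)
  have sf: "(\<lambda>b. (cmod (f b))\<^sup>2) summable_on S" for S using f by (auto simp: l2_def intro: summable_on_subset)
  have si: "(\<lambda>i. (cmod (ip (v i) f))\<^sup>2) summable_on I" by (rule Bessel_summable[OF v f])
  show "(\<Sum>\<^sub>\<infinity>i\<in>I. (cmod (ip (v i) f))\<^sup>2) \<le> (\<Sum>\<^sub>\<infinity>b\<in>P. (cmod (f b))\<^sup>2)"
  proof (rule infsum_le_finite_sums[OF si])
    fix A assume A: "finite A" "A \<subseteq> I"
    have "ip (v i) f = ip (v i) (res P f)" if "i \<in> A" for i
      unfolding ip_def using supp A that by (intro infsum_cong) (auto simp: res_def)
    hence "(\<Sum>i\<in>A. (cmod (ip (v i) f))\<^sup>2) = (\<Sum>i\<in>A. (cmod (ip (v i) (res P f)))\<^sup>2)" by simp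
    also have "\<dots> \<le> (nrm (res P f))\<^sup>2" by (rule Bessel(1)[OF v A l2_res[OF f]])
    also have "\<dots> = (\<Sum>\<^sub>\<infinity>b\<in>P. (cmod (f b))\<^sup>2)"
      unfolding nrm_sq by (rule infsum_cong_neutral) (auto simp: res_def)
    finally show "(\<Sum>i\<in>A. (cmod (ip (v i) f))\<^sup>2) \<le> (\<Sum>\<^sub>\<infinity>b\<in>P. (cmod (f b))\<^sup>2)" .
  qed
  show "(\<Sum>\<^sub>\<infinity>b\<in>P. (cmod (f b))\<^sup>2) \<le> (\<Sum>\<^sub>\<infinity>i\<in>I. (cmod (ip (v i) f))\<^sup>2)"
  proof (rule infsum_le_finite_sums[OF sf])
    fix B assume B: "finite B" "B \<subseteq> P"
    from span have "\<forall>b\<in>B. \<exists>A c. finite A \<and> A \<subseteq> I \<and> un b = (\<lambda>k. \<Sum>i\<in>A. c i * v i k)" using B by blast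
    then obtain AA c where Ac: "\<And>b. b \<in> B \<Longrightarrow> finite (AA b) \<and> AA b \<subseteq> I \<and> un b = (\<lambda>k. \<Sum>i\<in>AA b. c b i * v i k)"
      by metis
    define A where "A = (\<Union>b\<in>B. AA b)"
    have A: "finite A" "A \<subseteq> I" using Ac B by (auto simp: A_def)
    have u0: "co_proj v A (un b) = (\<lambda>_. 0)" if b: "b \<in> B" for b
    proof -
      have l: "\<And>i. i \<in> AA b \<Longrightarrow> l2 (v i)" using Ac[OF b] orthonormal_l2[OF v] by auto
      have "un b = (\<lambda>k. \<Sum>i\<in>AA b. c b i * v i k)" using Ac[OF b] by blast
      hence "co_proj v A (un b) = (\<lambda>k. \<Sum>i\<in>AA b. c b i * co_proj v A (v i) k)"
        using co_proj_sum[OF v A(2) l, of "AA b" "\<lambda>i. i" "c b"] by simp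
      also have "\<dots> = (\<lambda>_. 0)"
      proof (intro ext sum.neutral ballI)
        fix k i assume "i \<in> AA b"
        hence "i \<in> A" using b by (auto simp: A_def)
        thus "c b i * co_proj v A (v i) k = 0" by (simp add: co_proj_member[OF v A])
      qed
      finally show ?thesis .
    qed
    have rB: "res B f = (\<lambda>k. \<Sum>b\<in>B. f b * un b k)"
    proof
      fix k
      have "(\<Sum>b\<in>B. f b * un b k) = (\<Sum>b\<in>B. if k = b then f b else 0)" by (intro sum.cong refl) (auto simp: un_apply)
      thus "res B f k = (\<Sum>b\<in>B. f b * un b k)" using B by (simp add: res_def)
    qed
    have r0: "co_proj v A (res B f) = (\<lambda>_. 0)"
      unfolding rB using co_proj_sum[OF v A(2), of B un f] u0 by (simp cong: sum.cong)
    have d: "l2 (\<lambda>k. f k - res B f k)" using f by simp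
    have "co_proj v A (\<lambda>k. \<Sum>j\<in>{True, False}. 1 * (if j then (\<lambda>k. f k - res B f k) else res B f) k) =
       (\<lambda>k. \<Sum>j\<in>{True, False}. 1 * co_proj v A (if j then (\<lambda>k. f k - res B f k) else res B f) k)"
      by (rule co_proj_sum[OF v A(2)]) (use f d in auto)
    hence pe: "co_proj v A f = co_proj v A (\<lambda>k. f k - res B f k)"
      using r0 by simp
    have "(nrm (co_proj v A f))\<^sup>2 \<le> (nrm (\<lambda>k. f k - res B f k))\<^sup>2"
      unfolding pe Bessel(2)[OF v A d] by (simp add: sum_nonneg)
    also have "\<dots> = (nrm f)\<^sup>2 - (\<Sum>b\<in>B. (cmod (f b))\<^sup>2)"
    proof -
      have "(nrm (\<lambda>k. f k - res B f k))\<^sup>2 = (\<Sum>\<^sub>\<infinity>b\<in>-B. (cmod (f b))\<^sup>2)"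
        unfolding nrm_sq by (rule infsum_cong_neutral) (auto simp: res_def)
      moreover have "(\<Sum>\<^sub>\<infinity>b\<in>B \<union> - B. (cmod (f b))\<^sup>2) = (\<Sum>\<^sub>\<infinity>b\<in>B. (cmod (f b))\<^sup>2) + (\<Sum>\<^sub>\<infinity>b\<in>-B. (cmod (f b))\<^sup>2)"
        by (intro infsum_Un_disjoint sf) auto
      ultimately show ?thesis using B(1) by (simp add: nrm_sq)
    qed
    finally have "(\<Sum>b\<in>B. (cmod (f b))\<^sup>2) \<le> (\<Sum>i\<in>A. (cmod (ip (v i) f))\<^sup>2)"
      using Bessel(2)[OF v A f] by linarith
    also have "\<dots> \<le> (\<Sum>\<^sub>\<infinity>i\<in>I. (cmod (ip (v i) f))\<^sup>2)"
      by (rule finite_sum_le_infsum[OF si A]) auto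
    finally show "(\<Sum>b\<in>B. (cmod (f b))\<^sup>2) \<le> (\<Sum>\<^sub>\<infinity>i\<in>I. (cmod (ip (v i) f))\<^sup>2)" .
  qed
qed

lemma an_sum: "(\<And>i. i \<in> A \<Longrightarrow> an (q i)) \<Longrightarrow> an (\<lambda>z. \<Sum>i\<in>A. q i z)"
  by (induction A rule: infinite_finite_induct) (auto simp: an_const an_add)

section \<open>A basis adapted to one point, and the exchange for a factor 1 - a z\<close>

context
  fixes a :: complex and s :: real
  assumes a: "cmod a < 1" and s_def: "s = sqrt (1 - (cmod a)\<^sup>2)"
begin

text \<open>\<open>kap\<close> is the normalized reproducing kernel at \<open>cnj a\<close>,
  \<open>bl\<close> the Blaschke factor vanishing there, and \<open>be\<close> the
  Takenaka-Malmquist basis for this single point: the kernel, followed by the functions divisible by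
  \<open>bl\<close>.\<close>

definition kap :: "complex \<Rightarrow> complex" where "kap z = of_real s * (1 / (1 - a * z))"
definition bl :: "complex \<Rightarrow> complex" where "bl z = (z - cnj a) / (1 - a * z)"
definition be :: "nat \<Rightarrow> complex \<Rightarrow> complex" where
  "be n = (case n of 0 \<Rightarrow> kap | Suc m \<Rightarrow> (\<lambda>z. bl z * z ^ m))"

lemma s_pos: "s > 0" and s_sq: "s\<^sup>2 = 1 - (cmod a)\<^sup>2"
proof -
  have "(cmod a)\<^sup>2 < 1\<^sup>2" using a by (intro power_strict_mono) auto
  thus "s > 0" "s\<^sup>2 = 1 - (cmod a)\<^sup>2" by (auto simp: s_def)
qed

lemma s_sq_complex: "complex_of_real s * of_real s = 1 - a * cnj a"
  using arg_cong[OF s_sq, of complex_of_real]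
  by (simp only: of_real_diff of_real_1 complex_norm_square power2_eq_square[of s] of_real_mult)

lemma den_nz: "z \<in> sphere 0 1 \<Longrightarrow> 1 - a * z \<noteq> 0"
  by (rule one_minus_az_nonzero[OF a])

lemma an_kap: "an kap"
  unfolding kap_def[abs_def] by (intro an_scale geometric_an a)

lemma fc_kap: "fc kap (int l) = of_real s * a ^ l"
  unfolding kap_def[abs_def] by (simp only: fc_scale geometric_an(2)[OF a])

lemma an_bl: "an bl"
proof -
  have "an (\<lambda>z. (1 * z ^ 1 - cnj a) * (1 / (1 - a * z)))"
    by (intro an_mult an_diff an_power_id an_const geometric_an a)
  thus ?thesis unfolding bl_def[abs_def] by simp
qed

lemma an_be: "an (be n)"
  by (cases n) (use an_mult[OF an_bl an_power_id[of 1]] an_kap in \<open>auto simp: be_def\<close>)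

lemma cmod_bl: "z \<in> sphere 0 1 \<Longrightarrow> cnj (bl z) * bl z = 1"
proof -
  assume z: "z \<in> sphere 0 1"
  have zz: "z * cnj z = 1" using z complex_norm_square[of z] by simp
  have "1 - a * z \<noteq> 0" "1 - cnj a * cnj z \<noteq> 0" using den_nz[OF z] by (auto dest: arg_cong[where f=cnj])
  moreover have "(cnj z - a) * (z - cnj a) = (1 - cnj a * cnj z) * (1 - a * z)"
    using zz by (simp add: algebra_simps)
  ultimately show ?thesis by (simp add: bl_def)
qed

lemma ev_bl: "ev bl (cnj a) = 0"
proof -
  have a': "cmod (cnj a) < 1" using a by simp
  have "ev (\<lambda>z. (1 * z ^ 1 - cnj a) * (1 / (1 - a * z))) (cnj a) =
     ev (\<lambda>z. 1 * z ^ 1 - cnj a) (cnj a) * ev (\<lambda>z. 1 / (1 - a * z)) (cnj a)"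
    by (intro ev_mult an_diff an_power_id an_const geometric_an a a')
  also have "ev (\<lambda>z. 1 * z ^ 1 - cnj a) (cnj a) = 0"
    by (subst ev_diff) (use a' ev_power_id[of 1 1 "cnj a"] in \<open>auto simp: ev_const intro!: an_Ls an_power_id[of 1 1, simplified] an_const\<close>)
  finally show ?thesis unfolding bl_def[abs_def] by simp
qed

lemma si_kap:
  assumes f: "an f"
  shows "si kap f = of_real s * ev f (cnj a)"
proof -
  have a': "cmod (cnj a) < 1" using a by simp
  have "si kap f = (\<Sum>\<^sub>\<infinity>k. cnj (fc kap k) * fc f k)"
    unfolding Parseval[OF an_Ls[OF an_kap] an_Ls[OF f]] ip_def ..
  also have "\<dots> = (\<Sum>\<^sub>\<infinity>k\<in>range int. cnj (fc kap k) * fc f k)"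
  proof (rule infsum_cong_neutral)
    fix k assume "k \<in> UNIV - range int"
    hence "k < 0" by (metis DiffD2 UNIV_I int_nat_eq not_less rangeI image_eqI)
    thus "cnj (fc kap k) * fc f k = 0" using fc_neg[OF f] by simp
  qed auto
  also have "\<dots> = (\<Sum>\<^sub>\<infinity>l. of_real s * (fc f (int l) * cnj a ^ l))"
    by (subst infsum_reindex) (auto simp: o_def fc_kap mult_ac)
  also have "\<dots> = of_real s * (\<Sum>\<^sub>\<infinity>l. fc f (int l) * cnj a ^ l)" by (rule infsum_cmult_right')
  also have "(\<Sum>\<^sub>\<infinity>l. fc f (int l) * cnj a ^ l) = ev f (cnj a)"
    unfolding ev_def using norm_summable_imp_has_sum[OF ev_abs_summable[OF an_Ls[OF f] a'] summable_sums[OF ev_summable[OF an_Ls[OF f] a']]]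
    by (rule infsumI)
  finally show ?thesis .
qed

lemma si_be: "si (be m) (be n) = of_bool (m = n)"
proof -
  have a': "cmod (cnj a) < 1" using a by simp
  have k0: "si kap (be (Suc n)) = 0" for n
    using si_kap[OF an_be, of "Suc n"] ev_mult[OF an_bl an_power_id[of 1 n] a'] ev_bl by (simp add: be_def)
  have kk: "si kap kap = 1"
  proof -
    have "cmod (a * cnj a) < 1"
      using mult_strict_mono'[of "cmod a" 1 "cmod a" 1] a by (simp add: norm_mult)
    hence "ev kap (cnj a) = of_real s * (1 / (1 - a * cnj a))"
      unfolding ev_def fc_kap mult.assoc power_mult_distrib[symmetric]
      by (simp only: suminf_mult[OF summable_geometric] suminf_geometric)
    hence "si kap kap = (of_real s * of_real s) / (1 - a * cnj a)" by (simp add: si_kap[OF an_kap])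
    thus ?thesis unfolding s_sq_complex using s_sq_complex s_pos by (auto simp: divide_simps)
  qed
  have ss: "si (be (Suc m)) (be (Suc n)) = of_bool (m = n)" for m n
  proof -
    have "si (be (Suc m)) (be (Suc n)) = (\<integral>z. z powi (- int m) * z ^ n \<partial>circle)"
      unfolding si_def
    proof (intro Bochner_Integration.integral_cong refl)
      fix z assume "z \<in> space circle"
      hence z: "z \<in> sphere 0 1" by simp
      have "cnj (be (Suc m) z) * be (Suc n) z = (cnj (bl z) * bl z) * (cnj (z powi int m) * z ^ n)"
        by (simp add: be_def mult_ac)
      also have "\<dots> = z powi (- int m) * z ^ n" unfolding cmod_bl[OF z] cnj_powi[OF z] by simp
      finally show "cnj (be (Suc m) z) * be (Suc n) z = z powi (- int m) * z ^ n" .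
    qed
    also have "\<dots> = of_bool (m = n)" using fc_power_id[of 1 n "int m"] by (simp add: fc_def)
    finally show ?thesis .
  qed
  show ?thesis
    using kk k0 si_cnj[of kap "be (Suc _)"] ss by (cases m; cases n) (auto simp: be_def[of 0])
qed

text \<open>The coefficient of the kernel is forced by its reproducing property: \<open>s\<close>
  times the value of z^l at \<open>cnj a\<close>.\<close>

lemma be_expansion:
  "\<exists>C. C 0 = of_real s * cnj a ^ l \<and> (\<forall>z\<in>sphere 0 1. z ^ l = (\<Sum>k\<le>Suc l. C k * be k z))"
proof (induction l)
  case 0
  \<comment> \<open>s^2 = 1 - |a|^2 turns the numerator into 1 - a z.\<close>
  have "1 = of_real s * be 0 z + (- a) * be 1 z" if z: "z \<in> sphere 0 1" for z
  proof -
    have "of_real s * be 0 z + (- a) * be 1 z = (of_real s * of_real s - a * (z - cnj a)) / (1 - a * z)"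
      by (simp add: be_def kap_def bl_def diff_divide_distrib right_diff_distrib)
    also have "\<dots> = 1" unfolding s_sq_complex using den_nz[OF z] by (simp add: algebra_simps)
    finally show ?thesis ..
  qed
  thus ?case by (intro exI[of _ "\<lambda>k. if k = 0 then of_real s else - a"]) auto
next
  case (Suc l)
  then obtain C where C: "C 0 = of_real s * cnj a ^ l" "\<And>z. z \<in> sphere 0 1 \<Longrightarrow> z ^ l = (\<Sum>k\<le>Suc l. C k * be k z)" by blast
  \<comment> \<open>Multiplication by z shifts the functions bl z^m and sends kap to s bl + cnj(a)
    kap.\<close>
  define C' where "C' k = (case k of 0 \<Rightarrow> cnj a * C 0 | Suc 0 \<Rightarrow> of_real s * C 0 | Suc (Suc m) \<Rightarrow> C (Suc m))" for k
  have "z ^ Suc l = (\<Sum>k\<le>Suc (Suc l). C' k * be k z)" if z: "z \<in> sphere 0 1" for z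
  proof -
    have zk: "z * be 0 z = of_real s * be 1 z + cnj a * be 0 z"
    proof -
      have "of_real s * be 1 z + cnj a * be 0 z = (of_real s * (z - cnj a) + cnj a * of_real s) / (1 - a * z)"
        by (simp add: be_def kap_def bl_def add_divide_distrib)
      also have "\<dots> = z * be 0 z" by (simp add: be_def kap_def algebra_simps)
      finally show ?thesis ..
    qed
    have zb: "z * be (Suc m) z = be (Suc (Suc m)) z" for m by (simp add: be_def)
    have "z ^ Suc l = z * (\<Sum>k\<le>Suc l. C k * be k z)" using C(2)[OF z] by simp
    also have "\<dots> = C 0 * (z * be 0 z) + (\<Sum>k\<le>l. C (Suc k) * (z * be (Suc k) z))"
      by (simp add: sum.atMost_Suc_shift sum_distrib_left distrib_left mult_ac del: sum.atMost_Suc)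
    also have "\<dots> = (\<Sum>k\<le>Suc (Suc l). C' k * be k z)"
      unfolding zk zb sum.atMost_Suc_shift[of _ "Suc l"] sum.atMost_Suc_shift[of _ l]
      by (simp add: C'_def algebra_simps)
    finally show ?thesis .
  qed
  thus ?case using C(1) by (intro exI[of _ C']) (auto simp: C'_def)
qed

text \<open>Only component \<open>c\<close> is adapted to the point; the other keeps its monomials.
  \<open>nat\<close> does no harm, since the index set is always \<open>KP\<close>.\<close>

definition bv :: "2 \<Rightarrow> int \<times> 2 \<Rightarrow> vfun" where
  "bv c = (\<lambda>(k, d). if d = c then ax c (be (nat k)) else bas (k, d))"

lemma bv_L2: "bv c b \<in> L2"
  by (cases b) (auto simp: bv_def intro!: ax_L2 an_Ls an_be)

lemma vonb_bv: "vonb (bv c) KP"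
  unfolding vonb_def
proof (intro conjI ballI bv_L2)
  fix b b' assume "b \<in> KP" "b' \<in> KP"
  moreover obtain k d l e where bb: "b = (k, d)" "b' = (l, e)" by (cases b, cases b')
  ultimately have kl: "0 \<le> k" "0 \<le> l" by (auto simp: KP_def)
  have p: "si (\<lambda>z. z powi k) (\<lambda>z. z powi l) = of_bool (k = l)"
    using fc_monom[of 1 l k] by (simp add: fc_eq_si)
  show "L2_inner (bv c b) (bv c b') = of_bool (b = b')"
    using kl by (auto simp: bv_def bb inner_ax bas_eq_ax p si_be nat_eq_iff)
qed

text \<open>Both families span the Hardy space; for the new one, completeness follows from the
  finite expansions of the monomials.\<close>

lemma tdet_eq_vdet_bv:
  assumes h: "loop h"
  shows "tdet h = vdet h (bv c) KP"
  unfolding tdet_def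
proof (rule vdet_basis_change[OF h vonb_bas vonb_bv])
  fix f assume f: "f \<in> L2"
  have o: "orthonormal (\<lambda>b. co (bv c b)) KP"
    using vonb_bv[of c] by (auto simp: orthonormal_def vonb_def co_l2 L2_inner_eq_ip[symmetric])
  have "(\<Sum>\<^sub>\<infinity>b\<in>KP. (cmod (L2_inner (bas b) f))\<^sup>2) = (\<Sum>\<^sub>\<infinity>b\<in>KP. (cmod (co f b))\<^sup>2)"
    by (simp add: co_eq_inner[OF f])
  also have "\<dots> = (\<Sum>\<^sub>\<infinity>b\<in>KP. (cmod (ip (co (bv c b)) (co f)))\<^sup>2)"
  proof (rule orthonormal_complete[OF o _ _ co_l2[OF f], symmetric])
    fix i b assume "i \<in> KP" "b \<notin> KP"
    thus "co (bv c i) b = 0"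
      by (cases i, cases b) (auto simp: KP_def bv_def co_ax co_bas un_apply fc_neg[OF an_be])
  next
    fix b assume b: "b \<in> KP"
    obtain k d where kd: "b = (k, d)" by (cases b)
    have k: "0 \<le> k" using b kd by (simp add: KP_def)
    show "\<exists>A C. finite A \<and> A \<subseteq> KP \<and> un b = (\<lambda>x. \<Sum>i\<in>A. C i * co (bv c i) x)"
    proof (cases "d = c")
      case False
      thus ?thesis using b kd by (intro exI[of _ "{b}"] exI[of _ "\<lambda>_. 1"]) (auto simp: bv_def co_bas)
    next
      case True
      obtain C where C: "\<And>z. z \<in> sphere 0 1 \<Longrightarrow> z ^ nat k = (\<Sum>n\<le>Suc (nat k). C n * be n z)"
        using be_expansion[of "nat k"] by blast
      let ?A = "(\<lambda>n. (int n, c)) ` {..Suc (nat k)}"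
      have "un b x = (\<Sum>i\<in>?A. C (nat (fst i)) * co (bv c i) x)" for x
      proof -
        have "(\<Sum>i\<in>?A. C (nat (fst i)) * co (bv c i) x) = (\<Sum>n\<le>Suc (nat k). C n * co (ax c (be n)) x)"
          by (subst sum.reindex) (auto simp: inj_on_def bv_def)
        also have "\<dots> = co (\<lambda>z. \<Sum>n\<le>Suc (nat k). C n *s ax c (be n) z) x"
          by (subst co_sum) (auto simp: co_scale intro!: L2_scale ax_L2 an_Ls an_be)
        also have "co (\<lambda>z. \<Sum>n\<le>Suc (nat k). C n *s ax c (be n) z) = co (bas b)"
        proof (rule co_cong)
          fix z :: complex assume z: "z \<in> sphere 0 1"
          have "z powi k = z ^ nat k" using k by (simp add: power_int_def)
          thus "(\<Sum>n\<le>Suc (nat k). C n *s ax c (be n) z) = bas b z"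
            unfolding kd True bas_eq_ax
            by (simp add: vec_eq_iff ax_def axis_def C[OF z] if_distrib sum_distrib_left cong: if_cong del: sum.atMost_Suc)
        qed
        finally show ?thesis by (simp add: co_bas)
      qed
      thus ?thesis by (intro exI[of _ ?A] exI[of _ "\<lambda>i. C (nat (fst i))"]) (auto simp: KP_def)
    qed
  qed
  also have "\<dots> = (\<Sum>\<^sub>\<infinity>b\<in>KP. (cmod (L2_inner (bv c b) f))\<^sup>2)"
    by (simp add: L2_inner_eq_ip[OF bv_L2 f])
  finally show "(\<Sum>\<^sub>\<infinity>b\<in>KP. (cmod (L2_inner (bas b) f))\<^sup>2) = (\<Sum>\<^sub>\<infinity>b\<in>KP. (cmod (L2_inner (bv c b) f))\<^sup>2)" .
qed

lemma ax_diff: "ax c (\<lambda>z. f z - g z) = (\<lambda>z. ax c f z - ax c g z)"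
  and ax_scale: "ax c (\<lambda>z. t * f z) = (\<lambda>z. t *s ax c f z)"
  and ax_sum: "ax c (\<lambda>z. \<Sum>n\<in>A. q n z) = (\<lambda>z. \<Sum>n\<in>A. ax c (q n) z)"
  by (auto simp: ax_def axis_def fun_eq_iff vec_eq_iff)

lemma nrm_co_ax: "Ls f \<Longrightarrow> nrm (co (ax c f)) = sn f"
  using inner_ax[of c f c f] by (simp add: L2_inner_eq_ip ax_L2 ip_self co_l2 si_self power2_eq_iff_nonneg flip: of_real_power)

text \<open>Modulo the other members of the family, an analytic function is determined by its value at
  \<open>cnj a\<close>.\<close>
lemma null_an:
  assumes h: "loop h" and f: "an f"
  shows "null h (bv c) KP (0, c) (ax c (\<lambda>z. f z - (of_real s * ev f (cnj a)) * kap z))"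
proof -
  let ?N = "null h (bv c) KP (0, c)"
  have a': "cmod (cnj a) < 1" using a by simp
  note ns = null_scale[OF h vonb_bv] and nsum = null_sum[OF h vonb_bv]
  have bS: "?N (ax c (be (Suc n)))" for n
    using null_member[OF h vonb_bv, of "(int (Suc n), c)" "(0, c)" c] by (simp add: KP_def bv_def nat_add_distrib)
  \<comment> \<open>In the expansion of z^l only the kernel term is not a multiple of one of the
    other members.\<close>
  have pow: "?N (ax c (\<lambda>z. z ^ l - (of_real s * cnj a ^ l) * kap z))" for l
  proof -
    obtain C where C: "C 0 = of_real s * cnj a ^ l" "\<And>z. z \<in> sphere 0 1 \<Longrightarrow> z ^ l = (\<Sum>k\<le>Suc l. C k * be k z)"
      using be_expansion[of l] by blast
    have "?N (\<lambda>z. \<Sum>k\<le>l. C (Suc k) *s ax c (be (Suc k)) z)" by (intro nsum ns bS)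
    thus ?thesis
    proof (rule null_cong)
      fix z :: complex assume z: "z \<in> sphere 0 1"
      have "z ^ l - (of_real s * cnj a ^ l) * kap z = (\<Sum>k\<le>l. C (Suc k) * be (Suc k) z)"
        unfolding C(2)[OF z] sum.atMost_Suc_shift C(1)[symmetric] by (simp add: be_def[of 0])
      thus "(\<Sum>k\<le>l. C (Suc k) *s ax c (be (Suc k)) z) = ax c (\<lambda>z. z ^ l - (of_real s * cnj a ^ l) * kap z) z"
        by (simp add: ax_def axis_def vec_eq_iff)
    qed
  qed
  define T where "T n z = (\<Sum>l\<le>n. fc f (int l) * (z ^ l - (of_real s * cnj a ^ l) * kap z))" for n z
  have NT: "?N (ax c (T n))" for n
    unfolding T_def[abs_def] ax_sum ax_scale by (intro nsum ns pow)
  have tr: "trig (sq n) (fc f) z = (\<Sum>l\<le>n. fc f (int l) * z ^ l)" for n z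
  proof -
    have "trig (sq n) (fc f) z = (\<Sum>k\<in>int ` {..n}. fc f k * z powi k)"
      unfolding trig_def
    proof (rule sum.mono_neutral_right)
      show "\<forall>k\<in>sq n - int ` {..n}. fc f k * z powi k = 0"
      proof
        fix k assume "k \<in> sq n - int ` {..n}"
        hence "k < 0" by (auto simp: sq_def image_iff) (metis atMost_iff nat_le_iff not_less int_nat_eq zle_int)
        thus "fc f k * z powi k = 0" using fc_neg[OF f] by simp
      qed
    qed (auto simp: sq_def)
    thus ?thesis by (simp add: sum.reindex)
  qed
  define e where "e n = ev f (cnj a) - (\<Sum>l\<le>n. fc f (int l) * cnj a ^ l)" for n
  have e0: "e \<longlonglongrightarrow> 0"
    unfolding e_def using tendsto_diff[OF tendsto_const summable_LIMSEQ'[OF ev_summable[OF an_Ls[OF f] a']], of "ev f (cnj a)"]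
    by (simp add: ev_def)
  let ?F = "\<lambda>z. f z - (of_real s * ev f (cnj a)) * kap z"
  have LF: "Ls ?F" using f an_kap by (intro Ls_diff Ls_scale an_Ls)
  have LT: "Ls (T n)" for n
  proof -
    have "an (\<lambda>z. z ^ l)" for l using an_power_id[of 1 l] by simp
    hence "an (T n)" unfolding T_def[abs_def] by (intro an_sum an_scale an_diff an_kap)
    thus ?thesis by (rule an_Ls)
  qed
  \<comment> \<open>Two errors, both tending to 0 in norm: the Fourier remainder of \<open>f\<close>
    and the remainder \<open>e n\<close> of the series for \<open>ev f (cnj a)\<close>.\<close>
  have dec: "?F z - T n z = (f z - trig (sq n) (fc f) z) + (- (of_real s * e n)) * kap z" for n z
    unfolding tr T_def e_def by (simp add: algebra_simps sum_subtractf sum_distrib_left sum_distrib_right)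
  show "?N (ax c ?F)"
  proof (rule null_limit[OF h vonb_bv ax_L2[OF LF] NT])
    show "(\<lambda>n. nrm (co (\<lambda>z. ax c ?F z - ax c (T n) z))) \<longlonglongrightarrow> 0"
    proof (rule tendsto_sandwich[OF _ _ tendsto_const])
      show "(\<lambda>n. sn (\<lambda>z. f z - trig (sq n) (fc f) z) + s * cmod (e n) * sn kap) \<longlonglongrightarrow> 0"
        using tendsto_add[OF Fourier_convergence[OF an_Ls[OF f]]
           tendsto_mult[OF tendsto_mult[OF tendsto_const tendsto_norm[OF e0]] tendsto_const, of s "sn kap"]] by simp
      show "\<forall>\<^sub>F n in sequentially. nrm (co (\<lambda>z. ax c ?F z - ax c (T n) z)) \<le>
          sn (\<lambda>z. f z - trig (sq n) (fc f) z) + s * cmod (e n) * sn kap"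
      proof (intro always_eventually allI)
        fix n
        have L1: "Ls (\<lambda>z. f z - trig (sq n) (fc f) z)" using f by (intro Ls_diff an_Ls Ls_trig)
        have L2': "Ls (\<lambda>z. (- (of_real s * e n)) * kap z)" by (intro Ls_scale an_Ls an_kap)
        have "(\<lambda>z. ax c ?F z - ax c (T n) z) = (\<lambda>z. ax c (\<lambda>z. f z - trig (sq n) (fc f) z) z + ax c (\<lambda>z. (- (of_real s * e n)) * kap z) z)"
          unfolding ax_diff[symmetric] dec by (auto simp: ax_def axis_def fun_eq_iff vec_eq_iff)
        hence "co (\<lambda>z. ax c ?F z - ax c (T n) z) =
            (\<lambda>b. co (ax c (\<lambda>z. f z - trig (sq n) (fc f) z)) b + co (ax c (\<lambda>z. (- (of_real s * e n)) * kap z)) b)"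
          by (simp only: co_add[OF ax_L2[OF L1] ax_L2[OF L2']])
        hence "nrm (co (\<lambda>z. ax c ?F z - ax c (T n) z)) \<le>
            nrm (co (ax c (\<lambda>z. f z - trig (sq n) (fc f) z))) + nrm (co (ax c (\<lambda>z. (- (of_real s * e n)) * kap z)))"
          using nrm_triangle[OF co_l2[OF ax_L2[OF L1]] co_l2[OF ax_L2[OF L2']]] by simp
        also have "nrm (co (ax c (\<lambda>z. (- (of_real s * e n)) * kap z))) = cmod (- (of_real s * e n)) * nrm (co (ax c kap))"
          unfolding ax_scale co_scale by (rule nrm_scale)
        also have "\<dots> = s * cmod (e n) * sn kap"
          using s_pos by (simp add: nrm_co_ax an_Ls an_kap norm_mult)
        finally show "nrm (co (\<lambda>z. ax c ?F z - ax c (T n) z)) \<le> sn (\<lambda>z. f z - trig (sq n) (fc f) z) + s * cmod (e n) * sn kap"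
          by (simp only: nrm_co_ax[OF L1])
      qed
    qed auto
  qed
qed

text \<open>On the circle (1 - a z) / cnj (1 - a z) is the conjugate of w = z^-1 bl. Its adjoint
  turns the monomials into w, bl, bl z, ..., which differs from \<open>be\<close> only in that w
  stands in place of the kernel. The factor is |t|^2 for this one exchange.\<close>

lemma tdet_Blaschke:
  fixes \<phi> :: "2 \<Rightarrow> complex \<Rightarrow> complex"
  assumes h: "loop (dgv \<phi>)" and u: "an u" and u0: "fc u 0 \<noteq> 0" and unz: "\<And>z. z \<in> sphere 0 1 \<Longrightarrow> u z \<noteq> 0"
    and \<phi>: "\<And>z. z \<in> sphere 0 1 \<Longrightarrow> \<phi> c z = u z / cnj (u z)"
    and \<psi>: "\<And>z d. z \<in> sphere 0 1 \<Longrightarrow> \<psi> d z = (if d = c then \<phi> c z * ((1 - a * z) / cnj (1 - a * z)) else \<phi> d z)"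
  shows "tdet (dgv \<psi>) = (1 - (cmod a)\<^sup>2) * (cmod (ev u (cnj a) / fc u 0))\<^sup>2 * tdet (dgv \<phi>)"
proof -
  let ?N = "null (dgv \<phi>) (bv c) KP (0, c)"
  have a': "cmod (cnj a) < 1" using a by simp
  define w where "w z = z powi (-1) * bl z" for z
  define U where "U z = z powi (-1) * (u z - fc u 0)" for z
  \<comment> \<open>The coefficient t of the exchange: w agrees with \<tau> kap modulo null
    vectors.\<close>
  define \<tau> where "\<tau> = of_real s * ev u (cnj a) / fc u 0"
  have zinv: "z * z powi (-1) = 1" if "z \<in> sphere 0 1" for z :: complex
  proof -
    have "z \<noteq> 0" using that by auto
    thus ?thesis by (simp add: power_int_minus)
  qed
  have uU: "an (\<lambda>z. u z - fc u 0)" by (intro an_diff u an_const)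
  have anU: "an U"
    unfolding an_def
  proof (intro conjI allI impI)
    show "continuous_on (sphere 0 1) U"
      unfolding U_def[abs_def] by (intro continuous_on_mult continuous_on_circle_powi an_continuous[OF uU])
    fix k :: int assume k: "k < 0"
    have "fc U k = fc u (k + 1) - fc (\<lambda>z. fc u 0) (k + 1)"
      unfolding U_def[abs_def] fc_shift using fc_diff[OF an_Ls[OF u] an_Ls[OF an_const]] by simp
    thus "fc U k = 0" using k fc_neg[OF u, of "k + 1"] by (cases "k = -1") (auto simp: fc_const)
  qed
  have evU: "cnj a * ev U (cnj a) = ev u (cnj a) - fc u 0"
  proof -
    have "cnj a * ev U (cnj a) = ev (\<lambda>z. u z - fc u 0) (cnj a)"
    proof (rule fc_factor_id[OF uU anU _ a'])
      show "z * U z = u z - fc u 0" if "z \<in> sphere 0 1" for z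
        using zinv[OF that] by (simp add: U_def mult.assoc[symmetric])
    qed
    thus ?thesis by (simp add: ev_diff[OF an_Ls[OF u] an_Ls[OF an_const] a'] ev_const)
  qed
  \<comment> \<open>As \<phi> c = u / cnj u, the adjoint loop sends z^-1 u to z^-1 cnj u, which has
    only negative frequencies.\<close>
  have Nu: "?N (ax c (\<lambda>z. z powi (-1) * u z))"
  proof (rule null_kernel[OF h vonb_bv])
    show "ax c (\<lambda>z. z powi (-1) * u z) \<in> L2"
      using u by (intro ax_L2 Ls_mult_continuous an_Ls continuous_intros)
    fix b assume b: "b \<in> KP"
    obtain k d where kd: "b = (k, d)" by (cases b)
    have "co (\<lambda>z. adj (dgv \<phi> z) *v ax c (\<lambda>z. z powi (-1) * u z) z) = co (ax c (\<lambda>z. z powi (-1) * cnj (u z)))"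
    proof (rule co_cong)
      fix z :: complex assume z: "z \<in> sphere 0 1"
      show "adj (dgv \<phi> z) *v ax c (\<lambda>z. z powi (-1) * u z) z = ax c (\<lambda>z. z powi (-1) * cnj (u z)) z"
        using unz[OF z] \<phi>[OF z] by (auto simp: vec_eq_iff adj_dgv ax_def axis_def)
    qed
    moreover have "co (ax c (\<lambda>z. z powi (-1) * cnj (u z))) b = 0"
      unfolding kd co_ax fc_shift fc_cnj using b fc_neg[OF u, of "- (k + 1)"] by (auto simp: kd KP_def)
    ultimately show "co (\<lambda>z. adj (dgv \<phi> z) *v ax c (\<lambda>z. z powi (-1) * u z) z) b = 0" by (simp only:)
  qed
  have NU: "?N (ax c (\<lambda>z. U z - (of_real s * ev U (cnj a)) * kap z))"
    by (rule null_an[OF h anU])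
  \<comment> \<open>z^-1 u = u(0) z^-1 + U, where U is a multiple of the kernel modulo null vectors.
    This expresses z^-1, and with it w = s kap - cnj(a) z^-1, through the kernel.\<close>
  have "?N (\<lambda>z. (- cnj a / fc u 0) *s (ax c (\<lambda>z. z powi (-1) * u z) z - ax c (\<lambda>z. U z - (of_real s * ev U (cnj a)) * kap z) z))"
    by (intro null_scale[OF h vonb_bv] null_diff[OF h vonb_bv] Nu NU)
  hence Nw: "?N (\<lambda>z. ax c w z - \<tau> *s bv c (0, c) z)"
  proof (rule null_cong)
    fix z :: complex assume z: "z \<in> sphere 0 1"
    have "(- cnj a / fc u 0) * (z powi (-1) * u z - (U z - (of_real s * ev U (cnj a)) * kap z)) =
        - cnj a * z powi (-1) - (of_real s / fc u 0) * (cnj a * ev U (cnj a)) * kap z"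
      using u0 by (simp add: U_def field_simps) (simp add: diff_divide_distrib)
    also have "\<dots> = (- cnj a * z powi (-1) + of_real s * kap z) - \<tau> * kap z"
      unfolding evU \<tau>_def using u0 by (simp add: field_simps)
    also have "- cnj a * z powi (-1) + of_real s * kap z = w z"
    proof -
      have k: "of_real s * kap z = (1 - a * cnj a) / (1 - a * z)"
        using s_sq_complex by (simp add: kap_def)
      have zi: "z powi (-1) = 1 / z" by (simp add: power_int_minus inverse_eq_divide)
      have "z \<noteq> 0" using z by auto
      thus ?thesis
        unfolding w_def bl_def k zi using den_nz[OF z] by (simp add: divide_simps) (simp add: algebra_simps)
    qed
    finally show "(- cnj a / fc u 0) *s (ax c (\<lambda>z. z powi (-1) * u z) z - ax c (\<lambda>z. U z - (of_real s * ev U (cnj a)) * kap z) z) =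
        ax c w z - \<tau> *s bv c (0, c) z"
    proof -
      assume eq: "(- cnj a / fc u 0) * (z powi (-1) * u z - (U z - (of_real s * ev U (cnj a)) * kap z)) = w z - \<tau> * kap z"
      have "t *s (ax c p z - ax c q z) = axis c (t * (p z - q z))" for t p q
        by (auto simp: vec_eq_iff ax_def axis_def right_diff_distrib)
      moreover have "ax c w z - \<tau> *s bv c (0, c) z = axis c (w z - \<tau> * kap z)"
        by (auto simp: vec_eq_iff ax_def axis_def bv_def be_def)
      ultimately show ?thesis using eq by (simp only:)
    qed
  qed
  \<comment> \<open>The adjoint of this unitary loop multiplies component \<open>c\<close> by w,
    which also makes the new family orthonormal.\<close>
  define \<beta> where "\<beta> = dgv (\<lambda>d z. if d = c then cnj (w z) else 1)"
  have wc: "continuous_on (sphere 0 1) w"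
    unfolding w_def[abs_def] using an_continuous[OF an_bl] by (intro continuous_intros)
  have wn: "cmod (w z) = 1" if z: "z \<in> sphere 0 1" for z
  proof -
    have "complex_of_real ((cmod (bl z))\<^sup>2) = 1" using cmod_bl[OF z] unfolding complex_norm_square by (simp add: mult.commute)
    hence "(cmod (bl z))\<^sup>2 = 1\<^sup>2" using of_real_eq_1_iff by fastforce
    hence "cmod (bl z) = 1" by (rule power2_eq_imp_eq) auto
    thus ?thesis using z by (simp add: w_def norm_mult norm_power_int norm_inverse)
  qed
  have \<beta>: "loop \<beta>"
    unfolding \<beta>_def
  proof (rule loop_dgv)
    show "continuous_on (sphere 0 1) (\<lambda>z. if d = c then cnj (w z) else 1)" for d
      using wc by (cases "d = c") (auto intro: continuous_intros)
  qed (use wn in auto)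
  \<comment> \<open>For k > 0 one has w z^k = bl z^(k-1), the member number k of \<open>be\<close>;
    only k = 0 gives a new vector.\<close>
  have fam: "adj (\<beta> z) *v bas b z = ((bv c)((0, c) := ax c w)) b z" if b: "b \<in> KP" and z: "z \<in> sphere 0 1" for b z
  proof -
    obtain k d where kd: "b = (k, d)" by (cases b)
    have k: "0 \<le> k" using b kd by (simp add: KP_def)
    have zk: "w z * z powi k = bl z * z ^ (nat k - 1)" if "k > 0"
    proof -
      have "z \<noteq> 0" using z by auto
      hence "z powi (-1) * z powi k = z powi (k - 1)" using power_int_add[of z "-1" k] by simp
      also have "\<dots> = z ^ (nat k - 1)" using that by (simp add: power_int_def nat_diff_distrib)
      finally show ?thesis by (simp add: w_def mult_ac)
    qed
    show ?thesis
    proof (cases "d = c")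
      case True
      show ?thesis
      proof (cases "k = 0")
        case False
        hence "nat k = Suc (nat k - 1)" using k by simp
        hence "be (nat k) z = w z * z powi k" using zk False k by (simp add: be_def split: nat.split)
        thus ?thesis using True False by (auto simp: kd \<beta>_def adj_dgv vec_eq_iff bas_def axis_def bv_def ax_def)
      qed (use True in \<open>auto simp: kd \<beta>_def adj_dgv vec_eq_iff bas_def axis_def ax_def\<close>)
    qed (auto simp: kd \<beta>_def adj_dgv vec_eq_iff bas_def axis_def bv_def)
  qed
  have "vonb (\<lambda>b z. adj (\<beta> z) *v bas b z) KP" by (intro vonb_loop loop_adj \<beta> vonb_bas)
  hence vw: "vonb ((bv c)((0, c) := ax c w)) KP" by (rule vonb_cong[rotated]) (rule fam)
  have "tdet (dgv \<psi>) = tdet (\<lambda>z. \<beta> z ** dgv \<phi> z)"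
    unfolding tdet_def vdet_def
  proof (rule arg_cong2[where f=ldet, OF _ refl], rule ext)
    fix b
    show "Tmap (dgv \<psi>) (bas b) = Tmap (\<lambda>z. \<beta> z ** dgv \<phi> z) (bas b)"
      unfolding Tmap_def
    proof (intro arg_cong[where f="res KP"] co_cong)
      fix z :: complex assume z: "z \<in> sphere 0 1"
      have zz: "z * cnj z = 1" using z complex_norm_square[of z] by simp
      have zi: "z powi (-1) = cnj z" using cnj_powi[OF z, of 1] by simp
      have "cnj (w z) = (1 - a * z) / cnj (1 - a * z)"
      proof -
        have "cnj (w z) * cnj (1 - a * z) = z * (cnj z - a)"
          using den_nz[OF z] unfolding w_def zi bl_def by (auto simp: dest: arg_cong[where f=cnj])
        also have "\<dots> = 1 - a * z" using zz by (simp add: algebra_simps)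
        finally show ?thesis using den_nz[OF z] by (metis complex_cnj_zero_iff nonzero_eq_divide_eq)
      qed
      hence "dgv \<psi> z = \<beta> z ** dgv \<phi> z"
        unfolding \<beta>_def dgv_mult by (auto simp: dgv_def vec_eq_iff \<psi>[OF z])
      thus "adj (dgv \<psi> z) *v bas b z = adj (\<beta> z ** dgv \<phi> z) *v bas b z" by simp
    qed
  qed
  also have "\<dots> = vdet (dgv \<phi>) (\<lambda>b z. adj (\<beta> z) *v bas b z) KP" by (rule tdet_mult[OF \<beta> h])
  also have "\<dots> = vdet (dgv \<phi>) ((bv c)((0, c) := ax c w)) KP" by (rule vdet_cong) (rule fam)
  also have "\<dots> = (cmod \<tau>)\<^sup>2 * vdet (dgv \<phi>) (bv c) KP"
    by (rule vdet_exchange[OF h vonb_bv _ vw Nw]) (simp add: KP_def)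
  also have "(cmod \<tau>)\<^sup>2 = (1 - (cmod a)\<^sup>2) * (cmod (ev u (cnj a) / fc u 0))\<^sup>2"
    using s_sq by (simp add: \<tau>_def norm_mult norm_divide power_mult_distrib power_divide)
  finally show ?thesis by (simp only: tdet_eq_vdet_bv[OF h, of c])
qed

end

section \<open>Semicontinuity in the loop\<close>

lemma norm_sq_eq_sum: "complex_of_real ((norm v)\<^sup>2) = (\<Sum>c\<in>UNIV. cnj (v $ c) * v $ c)" for v :: "complex^2"
proof -
  have "(norm v)\<^sup>2 = (\<Sum>c\<in>UNIV. (cmod (v $ c))\<^sup>2)"
    by (auto simp: norm_vec_def L2_set_def sum_nonneg)
  thus ?thesis by (simp add: complex_norm_square mult.commute del: of_real_power)
qed

lemma norm_loop:
  assumes "loop g" "z \<in> sphere 0 1"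
  shows "norm (g z *v v) = norm v"
proof -
  have "complex_of_real ((norm (g z *v v))\<^sup>2) = of_real ((norm v)\<^sup>2)"
    unfolding norm_sq_eq_sum adj_inner using assms by (simp add: matrix_vector_mul_assoc loop_def)
  hence "(norm (g z *v v))\<^sup>2 = (norm v)\<^sup>2" by (simp only: of_real_eq_iff)
  thus ?thesis by (rule power2_eq_imp_eq) auto
qed

text \<open>Dominated convergence: unitarity bounds the difference of the images by 2|f|, so
  pointwise convergence of the loops is enough.\<close>

lemma co_loop_tendsto:
  assumes g: "\<And>n. loop (g n)" and g0: "loop g0" and f: "f \<in> L2"
    and lim: "\<And>z i j. z \<in> sphere 0 1 \<Longrightarrow> (\<lambda>n. g n z $ i $ j) \<longlonglongrightarrow> g0 z $ i $ j"
  shows "(\<lambda>n::nat. nrm (\<lambda>k. Tmap (g n) f k - Tmap g0 f k)) \<longlonglongrightarrow> 0"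
proof -
  let ?d = "\<lambda>n z. adj (g n z) *v f z - adj (g0 z) *v f z"
  have dL: "?d n \<in> L2" for n by (intro L2_diff loop_adj_L2 g g0 f)
  have dm: "?d n \<in> borel_measurable circle" for n using dL by (simp add: L2_def)
  have "(\<lambda>n. \<integral>z. (norm (?d n z))\<^sup>2 \<partial>circle) \<longlonglongrightarrow> (\<integral>z. 0 \<partial>circle)"
  proof (rule integral_dominated_convergence[where w="\<lambda>z. 4 * (norm (f z))\<^sup>2"])
    show "integrable circle (\<lambda>z. 4 * (norm (f z))\<^sup>2)" using f by (simp add: L2_def)
    show "(\<lambda>z. (norm (?d n z))\<^sup>2) \<in> borel_measurable circle" for n using dL[of n] by (auto simp: L2_def)
    show "AE z in circle. (\<lambda>n. (norm (?d n z))\<^sup>2) \<longlonglongrightarrow> 0"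
    proof (rule AE_I2)
      fix z assume "z \<in> space circle"
      hence z: "z \<in> sphere 0 1" by simp
      have "(\<lambda>n. (adj (g n z) *v f z) $ i) \<longlonglongrightarrow> (adj (g0 z) *v f z) $ i" for i
        unfolding matrix_vector_mult_def adj_def vec_lambda_beta
        by (intro tendsto_sum tendsto_mult tendsto_cnj lim z tendsto_const)
      hence "(\<lambda>n. adj (g n z) *v f z) \<longlonglongrightarrow> adj (g0 z) *v f z" by (intro vec_tendstoI)
      hence "(\<lambda>n. (norm (?d n z))\<^sup>2) \<longlonglongrightarrow> (norm (adj (g0 z) *v f z - adj (g0 z) *v f z))\<^sup>2"
        by (intro tendsto_intros)
      thus "(\<lambda>n. (norm (?d n z))\<^sup>2) \<longlonglongrightarrow> 0" by simp
    qed
    show "AE z in circle. norm ((norm (?d n z))\<^sup>2) \<le> 4 * (norm (f z))\<^sup>2" for n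
    proof (rule AE_I2)
      fix z assume "z \<in> space circle"
      hence z: "z \<in> sphere 0 1" by simp
      have "norm (?d n z) \<le> 2 * norm (f z)"
        using norm_triangle_ineq4[of "adj (g n z) *v f z" "adj (g0 z) *v f z"]
        by (simp add: norm_loop[OF loop_adj[OF g] z] norm_loop[OF loop_adj[OF g0] z])
      from power_mono[OF this, of 2] show "norm ((norm (?d n z))\<^sup>2) \<le> 4 * (norm (f z))\<^sup>2"
        by (simp add: power_mult_distrib)
    qed
  qed auto
  hence "(\<lambda>n. L2_norm (?d n)) \<longlonglongrightarrow> 0"
    unfolding L2_norm_def using tendsto_real_sqrt by fastforce
  hence l: "(\<lambda>n. nrm (co (?d n))) \<longlonglongrightarrow> 0" by (simp add: L2_norm_eq_nrm[OF dL])
  have "(\<lambda>k. Tmap (g n) f k - Tmap g0 f k) = res KP (co (?d n))" for n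
    using co_diff[OF loop_adj_L2[OF g f] loop_adj_L2[OF g0 f]] by (auto simp: Tmap_def res_def fun_eq_iff)
  hence "nrm (\<lambda>k. Tmap (g n) f k - Tmap g0 f k) \<le> nrm (co (?d n))" for n
    using nrm_res_le[OF co_l2[OF dL]] by simp
  thus ?thesis by (intro tendsto_sandwich[OF _ _ tendsto_const l]) auto
qed

lemma tdet_upper_semicontinuous:
  assumes g: "\<And>n. loop (g n)" and g0: "loop g0"
    and lim: "\<And>z i j. z \<in> sphere 0 1 \<Longrightarrow> (\<lambda>n::nat. g n z $ i $ j) \<longlonglongrightarrow> g0 z $ i $ j"
    and c: "c \<longlonglongrightarrow> d" and le: "\<And>n. c n \<le> tdet (g n)"
  shows "d \<le> tdet g0"
  unfolding tdet_def vdet_def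
proof (rule ldet_upper_semicontinuous[OF sequentially_bot _ c])
  show "c n \<le> ldet (\<lambda>i. Tmap (g n) (bas i)) KP" for n using le[of n] by (simp add: tdet_def vdet_def)
  show "contr (\<lambda>i. Tmap (g n) (bas i)) KP" for n by (intro contr_Tmap g vonb_bas)
  fix i j assume ij: "i \<in> KP" "j \<in> KP"
  let ?x = "\<lambda>n i. Tmap (g n) (bas i)" and ?y = "\<lambda>i. Tmap g0 (bas i)"
  have x: "l2 (?x n i)" "nrm (?x n j) \<le> 1" for n and i :: "int \<times> 2" and j
    by (rule contr_D[OF contr_Tmap[OF g vonb_bas[of UNIV]] UNIV_I])+
  have y: "l2 (?y i)" "nrm (?y j) \<le> 1" for i :: "int \<times> 2" and j
    by (rule contr_D[OF contr_Tmap[OF g0 vonb_bas[of UNIV]] UNIV_I])+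
  have D: "(\<lambda>n. nrm (\<lambda>k. ?x n i k - ?y i k)) \<longlonglongrightarrow> 0" for i
    by (rule co_loop_tendsto[OF g g0 bas_L2 lim])
  have "(\<lambda>n. ip (?x n i) (?x n j) - ip (?y i) (?y j)) \<longlonglongrightarrow> 0"
  proof (rule Lim_null_comparison)
    show "(\<lambda>n. nrm (\<lambda>k. ?x n i k - ?y i k) + nrm (\<lambda>k. ?x n j k - ?y j k)) \<longlonglongrightarrow> 0"
      using tendsto_add[OF D[of i] D[of j]] by simp
    show "\<forall>\<^sub>F n in sequentially. norm (ip (?x n i) (?x n j) - ip (?y i) (?y j)) \<le>
        nrm (\<lambda>k. ?x n i k - ?y i k) + nrm (\<lambda>k. ?x n j k - ?y j k)"
    proof (intro always_eventually allI)
      fix n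
      have e: "ip (?x n i) (?x n j) - ip (?y i) (?y j) =
          ip (\<lambda>k. ?x n i k - ?y i k) (?x n j) + ip (?y i) (\<lambda>k. ?x n j k - ?y j k)"
        using x y by (simp add: ip_diff_left ip_diff_right)
      have "cmod (ip (\<lambda>k. ?x n i k - ?y i k) (?x n j)) \<le> nrm (\<lambda>k. ?x n i k - ?y i k) * nrm (?x n j)"
        using x y by (intro ip_Cauchy_Schwarz) auto
      also have "\<dots> \<le> nrm (\<lambda>k. ?x n i k - ?y i k)"
        by (rule mult_right_le_one_le) (use x in auto)
      finally have 1: "cmod (ip (\<lambda>k. ?x n i k - ?y i k) (?x n j)) \<le> nrm (\<lambda>k. ?x n i k - ?y i k)" .
      have "cmod (ip (?y i) (\<lambda>k. ?x n j k - ?y j k)) \<le> nrm (?y i) * nrm (\<lambda>k. ?x n j k - ?y j k)"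
        using x y by (intro ip_Cauchy_Schwarz) auto
      also have "\<dots> \<le> nrm (\<lambda>k. ?x n j k - ?y j k)"
        by (rule mult_left_le_one_le) (use y in auto)
      finally show "norm (ip (?x n i) (?x n j) - ip (?y i) (?y j)) \<le>
          nrm (\<lambda>k. ?x n i k - ?y i k) + nrm (\<lambda>k. ?x n j k - ?y j k)"
        unfolding e using 1 by (intro order_trans[OF norm_triangle_ineq] add_mono)
    qed
  qed
  from tendsto_add[OF this tendsto_const, of "ip (?y i) (?y j)"]
  show "(\<lambda>n. gram (?x n) i j) \<longlonglongrightarrow> gram ?y i j" by (simp add: gram_def)
qed

section \<open>Exponential diagonal loops as limits of polynomial ones\<close>

lemma tendsto_one_plus_power_exp:
  fixes x :: complex
  shows "(\<lambda>n. (1 + x / of_nat n) ^ n) \<longlonglongrightarrow> exp x"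
proof (cases "x = 0")
  case False
  let ?y = "\<lambda>n. x / of_nat n"
  have y0: "?y \<longlonglongrightarrow> 0"
    by (rule tendsto_divide_0[OF tendsto_const tendsto_of_nat])
  have "filterlim ?y (at 0) sequentially"
    unfolding filterlim_at using y0 False eventually_gt_at_top[of 0] by (auto elim!: eventually_mono)
  from filterlim_compose[OF lim_exp_minus_1 this]
  have "(\<lambda>n. (exp (?y n) - 1) / ?y n) \<longlonglongrightarrow> 1" .
  hence "(\<lambda>n. exp (cmod x) * cmod (x * ((exp (?y n) - 1) / ?y n - 1))) \<longlonglongrightarrow> exp (cmod x) * cmod (x * (1 - 1))"
    by (intro tendsto_intros)
  hence l: "(\<lambda>n. exp (cmod x) * cmod (x * ((exp (?y n) - 1) / ?y n - 1))) \<longlonglongrightarrow> 0" by simp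
  have "(\<lambda>n. (1 + ?y n) ^ n - exp x) \<longlonglongrightarrow> 0"
  proof (rule Lim_null_comparison[OF _ l])
    show "\<forall>\<^sub>F n in sequentially. norm ((1 + ?y n) ^ n - exp x) \<le> exp (cmod x) * cmod (x * ((exp (?y n) - 1) / ?y n - 1))"
      using eventually_gt_at_top[of 0]
    proof eventually_elim
      case (elim n)
      \<comment> \<open>For numbers of modulus at most 1 the n-th powers differ by at most n times
        the difference. Division by \<open>r\<close> brings 1 + x/n and exp(x/n) into that range,
        and r^n = exp|x| does not depend on n.\<close>
      define r where "r = exp (cmod (?y n))"
      have r: "r \<ge> 1" "r > 0" by (simp_all add: r_def)
      have rn: "r ^ n = exp (cmod x)" using elim by (simp add: r_def exp_of_nat_mult[symmetric] norm_divide)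
      have en: "exp (?y n) ^ n = exp x" using elim by (simp add: exp_of_nat_mult[symmetric])
      let ?A = "(1 + ?y n) / of_real r" and ?B = "exp (?y n) / of_real r"
      have "cmod (1 + ?y n) \<le> 1 + cmod (?y n)" using norm_triangle_ineq[of 1 "?y n"] by simp
      also have "\<dots> \<le> r" unfolding r_def by (rule exp_ge_add_one_self)
      finally have A: "norm ?A \<le> 1" using r by (simp add: norm_divide divide_le_eq_1)
      have "cmod (exp (?y n)) \<le> r" unfolding r_def by (rule norm_exp)
      hence B: "norm ?B \<le> 1" using r by (simp add: norm_divide divide_le_eq_1)
      have "(1 + ?y n) ^ n - exp x = of_real (r ^ n) * (?A ^ n - ?B ^ n)"
        using r en by (simp add: power_divide right_diff_distrib)
      hence "norm ((1 + ?y n) ^ n - exp x) = r ^ n * norm (?A ^ n - ?B ^ n)"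
        using r by (simp add: norm_mult norm_power)
      also have "\<dots> \<le> r ^ n * (of_nat n * norm (?A - ?B))"
        using r by (intro mult_left_mono norm_power_diff A B) auto
      also have "norm (?A - ?B) = norm (1 + ?y n - exp (?y n)) / r"
        using r by (simp add: diff_divide_distrib[symmetric] norm_divide)
      also have "\<dots> \<le> norm (1 + ?y n - exp (?y n)) / 1"
        using r by (intro divide_left_mono) auto
      also have "of_nat n * (norm (1 + ?y n - exp (?y n)) / 1) = cmod (x * ((exp (?y n) - 1) / ?y n - 1))"
      proof -
        have "x * ((exp (?y n) - 1) / ?y n - 1) = - (of_nat n * (1 + ?y n - exp (?y n)))"
          using elim False by (simp add: field_simps)
        thus ?thesis by (simp only: norm_minus_cancel norm_mult norm_of_nat div_by_1)
      qed
      finally show ?case using r by (simp add: rn mult_left_mono)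
    qed
  qed
  from tendsto_add[OF this tendsto_const, of "exp x"] show ?thesis by simp
qed simp

text \<open>Both sides are polynomials in \<open>y\<close> of degree at most k that agree at the k +
  1 points 0 and \<open>inverse (w ^ i)\<close>.\<close>

lemma prod_roots_of_unity:
  fixes y :: complex
  assumes k: "k \<ge> 1"
  defines "w \<equiv> cis (2 * pi / real k)"
  shows "(\<Prod>i<k. 1 - w ^ i * y) = 1 - y ^ k"
proof -
  have wi: "w ^ i = cis (2 * pi * real i / real k)" for i unfolding w_def Complex.DeMoivre by (simp add: mult_ac)
  have wk: "w ^ k = 1" unfolding wi using k by simp
  define A where "A = insert 0 ((\<lambda>i. inverse (w ^ i)) ` {..<k})"
  have inj: "inj_on (\<lambda>i. w ^ i) {..<k}"
    using Complex.bij_betw_roots_unity[of k] k unfolding wi bij_betw_def by (simp add: mult_ac)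
  have wz: "w \<noteq> 0" by (simp add: w_def)
  hence w0: "w ^ i \<noteq> 0" for i by simp
  have inj': "inj_on (\<lambda>i. inverse (w ^ i)) {..<k}"
    using inj unfolding inj_on_def by auto
  have card: "card A = Suc k" unfolding A_def using wz by (subst card_insert_disjoint) (auto simp: card_image[OF inj'])
  define p where "p = (\<Prod>i<k. [:1, - (w ^ i):])"
  define q where "q = (1 - monom 1 k :: complex poly)"
  have pe: "poly p x = (\<Prod>i<k. 1 - w ^ i * x)" for x by (simp add: p_def poly_prod mult.commute)
  have qe: "poly q x = 1 - x ^ k" for x by (simp add: q_def poly_monom)
  have "p = q"
  proof (rule poly_eqI_degree[of A])
    fix x assume "x \<in> A"
    then consider "x = 0" | i where "i < k" "x = inverse (w ^ i)" by (auto simp: A_def)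
    thus "poly p x = poly q x"
    proof cases
      case 1 thus ?thesis using k by (simp add: pe qe)
    next
      case (2 i)
      have "w ^ i * x = 1" using 2(2) wz by simp
      hence "(\<Prod>i<k. 1 - w ^ i * x) = 0" using 2(1) by (intro prod_zero bexI[of _ i]) auto
      moreover have "x ^ k = 1"
      proof -
        have "(w ^ i) ^ k = (w ^ k) ^ i" by (simp only: power_mult[symmetric] mult.commute)
        thus ?thesis using wk 2(2) by (simp add: power_inverse)
      qed
      ultimately show ?thesis by (simp add: pe qe)
    qed
  next
    have "degree p \<le> (\<Sum>i<k. degree [:1, - (w ^ i):])" unfolding p_def by (rule degree_prod_sum_le[unfolded o_def]) simp
    also have "\<dots> \<le> (\<Sum>i<k. 1)" by (intro sum_mono) auto
    finally show "degree p < card A" by (simp add: card)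
    have "degree q \<le> k" unfolding q_def by (intro degree_diff_le) (auto simp: degree_monom_le)
    thus "degree q < card A" by (simp add: card)
  qed
  thus ?thesis using pe[of y] qe[of y] by simp
qed

lemma sum_roots_of_unity:
  assumes k: "k \<ge> 1"
  defines "w \<equiv> cis (2 * pi / real k)"
  shows "(\<Sum>i<k. (w ^ i) ^ l) = (if k dvd l then of_nat k else 0)"
proof -
  have e: "(w ^ i) ^ l = (w ^ l) ^ i" for i by (simp add: power_mult[symmetric] mult.commute)
  have wl: "w ^ l = exp (2 * of_real pi * \<i> * of_nat l / of_nat k)"
    unfolding w_def Complex.DeMoivre unfolding cis_conv_exp by (rule arg_cong[where f=exp]) (simp add: field_simps)
  have one: "w ^ l = 1 \<longleftrightarrow> k dvd l" unfolding wl using complex_root_unity_eq_1[OF k, of l] by simp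
  have wk: "(w ^ l) ^ k = 1"
  proof -
    have "w ^ k = 1" unfolding w_def Complex.DeMoivre using k by simp
    thus ?thesis by (metis power_mult mult.commute power_one)
  qed
  show ?thesis
    unfolding e using one wk by (auto simp: sum_gp_strict)
qed

text \<open>The exponent is purely imaginary, so the loop is unitary; each entry is u / cnj u with
  the nowhere vanishing u = exp (F c), as \<open>tdet_Blaschke\<close> requires.\<close>

definition dexp :: "(2 \<Rightarrow> complex \<Rightarrow> complex) \<Rightarrow> mfun" where
  "dexp F = dgv (\<lambda>c z. exp (F c z - cnj (F c z)))"

lemma cmod_exp_diff_cnj: "cmod (exp (w - cnj w)) = 1"
  by simp

lemma loop_dexp:
  assumes "\<And>c. an (F c)"
  shows "loop (dexp F)"
  unfolding dexp_def
  by (rule loop_dgv, intro continuous_on_exp continuous_on_diff continuous_on_cnj an_continuous assms) simp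

lemma sum_periodic:
  fixes g :: "nat \<Rightarrow> complex"
  assumes "\<And>i. g (i + k) = g i"
  shows "sum g {..<n * k} = of_nat n * sum g {..<k}"
proof -
  have per: "g (i + m * k) = g i" for i m
  proof (induction m)
    case (Suc m)
    have "g (i + Suc m * k) = g ((i + m * k) + k)" by (simp add: algebra_simps)
    thus ?case using assms Suc by simp
  qed simp
  have "sum g {m * k..<m * k + k} = sum g {..<k}" for m
    using sum.shift_bounds_nat_ivl[of g 0 "m * k" k] by (simp add: per add.commute lessThan_atLeast0)
  thus ?thesis using sum.nat_group[of g k n] by simp
qed

lemma prod_periodic:
  fixes g :: "nat \<Rightarrow> complex"
  assumes "\<And>i. g (i + k) = g i"
  shows "prod g {..<n * k} = prod g {..<k} ^ n"
proof -
  have per: "g (i + m * k) = g i" for i m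
  proof (induction m)
    case (Suc m)
    have "g (i + Suc m * k) = g ((i + m * k) + k)" by (simp add: algebra_simps)
    thus ?case using assms Suc by simp
  qed simp
  have "prod g {m * k..<m * k + k} = prod g {..<k}" for m
    using prod.shift_bounds_nat_ivl[of g 0 "m * k" k] by (simp add: per add.commute lessThan_atLeast0)
  thus ?thesis using prod.nat_group[of g k n] by simp
qed

text \<open>After N factors u has become u q_N. Its value at 0 stays u(0), and |q_N(cnj a_N)|^2
  together with 1 - |a_N|^2 supplies the new row, column and corner of the double product. The
  identity is a complex one because the single factors of that product need not be real.\<close>

lemma tdet_Blaschke_product:
  fixes \<phi> :: "2 \<Rightarrow> complex \<Rightarrow> complex" and a :: "nat \<Rightarrow> complex" and c :: 2
  assumes \<phi>c: "\<And>d. continuous_on (sphere 0 1) (\<phi> d)" and \<phi>n: "\<And>d z. z \<in> sphere 0 1 \<Longrightarrow> cmod (\<phi> d z) = 1"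
    and u: "an u" and u0: "fc u 0 \<noteq> 0" and unz: "\<And>z. z \<in> sphere 0 1 \<Longrightarrow> u z \<noteq> 0"
    and \<phi>u: "\<And>z. z \<in> sphere 0 1 \<Longrightarrow> \<phi> c z = u z / cnj (u z)" and a: "\<And>i. cmod (a i) < 1"
  defines "q \<equiv> \<lambda>N z. \<Prod>i<N. 1 - a i * z"
  defines "\<psi> \<equiv> \<lambda>N d z. if d = c then \<phi> c z * (q N z / cnj (q N z)) else \<phi> d z"
  shows "loop (dgv (\<psi> N))"
    and "of_real (tdet (dgv (\<psi> N))) = (\<Prod>i<N. \<Prod>j<N. 1 - a i * cnj (a j)) *
       of_real ((cmod (\<Prod>i<N. ev u (cnj (a i)) / fc u 0))\<^sup>2) * of_real (tdet (dgv \<phi>))"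
proof -
  have a': "cmod (cnj (a i)) < 1" for i using a by simp
  have l1: "an (\<lambda>z. 1 - a i * z)" and ev1: "cmod y < 1 \<Longrightarrow> ev (\<lambda>z. 1 - a i * z) y = 1 - a i * y" for i y
  proof -
    have "an (\<lambda>z. 1 - a i * z ^ 1)" by (intro an_diff an_const an_power_id)
    thus "an (\<lambda>z. 1 - a i * z)" by simp
    show "ev (\<lambda>z. 1 - a i * z) y = 1 - a i * y" if "cmod y < 1"
      using ev_diff[OF an_Ls[OF an_const] an_Ls[OF an_power_id] that, of 1 "a i" 1] ev_power_id[of "a i" 1 y]
      by (simp add: ev_const)
  qed
  have qS: "q (Suc N) = (\<lambda>z. q N z * (1 - a N * z))" for N by (simp add: q_def)
  have q0: "q 0 = (\<lambda>z. 1)" by (simp add: q_def)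
  have anq: "an (q N)" for N
  proof (induction N)
    case (Suc N) thus ?case unfolding qS by (intro an_mult l1)
  qed (simp add: q0 an_const)
  have evq: "ev (q N) y = (\<Prod>i<N. 1 - a i * y)" if "cmod y < 1" for N y
  proof (induction N)
    case (Suc N) thus ?case unfolding qS by (simp add: ev_mult[OF anq l1 that] ev1[OF that])
  qed (simp add: q0 ev_const)
  have qnz: "q N z \<noteq> 0" if "z \<in> sphere 0 1" for N z
    using one_minus_az_nonzero[OF a that] by (simp add: q_def)
  have loop: "loop (dgv (\<psi> N))" for N
  proof (rule loop_dgv)
    show "continuous_on (sphere 0 1) (\<psi> N d)" for d
      using \<phi>c qnz an_continuous[OF anq[of N]] by (cases "d = c") (auto simp: \<psi>_def intro!: continuous_intros)
    show "cmod (\<psi> N d z) = 1" if "z \<in> sphere 0 1" for d z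
      using \<phi>n[OF that] qnz[OF that] by (simp add: \<psi>_def norm_mult norm_divide)
  qed
  show "loop (dgv (\<psi> N))" by (rule loop)
  show "of_real (tdet (dgv (\<psi> N))) = (\<Prod>i<N. \<Prod>j<N. 1 - a i * cnj (a j)) *
       of_real ((cmod (\<Prod>i<N. ev u (cnj (a i)) / fc u 0))\<^sup>2) * of_real (tdet (dgv \<phi>))"
  proof (induction N)
    case 0
    have "\<psi> 0 = \<phi>" by (auto simp: \<psi>_def q0 fun_eq_iff)
    thus ?case by simp
  next
    case (Suc N)
    let ?u = "\<lambda>z. u z * q N z"
    let ?p = "\<Prod>i<N. 1 - a i * cnj (a N)"
    have anu: "an ?u" by (intro an_mult u anq)
    have fu: "fc ?u 0 = fc u 0"
      using ev_mult[OF u anq, of 0] evq[of 0] by (simp add: ev_0)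
    have eu: "ev ?u (cnj (a N)) = ev u (cnj (a N)) * ?p"
      by (simp add: ev_mult[OF u anq a'] evq[OF a'])
    have "tdet (dgv (\<psi> (Suc N))) = (1 - (cmod (a N))\<^sup>2) * (cmod (ev ?u (cnj (a N)) / fc ?u 0))\<^sup>2 * tdet (dgv (\<psi> N))"
    proof (rule tdet_Blaschke[OF a refl loop anu])
      fix z :: complex assume z: "z \<in> sphere 0 1"
      show "\<psi> N c z = ?u z / cnj (?u z)" using \<phi>u[OF z] by (simp add: \<psi>_def)
      show "?u z \<noteq> 0" using unz[OF z] qnz[OF z] by simp
      show "\<psi> (Suc N) d z = (if d = c then \<psi> N c z * ((1 - a N * z) / cnj (1 - a N * z)) else \<psi> N d z)" for d
        by (simp add: \<psi>_def qS)
    qed (use u0 fu in simp)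
    also have "\<dots> = (1 - (cmod (a N))\<^sup>2) * (cmod ?p)\<^sup>2 * (cmod (ev u (cnj (a N)) / fc u 0))\<^sup>2 * tdet (dgv (\<psi> N))"
      unfolding eu fu by (simp add: norm_mult norm_divide power_mult_distrib power_divide)
    finally have t: "tdet (dgv (\<psi> (Suc N))) = \<dots>" .
    have "complex_of_real ((1 - (cmod (a N))\<^sup>2) * (cmod ?p)\<^sup>2) = (1 - a N * cnj (a N)) * (?p * cnj ?p)"
      by (simp only: of_real_mult of_real_diff complex_norm_square of_real_1)
    also have "cnj ?p = (\<Prod>j<N. 1 - a N * cnj (a j))" by (simp add: mult.commute)
    also have "(1 - a N * cnj (a N)) * (?p * (\<Prod>j<N. 1 - a N * cnj (a j))) * (\<Prod>i<N. \<Prod>j<N. 1 - a i * cnj (a j)) =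
        (\<Prod>i<Suc N. \<Prod>j<Suc N. 1 - a i * cnj (a j))"
      by (simp add: prod.distrib)
    finally have e: "complex_of_real ((1 - (cmod (a N))\<^sup>2) * (cmod ?p)\<^sup>2) * (\<Prod>i<N. \<Prod>j<N. 1 - a i * cnj (a j)) =
        (\<Prod>i<Suc N. \<Prod>j<Suc N. 1 - a i * cnj (a j))"
      by (simp only: mult.assoc)
    show ?case
      unfolding t of_real_mult[of _ "tdet (dgv (\<psi> N))"] Suc e[symmetric]
      by (simp add: norm_mult norm_divide power_mult_distrib power_divide mult_ac)
  qed
qed

text \<open>Summation over the k-th roots of unity keeps only coefficients whose index is divisible
  by k: index 0 is subtracted, k gives the main term, and the rest, from 2k on, is bounded by a
  geometric series.\<close>

lemma ev_root_sum_bound: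
  assumes F: "Ls F" and k: "k \<ge> 1" and \<alpha>: "cmod \<alpha> < 1"
  defines "w \<equiv> cis (2 * pi / real k)"
  shows "cmod ((\<Sum>i<k. ev F (cnj (\<alpha> * w ^ i)) - fc F 0) - of_nat k * fc F (int k) * cnj \<alpha> ^ k) \<le>
    real k * sn F * cmod \<alpha> ^ (2 * k) / (1 - cmod \<alpha>)"
proof -
  define G where "G l = (if k dvd l then of_nat k else 0) * (fc F (int l) * cnj \<alpha> ^ l)" for l
  have y: "cmod (cnj (\<alpha> * w ^ i)) < 1" for i using \<alpha> by (simp add: norm_mult norm_power w_def)
  have Gs: "(\<Sum>i<k. fc F (int l) * cnj (\<alpha> * w ^ i) ^ l) = G l" for l
  proof -
    have "(\<Sum>i<k. fc F (int l) * cnj (\<alpha> * w ^ i) ^ l) = cnj (\<Sum>i<k. (w ^ i) ^ l) * (fc F (int l) * cnj \<alpha> ^ l)"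
      by (simp add: sum_distrib_left sum_distrib_right power_mult_distrib mult_ac)
    also have "(\<Sum>i<k. (w ^ i) ^ l) = (if k dvd l then of_nat k else 0)"
      unfolding w_def by (rule sum_roots_of_unity[OF k])
    finally show ?thesis by (simp add: G_def)
  qed
  have bound: "cmod (G l) \<le> real k * sn F * cmod \<alpha> ^ l" for l
  proof -
    have "cmod (G l) \<le> real k * (sn F * cmod \<alpha> ^ l)"
      using fc_norm_le[OF F, of "int l"] by (auto simp: G_def norm_mult norm_power intro!: mult_left_mono mult_right_mono)
    thus ?thesis by (simp add: mult.assoc)
  qed
  have sg: "summable (\<lambda>l. real k * sn F * cmod \<alpha> ^ l)" using \<alpha> by (intro summable_mult summable_geometric) simp
  have G: "summable G" by (rule summable_comparison_test'[OF sg bound])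
  have "(\<Sum>i<k. ev F (cnj (\<alpha> * w ^ i))) = (\<Sum>l. G l)"
    unfolding ev_def Gs[symmetric] by (rule suminf_sum[symmetric]) (rule ev_summable[OF F y])
  also have "\<dots> = (\<Sum>l. G (l + 2 * k)) + (\<Sum>l<2 * k. G l)"
    by (rule suminf_split_initial_segment[OF G])
  also have "(\<Sum>l<2 * k. G l) = (\<Sum>l\<in>{0, k}. G l)"
  proof (rule sum.mono_neutral_right)
    show "\<forall>l\<in>{..<2 * k} - {0, k}. G l = 0"
    proof
      fix l assume l: "l \<in> {..<2 * k} - {0, k}"
      have "\<not> k dvd l"
      proof
        assume "k dvd l"
        then obtain m where m: "l = k * m" by (elim dvdE)
        hence "m < 2" using l k by auto
        hence "m = 0 \<or> m = 1" by auto
        thus False using l m by auto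
      qed
      thus "G l = 0" by (simp add: G_def)
    qed
  qed (use k in auto)
  also have "\<dots> = of_nat k * fc F 0 + of_nat k * fc F (int k) * cnj \<alpha> ^ k"
    using k by (simp add: G_def)
  finally have "(\<Sum>i<k. ev F (cnj (\<alpha> * w ^ i)) - fc F 0) - of_nat k * fc F (int k) * cnj \<alpha> ^ k = (\<Sum>l. G (l + 2 * k))"
    by (simp add: sum_subtractf)
  also have "cmod \<dots> \<le> (\<Sum>l. real k * sn F * cmod \<alpha> ^ (l + 2 * k))"
  proof (rule order_trans[OF summable_norm suminf_le])
    show s: "summable (\<lambda>l. real k * sn F * cmod \<alpha> ^ (l + 2 * k))" by (rule summable_ignore_initial_segment[OF sg])
    show "summable (\<lambda>l. norm (G (l + 2 * k)))"
      by (rule summable_comparison_test'[OF s]) (use bound in auto)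
    thus "summable (\<lambda>l. norm (G (l + 2 * k)))" .
  qed (rule bound)
  also have "\<dots> = real k * sn F * cmod \<alpha> ^ (2 * k) / (1 - cmod \<alpha>)"
  proof -
    have "(\<Sum>l. real k * sn F * cmod \<alpha> ^ (l + 2 * k)) = (\<Sum>l. (real k * sn F * cmod \<alpha> ^ (2 * k)) * cmod \<alpha> ^ l)"
      by (simp add: power_add mult_ac)
    also have "\<dots> = (real k * sn F * cmod \<alpha> ^ (2 * k)) * (\<Sum>l. cmod \<alpha> ^ l)"
      using \<alpha> by (intro suminf_mult summable_geometric) simp
    finally show ?thesis using \<alpha> by (simp add: suminf_geometric)
  qed
  finally show ?thesis .
qed

text \<open>The factor \<open>exp (- \<gamma> z\<^sup>k)\<close> is the limit of the polynomials \<open>(1 - \<gamma> z\<^sup>k / n)\<^sup>n\<close>, to which the product formula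
  applies; only semicontinuity is available in the limit, hence an inequality.\<close>
lemma tdet_dexp_monomial_le:
  fixes F :: "2 \<Rightarrow> complex \<Rightarrow> complex" and \<gamma> :: complex and c :: 2
  assumes F: "\<And>d. an (F d)" and k: "k \<ge> 1"
  shows "exp (- real k * (cmod \<gamma>)\<^sup>2 + 2 * real k * Re (fc (F c) (int k) * cnj \<gamma>)) * tdet (dexp F) \<le>
    tdet (dexp (\<lambda>d z. if d = c then F c z - \<gamma> * z ^ k else F d z))"
proof -
  let ?f = "F c"
  \<comment> \<open>The shift ensures |\<gamma>| < n, so that the roots \<open>a\<close> below lie
    in the open disc.\<close>
  define N0 where "N0 = nat \<lceil>cmod \<gamma>\<rceil> + 1"
  define n where "n m = m + N0" for m :: nat
  have n: "cmod \<gamma> < real (n m)" "n m \<ge> 1" for m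
  proof -
    have "cmod \<gamma> \<le> real_of_int \<lceil>cmod \<gamma>\<rceil>" by (rule le_of_int_ceiling)
    also have "\<dots> \<le> real (nat \<lceil>cmod \<gamma>\<rceil>)" by simp
    finally show "cmod \<gamma> < real (n m)" unfolding n_def N0_def of_nat_add by linarith
  qed (simp add: n_def N0_def)
  have nlim: "filterlim n at_top sequentially"
    unfolding n_def by (rule filterlim_add_const_nat_at_top)
  have "\<exists>\<alpha>. \<gamma> / of_nat (n m) = \<alpha> ^ k" for m
    using exists_complex_root[of k "\<gamma> / of_nat (n m)"] k by (metis not_one_le_zero)
  then obtain \<alpha> where \<alpha>k: "\<And>m. \<alpha> m ^ k = \<gamma> / of_nat (n m)" by metis
  define w where "w = cis (2 * pi / real k)"
  have wk: "w ^ k = 1" unfolding w_def Complex.DeMoivre using k by simp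
  have wn: "cmod w = 1" by (simp add: w_def)
  have \<alpha>kn: "cmod (\<alpha> m) ^ k = cmod \<gamma> / real (n m)" for m
    using arg_cong[OF \<alpha>k[of m], of cmod] by (simp add: norm_power norm_divide)
  have \<alpha>1: "cmod (\<alpha> m) < 1" for m
  proof (rule ccontr)
    assume "\<not> cmod (\<alpha> m) < 1"
    hence "1 \<le> cmod (\<alpha> m) ^ k" by (intro one_le_power) simp
    thus False using n[of m] by (simp add: \<alpha>kn)
  qed
  \<comment> \<open>The k-th roots of \<gamma> / n, each repeated n times, are the inverse zeros of
    (1 - \<gamma> z^k / n)^n; periodicity in \<open>i\<close> encodes the repetition.\<close>
  define a where "a m i = \<alpha> m * w ^ i" for m i
  have a1: "cmod (a m i) < 1" for m i using \<alpha>1 wn by (simp add: a_def norm_mult norm_power)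
  have aper: "a m (i + k) = a m i" for m i by (simp add: a_def power_add wk)
  have ak: "a m i ^ k = \<gamma> / of_nat (n m)" for m i
  proof -
    have "(w ^ i) ^ k = (w ^ k) ^ i" by (simp only: power_mult[symmetric] mult.commute)
    thus ?thesis by (simp add: a_def power_mult_distrib \<alpha>k wk)
  qed
  define M where "M m = n m * k" for m
  have q: "(\<Prod>i<M m. 1 - a m i * y) = (1 - \<gamma> / of_nat (n m) * y ^ k) ^ n m" for m y
  proof -
    have "(\<Prod>i<M m. 1 - a m i * y) = (\<Prod>i<k. 1 - a m i * y) ^ n m"
      unfolding M_def by (rule prod_periodic) (simp add: aper)
    also have "(\<Prod>i<k. 1 - a m i * y) = (\<Prod>i<k. 1 - w ^ i * (\<alpha> m * y))" by (simp add: a_def mult_ac)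
    also have "\<dots> = 1 - (\<alpha> m * y) ^ k" unfolding w_def by (rule prod_roots_of_unity[OF k])
    finally show ?thesis by (simp add: power_mult_distrib \<alpha>k)
  qed
  define \<phi> where "\<phi> d z = exp (F d z - cnj (F d z))" for d z
  define u where "u z = exp (?f z)" for z
  define S where "S m = of_nat (n m) * (\<Sum>i<k. ev ?f (cnj (a m i)) - fc ?f 0)" for m
  define \<psi> where "\<psi> m d z = (if d = c then \<phi> c z * ((\<Prod>i<M m. 1 - a m i * z) / cnj (\<Prod>i<M m. 1 - a m i * z)) else \<phi> d z)" for m d z
  have u0: "fc u 0 = exp (fc ?f 0)" unfolding u_def[abs_def] using an_exp(2)[OF F, of 0 c] by (simp add: ev_0)
  have anu: "an u" unfolding u_def[abs_def] by (rule an_exp(1)[OF F])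
  have \<phi>c: "continuous_on (sphere 0 1) (\<phi> d)" for d
    unfolding \<phi>_def[abs_def] by (intro continuous_on_exp continuous_on_diff continuous_on_cnj an_continuous F)
  have \<phi>n: "cmod (\<phi> d z) = 1" for d z unfolding \<phi>_def by (rule cmod_exp_diff_cnj)
  have \<phi>u: "\<phi> c z = u z / cnj (u z)" for z by (simp add: \<phi>_def u_def exp_diff exp_cnj)
  have dF: "dexp F = dgv \<phi>" by (simp add: dexp_def \<phi>_def[abs_def])
  have un0: "fc u 0 \<noteq> 0" "\<And>z. u z \<noteq> 0" by (simp_all add: u0) (simp add: u_def)
  note B = tdet_Blaschke_product[where \<phi> = \<phi> and u = u and c = c and a = "a m" for m, OF \<phi>c \<phi>n anu un0 \<phi>u a1]
  have lpsi: "loop (dgv (\<psi> m))" for m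
    using B(1)[of m "M m"] unfolding \<psi>_def[abs_def] by simp
  have evu: "(\<Prod>i<M m. ev u (cnj (a m i)) / fc u 0) = exp (S m)" for m
  proof -
    have "ev u (cnj (a m i)) / fc u 0 = exp (ev ?f (cnj (a m i)) - fc ?f 0)" for i
      unfolding u0 exp_diff unfolding u_def[abs_def] using an_exp(2)[OF F, of "cnj (a m i)" c] a1 by simp
    hence "(\<Prod>i<M m. ev u (cnj (a m i)) / fc u 0) = exp (\<Sum>i<M m. ev ?f (cnj (a m i)) - fc ?f 0)"
      by (simp add: exp_sum)
    also have "(\<Sum>i<M m. ev ?f (cnj (a m i)) - fc ?f 0) = S m"
      unfolding M_def S_def by (rule sum_periodic) (simp add: aper)
    finally show ?thesis .
  qed
  \<comment> \<open>The inner product is the same polynomial evaluated at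
    \<open>cnj (a m j)\<close>, hence (1 - |\<gamma>|^2 / n^2)^n for each of the n k indices
    \<open>j\<close>. The total tends to exp(-k |\<gamma>|^2).\<close>
  have E: "(\<Prod>i<M m. \<Prod>j<M m. 1 - a m i * cnj (a m j)) = of_real (((1 + (- (cmod \<gamma>)\<^sup>2) / real (n m * n m)) ^ (n m * n m)) ^ k)" for m
  proof -
    have "(\<Prod>i<M m. \<Prod>j<M m. 1 - a m i * cnj (a m j)) = (\<Prod>j<M m. \<Prod>i<M m. 1 - a m i * cnj (a m j))"
      by (rule prod.swap)
    also have "\<dots> = (\<Prod>j<M m. (1 - \<gamma> / of_nat (n m) * cnj (\<gamma> / of_nat (n m))) ^ n m)"
      unfolding q complex_cnj_power[symmetric] ak ..
    also have "1 - \<gamma> / of_nat (n m) * cnj (\<gamma> / of_nat (n m)) = of_real (1 + (- (cmod \<gamma>)\<^sup>2) / real (n m * n m))"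
      by (simp add: complex_norm_square del: of_real_power)
    finally show ?thesis by (simp add: M_def power_mult mult_ac flip: power_mult)
  qed
  define C where "C m = ((1 + (- (cmod \<gamma>)\<^sup>2) / real (n m * n m)) ^ (n m * n m)) ^ k * (exp (Re (S m)))\<^sup>2 * tdet (dexp F)" for m
  have tC: "tdet (dgv (\<psi> m)) = C m" for m
  proof -
    have "complex_of_real (tdet (dgv (\<psi> m))) = (\<Prod>i<M m. \<Prod>j<M m. 1 - a m i * cnj (a m j)) *
        of_real ((cmod (\<Prod>i<M m. ev u (cnj (a m i)) / fc u 0))\<^sup>2) * of_real (tdet (dgv \<phi>))"
      using B(2)[of m "M m"] unfolding \<psi>_def[abs_def] by simp
    also have "\<dots> = of_real (C m)" unfolding E evu C_def dF by simp
    finally show ?thesis by (simp only: of_real_eq_iff)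
  qed
  have \<alpha>0: "(\<lambda>m. cmod \<gamma> / real (n m)) \<longlonglongrightarrow> 0"
    by (intro tendsto_divide_0[OF tendsto_const] filterlim_at_top_imp_at_infinity
         filterlim_compose[OF filterlim_real_sequentially nlim])
  \<comment> \<open>The error in \<open>ev_root_sum_bound\<close> is of order |\<alpha>|^(2k) =
    (|\<gamma>| / n)^2 and stays small after multiplication by n.\<close>
  have Slim: "S \<longlonglongrightarrow> of_nat k * fc ?f (int k) * cnj \<gamma>"
  proof -
    have "(\<lambda>m. S m - of_nat k * fc ?f (int k) * cnj \<gamma>) \<longlonglongrightarrow> 0"
    proof (rule Lim_null_comparison)
      show "(\<lambda>m. real k * sn ?f * cmod \<gamma> * (cmod \<gamma> / real (n m)) / (1 - root k (cmod \<gamma> / real (n m)))) \<longlonglongrightarrow> 0"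
      proof -
        have "(\<lambda>m. root k (cmod \<gamma> / real (n m))) \<longlonglongrightarrow> root k 0" by (intro tendsto_real_root \<alpha>0)
        hence "(\<lambda>m. 1 - root k (cmod \<gamma> / real (n m))) \<longlonglongrightarrow> 1 - 0" by (intro tendsto_intros) simp
        from tendsto_divide[OF tendsto_mult[OF tendsto_const \<alpha>0, of "real k * sn ?f * cmod \<gamma>"] this] show ?thesis by simp
      qed
      show "\<forall>\<^sub>F m in sequentially. norm (S m - of_nat k * fc ?f (int k) * cnj \<gamma>) \<le>
          real k * sn ?f * cmod \<gamma> * (cmod \<gamma> / real (n m)) / (1 - root k (cmod \<gamma> / real (n m)))"
      proof (intro always_eventually allI)
        fix m
        have nz: "real (n m) > 0" using n(2)[of m] by simp
        have r: "root k (cmod \<gamma> / real (n m)) = cmod (\<alpha> m)"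
          using k by (simp add: \<alpha>kn[symmetric] real_root_power_cancel)
        have ck: "cnj (\<alpha> m) ^ k = cnj \<gamma> / of_nat (n m)"
          by (simp only: complex_cnj_power[symmetric] \<alpha>k complex_cnj_divide complex_cnj_of_nat)
        have "of_nat (n m) * (of_nat k * fc ?f (int k) * cnj (\<alpha> m) ^ k) = of_nat k * fc ?f (int k) * cnj \<gamma>"
          unfolding ck using nz by simp
        hence "S m - of_nat k * fc ?f (int k) * cnj \<gamma> =
            of_nat (n m) * ((\<Sum>i<k. ev ?f (cnj (a m i)) - fc ?f 0) - of_nat k * fc ?f (int k) * cnj (\<alpha> m) ^ k)"
          unfolding S_def by (simp only: right_diff_distrib)
        hence "norm (S m - of_nat k * fc ?f (int k) * cnj \<gamma>) =
            real (n m) * cmod ((\<Sum>i<k. ev ?f (cnj (a m i)) - fc ?f 0) - of_nat k * fc ?f (int k) * cnj (\<alpha> m) ^ k)"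
          by (simp only: norm_mult norm_of_nat)
        also have "\<dots> \<le> real (n m) * (real k * sn ?f * cmod (\<alpha> m) ^ (2 * k) / (1 - cmod (\<alpha> m)))"
          unfolding a_def w_def by (intro mult_left_mono ev_root_sum_bound an_Ls F k \<alpha>1) simp
        also have "cmod (\<alpha> m) ^ (2 * k) = (cmod \<gamma> / real (n m)) * (cmod \<gamma> / real (n m))"
          by (simp only: mult_2 power_add \<alpha>kn)
        finally show "norm (S m - of_nat k * fc ?f (int k) * cnj \<gamma>) \<le>
            real k * sn ?f * cmod \<gamma> * (cmod \<gamma> / real (n m)) / (1 - root k (cmod \<gamma> / real (n m)))"
          unfolding r using nz by (simp add: mult_ac)
      qed
    qed
    from tendsto_add[OF this tendsto_const, of "of_nat k * fc ?f (int k) * cnj \<gamma>"] show ?thesis by simp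
  qed
  have "filterlim (\<lambda>m. n m * n m) at_top sequentially"
    by (rule filterlim_at_top_mono[OF nlim]) (use n(2) in \<open>auto intro!: always_eventually\<close>)
  from filterlim_compose[OF tendsto_exp_limit_sequentially this]
  have e1: "(\<lambda>m. (1 + (- (cmod \<gamma>)\<^sup>2) / real (n m * n m)) ^ (n m * n m)) \<longlonglongrightarrow> exp (- (cmod \<gamma>)\<^sup>2)" .
  have "C \<longlonglongrightarrow> exp (- (cmod \<gamma>)\<^sup>2) ^ k * (exp (Re (of_nat k * fc ?f (int k) * cnj \<gamma>)))\<^sup>2 * tdet (dexp F)"
    unfolding C_def[abs_def] by (intro tendsto_mult tendsto_power e1 tendsto_exp tendsto_Re Slim tendsto_const)
  also have "exp (- (cmod \<gamma>)\<^sup>2) ^ k * (exp (Re (of_nat k * fc ?f (int k) * cnj \<gamma>)))\<^sup>2 =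
      exp (- real k * (cmod \<gamma>)\<^sup>2 + 2 * real k * Re (fc ?f (int k) * cnj \<gamma>))"
  proof -
    have "exp (- (cmod \<gamma>)\<^sup>2) ^ k = exp (- real k * (cmod \<gamma>)\<^sup>2)" by (simp add: exp_of_nat_mult[symmetric])
    moreover have "(exp (Re (of_nat k * fc ?f (int k) * cnj \<gamma>)))\<^sup>2 = exp (2 * real k * Re (fc ?f (int k) * cnj \<gamma>))"
      by (simp add: power2_eq_square exp_add[symmetric] mult.assoc)
    ultimately show ?thesis unfolding exp_add by (simp only:)
  qed
  finally have Clim: "C \<longlonglongrightarrow> exp (- real k * (cmod \<gamma>)\<^sup>2 + 2 * real k * Re (fc ?f (int k) * cnj \<gamma>)) * tdet (dexp F)" .
  let ?F' = "\<lambda>d z. if d = c then F c z - \<gamma> * z ^ k else F d z"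
  have anF': "an (?F' d)" for d
    using F an_diff[OF F an_power_id] by (cases "d = c") auto
  show ?thesis
  proof (rule tdet_upper_semicontinuous[OF lpsi loop_dexp[OF anF'] _ Clim])
    show "C m \<le> tdet (dgv (\<psi> m))" for m by (simp add: tC)
    fix z :: complex and i j :: 2 assume z: "z \<in> sphere 0 1"
    have qlim: "(\<lambda>m. \<Prod>i<M m. 1 - a m i * z) \<longlonglongrightarrow> exp (- \<gamma> * z ^ k)"
      using filterlim_compose[OF tendsto_one_plus_power_exp[of "- \<gamma> * z ^ k"] nlim]
      unfolding q by (simp add: field_simps)
    have "(\<lambda>m. \<psi> m d z) \<longlonglongrightarrow> exp (?F' d z - cnj (?F' d z))" for d
    proof (cases "d = c")
      case True
      have "(\<lambda>m. \<psi> m c z) \<longlonglongrightarrow> \<phi> c z * (exp (- \<gamma> * z ^ k) / cnj (exp (- \<gamma> * z ^ k)))"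
        unfolding \<psi>_def if_P[OF refl] by (intro tendsto_mult tendsto_const tendsto_divide tendsto_cnj qlim) simp
      also have "\<phi> c z * (exp (- \<gamma> * z ^ k) / cnj (exp (- \<gamma> * z ^ k))) = exp (?F' c z - cnj (?F' c z))"
        unfolding \<phi>_def exp_cnj exp_diff[symmetric] exp_add[symmetric] by (rule arg_cong[where f=exp]) simp
      finally show ?thesis using True by simp
    qed (simp add: \<psi>_def \<phi>_def)
    thus "(\<lambda>m. dgv (\<psi> m) z $ i $ j) \<longlonglongrightarrow> dexp ?F' z $ i $ j"
      unfolding dexp_def by (cases "i = j") (simp_all add: dgv_def)
  qed
qed

text \<open>A constant diagonal loop keeps the monomials orthonormal within the Hardy space, so all
  Gram matrices are the identity.\<close>

lemma tdet_const:
  assumes q: "\<And>d. cmod (q d) = 1"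
  shows "tdet (dgv (\<lambda>d z. q d)) = 1"
proof -
  have co: "Tmap (dgv (\<lambda>d z. q d)) (bas (k, d)) = (\<lambda>b. cnj (q d) * un (k, d) b)" if "(k, d) \<in> KP" for k d
  proof -
    have "(\<lambda>z. adj (dgv (\<lambda>d z. q d) z) *v bas (k, d) z) = (\<lambda>z. cnj (q d) *s bas (k, d) z)"
      by (auto simp: fun_eq_iff vec_eq_iff adj_dgv bas_def axis_def)
    thus ?thesis using that unfolding Tmap_def by (auto simp: co_scale co_bas res_def un_def fun_eq_iff)
  qed
  have g: "gram (\<lambda>b. Tmap (dgv (\<lambda>d z. q d)) (bas b)) b c = of_bool (b = c)" if bc: "b \<in> KP" "c \<in> KP" for b c
  proof -
    obtain k d l e where b: "b = (k, d)" "c = (l, e)" by (cases b; cases c)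
    have "q d * cnj (q d) = 1" using q[of d] by (simp add: complex_norm_square[symmetric])
    moreover have "ip (un (k, d)) (un (l, e)) = of_bool (b = c)" by (auto simp: b ip_un_left un_apply)
    ultimately show ?thesis using bc unfolding gram_def b
      by (auto simp: co ip_scale_left ip_scale_right mult.commute)
  qed
  have "gdet (\<lambda>b. Tmap (dgv (\<lambda>d z. q d)) (bas b)) A = 1" if "finite A" "A \<subseteq> KP" for A
  proof -
    have "pdet (gram (\<lambda>b. Tmap (dgv (\<lambda>d z. q d)) (bas b))) A = pdet (\<lambda>b c. of_bool (b = c)) A"
      by (intro pdet_cong) (use that in \<open>auto simp: g subset_iff\<close>)
    also have "\<dots> = 1" using pdet_Sylvester[OF that(1), of "{}::unit set" "\<lambda>_ _. 0" "\<lambda>_ _. 0"] by simp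
    finally show ?thesis by (simp add: gdet_def)
  qed
  hence "1 \<le> tdet (dgv (\<lambda>d z. q d))" unfolding tdet_def vdet_def by (intro ldet_greatest) simp
  moreover have "tdet (dgv (\<lambda>d z. q d)) \<le> 1"
    by (intro tdet_le_1 loop_dgv q) simp
  ultimately show ?thesis by simp
qed

text \<open>Degrees are treated in increasing order, one component after the other. A monomial
  leaves the coefficients of other degrees and of the other component alone, so the linear terms
  involve the original coefficients of \<open>F\<close>.\<close>

lemma tdet_dexp_polynomial_le:
  fixes F :: "2 \<Rightarrow> complex \<Rightarrow> complex" and \<gamma> :: "2 \<Rightarrow> nat \<Rightarrow> complex"
  assumes F: "\<And>d. an (F d)"
  defines "G \<equiv> \<lambda>N d z. F d z - (\<Sum>k=1..N. \<gamma> d k * z ^ k)"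
  shows "exp (\<Sum>k=1..N. \<Sum>d\<in>UNIV. - real k * (cmod (\<gamma> d k))\<^sup>2 + 2 * real k * Re (fc (F d) (int k) * cnj (\<gamma> d k))) * tdet (dexp F)
    \<le> tdet (dexp (G N))"
proof (induction N)
  case 0 show ?case by (simp add: G_def)
next
  case (Suc N)
  define e where "e d k = - real k * (cmod (\<gamma> d k))\<^sup>2 + 2 * real k * Re (fc (F d) (int k) * cnj (\<gamma> d k))" for d k
  let ?k = "Suc N"
  have anS: "an (\<lambda>z. \<Sum>k=1..M. \<gamma> d k * z ^ k)" for d M
    by (intro an_sum an_power_id)
  have anG: "an (G M d)" for M d unfolding G_def by (intro an_diff F anS)
  have fcG: "fc (G N d) (int ?k) = fc (F d) (int ?k)" for d
  proof -
    have "fc (\<lambda>z. \<Sum>k=1..M. \<gamma> d k * z ^ k) (int ?k) = 0" if "M \<le> N" for M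
      using that
    proof (induction M)
      case (Suc M) thus ?case using fc_add[OF an_Ls[OF anS] an_Ls[OF an_power_id]] by (simp add: fc_power_id del: power_Suc)
    qed (simp add: fc_const)
    thus ?thesis unfolding G_def using fc_diff[OF an_Ls[OF F] an_Ls[OF anS]] by simp
  qed
  define G1 where "G1 d z = (if d = 1 then G N 1 z - \<gamma> 1 ?k * z ^ ?k else G N d z)" for d z
  have anG1: "an (G1 d)" for d
    unfolding G1_def using an_diff[OF anG an_power_id] anG by (cases "d = 1") (auto simp del: power_Suc)
  have 1: "exp (e 1 ?k) * tdet (dexp (G N)) \<le> tdet (dexp G1)"
    using tdet_dexp_monomial_le[of "G N" ?k "\<gamma> 1 ?k" 1, OF anG] unfolding fcG G1_def[abs_def] e_def by simp
  have G2: "G ?k = (\<lambda>d z. if d = 2 then G1 2 z - \<gamma> 2 ?k * z ^ ?k else G1 d z)"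
    unfolding G1_def G_def using exhaust_2 by (auto simp: fun_eq_iff)
  have fcG1: "fc (G1 2) (int ?k) = fc (F 2) (int ?k)" using fcG[of 2] by (simp add: G1_def[abs_def])
  have 2: "exp (e 2 ?k) * tdet (dexp G1) \<le> tdet (dexp (G ?k))"
    using tdet_dexp_monomial_le[of G1 ?k "\<gamma> 2 ?k" 2, OF anG1] unfolding fcG1 G2 e_def by simp
  have "exp (\<Sum>k=1..?k. \<Sum>d\<in>UNIV. e d k) * tdet (dexp F) =
      exp (e 2 ?k) * (exp (e 1 ?k) * (exp (\<Sum>k=1..N. \<Sum>d\<in>UNIV. e d k) * tdet (dexp F)))"
    by (simp add: UNIV_2 exp_add[symmetric] mult.assoc[symmetric] add_ac)
  also have "\<dots> \<le> exp (e 2 ?k) * (exp (e 1 ?k) * tdet (dexp (G N)))"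
    by (intro mult_left_mono Suc.IH[folded e_def]) auto
  also have "\<dots> \<le> exp (e 2 ?k) * tdet (dexp G1)" by (intro mult_left_mono 1) auto
  finally show ?case using 2 unfolding e_def by linarith
qed

lemma tdet_dexp_power_series:
  fixes F :: "2 \<Rightarrow> complex \<Rightarrow> complex" and f :: "2 \<Rightarrow> nat \<Rightarrow> complex"
  assumes an: "\<And>d. an (F d)" and fcF: "\<And>d k. fc (F d) (int k) = f d k"
    and sums: "\<And>d z. z \<in> sphere 0 1 \<Longrightarrow> (\<lambda>k. f d k * z ^ k) sums F d z"
    and S: "(\<lambda>k. real k * (\<Sum>d\<in>UNIV. (cmod (f d k))\<^sup>2)) sums S"
  shows "tdet (dexp F) = exp (- S)"
proof (rule antisym)
  define E where "E N = (\<Sum>k=1..N. real k * (\<Sum>d\<in>UNIV. (cmod (f d k))\<^sup>2))" for N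
  have "(\<lambda>N. \<Sum>k<Suc N. real k * (\<Sum>d\<in>UNIV. (cmod (f d k))\<^sup>2)) \<longlonglongrightarrow> S"
    using S unfolding sums_def by (rule LIMSEQ_Suc)
  moreover have "(\<Sum>k<Suc N. real k * (\<Sum>d\<in>UNIV. (cmod (f d k))\<^sup>2)) = E N" for N
    unfolding E_def lessThan_Suc_atMost atMost_atLeast0 by (simp add: sum.atLeast_Suc_atMost)
  ultimately have E: "E \<longlonglongrightarrow> S" by simp
  have Re: "Re (w * cnj w) = (cmod w)\<^sup>2" for w by (simp add: complex_norm_square[symmetric])
  \<comment> \<open>With \<gamma> = f the exponent is -k|f|^2 + 2k|f|^2 = k|f|^2 for each
    coefficient, while the stripped loop has determinant at most 1.\<close>
  have "tdet (dexp F) \<le> exp (- E N)" for N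
  proof -
    have "exp (E N) * tdet (dexp F) =
        exp (\<Sum>k=1..N. \<Sum>d\<in>UNIV. - real k * (cmod (f d k))\<^sup>2 + 2 * real k * Re (fc (F d) (int k) * cnj (f d k))) * tdet (dexp F)"
      unfolding fcF Re E_def by (simp add: UNIV_2 algebra_simps)
    also have "\<dots> \<le> tdet (dexp (\<lambda>d z. F d z - (\<Sum>k=1..N. f d k * z ^ k)))"
      by (rule tdet_dexp_polynomial_le[OF an])
    also have "\<dots> \<le> 1" by (intro tdet_le_1 loop_dexp an_diff an an_sum an_power_id)
    finally show ?thesis by (simp add: exp_minus field_simps)
  qed
  moreover have "(\<lambda>N. exp (- E N)) \<longlonglongrightarrow> exp (- S)" by (intro tendsto_intros E)
  ultimately show "tdet (dexp F) \<le> exp (- S)" by (intro LIMSEQ_le_const) auto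
  \<comment> \<open>A partial sum of the series, written as a constant minus a polynomial with
    \<gamma> = -f; at a constant the linear terms of the bound vanish.\<close>
  define P where "P N d z = f d 0 - (\<Sum>k=1..N. - f d k * z ^ k)" for N d z
  have anP: "an (P N d)" for N d unfolding P_def by (intro an_diff an_const an_sum an_power_id)
  show "exp (- S) \<le> tdet (dexp F)"
  proof (rule tdet_upper_semicontinuous[of "\<lambda>N. dexp (P N)"])
    show "loop (dexp (P N))" for N by (intro loop_dexp anP)
    show "loop (dexp F)" by (intro loop_dexp an)
    show "(\<lambda>N. exp (- E N)) \<longlonglongrightarrow> exp (- S)" by (intro tendsto_intros E)
    fix N
    have c: "tdet (dexp (\<lambda>d z. f d 0)) = 1"
      unfolding dexp_def by (rule tdet_const) (rule cmod_exp_diff_cnj)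
    have "exp (- E N) = exp (\<Sum>k=1..N. \<Sum>d\<in>UNIV. - real k * (cmod (- f d k))\<^sup>2 + 2 * real k * Re (fc (\<lambda>z. f d 0) (int k) * cnj (- f d k)))
       * tdet (dexp (\<lambda>d z. f d 0))"
      unfolding c E_def by (simp add: fc_const UNIV_2 algebra_simps flip: sum_negf)
    also have "\<dots> \<le> tdet (dexp (P N))" unfolding P_def[abs_def] by (rule tdet_dexp_polynomial_le[OF an_const])
    finally show "exp (- E N) \<le> tdet (dexp (P N))" .
  next
    fix z :: complex and i j :: 2 assume z: "z \<in> sphere 0 1"
    have "(\<lambda>N. P N d z) \<longlonglongrightarrow> F d z" for d
    proof -
      have "P N d z = (\<Sum>k<Suc N. f d k * z ^ k)" for N
        unfolding P_def lessThan_Suc_atMost atMost_atLeast0 by (simp add: sum.atLeast_Suc_atMost sum_negf)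
      thus ?thesis using LIMSEQ_Suc[OF sums[OF z, of d, unfolded sums_def]] by simp
    qed
    hence "(\<lambda>N. exp (P N d z - cnj (P N d z))) \<longlonglongrightarrow> exp (F d z - cnj (F d z))" for d
      by (intro tendsto_intros)
    thus "(\<lambda>N. dexp (P N) z $ i $ j) \<longlonglongrightarrow> dexp F z $ i $ j"
      by (cases "i = j") (simp_all add: dexp_def dgv_def)
  qed
qed

text \<open>The series converges uniformly on the circle, hence to a continuous function and in
  mean.\<close>

lemma an_power_series:
  fixes c :: "nat \<Rightarrow> complex"
  assumes c: "summable (\<lambda>k. cmod (c k))"
  defines "F \<equiv> \<lambda>z. \<Sum>k. c k * z ^ k"
  shows "an F" and "fc F (int k) = c k" and "z \<in> sphere 0 1 \<Longrightarrow> (\<lambda>k. c k * z ^ k) sums F z"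
proof -
  define P where "P N z = (\<Sum>k<N. c k * z ^ k)" for N z
  have anP: "an (P N)" for N unfolding P_def[abs_def] by (intro an_sum an_power_id)
  have fcP: "fc (P N) (int k) = (if k < N then c k else 0)" for N k
  proof (induction N)
    case (Suc N)
    have "fc (P (Suc N)) (int k) = fc (P N) (int k) + fc (\<lambda>z. c N * z ^ N) (int k)"
      using fc_add[OF an_Ls[OF anP] an_Ls[OF an_power_id]] by (simp add: P_def[abs_def])
    thus ?case using Suc by (auto simp: fc_power_id)
  qed (simp add: P_def[abs_def] fc_const)
  have u: "uniform_limit (sphere 0 1) P F sequentially"
    unfolding P_def[abs_def] F_def by (rule Weierstrass_m_test[OF _ c]) (simp add: norm_mult norm_power)
  have cont: "continuous_on (sphere 0 1) F"
    by (rule uniform_limit_theorem[OF _ u]) (auto intro!: always_eventually an_continuous anP)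
  have lim: "(\<lambda>N. sn (\<lambda>z. F z - P N z)) \<longlonglongrightarrow> 0"
  proof (rule LIMSEQ_I)
    fix r :: real assume r: "0 < r"
    from uniform_limitD[OF u, of "r / 2"] r obtain N where
      N: "\<And>m z. m \<ge> N \<Longrightarrow> z \<in> sphere 0 1 \<Longrightarrow> dist (P m z) (F z) < r / 2"
      unfolding eventually_sequentially by force
    have "sn (\<lambda>z. F z - P m z) \<le> r / 2" if "m \<ge> N" for m
      by (rule sn_le_sup[OF Ls_diff[OF Ls_continuous[OF cont] an_Ls[OF anP]]])
        (use N[OF that] r in \<open>auto simp: dist_norm norm_minus_commute intro!: less_imp_le\<close>)
    hence "norm (sn (\<lambda>z. F z - P m z) - 0) < r" if "m \<ge> N" for m
      using that r by fastforce
    thus "\<exists>N. \<forall>m\<ge>N. norm (sn (\<lambda>z. F z - P m z) - 0) < r" by blast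
  qed
  show "an F" by (rule an_limit(1)[OF cont anP lim])
  have "(\<lambda>N. fc (P N) (int k)) \<longlonglongrightarrow> c k"
    unfolding fcP by (rule tendsto_eventually) (auto simp: eventually_sequentially intro!: exI[of _ "Suc k"])
  thus "fc F (int k) = c k" using an_limit(3)[OF cont anP lim, of "int k"] LIMSEQ_unique by blast
  show "(\<lambda>k. c k * z ^ k) sums F z" if "z \<in> sphere 0 1"
    using tendsto_uniform_limitI[OF u that] unfolding sums_def P_def .
qed

lemma tdet_cong:
  assumes "\<And>z. z \<in> sphere 0 1 \<Longrightarrow> g z = h z"
  shows "tdet g = tdet h"
proof -
  have "Tmap g f = Tmap h f" for f
    unfolding Tmap_def by (intro arg_cong[of _ _ "res KP"] co_cong) (simp add: assms)
  thus ?thesis by (simp add: tdet_def vdet_def)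
qed

lemma loop_cong:
  assumes "\<And>z. z \<in> sphere 0 1 \<Longrightarrow> g z = h z" "loop g"
  shows "loop h"
proof -
  have "continuous_on (sphere 0 1) (\<lambda>z. h z $ i $ j)" for i j
    using loop_continuous[OF assms(2), of i j] by (rule iffD1[OF continuous_on_cong, rotated 2]) (simp_all add: assms(1))
  thus ?thesis using assms by (auto simp: loop_def)
qed

lemma loop_flip:
  assumes g: "loop g"
  shows "loop (\<lambda>z. adj (g (inverse z)))"
proof -
  have "loop (\<lambda>z. g (inverse z))"
    unfolding loop_def
  proof (intro conjI allI ballI)
    show "continuous_on (sphere 0 1) (\<lambda>z. g (inverse z) $ i $ j)" for i j
      by (rule continuous_on_compose2[OF loop_continuous[OF g]])
        (auto intro!: continuous_intros simp: norm_inverse)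
    show "adj (g (inverse z)) ** g (inverse z) = mat 1" if "z \<in> sphere 0 1" for z
      using g that by (simp add: loop_def norm_inverse)
  qed
  thus ?thesis by (rule loop_adj)
qed

text \<open>Conjugation and reflection each negate the Fourier index, so together they preserve
  it.\<close>

lemma an_reflect:
  assumes f: "an f"
  shows "an (\<lambda>z. cnj (f (inverse z)))"
proof -
  have cont: "continuous_on (sphere 0 1) (\<lambda>z. f (inverse z))"
    by (rule continuous_on_compose2[OF an_continuous[OF f]]) (auto intro!: continuous_intros simp: norm_inverse)
  have "fc (\<lambda>z. f (inverse z)) k = fc f (- k)" for k
  proof -
    have "fc (\<lambda>z. f (inverse z)) k = (\<integral>z. inverse z powi k * f (inverse z) \<partial>circle)"
      unfolding fc_def by (simp add: power_int_inverse power_int_minus)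
    also have "\<dots> = (\<integral>z. z powi k * f z \<partial>circle)"
      by (rule integral_circle_inverse) (intro continuous_intros an_continuous f)
    finally show ?thesis by (simp add: fc_def)
  qed
  thus ?thesis using fc_neg[OF f] by (auto simp: an_def fc_cnj intro!: continuous_on_cnj cont)
qed

text \<open>A vector with first component 0 meets the support condition for every \<open>m\<close>,
  so it can start a product with any number of rotations.\<close>

lemma annihilator_axis:
  assumes u: "an u" "fc u 0 \<noteq> 0"
    and h: "\<And>z c. z \<in> sphere 0 1 \<Longrightarrow> (adj (h z) *v ax 2 u z) $ c = cnj (q c z)" "\<And>c. an (q c)"
  shows "annihilator m h (ax 2 u)"
  unfolding annihilator_def
proof (intro conjI allI impI)
  show "ax 2 u \<in> L2" by (intro ax_L2 an_Ls u)
  show "co (ax 2 u) (0, 2) \<noteq> 0" using u by (simp add: co_ax)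
  fix k :: int and c :: 2 assume k: "k > 0"
  have "co (\<lambda>z. adj (h z) *v ax 2 u z) (k, c) = fc (\<lambda>z. cnj (q c z)) k"
    unfolding co_def prod.case by (intro fc_cong h)
  thus "co (\<lambda>z. adj (h z) *v ax 2 u z) (k, c) = 0" using k by (simp add: fc_cnj fc_neg[OF h(2)])
qed (use u in \<open>auto simp: co_ax fc_neg\<close>)

section \<open>The determinant of the root loop\<close>

definition sym_exp :: "(complex \<Rightarrow> complex) \<Rightarrow> mfun" where
  "sym_exp F = dexp (\<lambda>d. if d = 1 then F else (\<lambda>z. - F z))"

lemma loop_sym_exp: "an F \<Longrightarrow> loop (sym_exp F)"
  unfolding sym_exp_def using an_scale[of F "- 1"] by (intro loop_dexp) auto

lemma sym_exp_mult_vec [simp]: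
  "(sym_exp F z *v v) $ 1 = exp (F z - cnj (F z)) * v $ 1"
  "(sym_exp F z *v v) $ 2 = exp (cnj (F z) - F z) * v $ 2"
  by (simp_all add: sym_exp_def dexp_def)

lemma adj_sym_exp_mult_vec [simp]:
  "(adj (sym_exp F z) *v v) $ 1 = exp (cnj (F z) - F z) * v $ 1"
  "(adj (sym_exp F z) *v v) $ 2 = exp (F z - cnj (F z)) * v $ 2"
  by (simp_all add: sym_exp_def dexp_def adj_dgv exp_cnj)

lemma zeta_factor_eq_rot: "zeta_factor \<zeta> j = rot (\<zeta> j) (- int j)"
  by (simp add: fun_eq_iff zeta_factor_def rot_def)

definition zeta_product :: "(nat \<Rightarrow> complex) \<Rightarrow> nat \<Rightarrow> mfun" where
  "zeta_product \<zeta> n z = mat_prod (map (\<lambda>j. zeta_factor \<zeta> j z) (rev [1..<Suc n]))"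

lemma zeta_product_0: "zeta_product \<zeta> 0 z = mat 1"
  by (simp add: zeta_product_def mat_prod_Nil)

lemma zeta_product_Suc: "zeta_product \<zeta> (Suc n) z = rot (\<zeta> (Suc n)) (- int (Suc n)) z ** zeta_product \<zeta> n z"
  by (simp add: zeta_product_def mat_prod_Cons zeta_factor_eq_rot)

lemma mat_prod_append: "mat_prod (Ms @ Ns) = mat_prod Ms ** mat_prod Ns"
  by (induction Ms) (simp_all add: mat_prod_Nil mat_prod_Cons matrix_mul_assoc)

lemma loop_zeta_product: "loop (zeta_product \<zeta> n)"
proof (induction n)
  case 0
  have "zeta_product \<zeta> 0 = dgv (\<lambda>_ _. 1)"
    by (auto simp: fun_eq_iff vec_eq_iff zeta_product_0 dgv_def mat_def)
  thus ?case by (simp add: loop_dgv)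
next
  case (Suc n)
  have "zeta_product \<zeta> (Suc n) = (\<lambda>z. rot (\<zeta> (Suc n)) (- int (Suc n)) z ** zeta_product \<zeta> n z)"
    by (simp add: fun_eq_iff zeta_product_Suc)
  thus ?case using Suc by (simp only: loop_mult loop_rot)
qed

text \<open>The two claims feed each other: a new factor adds to the second row a multiple of
  z^(n+1) times the first, and to the scaled first row a multiple of the second.\<close>

lemma an_zeta_product:
  "an (\<lambda>z. zeta_product \<zeta> n z $ 2 $ j) \<and> an (\<lambda>z. z ^ n * zeta_product \<zeta> n z $ 1 $ j)"
proof (induction n)
  case 0 show ?case by (simp add: zeta_product_0 an_const)
next
  case (Suc n)
  let ?Z = "zeta_product \<zeta> n" and ?e = "\<zeta> (Suc n)" and ?r = "complex_of_real (a_fac (\<zeta> (Suc n)))"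
  have 2: "zeta_product \<zeta> (Suc n) z $ 2 $ j = ?r * (?Z z $ 2 $ j + (- cnj ?e) * ((1 * z ^ 1) * (z ^ n * ?Z z $ 1 $ j)))" for z
  proof -
    have "z powi (1 + int n) = z * z ^ n" by (metis of_nat_Suc power_Suc power_int_of_nat)
    thus ?thesis
      unfolding zeta_product_Suc by (simp add: rot_def matrix_matrix_mult_def sum_2 scaleR_conv_of_real[where 'a=complex] algebra_simps)
  qed
  have 1: "z ^ Suc n * zeta_product \<zeta> (Suc n) z $ 1 $ j = ?r * ((1 * z ^ 1) * (z ^ n * ?Z z $ 1 $ j) + ?e * ?Z z $ 2 $ j)"
    if "z \<in> sphere 0 1" for z
  proof -
    have z: "z \<noteq> 0" using that by auto
    have "z powi (- 1 - int n) = inverse (z * z ^ n)"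
      using power_int_minus[of z "int (Suc n)"] by (simp only: power_int_of_nat) (simp add: power_int_minus)
    thus ?thesis using z
      unfolding zeta_product_Suc by (simp add: rot_def matrix_matrix_mult_def sum_2 scaleR_conv_of_real[where 'a=complex] field_simps)
  qed
  have ih: "an (\<lambda>z. ?Z z $ 2 $ j)" "an (\<lambda>z. (1 * z ^ 1) * (z ^ n * ?Z z $ 1 $ j))"
    using Suc.IH an_mult[OF an_power_id[of 1 1]] by blast+
  show ?case unfolding 2 by (subst an_cong[OF 1]) (assumption, intro conjI an_scale an_add ih)
qed

text \<open>The adjoint of the diagonal loop turns (0, exp(-F)) into its conjugate. Then only the
  second row of the \<zeta> product enters, also conjugated, and that row is analytic.\<close>

lemma sym_exp_zeta_annihilator:
  assumes F: "an F"
  shows "\<exists>w. annihilator m (\<lambda>z. sym_exp F z ** zeta_product \<zeta> n z) w"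
proof (rule exI[where x="ax 2 (\<lambda>z. exp (- F z))"], rule annihilator_axis)
  have mF: "an (\<lambda>z. - F z)" using an_scale[OF F, of "- 1"] by simp
  show E: "an (\<lambda>z. exp (- F z))" by (rule an_exp[OF mF])
  show "fc (\<lambda>z. exp (- F z)) 0 \<noteq> 0" using an_exp(2)[OF mF, of 0] by (simp add: ev_0)
  show "an (\<lambda>z. zeta_product \<zeta> n z $ 2 $ c * exp (- F z))" for c
    using an_zeta_product by (intro an_mult E) blast
  fix z :: complex and c :: 2
  let ?u = "ax 2 (\<lambda>z. exp (- F z))"
  have e: "exp (F z - cnj (F z)) * exp (- F z) = cnj (exp (- F z))" by (simp add: exp_add[symmetric] exp_cnj)
  have v: "adj (sym_exp F z) *v ?u z = ax 2 (\<lambda>z. cnj (exp (- F z))) z"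
    by (simp add: vec_eq_iff forall_2 ax_def axis_def e)
  have "(adj (sym_exp F z ** zeta_product \<zeta> n z) *v ?u z) $ c =
      (adj (zeta_product \<zeta> n z) *v (adj (sym_exp F z) *v ?u z)) $ c"
    by (simp add: adj_mult matrix_vector_mul_assoc)
  also have "\<dots> = cnj (zeta_product \<zeta> n z $ 2 $ c * exp (- F z))"
    unfolding v by (simp add: matrix_vector_mult_def sum_2 adj_def ax_def axis_def)
  finally show "(adj (sym_exp F z ** zeta_product \<zeta> n z) *v ?u z) $ c = cnj (zeta_product \<zeta> n z $ 2 $ c * exp (- F z))" .
qed

text \<open>The reflected loop is the diagonal loop of the analytic function cnj (F (1/z)), so the
  analogous vector works.\<close>

lemma sym_exp_flip_annihilator:
  assumes F: "an F"
  shows "\<exists>w. annihilator m (\<lambda>z. adj (sym_exp F (inverse z))) w"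
proof (rule exI[where x="ax 2 (\<lambda>z. exp (- cnj (F (inverse z))))"], rule annihilator_axis)
  let ?F = "\<lambda>z. cnj (F (inverse z))"
  have mF: "an (\<lambda>z. - ?F z)" using an_scale[OF an_reflect[OF F], of "- 1"] by simp
  show E: "an (\<lambda>z. exp (- ?F z))" by (rule an_exp[OF mF])
  show "fc (\<lambda>z. exp (- ?F z)) 0 \<noteq> 0" using an_exp(2)[OF mF, of 0] by (simp add: ev_0)
  show "an (\<lambda>z. if c = 2 then exp (- ?F z) else 0)" for c :: 2
    using E an_const by (cases "c = 2") auto
  fix z :: complex and c :: 2
  have e: "exp (cnj (F (inverse z)) - F (inverse z)) * exp (- ?F z) = exp (- F (inverse z))" by (simp add: exp_add[symmetric])
  show "(adj (adj (sym_exp F (inverse z))) *v ax 2 (\<lambda>z. exp (- ?F z)) z) $ c = cnj (if c = 2 then exp (- ?F z) else 0)"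
    using two_cases[of c] by (auto simp: ax_def axis_def e exp_cnj simp del: complex_cnj_inverse)
qed

lemma a_fac_minus: "a_fac (- e) = a_fac e"
  by (simp add: a_fac_def)

text \<open>Reflection and adjoint move the \<zeta> factors from the right to the left, in the order
  1, ..., n, where they are \<eta> factors with parameters -\<zeta>. The remaining diagonal loop is
  reflected back afterwards.\<close>

lemma tdet_sym_exp_zeta:
  assumes F: "an F"
  shows "tdet (\<lambda>z. sym_exp F z ** zeta_product \<zeta> n z) = (\<Prod>j=1..n. a_fac (\<zeta> j) ^ (2 * j)) * tdet (sym_exp F)"
proof -
  let ?q = "\<lambda>z. adj (sym_exp F (inverse z))"
  let ?p = "\<lambda>z. mat_prod (map (\<lambda>j. eta_factor (\<lambda>j. - \<zeta> j) j z) [1..<Suc n]) ** ?q z"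
  have E: "adj (zeta_product \<zeta> n (inverse z)) = mat_prod (map (\<lambda>j. eta_factor (\<lambda>j. - \<zeta> j) j z) [1..<Suc n])"
    if z: "z \<in> sphere 0 1" for z
  proof (induction n)
    case 0 show ?case by (simp add: zeta_product_0 mat_prod_Nil mat_1_eq_mat2 adj_mat2)
  next
    case (Suc n)
    have "inverse z \<in> sphere 0 1" using z by (simp add: norm_inverse)
    hence "adj (rot (\<zeta> (Suc n)) (- int (Suc n)) (inverse z)) = rot (- \<zeta> (Suc n)) (int (Suc n)) z"
      by (subst adj_rot, assumption) (simp add: rot_def a_fac_minus power_int_inverse add.commute algebra_simps flip: power_int_minus)
    thus ?case using Suc by (simp add: zeta_product_Suc adj_mult mat_prod_append mat_prod_Cons mat_prod_Nil eta_factor_eq_rot)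
  qed
  have lq: "loop ?q" by (intro loop_flip loop_sym_exp F)
  obtain w where w: "annihilator (int n) ?q w" using sym_exp_flip_annihilator[OF F] by blast
  note P = tdet_eta_product[OF lq w, of 1 "\<lambda>j. - \<zeta> j"]
  have "tdet ?p = tdet (\<lambda>z. sym_exp F z ** zeta_product \<zeta> n z)"
  proof (rule tdet_flip)
    show "loop (\<lambda>z. sym_exp F z ** zeta_product \<zeta> n z)" by (intro loop_mult loop_sym_exp loop_zeta_product F)
    show "loop ?p" using P by simp
    show "?p z = adj (sym_exp F (inverse z) ** zeta_product \<zeta> n (inverse z))" if "z \<in> sphere 0 1" for z
      by (simp add: adj_mult E[OF that])
  qed
  moreover have "tdet ?q = tdet (sym_exp F)"
    by (rule tdet_flip[OF loop_sym_exp[OF F] lq]) simp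
  ultimately show ?thesis using P by (simp add: a_fac_minus)
qed


lemma chi_factor_eq_sym_exp:
  fixes chi :: "int \<Rightarrow> complex"
  assumes skew: "\<And>j. chi (- j) = - cnj (chi j)"
    and series: "\<And>z. z \<in> sphere 0 1 \<Longrightarrow> (\<lambda>j. chi j * z powi j) summable_on UNIV"
    and half: "(\<lambda>j. of_int \<bar>j\<bar> * (cmod (chi j))\<^sup>2) summable_on UNIV"
  obtains F where "an F" "\<And>z. z \<in> sphere 0 1 \<Longrightarrow> chi_factor chi z = sym_exp F z"
    "tdet (sym_exp F) = (\<Prod>m::nat. \<Prod>j\<in>{int m, - int m}. exp (- of_int \<bar>j\<bar> * (cmod (chi j))\<^sup>2))"
    "tdet (sym_exp F) > 0"
proof -
  \<comment> \<open>\<open>chi 0\<close> is purely imaginary by skew symmetry, so one half of it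
    gives \<open>chi 0\<close> back in \<open>F - cnj F\<close>.\<close>
  define c where "c k = (if k = 0 then chi 0 / 2 else chi (int k))" for k :: nat
  \<comment> \<open>Unordered convergence at z = 1 is absolute convergence, which yields a
    continuous \<open>F\<close>.\<close>
  have "chi summable_on UNIV" using series[of 1] by simp
  hence "(\<lambda>j. cmod (chi j)) summable_on UNIV"
    by (simp add: summable_on_iff_abs_summable_on_complex)
  hence "(\<lambda>j. cmod (chi j)) summable_on range int" by (rule summable_on_subset_banach) simp
  hence "summable (\<lambda>k. cmod (chi (int k)))"
    by (subst (asm) summable_on_reindex) (auto simp: o_def intro: summable_on_imp_summable)
  hence c: "summable (\<lambda>k. cmod (c k))"
    by (rule summable_comparison_test'[of _ 1]) (auto simp: c_def)
  define F where "F z = (\<Sum>k. c k * z ^ k)" for z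
  note F = an_power_series[OF c, folded F_def]
  have "chi_factor chi z = sym_exp F z" if z: "z \<in> sphere 0 1" for z
  proof -
    let ?P = "\<lambda>n. \<Sum>k<Suc n. c k * z ^ k"
    have c0: "cnj (chi 0) = - chi 0" using skew[of 0] by (metis add.inverse_inverse minus_zero)
    \<comment> \<open>On the circle the terms of index j and -j are negative conjugates of each
      other.\<close>
    have sq: "(\<Sum>j\<in>sq n. chi j * z powi j) = ?P n - cnj (?P n)" for n
    proof (induction n)
      case 0 show ?case by (simp add: sq_def c_def c0)
    next
      case (Suc n)
      let ?m = "int (Suc n)"
      have "sq (Suc n) = insert ?m (insert (- ?m) (sq n))" by (auto simp: sq_def)
      hence "(\<Sum>j\<in>sq (Suc n). chi j * z powi j) = chi ?m * z powi ?m + (chi (- ?m) * z powi (- ?m) + (\<Sum>j\<in>sq n. chi j * z powi j))"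
        by (simp add: sq_def)
      also have "chi ?m * z powi ?m = c (Suc n) * z ^ Suc n" unfolding c_def power_int_of_nat by simp
      also have "chi (- ?m) * z powi (- ?m) = - cnj (c (Suc n) * z ^ Suc n)"
        unfolding skew cnj_powi[OF z, symmetric] c_def power_int_of_nat by simp
      finally show ?case unfolding Suc by simp
    qed
    have "?P \<longlonglongrightarrow> F z" by (rule LIMSEQ_Suc) (use F(3)[OF z] in \<open>simp add: sums_def\<close>)
    hence "(\<lambda>n. ?P n - cnj (?P n)) \<longlonglongrightarrow> F z - cnj (F z)" by (intro tendsto_intros)
    moreover have "(\<lambda>n. ?P n - cnj (?P n)) \<longlonglongrightarrow> (\<Sum>\<^sub>\<infinity>j. chi j * z powi j)"
      using sum_sq_tendsto[OF series[OF z]] unfolding sq .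
    ultimately have "(\<Sum>\<^sub>\<infinity>j. chi j * z powi j) = F z - cnj (F z)" by (rule LIMSEQ_unique[symmetric])
    thus ?thesis
      by (simp add: chi_factor_def Let_def vec_eq_iff forall_2 sym_exp_def dexp_def dgv_def)
  qed
  moreover have "tdet (sym_exp F) = (\<Prod>m::nat. \<Prod>j\<in>{int m, - int m}. exp (- of_int \<bar>j\<bar> * (cmod (chi j))\<^sup>2)) \<and> tdet (sym_exp F) > 0"
  proof -
    \<comment> \<open>The factor 2 counts the entries \<open>F\<close> and \<open>- F\<close>. For k
      = 0 the summand vanishes, so the halved coefficient has no effect.\<close>
    define s where "s k = 2 * real k * (cmod (chi (int k)))\<^sup>2" for k :: nat
    have "(\<lambda>j. of_int \<bar>j\<bar> * (cmod (chi j))\<^sup>2) summable_on range int" by (rule summable_on_subset_banach[OF half]) simp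
    hence "summable (\<lambda>k. real k * (cmod (chi (int k)))\<^sup>2)"
      by (subst (asm) summable_on_reindex) (auto simp: o_def intro: summable_on_imp_summable)
    hence s: "summable s" unfolding s_def mult.assoc by (rule summable_mult)
    have t: "tdet (sym_exp F) = exp (- suminf s)"
      unfolding sym_exp_def
    proof (rule tdet_dexp_power_series[where f="\<lambda>d k. if d = 1 then c k else - c k"])
      have mF: "an (\<lambda>z. - F z)" using an_scale[OF F(1), of "- 1"] by simp
      show "an (if d = 1 then F else (\<lambda>z. - F z))" for d :: 2 using F(1) mF by simp
      show "fc (if d = 1 then F else (\<lambda>z. - F z)) (int k) = (if d = 1 then c k else - c k)" for d :: 2 and k
        using F(2)[of k] fc_scale[of "- 1" F "int k"] by simp
      show "(\<lambda>k. (if d = 1 then c k else - c k) * z ^ k) sums (if d = 1 then F else (\<lambda>z. - F z)) z"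
        if "z \<in> sphere 0 1" for d :: 2 and z
        using F(3)[OF that] sums_minus[OF F(3)[OF that]] by simp
      have "(\<lambda>k. real k * (\<Sum>d\<in>(UNIV::2 set). (cmod (if d = 1 then c k else - c k))\<^sup>2)) = s"
        by (auto simp: fun_eq_iff s_def sum_2 c_def)
      thus "(\<lambda>k. real k * (\<Sum>d\<in>(UNIV::2 set). (cmod (if d = 1 then c k else - c k))\<^sup>2)) sums suminf s"
        using s by (simp add: summable_sums)
    qed
    also have "exp (- suminf s) = (\<Prod>m. exp (- s m))" using s by (simp add: prodinf_exp summable_minus suminf_minus)
    also have "(\<lambda>m. exp (- s m)) = (\<lambda>m. \<Prod>j\<in>{int m, - int m}. exp (- of_int \<bar>j\<bar> * (cmod (chi j))\<^sup>2))"
    proof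
      fix m :: nat
      have "cmod (chi (- int m)) = cmod (chi (int m))" unfolding skew by simp
      thus "exp (- s m) = (\<Prod>j\<in>{int m, - int m}. exp (- of_int \<bar>j\<bar> * (cmod (chi j))\<^sup>2))"
        by (cases "m = 0") (simp_all add: s_def exp_add[symmetric])
    qed
    finally show ?thesis using exp_gt_zero[of "- suminf s"] unfolding t by blast
  qed
  ultimately show ?thesis using that F(1) by blast
qed

lemma tdet_root_loop:
  fixes chi :: "int \<Rightarrow> complex"
  assumes "\<And>j. chi (- j) = - cnj (chi j)"
    and "\<And>z. z \<in> sphere 0 1 \<Longrightarrow> (\<lambda>j. chi j * z powi j) summable_on UNIV"
    and "(\<lambda>j. of_int \<bar>j\<bar> * (cmod (chi j))\<^sup>2) summable_on UNIV"
  shows "loop (root_loop n \<eta> \<zeta> chi)"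
    and "tdet (root_loop n \<eta> \<zeta> chi) = (\<Prod>j=0..n. a_fac (\<eta> j) ^ (2 * j)) * (\<Prod>j=1..n. a_fac (\<zeta> j) ^ (2 * j)) *
       (\<Prod>m::nat. \<Prod>j\<in>{int m, - int m}. exp (- of_int \<bar>j\<bar> * (cmod (chi j))\<^sup>2))"
    and "tdet (root_loop n \<eta> \<zeta> chi) > 0"
proof -
  obtain F where F: "an F" "\<And>z. z \<in> sphere 0 1 \<Longrightarrow> chi_factor chi z = sym_exp F z"
    "tdet (sym_exp F) = (\<Prod>m::nat. \<Prod>j\<in>{int m, - int m}. exp (- of_int \<bar>j\<bar> * (cmod (chi j))\<^sup>2))"
    "tdet (sym_exp F) > 0"
    using chi_factor_eq_sym_exp[OF assms] by blast
  let ?h = "\<lambda>z. sym_exp F z ** zeta_product \<zeta> n z"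
  let ?p = "\<lambda>z. mat_prod (map (\<lambda>j. eta_factor \<eta> j z) [0..<Suc n]) ** ?h z"
  have e: "?p z = root_loop n \<eta> \<zeta> chi z" if "z \<in> sphere 0 1" for z
    using F(2)[OF that] by (simp add: root_loop_def zeta_product_def matrix_mul_assoc del: upt_Suc)
  have lh: "loop ?h" by (intro loop_mult loop_sym_exp loop_zeta_product F)
  obtain w where w: "annihilator (int n) ?h w" using sym_exp_zeta_annihilator[OF F(1)] by blast
  note P = tdet_eta_product[OF lh w, of 0 \<eta>, simplified]
  show "loop (root_loop n \<eta> \<zeta> chi)" using loop_cong[of ?p] P e by auto
  have "tdet (root_loop n \<eta> \<zeta> chi) = tdet ?p" by (rule tdet_cong) (simp only: e)
  hence t: "tdet (root_loop n \<eta> \<zeta> chi) = (\<Prod>j=0..n. a_fac (\<eta> j) ^ (2 * j)) * (\<Prod>j=1..n. a_fac (\<zeta> j) ^ (2 * j)) * tdet (sym_exp F)"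
    using P tdet_sym_exp_zeta[OF F(1)] by (simp add: atLeast0AtMost)
  show "tdet (root_loop n \<eta> \<zeta> chi) > 0" unfolding t using F(4) by (intro mult_pos_pos prod_pos zero_less_power a_fac_pos)
  show "tdet (root_loop n \<eta> \<zeta> chi) = (\<Prod>j=0..n. a_fac (\<eta> j) ^ (2 * j)) * (\<Prod>j=1..n. a_fac (\<zeta> j) ^ (2 * j)) *
       (\<Prod>m::nat. \<Prod>j\<in>{int m, - int m}. exp (- of_int \<bar>j\<bar> * (cmod (chi j))\<^sup>2))"
    unfolding t F(3) ..
qed

section \<open>The Fredholm determinant\<close>

text \<open>Hadamard's inequality and x \<le> exp (x - 1) bound every partial sum by minus the
  logarithm of the limiting determinant.\<close>

lemma ldet_pos_summable:
  assumes x: "contr x I" and pos: "ldet x I > 0"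
  shows "(\<lambda>i. 1 - (nrm (x i))\<^sup>2) summable_on I"
proof (rule nonneg_bounded_partial_sums_imp_summable_on)
  show "0 \<le> 1 - (nrm (x i))\<^sup>2" if "i \<in> I" for i
    using contr_D[OF x that] by (simp add: power_le_one)
  have "(\<Sum>i\<in>A. 1 - (nrm (x i))\<^sup>2) \<le> - ln (ldet x I)" if A: "finite A" "A \<subseteq> I" for A
  proof -
    have "ldet x I \<le> gdet x A" by (rule ldet_le[OF x A])
    also have "\<dots> \<le> (\<Prod>i\<in>A. (nrm (x i))\<^sup>2)"
      by (rule gdet_Hadamard[OF A(1)]) (use contr_D[OF x] A in auto)
    also have "\<dots> \<le> (\<Prod>i\<in>A. exp (- (1 - (nrm (x i))\<^sup>2)))"
    proof (intro prod_mono conjI)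
      show "(nrm (x i))\<^sup>2 \<le> exp (- (1 - (nrm (x i))\<^sup>2))" for i
        using exp_ge_add_one_self[of "- (1 - (nrm (x i))\<^sup>2)"] by simp
    qed simp
    also have "\<dots> = exp (- (\<Sum>i\<in>A. 1 - (nrm (x i))\<^sup>2))" using A by (simp add: exp_sum sum_negf[symmetric])
    finally have "ln (ldet x I) \<le> - (\<Sum>i\<in>A. 1 - (nrm (x i))\<^sup>2)"
      using pos by (metis ln_exp ln_mono exp_gt_zero)
    thus ?thesis by simp
  qed
  thus "\<forall>\<^sub>F A in finite_subsets_at_top I. (\<Sum>i\<in>A. 1 - (nrm (x i))\<^sup>2) \<le> - ln (ldet x I)"
    by (auto simp: eventually_finite_subsets_at_top)
qed

lemma cmod_pdet_uminus: "cmod (pdet (\<lambda>i j. - M i j) A) = cmod (pdet M A)"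
proof -
  have p: "(\<Prod>i\<in>A. - M i (p i)) = (-1) ^ card A * (\<Prod>i\<in>A. M i (p i))" for p
    using prod.distrib[of "\<lambda>_. - 1" "\<lambda>i. M i (p i)" A] by simp
  have "pdet (\<lambda>i j. - M i j) A = (-1) ^ card A * pdet M A"
    unfolding pdet_def sum_distrib_left by (intro sum.cong refl) (simp add: p mult_ac)
  thus ?thesis by (simp add: norm_mult norm_power)
qed

text \<open>Over all subsets of a finite set these products sum to the product of the 1 + c i, which
  is at most the exponential of the sum of the \<open>c i\<close>.\<close>

lemma prod_summable_on_finite_subsets:
  fixes c :: "'i \<Rightarrow> real"
  assumes nonneg: "\<And>i. i \<in> I \<Longrightarrow> 0 \<le> c i" and sum: "c summable_on I"
  shows "(\<lambda>A. \<Prod>i\<in>A. c i) summable_on {A. finite A \<and> A \<subseteq> I}"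
proof (rule nonneg_bounded_partial_sums_imp_summable_on)
  show "0 \<le> (\<Prod>i\<in>A. c i)" if "A \<in> {A. finite A \<and> A \<subseteq> I}" for A
    using that nonneg by (intro prod_nonneg) auto
  have "(\<Sum>A\<in>\<A>. \<Prod>i\<in>A. c i) \<le> exp (infsum c I)" if \<A>: "finite \<A>" "\<A> \<subseteq> {A. finite A \<and> A \<subseteq> I}" for \<A>
  proof -
    have B: "finite (\<Union>\<A>)" "\<Union>\<A> \<subseteq> I" using \<A> by auto
    have "(\<Sum>A\<in>\<A>. \<Prod>i\<in>A. c i) \<le> (\<Sum>A\<in>Pow (\<Union>\<A>). \<Prod>i\<in>A. c i)"
      using B nonneg by (intro sum_mono2 prod_nonneg) (auto simp: subset_iff)
    also have "\<dots> = (\<Prod>i\<in>\<Union>\<A>. 1 + c i)"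
      using prod_add[OF B(1), of c "\<lambda>_. 1"] by (simp add: add.commute)
    also have "\<dots> \<le> exp (sum c (\<Union>\<A>))" using B nonneg by (intro prod_le_exp_sum) auto
    also have "\<dots> \<le> exp (infsum c I)"
      using finite_sum_le_infsum[OF sum B] nonneg by simp
    finally show ?thesis .
  qed
  thus "\<forall>\<^sub>F \<A> in finite_subsets_at_top {A. finite A \<and> A \<subseteq> I}. (\<Sum>A\<in>\<A>. \<Prod>i\<in>A. c i) \<le> exp (infsum c I)"
    by (auto simp: eventually_finite_subsets_at_top)
qed

text \<open>\<open>y\<close> is the complementary part of an orthonormal family. The matrix of the
  minors is minus the Gram matrix of \<open>y\<close>, so Hadamard bounds them by products of 1 - |x
  i|^2, which are summable. Absolute convergence then permits summation along power sets, where the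
  partial sums are the finite determinants.\<close>

lemma has_sum_minors:
  fixes x :: "'i \<Rightarrow> 'k \<Rightarrow> complex" and y :: "'i \<Rightarrow> 'l \<Rightarrow> complex"
  assumes x: "contr x I" and pos: "ldet x I > 0" and y: "\<And>i. i \<in> I \<Longrightarrow> l2 (y i)"
    and xy: "\<And>i j. i \<in> I \<Longrightarrow> j \<in> I \<Longrightarrow> gram x i j + gram y i j = of_bool (i = j)"
  shows "(pdet (\<lambda>i j. gram x i j - of_bool (i = j)) has_sum of_real (ldet x I)) {A. finite A \<and> A \<subseteq> I}"
proof -
  let ?T = "\<lambda>i j. gram x i j - of_bool (i = j)" and ?\<F> = "{A. finite A \<and> A \<subseteq> I}"
  have ny: "(nrm (y i))\<^sup>2 = 1 - (nrm (x i))\<^sup>2" if "i \<in> I" for i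
  proof -
    have "of_real ((nrm (x i))\<^sup>2 + (nrm (y i))\<^sup>2) = (1::complex)"
      using xy[OF that that] contr_D[OF x that] y[OF that] by (simp add: gram_def ip_self)
    thus ?thesis unfolding of_real_eq_1_iff by simp
  qed
  have c: "(\<lambda>i. (nrm (y i))\<^sup>2) summable_on I"
    using ldet_pos_summable[OF x pos] by (rule summable_on_cong[THEN iffD1, rotated]) (simp add: ny)
  have "cmod (pdet ?T A) \<le> (\<Prod>i\<in>A. (nrm (y i))\<^sup>2)" if "A \<in> ?\<F>" for A
  proof -
    have A: "finite A" "A \<subseteq> I" using that by auto
    have yA: "\<And>i. i \<in> A \<Longrightarrow> l2 (y i)" using A y by auto
    have "pdet ?T A = pdet (\<lambda>i j. - gram y i j) A"
    proof (rule pdet_cong)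
      fix i j assume "i \<in> A" "j \<in> A"
      thus "?T i j = - gram y i j" using xy[of i j] A by (simp add: subset_iff algebra_simps eq_diff_eq)
    qed
    hence "cmod (pdet ?T A) = cmod (pdet (gram y) A)" by (simp only: cmod_pdet_uminus)
    also have "\<dots> = gdet y A" using gdet_nonneg[OF A(1) yA] by (simp add: pdet_gram_eq[OF A(1) yA])
    also have "\<dots> \<le> (\<Prod>i\<in>A. (nrm (y i))\<^sup>2)" by (rule gdet_Hadamard[OF A(1) yA])
    finally show ?thesis .
  qed
  hence "pdet ?T summable_on ?\<F>"
    by (intro abs_summable_summable[OF summable_on_comparison_test[OF prod_summable_on_finite_subsets[OF _ c]]]) auto
  hence hs: "(pdet ?T has_sum infsum (pdet ?T) ?\<F>) ?\<F>" by (rule has_sum_infsum)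
  \<comment> \<open>Power sets of finite sets are cofinal among the finite collections of finite
    subsets.\<close>
  have "filterlim Pow (finite_subsets_at_top ?\<F>) (finite_subsets_at_top I)"
  proof (subst filterlim_finite_subsets_at_top, intro allI impI)
    fix \<A> assume \<A>: "finite \<A> \<and> \<A> \<subseteq> ?\<F>"
    show "\<forall>\<^sub>F A in finite_subsets_at_top I. finite (Pow A) \<and> \<A> \<subseteq> Pow A \<and> Pow A \<subseteq> ?\<F>"
      unfolding eventually_finite_subsets_at_top
      by (rule exI[of _ "\<Union>\<A>"]) (use \<A> in \<open>auto intro: finite_subset\<close>)
  qed
  from filterlim_compose[OF hs[unfolded has_sum_def] this]
  have "((\<lambda>A. \<Sum>J\<in>Pow A. pdet ?T J) \<longlongrightarrow> infsum (pdet ?T) ?\<F>) (finite_subsets_at_top I)" .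
  moreover have "\<forall>\<^sub>F A in finite_subsets_at_top I. (\<Sum>J\<in>Pow A. pdet ?T J) = of_real (gdet x A)"
  proof -
    have "(\<Sum>J\<in>Pow A. pdet ?T J) = of_real (gdet x A)" if A: "finite A" "A \<subseteq> I" for A
    proof -
      have "(\<Sum>J\<in>Pow A. pdet ?T J) = pdet (\<lambda>i j. of_bool (i = j) + ?T i j) A"
        by (rule pdet_identity_plus[OF A(1), symmetric])
      also have "\<dots> = pdet (gram x) A" by (intro pdet_cong) simp
      also have "\<dots> = of_real (gdet x A)" by (rule pdet_gram_eq[OF A(1)]) (use contr_D[OF x] A in auto)
      finally show ?thesis .
    qed
    thus ?thesis by (auto simp: eventually_finite_subsets_at_top)
  qed
  ultimately have "((\<lambda>A. complex_of_real (gdet x A)) \<longlongrightarrow> infsum (pdet ?T) ?\<F>) (finite_subsets_at_top I)"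
    by (rule Lim_transform_eventually)
  moreover have "((\<lambda>A. complex_of_real (gdet x A)) \<longlongrightarrow> of_real (ldet x I)) (finite_subsets_at_top I)"
    by (intro tendsto_of_real gdet_tendsto_ldet x)
  ultimately have "infsum (pdet ?T) ?\<F> = of_real (ldet x I)"
    by (rule tendsto_unique[OF finite_subsets_at_top_neq_bot])
  thus ?thesis using hs by simp
qed

section \<open>Hardy space and Toeplitz operators in Fourier coordinates\<close>

lemma fourier_coeff_nth:
  assumes f: "f \<in> L2"
  shows "fourier_coeff f k $ c = co f (k, c)"
proof -
  let ?h = "\<lambda>z. (z powi (- k)) *s f z"
  have "continuous_on (sphere 0 1) (\<lambda>z. mat (z powi (- k)) $ i $ j :: complex)" for i j :: 2
    by (cases "i = j") (auto simp: mat_def intro!: continuous_intros)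
  from L2_mult[OF this f] have "(\<lambda>z. mat (z powi (- k)) *v f z) \<in> L2" .
  also have "(\<lambda>z. mat (z powi (- k)) *v f z) = ?h"
    by (auto simp: fun_eq_iff vec_eq_iff forall_2 matrix_vector_mult_def mat_def sum_2)
  finally have h: "?h \<in> L2" .
  have "integrable circle ?h"
  proof (rule Bochner_Integration.integrable_bound)
    show "integrable circle (\<lambda>z. 1 + (norm (?h z))\<^sup>2)"
      using h integrable_circle_continuous[of "\<lambda>_. 1::real"] by (simp add: L2_def)
    show "?h \<in> borel_measurable circle" using h by (simp add: L2_def)
    have "t \<le> 1 + t\<^sup>2" for t :: real using zero_le_power2[of "t - 1/2"] by (simp add: power2_eq_square algebra_simps)
    thus "AE z in circle. norm (?h z) \<le> norm (1 + (norm (?h z))\<^sup>2)" by simp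
  qed
  from integral_bounded_linear[OF bounded_linear_vec_nth this, of c]
  show ?thesis by (simp add: fourier_coeff_def co_def fc_def)
qed

lemma Hardy_iff: "f \<in> Hardy \<longleftrightarrow> f \<in> L2 \<and> (\<forall>b. b \<notin> KP \<longrightarrow> co f b = 0)"
  by (auto simp: Hardy_def vec_eq_iff fourier_coeff_nth KP_def not_le)

lemma Hardy_L2: "f \<in> Hardy \<Longrightarrow> f \<in> L2"
  by (simp add: Hardy_iff)

lemma res_co_Hardy: "f \<in> Hardy \<Longrightarrow> res KP (co f) = co f"
  by (auto simp: Hardy_iff res_def fun_eq_iff)

lemma Hardy_of_res:
  assumes "l2 F"
  obtains f where "f \<in> Hardy" "co f = res KP F"
  using co_surj[OF l2_res[OF assms, of KP]] by (metis Hardy_iff res_def)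

lemma ip_res: "ip (res S x) y = ip x (res S y)"
  unfolding ip_def by (intro infsum_cong) (simp add: res_def)

lemma res_res [simp]: "res S (res S x) = res S x"
  by (auto simp: res_def)

lemma inner_Hardy_left: "u \<in> Hardy \<Longrightarrow> f \<in> L2 \<Longrightarrow> L2_inner u f = ip (co u) (res KP (co f))"
  by (metis L2_inner_eq_ip Hardy_L2 ip_res res_co_Hardy)

lemma bas_Hardy: "b \<in> KP \<Longrightarrow> bas b \<in> Hardy"
  by (auto simp: Hardy_iff co_bas un_apply)

text \<open>The representative chosen by \<open>SOME\<close> is arbitrary on null sets, but testing
  against the monomials determines its Fourier coefficients, and only these matter below.\<close>

lemma Hardy_proj:
  assumes f: "f \<in> L2"
  shows "Hardy_proj f \<in> Hardy" and "co (Hardy_proj f) = res KP (co f)"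
proof -
  let ?Q = "\<lambda>h. h \<in> Hardy \<and> (\<forall>u\<in>Hardy. L2_inner u (\<lambda>z. f z - h z) = 0)"
  obtain h where h: "h \<in> Hardy" "co h = res KP (co f)" using Hardy_of_res[OF co_l2[OF f]] .
  have "L2_inner u (\<lambda>z. f z - h z) = 0" if "u \<in> Hardy" for u
  proof -
    have "res KP (co (\<lambda>z. f z - h z)) = (\<lambda>b. 0)"
      unfolding co_diff[OF f Hardy_L2[OF h(1)]] h by (auto simp: res_def)
    thus ?thesis using that f h by (simp add: inner_Hardy_left L2_diff Hardy_L2 ip_def)
  qed
  hence "?Q h" using h by blast
  hence Q: "?Q (Hardy_proj f)" unfolding Hardy_proj_def by (rule someI[of ?Q])
  thus H: "Hardy_proj f \<in> Hardy" by blast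
  have "co f b = co (Hardy_proj f) b" if "b \<in> KP" for b
  proof -
    have "co (\<lambda>z. f z - Hardy_proj f z) b = 0"
      using Q bas_Hardy[OF that] f Hardy_L2[OF H] by (simp add: co_eq_inner L2_diff)
    thus ?thesis by (simp add: co_diff[OF f Hardy_L2[OF H]])
  qed
  thus "co (Hardy_proj f) = res KP (co f)" using H by (auto simp: res_def fun_eq_iff Hardy_iff)
qed

lemma Toeplitz:
  assumes g: "loop g" and f: "f \<in> L2"
  shows "Toeplitz g f \<in> Hardy" and "co (Toeplitz g f) = res KP (co (\<lambda>z. g z *v f z))"
  unfolding Toeplitz_def using Hardy_proj[OF loop_L2[OF g f]] by auto

lemma inner_Toeplitz_left:
  assumes g: "loop g" and u: "u \<in> L2" and f: "f \<in> Hardy"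
  shows "L2_inner (Toeplitz g u) f = L2_inner u (\<lambda>z. adj (g z) *v f z)"
proof -
  have "L2_inner (Toeplitz g u) f = ip (co (\<lambda>z. g z *v u z)) (co f)"
    using Toeplitz[OF g u] f by (simp add: L2_inner_eq_ip Hardy_L2 ip_res res_co_Hardy)
  also have "\<dots> = L2_inner (\<lambda>z. g z *v u z) f"
    using g u f by (simp add: L2_inner_eq_ip Hardy_L2 loop_L2)
  also have "\<dots> = L2_inner u (\<lambda>z. adj (g z) *v f z)" by (simp add: L2_inner_adj)
  finally show ?thesis .
qed

text \<open>Links the determinants of the previous sections to the operator: \<open>Tmap g\<close>
  is the adjoint of the Toeplitz operator in coordinates.\<close>

lemma Hardy_adjoint_Toeplitz:
  assumes g: "loop g" and f: "f \<in> Hardy"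
  shows "Hardy_adjoint (Toeplitz g) f \<in> Hardy" and "co (Hardy_adjoint (Toeplitz g) f) = Tmap g f"
proof -
  let ?Q = "\<lambda>h. h \<in> Hardy \<and> (\<forall>u\<in>Hardy. L2_inner u h = L2_inner (Toeplitz g u) f)"
  have gf: "(\<lambda>z. adj (g z) *v f z) \<in> L2" using g Hardy_L2[OF f] by (rule loop_adj_L2)
  obtain h where h: "h \<in> Hardy" "co h = Tmap g f" unfolding Tmap_def using Hardy_of_res[OF co_l2[OF gf]] .
  have "L2_inner u h = L2_inner (Toeplitz g u) f" if "u \<in> Hardy" for u
    using that h gf by (simp add: inner_Toeplitz_left[OF g _ f] inner_Hardy_left Hardy_L2 Tmap_def)
  hence Qh: "?Q h" using h by blast
  hence Q: "?Q (Hardy_adjoint (Toeplitz g) f)" unfolding Hardy_adjoint_def by (rule someI[of ?Q])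
  thus H: "Hardy_adjoint (Toeplitz g) f \<in> Hardy" by blast
  have "co (Hardy_adjoint (Toeplitz g) f) b = co h b" if "b \<in> KP" for b
    using Q Qh bas_Hardy[OF that] by (simp add: co_eq_inner Hardy_L2)
  thus "co (Hardy_adjoint (Toeplitz g) f) = Tmap g f"
    using H h(1) unfolding h(2)[symmetric] by (fastforce simp: fun_eq_iff Hardy_iff)
qed

lemma inner_Toeplitz_adjoint:
  assumes g: "loop g" and e: "e \<in> Hardy" and f: "f \<in> Hardy"
  shows "L2_inner e (Toeplitz g (Hardy_adjoint (Toeplitz g) f)) = ip (Tmap g e) (Tmap g f)"
proof -
  let ?h = "Hardy_adjoint (Toeplitz g) f"
  note h = Hardy_adjoint_Toeplitz[OF g f]
  have ge: "(\<lambda>z. adj (g z) *v e z) \<in> L2" using g Hardy_L2[OF e] by (rule loop_adj_L2)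
  have "L2_inner e (Toeplitz g ?h) = L2_inner e (\<lambda>z. g z *v ?h z)"
    using e h Toeplitz[OF g Hardy_L2[OF h(1)]] loop_L2[OF g Hardy_L2[OF h(1)]] by (simp add: inner_Hardy_left Hardy_L2)
  also have "\<dots> = L2_inner (\<lambda>z. adj (g z) *v e z) ?h" by (rule L2_inner_adj)
  also have "\<dots> = ip (co (\<lambda>z. adj (g z) *v e z)) (Tmap g f)"
    using ge h by (simp add: L2_inner_eq_ip Hardy_L2)
  also have "\<dots> = ip (Tmap g e) (Tmap g f)" by (simp add: Tmap_def ip_res)
  finally show ?thesis .
qed

lemma L2_inner_diff_right: "u \<in> L2 \<Longrightarrow> f \<in> L2 \<Longrightarrow> h \<in> L2 \<Longrightarrow> L2_inner u (\<lambda>z. f z - h z) = L2_inner u f - L2_inner u h"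
  by (simp add: L2_inner_eq_ip L2_diff co_diff ip_diff_right co_l2)

lemma Hardy_onb_vonb: "Hardy_onb e \<Longrightarrow> vonb e UNIV"
  by (auto simp: Hardy_onb_def vonb_def Hardy_L2)

text \<open>Projecting \<open>f\<close> to the Hardy space changes neither side. There, by the
  equality in \<open>Bessel\<close>, convergence of the expansion means that the squared
  coefficients sum to the squared norm.\<close>

lemma Hardy_onb_Parseval:
  assumes e: "Hardy_onb e" and f: "f \<in> L2"
  shows "(\<Sum>\<^sub>\<infinity>n. (cmod (L2_inner (e n) f))\<^sup>2) = (\<Sum>\<^sub>\<infinity>b\<in>KP. (cmod (L2_inner (bas b) f))\<^sup>2)"
proof -
  have eH: "e n \<in> Hardy" for n using e by (simp add: Hardy_onb_def)
  have eL: "e n \<in> L2" for n using eH by (rule Hardy_L2)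
  have o: "orthonormal (\<lambda>n. co (e n)) UNIV"
    using Hardy_onb_vonb[OF e] by (auto simp: orthonormal_def vonb_def co_l2 L2_inner_eq_ip[symmetric])
  obtain p where p: "p \<in> Hardy" "co p = res KP (co f)" using Hardy_of_res[OF co_l2[OF f]] .
  have pL: "p \<in> L2" using p by (simp add: Hardy_L2)
  have ep: "L2_inner (e n) f = ip (co (e n)) (co p)" for n
    using eH f p by (simp add: inner_Hardy_left)
  let ?r = "\<lambda>N z. p z - (\<Sum>n<N. L2_inner (e n) p *s e n z)"
  have lim: "(\<lambda>N. L2_norm (?r N)) \<longlonglongrightarrow> 0" using e p by (simp add: Hardy_onb_def)
  have r: "L2_norm (?r N) = nrm (co_proj (\<lambda>n. co (e n)) {..<N} (co p))" for N
  proof -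
    have s: "(\<lambda>z. \<Sum>n<N. L2_inner (e n) p *s e n z) \<in> L2" by (intro L2_sum L2_scale eL)
    show ?thesis
      unfolding L2_norm_eq_nrm[OF L2_diff[OF pL s]] co_diff[OF pL s]
      by (subst co_sum) (simp_all add: co_proj_def co_scale L2_scale eL L2_inner_eq_ip[OF eL pL])
  qed
  have "(\<lambda>N. (nrm (co_proj (\<lambda>n. co (e n)) {..<N} (co p)))\<^sup>2) \<longlonglongrightarrow> 0\<^sup>2"
    using lim unfolding r by (rule tendsto_power)
  hence "(\<lambda>N. (nrm (co p))\<^sup>2 - (nrm (co_proj (\<lambda>n. co (e n)) {..<N} (co p)))\<^sup>2) \<longlonglongrightarrow> (nrm (co p))\<^sup>2 - 0\<^sup>2"
    by (intro tendsto_diff tendsto_const)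
  hence "(\<lambda>n. (cmod (ip (co (e n)) (co p)))\<^sup>2) sums (nrm (co p))\<^sup>2"
    unfolding sums_def Bessel(2)[OF o finite_lessThan subset_UNIV co_l2[OF pL]] by simp
  hence "(\<Sum>\<^sub>\<infinity>n. (cmod (L2_inner (e n) f))\<^sup>2) = (nrm (co p))\<^sup>2"
    unfolding ep by (intro infsumI sums_nonneg_imp_has_sum) auto
  also have "\<dots> = (\<Sum>\<^sub>\<infinity>b\<in>KP. (cmod (L2_inner (bas b) f))\<^sup>2)"
    unfolding nrm_sq p co_eq_inner[OF f, symmetric]
    by (rule infsum_cong_neutral) (auto simp: res_def)
  finally show ?thesis .
qed

lemma vdet_Hardy_onb:
  assumes "loop g" "Hardy_onb e"
  shows "vdet g e UNIV = tdet g"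
  unfolding tdet_def
  by (rule vdet_basis_change[OF assms(1) Hardy_onb_vonb[OF assms(2)] vonb_bas Hardy_onb_Parseval[OF assms(2)]])

text \<open>The vectors g^* e_n are orthonormal, with nonnegative-frequency part
  \<open>Tmap g (e n)\<close>; their negative-frequency parts serve as the complementary
  family.\<close>

lemma Toeplitz_minors_has_sum:
  assumes g: "loop g" and pos: "tdet g > 0" and e: "Hardy_onb e"
  defines "T \<equiv> \<lambda>f z. (Toeplitz g \<circ> Hardy_adjoint (Toeplitz g)) f z - f z"
  shows "(principal_minor (\<lambda>i j. L2_inner (e i) (T (e j))) has_sum of_real (tdet g)) {I. finite I}"
proof -
  have eH: "e n \<in> Hardy" for n using e by (simp add: Hardy_onb_def)
  note v = Hardy_onb_vonb[OF e]
  let ?x = "\<lambda>n. Tmap g (e n)" and ?\<phi> = "\<lambda>n. co (\<lambda>z. adj (g z) *v e n z)"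
  note o = orthonormal_loop[OF g v]
  have "L2_inner (e i) (T (e j)) = gram ?x i j - of_bool (i = j)" for i j
  proof -
    have S: "Toeplitz g (Hardy_adjoint (Toeplitz g) (e j)) \<in> Hardy"
      by (intro Toeplitz(1) g Hardy_L2 Hardy_adjoint_Toeplitz eH)
    have "L2_inner (e i) (T (e j)) = L2_inner (e i) (Toeplitz g (Hardy_adjoint (Toeplitz g) (e j))) - L2_inner (e i) (e j)"
      unfolding T_def o_def by (intro L2_inner_diff_right Hardy_L2 eH S)
    thus ?thesis using v by (simp add: inner_Toeplitz_adjoint[OF g eH eH] vonb_def gram_def)
  qed
  moreover have "(pdet (\<lambda>i j. gram ?x i j - of_bool (i = j)) has_sum of_real (ldet ?x UNIV)) {I. finite I \<and> I \<subseteq> UNIV}"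
  proof (rule has_sum_minors[where y="\<lambda>n. res (- KP) (?\<phi> n)"])
    show "contr ?x UNIV" by (rule contr_Tmap[OF g v])
    show "ldet ?x UNIV > 0" using pos vdet_Hardy_onb[OF g e] by (simp add: vdet_def)
    show "l2 (res (- KP) (?\<phi> i))" for i using orthonormal_l2[OF o] by simp
    show "gram ?x i j + gram (\<lambda>n. res (- KP) (?\<phi> n)) i j = of_bool (i = j)" for i j
      using orthonormal_l2[OF o, of i] orthonormal_l2[OF o, of j] orthonormal_ip[OF o, of i j]
      by (simp add: gram_def Tmap_def res_ip_compl[of _ _ KP] res_ip[of _ _ "- KP"])
  qed
  ultimately show ?thesis using vdet_Hardy_onb[OF g e] by (simp add: principal_minor_eq_pdet vdet_def)
qed

lemma Tmap_sum:
  assumes g: "loop g" and v: "\<And>n. n \<in> A \<Longrightarrow> v n \<in> L2"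
  shows "Tmap g (\<lambda>z. \<Sum>n\<in>A. t n *s v n z) = (\<lambda>k. \<Sum>n\<in>A. t n * Tmap g (v n) k)"
  using v
proof (induction A rule: infinite_finite_induct)
  case (insert a A)
  have "Tmap g (\<lambda>z. t a *s v a z + (\<Sum>n\<in>A. t n *s v n z)) = (\<lambda>k. t a * Tmap g (v a) k + Tmap g (\<lambda>z. \<Sum>n\<in>A. t n *s v n z) k)"
    using insert.prems by (subst Tmap_add[OF g L2_scale L2_sum]) (auto simp: Tmap_scale)
  thus ?case using insert by simp
qed (use Tmap_scale[of g 0 "\<lambda>_. 0"] in auto)

text \<open>With \<open>H = P\<^sub>+ g P\<^sub>-\<close> one has \<open>1 - A(g) A(g)\<^sup>* = H H\<^sup>*\<close>, and \<open>H\<close> is Hilbert--Schmidt by the dual form of the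
  determinant; the nuclear expansion is along the basis of the range of \<open>P\<^sub>-\<close>.\<close>
lemma Toeplitz_trace_class:
  assumes g: "loop g" and pos: "tdet g > 0"
  shows "Hardy_trace_class (\<lambda>f z. (Toeplitz g \<circ> Hardy_adjoint (Toeplitz g)) f z - f z)"
proof -
  let ?M = "- KP :: (int \<times> 2) set" and ?a = "\<lambda>z. adj (g z)"
  have la: "loop ?a" by (rule loop_adj[OF g])
  have Pg: "Tmap ?a f = res KP (co (\<lambda>z. g z *v f z))" for f by (simp add: Tmap_def)
  define \<phi> where "\<phi> b = co (\<lambda>z. g z *v bas b z)" for b
  have o: "orthonormal \<phi> ?M" using orthonormal_loop[OF la vonb_bas] by (simp add: \<phi>_def[abs_def])
  have P: "Tmap ?a (bas b) = res KP (\<phi> b)" for b by (simp add: Pg \<phi>_def)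
  have c: "contr (\<lambda>b. res ?M (\<phi> b)) ?M" by (rule contr_res[OF o])
  \<comment> \<open>The dual form has the same positive determinant, so the columns of H have
    summable squared norms.\<close>
  have "(\<lambda>b. 1 - (nrm (res ?M (\<phi> b)))\<^sup>2) summable_on ?M"
    by (rule ldet_pos_summable[OF c]) (use pos tdet_eq_dual[OF g] in \<open>simp add: \<phi>_def[abs_def]\<close>)
  moreover have "1 - (nrm (res ?M (\<phi> b)))\<^sup>2 = (nrm (res KP (\<phi> b)))\<^sup>2" if "b \<in> ?M" for b
  proof -
    have l: "l2 (\<phi> b)" using orthonormal_l2[OF o that] .
    have "complex_of_real ((nrm (res KP (\<phi> b)))\<^sup>2 + (nrm (res ?M (\<phi> b)))\<^sup>2) = 1"
      using l orthonormal_ip[OF o that that] by (simp add: ip_self[symmetric] res_ip_compl[of _ _ KP] res_ip[of _ _ "- KP"] del: of_real_power)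
    thus ?thesis unfolding of_real_eq_1_iff by simp
  qed
  ultimately have "(\<lambda>b. (nrm (res KP (\<phi> b)))\<^sup>2) summable_on ?M"
    by (rule summable_on_cong[THEN iffD1, rotated]) auto
  \<comment> \<open>A nuclear expansion is indexed by \<open>nat\<close>, so the negative indices
    are enumerated.\<close>
  moreover define \<beta> where "\<beta> = from_nat_into ?M"
  have \<beta>: "bij_betw \<beta> UNIV ?M"
    unfolding \<beta>_def
  proof (rule bij_betw_from_nat_into)
    have "(\<lambda>n. (- 1 - int n, 1)) ` UNIV \<subseteq> ?M" by (auto simp: KP_def)
    moreover have "inj (\<lambda>n. (- 1 - int n, 1 :: 2))" by (auto simp: inj_on_def)
    ultimately show "infinite ?M" using range_inj_infinite infinite_super by metis
  qed simp
  ultimately have "(\<lambda>n. (nrm (res KP (\<phi> (\<beta> n))))\<^sup>2) summable_on UNIV"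
    using summable_on_reindex_bij_betw[OF \<beta>, of "\<lambda>b. (nrm (res KP (\<phi> b)))\<^sup>2"] by blast
  hence sum: "summable (\<lambda>n. (nrm (res KP (\<phi> (\<beta> n))))\<^sup>2)" by (rule summable_on_imp_summable)
  define X where "X n = Toeplitz g (bas (\<beta> n))" for n
  have XH: "X n \<in> Hardy" and coX: "co (X n) = Tmap ?a (bas (\<beta> n))" for n
    unfolding X_def Pg by (simp_all add: Toeplitz[OF g])
  have XL: "X n \<in> L2" for n using XH by (rule Hardy_L2)
  \<comment> \<open>The operator is A(g) A(g)^* - 1 = - H H^*, hence the sign.\<close>
  define Y where "Y n z = (- 1) *s X n z" for n z
  have YL: "Y n \<in> L2" for n unfolding Y_def[abs_def] by (intro L2_scale XL)
  have coY: "co (Y n) = (\<lambda>k. - Tmap ?a (bas (\<beta> n)) k)" for n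
    unfolding Y_def[abs_def] co_scale coX by simp
  have YH: "Y n \<in> Hardy" for n
    unfolding Hardy_iff using YL by (auto simp: coY Tmap_def res_def)
  have N: "L2_norm (X n) * L2_norm (Y n) = (nrm (res KP (\<phi> (\<beta> n))))\<^sup>2" for n
    using nrm_scale[of "- 1" "res KP (\<phi> (\<beta> n))"] by (simp add: L2_norm_eq_nrm XL YL coX coY P power2_eq_square)
  let ?S = "\<lambda>f. Toeplitz g (Hardy_adjoint (Toeplitz g) f)"
  show ?thesis
    unfolding Hardy_trace_class_def o_def
  proof (rule conjI[OF _ exI[of _ X, OF exI[of _ Y]]], safe intro!: XH YH)
    show "summable (\<lambda>n. L2_norm (X n) * L2_norm (Y n))" unfolding N by (rule sum)
    fix f assume f: "f \<in> Hardy"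
    note h = Hardy_adjoint_Toeplitz[OF g f]
    let ?h = "Hardy_adjoint (Toeplitz g) f"
    have hL: "?h \<in> L2" and fL: "f \<in> L2" using h f by (auto intro: Hardy_L2)
    note S = Toeplitz[OF g hL]
    have SL: "?S f \<in> L2" using S by (simp add: Hardy_L2)
    have TL: "(\<lambda>z. ?S f z - f z) \<in> L2" by (rule L2_diff[OF SL fL])
    have coT: "co (\<lambda>z. ?S f z - f z) = (\<lambda>k. Tmap ?a ?h k - co f k)"
      unfolding co_diff[OF SL fL] S Pg ..
    show "(\<lambda>z. ?S f z - f z) \<in> Hardy"
      unfolding Hardy_iff coT using TL f by (auto simp: Pg res_def Hardy_iff)
    define \<psi> where "\<psi> = co (\<lambda>z. ?a z *v f z)"
    have aL: "(\<lambda>z. ?a z *v f z) \<in> L2" by (rule loop_adj_L2[OF g fL])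
    have \<psi>: "l2 \<psi>" unfolding \<psi>_def by (rule co_l2[OF aL])
    have Xf: "L2_inner (X n) f = \<psi> (\<beta> n)" for n
      unfolding X_def inner_Toeplitz_left[OF g bas_L2 f] \<psi>_def co_eq_inner[OF aL] ..
    have Pa: "Tmap ?a (\<lambda>z. ?a z *v f z) = co f"
    proof -
      have "Tmap ?a (\<lambda>z. ?a z *v f z) = res KP (co f)"
        unfolding Pg by (intro arg_cong[of _ _ "res KP"] co_cong) (simp add: matrix_vector_mul_assoc loop_adj_right[OF g])
      thus ?thesis by (simp add: res_co_Hardy[OF f])
    qed
    let ?s = "\<lambda>N z. \<Sum>n<N. \<psi> (\<beta> n) *s bas (\<beta> n) z"
    let ?r = "\<lambda>N z. (?h z - ?a z *v f z) + ?s N z"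
    let ?D = "\<lambda>N z. (?S f z - f z) - (\<Sum>n<N. L2_inner (X n) f *s Y n z)"
    let ?\<psi> = "res ?M \<psi>"
    have sL: "?s N \<in> L2" for N by (intro L2_sum L2_scale bas_L2)
    have dL: "(\<lambda>z. ?h z - ?a z *v f z) \<in> L2" by (rule L2_diff[OF hL aL])
    have rL: "?r N \<in> L2" for N by (rule L2_add[OF dL sL])
    have YsL: "(\<lambda>z. \<Sum>n<N. L2_inner (X n) f *s Y n z) \<in> L2" for N by (intro L2_sum L2_scale YL)
    \<comment> \<open>The remainder is the nonnegative-frequency part of g times
      \<open>?r N\<close>, so its norm is at most that of \<open>?r N\<close>.\<close>
    have coD: "co (?D N) = Tmap ?a (?r N)" for N
    proof -
      have "co (?D N) = (\<lambda>k. (Tmap ?a ?h k - co f k) - (\<Sum>n<N. L2_inner (X n) f * co (Y n) k))"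
        unfolding co_diff[OF TL YsL] coT by (subst co_sum) (simp_all add: L2_scale YL co_scale)
      also have "\<dots> = (\<lambda>k. (Tmap ?a ?h k - co f k) + (\<Sum>n<N. \<psi> (\<beta> n) * Tmap ?a (bas (\<beta> n)) k))"
        by (simp add: Xf coY sum_negf)
      also have "\<dots> = Tmap ?a (?r N)"
        unfolding Tmap_add[OF la dL sL] Tmap_diff[OF la hL aL] Pa Tmap_sum[OF la bas_L2] ..
      finally show ?thesis .
    qed
    have o': "orthonormal (\<lambda>n. un (\<beta> n)) UNIV"
      using bij_betw_imp_inj_on[OF \<beta>] by (auto simp: orthonormal_def un_apply inj_on_def)
    have \<beta>M: "\<beta> n \<in> ?M" for n using bij_betwE[OF \<beta>] by blast
    \<comment> \<open>Since \<open>?h\<close> is the nonnegative-frequency part of g^* f, the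
      difference is minus the negative-frequency part; adding the finite sum leaves minus its
      tail.\<close>
    have cor: "co (?r N) = (\<lambda>k. - 1 * co_proj (\<lambda>n. un (\<beta> n)) {..<N} ?\<psi> k)" for N
    proof -
      have "co (?r N) = (\<lambda>k. (Tmap g f k - \<psi> k) + (\<Sum>n<N. \<psi> (\<beta> n) * un (\<beta> n) k))"
        unfolding co_add[OF dL sL] co_diff[OF hL aL] h \<psi>_def[symmetric]
        by (subst co_sum) (simp_all add: L2_scale co_scale co_bas)
      thus ?thesis using \<beta>M by (auto simp: fun_eq_iff co_proj_def Tmap_def \<psi>_def[symmetric] res_def)
    qed
    have sq: "(L2_norm (?D N))\<^sup>2 \<le> (nrm ?\<psi>)\<^sup>2 - (\<Sum>n<N. (cmod (\<psi> (\<beta> n)))\<^sup>2)" for N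
    proof -
      have "L2_norm (?D N) \<le> nrm (co (?r N))"
        unfolding L2_norm_eq_nrm[OF L2_diff[OF TL YsL]] coD by (rule nrm_Tmap_le[OF la rL])
      also have "\<dots> = nrm (co_proj (\<lambda>n. un (\<beta> n)) {..<N} ?\<psi>)" unfolding cor nrm_scale by simp
      finally have "(L2_norm (?D N))\<^sup>2 \<le> (nrm (co_proj (\<lambda>n. un (\<beta> n)) {..<N} ?\<psi>))\<^sup>2"
        by (rule power_mono) (simp add: L2_norm_eq_nrm[OF L2_diff[OF TL YsL]])
      also have "\<dots> = (nrm ?\<psi>)\<^sup>2 - (\<Sum>n<N. (cmod (\<psi> (\<beta> n)))\<^sup>2)"
        using Bessel(2)[OF o' finite_lessThan subset_UNIV l2_res[OF \<psi>], of N ?M] \<beta>M by (simp add: res_def)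
      finally show ?thesis .
    qed
    have "(\<lambda>n. (cmod (\<psi> (\<beta> n)))\<^sup>2) sums (nrm ?\<psi>)\<^sup>2"
    proof -
      have "(nrm ?\<psi>)\<^sup>2 = (\<Sum>\<^sub>\<infinity>b\<in>?M. (cmod (\<psi> b))\<^sup>2)"
        unfolding nrm_sq by (rule infsum_cong_neutral) (auto simp: res_def)
      also have "\<dots> = (\<Sum>\<^sub>\<infinity>n. (cmod (\<psi> (\<beta> n)))\<^sup>2)" by (rule infsum_reindex_bij_betw[OF \<beta>, symmetric])
      finally have e: "(nrm ?\<psi>)\<^sup>2 = (\<Sum>\<^sub>\<infinity>n. (cmod (\<psi> (\<beta> n)))\<^sup>2)" .
      have "(\<lambda>b. (cmod (\<psi> b))\<^sup>2) summable_on ?M" using \<psi> unfolding l2_def by (rule summable_on_subset_banach) simp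
      hence "(\<lambda>n. (cmod (\<psi> (\<beta> n)))\<^sup>2) summable_on UNIV"
        using summable_on_reindex_bij_betw[OF \<beta>, of "\<lambda>b. (cmod (\<psi> b))\<^sup>2"] by blast
      thus ?thesis unfolding e by (intro has_sum_imp_sums has_sum_infsum)
    qed
    hence "(\<lambda>N. (nrm ?\<psi>)\<^sup>2 - (\<Sum>n<N. (cmod (\<psi> (\<beta> n)))\<^sup>2)) \<longlonglongrightarrow> (nrm ?\<psi>)\<^sup>2 - (nrm ?\<psi>)\<^sup>2"
      unfolding sums_def by (intro tendsto_diff tendsto_const)
    hence "(\<lambda>N. (nrm ?\<psi>)\<^sup>2 - (\<Sum>n<N. (cmod (\<psi> (\<beta> n)))\<^sup>2)) \<longlonglongrightarrow> 0" by simp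
    hence "(\<lambda>N. (L2_norm (?D N))\<^sup>2) \<longlonglongrightarrow> 0"
      by (rule tendsto_sandwich[OF _ _ tendsto_const, rotated 2]) (use sq in auto)
    hence "(\<lambda>N. sqrt ((L2_norm (?D N))\<^sup>2)) \<longlonglongrightarrow> sqrt 0" by (rule tendsto_real_sqrt)
    moreover have "sqrt ((L2_norm (?D N))\<^sup>2) = L2_norm (?D N)" for N
      by (simp add: L2_norm_eq_nrm[OF L2_diff[OF TL YsL]])
    ultimately show "(\<lambda>N. L2_norm (?D N)) \<longlonglongrightarrow> 0" by simp
  qed
qed

lemma has_Fredholm_det_Toeplitz:
  assumes "loop g" "tdet g > 0"
  shows "has_Fredholm_det (Toeplitz g \<circ> Hardy_adjoint (Toeplitz g)) (of_real (tdet g))"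
  unfolding has_Fredholm_det_def Let_def
  using Toeplitz_trace_class[OF assms] Toeplitz_minors_has_sum[OF assms] by blast

theorem theorem2:
  fixes n :: nat and \<eta> \<zeta> :: "nat \<Rightarrow> complex" and chi :: "int \<Rightarrow> complex"
  assumes skew: "\<And>j. chi (- j) = - cnj (chi j)"
    and series: "\<And>z. z \<in> sphere 0 1 \<Longrightarrow> (\<lambda>j. chi j * z powi j) summable_on UNIV"
    and half: "(\<lambda>j. of_int \<bar>j\<bar> * (cmod (chi j))\<^sup>2) summable_on UNIV"
  shows "has_Fredholm_det
    (Toeplitz (root_loop n \<eta> \<zeta> chi) \<circ> Hardy_adjoint (Toeplitz (root_loop n \<eta> \<zeta> chi)))
    (of_real
      ((\<Prod>j=0..n. a_fac (\<eta> j) ^ (2 * j)) *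
       (\<Prod>j=1..n. a_fac (\<zeta> j) ^ (2 * j)) *
       (\<Prod>m::nat. \<Prod>j\<in>{int m, - int m}. exp (- of_int \<bar>j\<bar> * (cmod (chi j))\<^sup>2))))"
proof -
  note R = tdet_root_loop[of chi n \<eta> \<zeta>, OF skew _ half]
  have "tdet (root_loop n \<eta> \<zeta> chi) = (\<Prod>j=0..n. a_fac (\<eta> j) ^ (2 * j)) * (\<Prod>j=1..n. a_fac (\<zeta> j) ^ (2 * j)) *
      (\<Prod>m::nat. \<Prod>j\<in>{int m, - int m}. exp (- of_int \<bar>j\<bar> * (cmod (chi j))\<^sup>2))"
    by (rule R(2)) (rule series)
  moreover have "loop (root_loop n \<eta> \<zeta> chi)" by (rule R(1)) (rule series)
  moreover have "tdet (root_loop n \<eta> \<zeta> chi) > 0" by (rule R(3)) (rule series)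
  ultimately show ?thesis using has_Fredholm_det_Toeplitz by metis
qed

end
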